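(* Let $(\mathfrak{F}^c_{T,F})_{T\in\mathcal{T}_h,\,F\in\mathcal{F}_T}$ be linear fluxes $\mathfrak{F}^c_{T,F}:X_h^c\to\mathbb{R}$ such that $\mathfrak{F}^c_{T,F}+\mathfrak{F}^c_{T',F}=0$ on $X_h^c$ for all $F\in\mathcal{F}_h^{\rm i}$ with $\mathcal{T}_F=\{T,T'\}$. Assume that they satisfy the following coercivity property for some $\gamma>0$: for all $v_h\in X_h^c$, $$\sum_{F\in\mathcal{F}_h^{\rm i},\,\mathcal{T}_F=\{T,T'\}}\mathfrak{F}^c_{T,F}(v_h)(v_T-v_{T'})+\sum_{F\in\mathcal{F}_h^{\rm b},\,\mathcal{T}_F=\{T\}}\mathfrak{F}^c_{T,F}(v_h)v_T\ge\gamma\|v_h\|_{1,\mathcal{T}_h,c}^2.$$ Then, if the solution $u\in H^1_0(\Omega)$ of $(\boldsymbol{K}\nabla u,\nabla v)=(f,v)$ for all $v\in H^1_0(\Omega)$ belongs to $C(\overline\Omega)\cap H^2(\mathcal{T}_h)$, denoting by $u_h\in X_h^c$ the solution of the cell-centred Finite Volume scheme $$\sum_{F\in\mathcal{F}_T}\mathfrak{F}^c_{T,F}(u_h)=\int_Tf\quad\forall T\in\mathcal{T}_h,$$ it holds $$\|u_h-I_h^cu\|_{1,\mathcal{T}_h,c}\le\gamma^{-1}\Big(\sum_{F\in\mathcal{F}_h}\underline{\lambda}_F^{-1}\frac{d_F}{|F|}\Big[\int_F\boldsymbol{K}_T\nabla u_{|T}\cdot\boldsymbol{n}_{TF}+\mathfrak{F}^c_{T,F}(I_h^cu)\Big]^2\Big)^{1/2},$$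 where, for each $F\in\mathcal{F}_h$, $T$ is an arbitrary cell in $\mathcal{T}_F$.
   Context: $\Omega\subset\mathbb{R}^d$ ($d\ge1$) is an open bounded connected polytopal domain, $f\in L^2(\Omega)$, $(\cdot,\cdot)$ is the $L^2(\Omega)$ (scalar or vector) inner product. $\boldsymbol{K}:\Omega\to\mathbb{R}^{d\times d}$ is symmetric, uniformly elliptic, and piecewise constant on a finite partition of $\Omega$ into polytopes. $\mathcal{M}_h=(\mathcal{T}_h,\mathcal{F}_h)$ is a polytopal mesh of $\Omega$: $\mathcal{T}_h$ is the set of cells, $\mathcal{F}_h=\mathcal{F}_h^{\rm i}\cup\mathcal{F}_h^{\rm b}$ the set of hyperplanar internal and boundary faces, $\mathcal{F}_T$ the set of faces lying on $\partial T$, $\mathcal{T}_F$ the set of the one or two cells sharing $F$, $\boldsymbol{n}_{TF}$ the unit normal to $F$ pointing out of $T$. Each cell lies in one polytope of the partition, and $\boldsymbol{K}_T=\boldsymbol{K}_{|T}$ is constant, with smallest eigenvalue $\underline{\lambda}_T$. $H^2(\mathcal{T}_h)=\{v\in L^2(\Omega):v_{|T}\in H^2(T)\ \forall T\}$. (The mesh is also taken in a regular family, but no hidden constant appears in the estimate.) One point $\boldsymbol{x}_T$ is chosen in each cell $T$. $|F|$ is the $(d-1)$-dimensional measure of $F$ and $d_{TF}>0$ is the orthogonal distance between $\boldsymbol{x}_T$ and $F$. The space of unknowns is $X_h^c=\{v_h=(v_T)_{T\in\mathcal{T}_h}:v_T\in\mathbb{R}\}$ with norm $$\|v_h\|_{1,\mathcal{T}_h,c}=\Big(\sum_{F\in\mathcal{F}_h}\underline{\lambda}_F|F|d_F\Big(\frac{v_T-v_{T'}}{d_F}\Big)^2\Big)^{1/2},$$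 where, for $F\in\mathcal{F}_h^{\rm i}$ with $\mathcal{T}_F=\{T,T'\}$, $\underline{\lambda}_F=\min(\underline{\lambda}_T,\underline{\lambda}_{T'})$ and $d_F=d_{TF}+d_{T'F}$, and, for $F\in\mathcal{F}_h^{\rm b}$ with $\mathcal{T}_F=\{T\}$, $\underline{\lambda}_F=\underline{\lambda}_T$, $d_F=d_{TF}$ and $v_{T'}=0$. The interpolant of a continuous function $u$ is $I_h^cu=(u(\boldsymbol{x}_T))_{T\in\mathcal{T}_h}\in X_h^c$. *)

theory Defs
  imports "HOL-Analysis.Analysis"
begin

text \<open>
  Elements of the function spaces below are actual functions on the whole type; only their values
  (up to null sets) on the set \<open>\<Omega>\<close> matter. In particular restricting to a subset \<open>T\<close> is
  just replacing \<open>\<Omega>\<close> by \<open>T\<close>.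
\<close>

definition L2 :: "(real^'n) set \<Rightarrow> (real^'n \<Rightarrow> 'b::euclidean_space) set" where
  "L2 \<Omega> = {f. f \<in> borel_measurable (lebesgue_on \<Omega>) \<and>
              integrable (lebesgue_on \<Omega>) (\<lambda>x. (norm (f x))\<^sup>2)}"

primrec C_k :: "nat \<Rightarrow> (real^'n \<Rightarrow> real) \<Rightarrow> bool" where
  "C_k 0 \<phi> = continuous_on UNIV \<phi>"
| "C_k (Suc k) \<phi> = (\<exists>D. (\<forall>x. GDERIV \<phi> x :> D x) \<and> (\<forall>i. C_k k (\<lambda>x. D x $ i)))"

definition test_functions :: "(real^'n) set \<Rightarrow> (real^'n \<Rightarrow> real) set" where
  "test_functions \<Omega> =
     {\<phi>. (\<forall>k. C_k k \<phi>) \<and> compact (closure {x. \<phi> x \<noteq> 0}) \<and> closure {x. \<phi> x \<noteq> 0} \<subseteq> \<Omega>}"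

definition has_weak_gradient ::
    "(real^'n) set \<Rightarrow> (real^'n \<Rightarrow> real) \<Rightarrow> (real^'n \<Rightarrow> real^'n) \<Rightarrow> bool" where
  "has_weak_gradient \<Omega> v g \<longleftrightarrow>
     v \<in> L2 \<Omega> \<and> g \<in> L2 \<Omega> \<and>
     (\<forall>\<phi> D. \<phi> \<in> test_functions \<Omega> \<and> (\<forall>x. GDERIV \<phi> x :> D x) \<longrightarrow>
        (LINT x|lebesgue_on \<Omega>. v x *\<^sub>R D x) = - (LINT x|lebesgue_on \<Omega>. \<phi> x *\<^sub>R g x))"

text \<open>The weak gradient is unique up to a null set; any representative is selected.\<close>

definition weak_grad :: "(real^'n) set \<Rightarrow> (real^'n \<Rightarrow> real) \<Rightarrow> real^'n \<Rightarrow> real^'n" where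
  "weak_grad \<Omega> v = (SOME g. has_weak_gradient \<Omega> v g)"

definition H1 :: "(real^'n) set \<Rightarrow> (real^'n \<Rightarrow> real) set" where
  "H1 \<Omega> = {v. \<exists>g. has_weak_gradient \<Omega> v g}"

definition H10 :: "(real^'n) set \<Rightarrow> (real^'n \<Rightarrow> real) set" where
  "H10 \<Omega> = {v \<in> H1 \<Omega>. \<exists>\<phi> D.
     (\<forall>k::nat. \<phi> k \<in> test_functions \<Omega> \<and> (\<forall>x. GDERIV (\<phi> k) x :> D k x)) \<and>
     (\<lambda>k. LINT x|lebesgue_on \<Omega>. (\<phi> k x - v x)\<^sup>2) \<longlonglongrightarrow> 0 \<and>
     (\<lambda>k. LINT x|lebesgue_on \<Omega>. (norm (D k x - weak_grad \<Omega> v x))\<^sup>2) \<longlonglongrightarrow> 0}"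

definition H2 :: "(real^'n) set \<Rightarrow> (real^'n \<Rightarrow> real) set" where
  "H2 \<Omega> = {v \<in> H1 \<Omega>. \<forall>i. (\<lambda>x. weak_grad \<Omega> v x $ i) \<in> H1 \<Omega>}"

definition broken_H2 :: "(real^'n) set \<Rightarrow> (real^'n) set set \<Rightarrow> (real^'n \<Rightarrow> real) set" where
  "broken_H2 \<Omega> Th = {v \<in> L2 \<Omega>. \<forall>T\<in>Th. v \<in> H2 T}"

text \<open>
  The \<open>(d-1)\<close>-dimensional Lebesgue measure on a hyperplane \<open>H\<close>: the measure of \<open>A \<subseteq> H\<close> is
  the \<open>d\<close>-dimensional measure of the right cylinder of height 1 over \<open>A\<close>, centred at \<open>H\<close>
  (\<open>closest_point H\<close> is the orthogonal projection onto \<open>H\<close>). For \<open>d = 1\<close>, \<open>H\<close> is a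
  point, of measure 1. The completion is taken because traces of Lebesgue measurable functions need
  not be Borel.
\<close>

definition hyperplane_measure :: "(real^'n) set \<Rightarrow> (real^'n) measure" where
  "hyperplane_measure H =
     completion (distr (restrict_space lborel {y. infdist y H \<le> 1/2}) borel (closest_point H))"

abbreviation face_measure :: "(real^'n) set \<Rightarrow> (real^'n) measure" where
  "face_measure F \<equiv> hyperplane_measure (affine hull F)"

text \<open>
  The trace at a boundary point \<open>x\<close> with outward unit normal \<open>n\<close> of a function (or,
  componentwise, a vector field) defined on one side of the boundary. A Sobolev function is absolutely
  continuous on almost every normal line, and its trace is the one-sided limit along that line; the
  limit is taken in the mean so that, for almost every \<open>x\<close>, it does not depend on the representative
  of the function. For functions continuous up to the boundary this is the restriction.
\<close>

definition face_trace :: "real^'n \<Rightarrow> (real^'n \<Rightarrow> 'b::euclidean_space) \<Rightarrow> real^'n \<Rightarrow> 'b" where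
  "face_trace n g x =
     Lim (at_right 0) (\<lambda>\<epsilon>. (1/\<epsilon>) *\<^sub>R (LINT t|lebesgue_on {0<..<\<epsilon>}. g (x - t *\<^sub>R n)))"

text \<open>
  Polytopal domains need not be convex: they are connected interiors of finite unions of (closed,
  convex) polytopes. This excludes slits.
\<close>

definition polytopal_domain :: "(real^'n) set \<Rightarrow> bool" where
  "polytopal_domain S \<longleftrightarrow>
     S \<noteq> {} \<and> connected S \<and> (\<exists>P. finite P \<and> (\<forall>Q\<in>P. polytope Q) \<and> S = interior (\<Union>P))"

definition polytopal_partition :: "(real^'n) set \<Rightarrow> (real^'n) set set \<Rightarrow> bool" where
  "polytopal_partition \<Omega> P \<longleftrightarrow>
     finite P \<and> pairwise disjnt P \<and> (\<forall>Q\<in>P. polytopal_domain Q \<and> Q \<subseteq> \<Omega>) \<and>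
     closure \<Omega> = (\<Union>Q\<in>P. closure Q)"

definition faces_of :: "(real^'n) set set \<Rightarrow> (real^'n) set \<Rightarrow> (real^'n) set set" where
  "faces_of Fh T = {F \<in> Fh. F \<subseteq> frontier T}"

definition cells_of :: "(real^'n) set set \<Rightarrow> (real^'n) set \<Rightarrow> (real^'n) set set" where
  "cells_of Th F = {T \<in> Th. F \<subseteq> frontier T}"

definition internal_faces ::
    "(real^'n) set set \<Rightarrow> (real^'n) set set \<Rightarrow> (real^'n) set set" where
  "internal_faces Th Fh = {F \<in> Fh. card (cells_of Th F) = 2}"

definition boundary_faces ::
    "(real^'n) set set \<Rightarrow> (real^'n) set set \<Rightarrow> (real^'n) set set" where
  "boundary_faces Th Fh = {F \<in> Fh. card (cells_of Th F) = 1}"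

text \<open>
  The one-sidedness condition is only imposed at almost every point of \<open>F\<close>, since a non-convex
  cell may touch one of its own faces from the other side along a lower-dimensional set.
\<close>

definition outward_normal :: "(real^'n) set \<Rightarrow> (real^'n) set \<Rightarrow> real^'n \<Rightarrow> bool" where
  "outward_normal T F n \<longleftrightarrow>
     norm n = 1 \<and> (\<forall>x\<in>F. \<forall>y\<in>F. n \<bullet> (x - y) = 0) \<and>
     (AE x in face_measure F. x \<in> F \<longrightarrow>
        (\<exists>\<epsilon>>0. \<forall>t\<in>{0<..<\<epsilon>}. x - t *\<^sub>R n \<in> T \<and> x + t *\<^sub>R n \<notin> T))"

definition unit_normal :: "(real^'n) set \<Rightarrow> (real^'n) set \<Rightarrow> real^'n" where
  "unit_normal T F = (SOME n. outward_normal T F n)"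

text \<open>
  Cells are open, and faces are relatively open in their hyperplane. The last condition makes
  the outward normal of a cell on each of its faces meaningful: a face must not see the
  same cell on one side on one part of it, and on the other side on another part.
\<close>

definition polytopal_mesh ::
    "(real^'n) set \<Rightarrow> (real^'n) set set \<Rightarrow> (real^'n) set set \<Rightarrow> bool" where
  "polytopal_mesh \<Omega> Th Fh \<longleftrightarrow>
     polytopal_partition \<Omega> Th \<and>
     finite Fh \<and> pairwise disjnt Fh \<and>
     (\<forall>F\<in>Fh. F \<noteq> {} \<and> aff_dim F = int CARD('n) - 1 \<and>
        openin (top_of_set (affine hull F)) F \<and>
        closure F - F \<in> null_sets (face_measure F)) \<and>
     (\<forall>F\<in>Fh. F \<in> internal_faces Th Fh \<and> F \<subseteq> \<Omega> \<or>
              F \<in> boundary_faces Th Fh \<and> F \<subseteq> frontier \<Omega>) \<and>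
     (\<forall>T\<in>Th. frontier T = (\<Union>F\<in>faces_of Fh T. closure F)) \<and>
     (\<forall>T\<in>Th. \<forall>F\<in>faces_of Fh T. \<exists>n. outward_normal T F n)"

definition diffusion_tensor ::
    "(real^'n) set \<Rightarrow> (real^'n) set set \<Rightarrow> (real^'n \<Rightarrow> real^'n^'n) \<Rightarrow> bool" where
  "diffusion_tensor \<Omega> P K \<longleftrightarrow>
     (\<forall>x\<in>\<Omega>. transpose (K x) = K x) \<and>
     (\<exists>\<alpha>>0. \<forall>x\<in>\<Omega>. \<forall>\<xi>. \<alpha> * (norm \<xi>)\<^sup>2 \<le> (K x *v \<xi>) \<bullet> \<xi>) \<and>
     polytopal_partition \<Omega> P \<and> (\<forall>Q\<in>P. K constant_on Q)"

definition cell_tensor :: "(real^'n \<Rightarrow> real^'n^'n) \<Rightarrow> (real^'n) set \<Rightarrow> real^'n^'n" where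
  "cell_tensor K T = (THE A. \<forall>x\<in>T. K x = A)"

definition smallest_eigenvalue :: "real^'n^'n \<Rightarrow> real" where
  "smallest_eigenvalue A = Min {l. \<exists>v. v \<noteq> 0 \<and> A *v v = l *\<^sub>R v}"

definition face_lambda ::
    "(real^'n \<Rightarrow> real^'n^'n) \<Rightarrow> (real^'n) set set \<Rightarrow> (real^'n) set \<Rightarrow> real" where
  "face_lambda K Th F = Min ((\<lambda>T. smallest_eigenvalue (cell_tensor K T)) ` cells_of Th F)"

text \<open>The orthogonal distance between \<open>x\<^sub>T\<close> and \<open>F\<close> is the distance to the hyperplane of \<open>F\<close>.\<close>

definition cell_face_dist ::
    "((real^'n) set \<Rightarrow> real^'n) \<Rightarrow> (real^'n) set \<Rightarrow> (real^'n) set \<Rightarrow> real" where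
  "cell_face_dist xc T F = infdist (xc T) (affine hull F)"

definition face_dist ::
    "((real^'n) set \<Rightarrow> real^'n) \<Rightarrow> (real^'n) set set \<Rightarrow> (real^'n) set \<Rightarrow> real" where
  "face_dist xc Th F = (\<Sum>T\<in>cells_of Th F. cell_face_dist xc T F)"

abbreviation face_area :: "(real^'n) set \<Rightarrow> real" where
  "face_area F \<equiv> measure (face_measure F) F"

text \<open>Families indexed by \<open>\<T>\<^sub>h\<close>, encoded as functions vanishing outside \<open>\<T>\<^sub>h\<close>.\<close>

definition X_c :: "(real^'n) set set \<Rightarrow> ((real^'n) set \<Rightarrow> real) set" where
  "X_c Th = {v. \<forall>T. T \<notin> Th \<longrightarrow> v T = 0}"

definition linear_on_X_c ::
    "(real^'n) set set \<Rightarrow> (((real^'n) set \<Rightarrow> real) \<Rightarrow> real) \<Rightarrow> bool" where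
  "linear_on_X_c Th L \<longleftrightarrow>
     (\<forall>v\<in>X_c Th. \<forall>w\<in>X_c Th. L (\<lambda>T. v T + w T) = L v + L w) \<and>
     (\<forall>v\<in>X_c Th. \<forall>a. L (\<lambda>T. a * v T) = a * L v)"

definition interpolant ::
    "((real^'n) set \<Rightarrow> real^'n) \<Rightarrow> (real^'n) set set \<Rightarrow> (real^'n \<Rightarrow> real) \<Rightarrow> (real^'n) set \<Rightarrow> real"
  where "interpolant xc Th u = (\<lambda>T. if T \<in> Th then u (xc T) else 0)"

text \<open>
  \<open>v\<^sub>T - v\<^sub>T\<^sub>'\<close> with \<open>T'\<close> the other cell of the face, and \<open>v\<^sub>T\<^sub>' = 0\<close> on boundary faces:
  the sum has exactly one term for internal faces and is empty for boundary faces.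
\<close>

definition jump ::
    "(real^'n) set set \<Rightarrow> ((real^'n) set \<Rightarrow> real) \<Rightarrow> (real^'n) set \<Rightarrow> (real^'n) set \<Rightarrow> real" where
  "jump Th v T F = v T - (\<Sum>T'\<in>cells_of Th F - {T}. v T')"

text \<open>
  Here \<open>\<tau> F\<close> is any cell of \<open>F\<close>; its choice only affects the sign of the jumps.
\<close>

definition norm_1_c ::
    "(real^'n \<Rightarrow> real^'n^'n) \<Rightarrow> ((real^'n) set \<Rightarrow> real^'n) \<Rightarrow> (real^'n) set set \<Rightarrow>
     (real^'n) set set \<Rightarrow> ((real^'n) set \<Rightarrow> (real^'n) set) \<Rightarrow> ((real^'n) set \<Rightarrow> real) \<Rightarrow> real" where
  "norm_1_c K xc Th Fh \<tau> v =
     sqrt (\<Sum>F\<in>Fh. face_lambda K Th F * face_area F * face_dist xc Th F *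
                    (jump Th v (\<tau> F) F / face_dist xc Th F)\<^sup>2)"

end

theory Submission
  imports Defs
begin

text \<open>
  Put \<open>\<Phi>(T,F) = \<integral>\<^sub>F K\<^sub>T \<nabla>u \<bullet> n\<^sub>T\<^sub>F\<close>. These exact fluxes satisfy the balance
  \<open>\<Sum>\<^sub>F \<Phi>(T,F) = - \<integral>\<^sub>T f\<close> in every cell and are conservative across internal faces. Hence
  the error \<open>e = u\<^sub>h - I u\<close> solves the scheme whose right-hand side consists of the defects
  \<open>\<Phi>(T,F) + flux T F (I u)\<close>; testing it with \<open>e\<close>, using coercivity on the left and the weighted
  Cauchy-Schwarz inequality on the right, gives the estimate.

  The balance is the divergence theorem for \<open>H\<^sup>1\<close> fields on a possibly non-convex polyhedral cell, with
  traces given by limits along normal lines. It follows by testing the weak gradient with cut-offs vanishing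
  near the hyperplanes that carry the faces: their gradients concentrate on strips of width \<open>\<epsilon>\<close> along
  these hyperplanes, where the averages tend to the traces, while the overlaps of different strips do not
  contribute in the limit. Adding Green's formula over all cells, with a test function that lives near a single
  internal face, and applying the fundamental lemma of the calculus of variations in the hyperplane of that
  face yields conservativity.
\<close>

section \<open>Smooth functions\<close>

text \<open>The obstacle is that Sobolev functions are known only up to null sets, while the traces
  are limits on single lines. Hence every function is replaced by a Borel representative extended by
  zero, the weak gradient is turned into an integral formula on almost every normal line, and
  Lebesgue measure is split into a hyperplane measure and the normal coordinate. Traces thereby
  become values of absolutely continuous functions of one variable. The cut-offs vanish along entire
  hyperplanes, not only near the faces, because they are then plain products of one-variable
  profiles, whatever the shape of the cell. The price is paid twice. Where a hyperplane cuts through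
  the interior of a cell, two artificial traces appear, which agree and cancel. And the traces must
  be integrable up to the edges of the arrangement, which is shown by translating pieces of its
  convex cells inwards. The overlap of two strips has measure of order \<epsilon>^2 against
  gradients of order 1/\<epsilon>, which is just enough for square integrable functions.\<close>

primrec C_k_real :: "nat \<Rightarrow> (real \<Rightarrow> real) \<Rightarrow> bool" where
  "C_k_real 0 f = continuous_on UNIV f"
| "C_k_real (Suc k) f = (\<exists>f'. (\<forall>x. DERIV f x :> f' x) \<and> C_k_real k f')"

lemma C_k_real_pred: "C_k_real (Suc k) f \<Longrightarrow> C_k_real k f"
proof (induction k arbitrary: f)
  case 0
  then show ?case by (auto intro!: DERIV_continuous_on simp: continuous_on_eq_continuous_at intro: DERIV_isCont)
next
  case (Suc k)
  then obtain f' where "\<forall>x. DERIV f x :> f' x" "C_k_real (Suc k) f'" by auto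
  with Suc.IH show ?case by auto
qed

lemma C_k_real_const: "C_k_real k (\<lambda>x. c)"
  by (induction k arbitrary: c) (auto intro!: exI[of _ "\<lambda>x. 0"])

lemma C_k_real_add: "C_k_real k f \<Longrightarrow> C_k_real k g \<Longrightarrow> C_k_real k (\<lambda>x. f x + g x)"
proof (induction k arbitrary: f g)
  case (Suc k)
  then obtain f' g' where "\<forall>x. DERIV f x :> f' x" "C_k_real k f'" "\<forall>x. DERIV g x :> g' x" "C_k_real k g'"
    by auto
  with Suc.IH show ?case by (auto intro!: exI[of _ "\<lambda>x. f' x + g' x"] derivative_intros)
qed (auto intro: continuous_intros)

lemma C_k_real_mult: "C_k_real k f \<Longrightarrow> C_k_real k g \<Longrightarrow> C_k_real k (\<lambda>x. f x * g x)"
proof (induction k arbitrary: f g)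
  case (Suc k)
  then obtain f' g' where d: "\<forall>x. DERIV f x :> f' x" "C_k_real k f'" "\<forall>x. DERIV g x :> g' x" "C_k_real k g'"
    by auto
  have "C_k_real k f" "C_k_real k g" using Suc.prems C_k_real_pred by blast+
  then have "C_k_real k (\<lambda>x. f' x * g x + g' x * f x)"
    using d Suc.IH by (intro C_k_real_add) auto
  moreover have "\<forall>x. DERIV (\<lambda>x. f x * g x) x :> f' x * g x + g' x * f x"
    using d by (auto intro!: DERIV_mult)
  ultimately show ?case by auto
qed (auto intro: continuous_intros)

lemma C_k_real_affine: "C_k_real k f \<Longrightarrow> C_k_real k (\<lambda>x. f (a * x + b))"
proof (induction k arbitrary: f)
  case 0
  then show ?case by (auto intro!: continuous_on_compose2[where f="\<lambda>x. a * x + b" and t=UNIV] continuous_intros)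
next
  case (Suc k)
  then obtain f' where d: "\<forall>x. DERIV f x :> f' x" "C_k_real k f'" by auto
  have "DERIV (\<lambda>x. f (a * x + b)) x :> f' (a * x + b) * a" for x
    by (rule DERIV_chain2[where g="\<lambda>x. a * x + b"]) (use d in \<open>auto intro!: derivative_eq_intros\<close>)
  moreover have "C_k_real k (\<lambda>x. f' (a * x + b) * a)"
    using Suc.IH d by (intro C_k_real_mult C_k_real_const) auto
  ultimately show ?case
    unfolding C_k_real.simps by (intro exI[of _ "\<lambda>x. f' (a * x + b) * a"]) blast
qed

text \<open>For m = 0 this is the classical function exp(-1/x), flat at the origin. The powers of
  1/x are included so that the span of the family is closed under differentiation, which makes
  smoothness a plain induction.\<close>

definition flat_exp :: "nat \<Rightarrow> real \<Rightarrow> real" where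
  "flat_exp m x = (if x > 0 then (1/x)^m * exp (- (1/x)) else 0)"

lemma flat_exp_tendsto_0: "((\<lambda>x. (1/x)^m * exp (- (1/x))) \<longlongrightarrow> 0) (at_right (0::real))"
proof -
  have "((\<lambda>y::real. y ^ m / exp y) \<longlongrightarrow> 0) at_top" by (rule tendsto_power_div_exp_0)
  moreover have "filterlim (\<lambda>x. inverse x :: real) at_top (at_right 0)" by (rule filterlim_inverse_at_top_right)
  ultimately have "((\<lambda>x. (inverse x) ^ m / exp (inverse x)) \<longlongrightarrow> 0) (at_right (0::real))"
    by (rule filterlim_compose)
  then show ?thesis by (simp add: exp_minus divide_inverse)
qed

lemma DERIV_flat_exp:
  "DERIV (flat_exp m) x :> flat_exp (m+2) x - real m * flat_exp (m+1) x"
proof -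
  consider "x > 0" | "x < 0" | "x = 0" by linarith
  then show ?thesis
  proof cases
    case 1
    have ev: "eventually (\<lambda>y. flat_exp m y = (1/y)^m * exp (- (1/y))) (nhds x)"
      using eventually_nhds_in_open[of "{0<..}" x] 1 by (auto elim!: eventually_mono simp: flat_exp_def)
    have d: "DERIV (\<lambda>y. 1/y) x :> - ((1/x)^2)"
      using 1 by (auto intro!: derivative_eq_intros simp: power2_eq_square)
    have "DERIV (\<lambda>y. exp (- (1/y))) x :> exp (- (1/x)) * (1/x)^2"
      using DERIV_chain2[OF DERIV_exp DERIV_minus[OF d]] by simp
    from DERIV_mult[OF DERIV_power[OF d, of m] this]
    have "DERIV (\<lambda>y. (1/y)^m * exp (- (1/y))) x :>
        real m * (- ((1/x)^2) * (1/x)^(m - Suc 0)) * exp (- (1/x)) + exp (- (1/x)) * (1/x)^2 * (1/x)^m" .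
    moreover have "real m * (- ((1/x)^2) * (1/x)^(m - Suc 0)) * exp (- (1/x)) + exp (- (1/x)) * (1/x)^2 * (1/x)^m
        = flat_exp (m+2) x - real m * flat_exp (m+1) x"
    proof -
      \<comment> \<open>For m = 0 the truncated exponent is wrong, but then the prefactor
        \<open>real m\<close> is zero.\<close>
      have "(1/x)^2 * (1/x)^(m - Suc 0) = (1/x)^(m+1)" if "m > 0"
        using that by (cases m) (simp_all add: power2_eq_square)
      then have "real m * (- ((1/x)^2) * (1/x)^(m - Suc 0)) = - (real m * (1/x)^(m+1))"
        by (cases "m = 0") auto
      moreover have "(1/x)^2 * (1/x)^m = (1/x)^(m+2)" by (simp add: power2_eq_square)
      ultimately show ?thesis using 1 by (simp only: flat_exp_def if_True mult.assoc) (simp only: mult_minus_left, argo)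
    qed
    ultimately have "DERIV (\<lambda>y. (1/y)^m * exp (- (1/y))) x :> flat_exp (m+2) x - real m * flat_exp (m+1) x"
      by simp
    then show ?thesis using DERIV_cong_ev[OF refl ev refl] by simp
  next
    case 2
    have ev: "eventually (\<lambda>y. flat_exp m y = 0) (nhds x)"
      using eventually_nhds_in_open[of "{..<0}" x] 2 by (auto elim!: eventually_mono simp: flat_exp_def)
    have "DERIV (flat_exp m) x :> 0" using DERIV_cong_ev[OF refl ev refl, of 0] by simp
    then show ?thesis using 2 by (simp add: flat_exp_def)
  next
    case 3
    have "((\<lambda>h. (flat_exp m h - flat_exp m 0) / h) \<longlongrightarrow> 0) (at 0)"
    proof (rule filterlim_split_at)
      have "eventually (\<lambda>h::real. (flat_exp m h - flat_exp m 0) / h = 0) (at_left 0)"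
        by (auto simp: flat_exp_def eventually_at_filter)
      then show "((\<lambda>h. (flat_exp m h - flat_exp m 0) / h) \<longlongrightarrow> 0) (at_left 0)"
        by (rule tendsto_eventually)
      \<comment> \<open>The difference quotient at 0 only raises the power of 1/x by one, so the
        known limit at the origin applies with \<open>Suc m\<close>.\<close>
      have "eventually (\<lambda>h::real. (1/h)^(Suc m) * exp (- (1/h)) = (flat_exp m h - flat_exp m 0) / h) (at_right 0)"
        by (auto simp: flat_exp_def eventually_at_filter)
      then show "((\<lambda>h. (flat_exp m h - flat_exp m 0) / h) \<longlongrightarrow> 0) (at_right 0)"
        using flat_exp_tendsto_0[of "Suc m"] by (rule Lim_transform_eventually[rotated])
    qed
    then show ?thesis using 3 by (simp add: DERIV_def flat_exp_def)
  qed
qed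

lemma C_k_real_flat_exp: "C_k_real k (flat_exp m)"
proof (induction k arbitrary: m)
  case 0
  then show ?case using DERIV_flat_exp by (auto simp: continuous_on_eq_continuous_at intro: DERIV_isCont)
next
  case (Suc k)
  have "C_k_real k (\<lambda>x. flat_exp (m+2) x + (- real m) * flat_exp (m+1) x)"
    by (intro C_k_real_add C_k_real_mult C_k_real_const Suc)
  then show ?case using DERIV_flat_exp[of m] by (auto intro!: exI[of _ "\<lambda>x. flat_exp (m+2) x - real m * flat_exp (m+1) x"])
qed

text \<open>The normalised primitive of a bump supported in [1/2, 1]. Vanishing up to 1/2, and not
  only up to 0, leaves a margin: cut-offs built from it at scale \<epsilon> vanish on whole
  neighbourhoods of width \<epsilon>/2 and so have compact support in an open set.\<close>

lemma smooth_step_exists: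
  "\<exists>F F'. (\<forall>x. DERIV F x :> F' x) \<and> (\<forall>k. C_k_real k F) \<and> (\<forall>k. C_k_real k F') \<and>
     (\<forall>x\<le>1/2. F x = 0) \<and> (\<forall>x\<ge>1. F x = 1) \<and>
     (\<forall>x. 0 \<le> F' x) \<and> (\<forall>x. x \<le> 1/2 \<or> 1 \<le> x \<longrightarrow> F' x = 0)"
proof -
  define b where "b = (\<lambda>x. flat_exp 0 (1 * x + (-1/2)) * flat_exp 0 (-1 * x + 1))"
  have sb: "C_k_real k b" for k
    unfolding b_def by (intro C_k_real_mult C_k_real_affine C_k_real_flat_exp)
  have cb: "isCont b x" for x
    using sb[of 0] by (auto simp: continuous_on_eq_continuous_at)
  have b0: "b x = 0" if "x \<le> 1/2 \<or> 1 \<le> x" for x using that by (auto simp: b_def flat_exp_def)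
  have bp: "b x \<ge> 0" for x by (auto simp: b_def flat_exp_def)
  have bpos: "b x > 0" if "1/2 < x" "x < 1" for x using that by (auto simp: b_def flat_exp_def)
  obtain F where "\<And>x::real. (F has_vector_derivative b x) (at x)"
    using einterval_antiderivative[of "-\<infinity>" "\<infinity>" b] cb by (auto simp del: has_real_derivative_iff_has_vector_derivative)
  then have F: "DERIV F x :> b x" for x by (simp add: has_real_derivative_iff_has_vector_derivative)
  have c1: "F x = F (1/2)" if "x \<le> 1/2" for x
  proof (cases "x = 1/2")
    case False
    show ?thesis
    proof (rule DERIV_isconst_end[of x "1/2" F, symmetric])
      show "x < 1/2" using that False by simp
      show "continuous_on {x..1/2} F" using F by (intro DERIV_continuous_on) (auto intro: DERIV_subset)
      show "DERIV F y :> 0" if "x < y" "y < 1/2" for y using F[of y] b0[of y] that by simp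
    qed
  next
    case True
    show ?thesis unfolding True ..
  qed
  have c2: "F x = F 1" if "x \<ge> 1" for x
  proof (cases "x = 1")
    case False
    show ?thesis
    proof (rule DERIV_isconst_end[of 1 x F])
      show "1 < x" using that False by simp
      show "continuous_on {1..x} F" using F by (intro DERIV_continuous_on) (auto intro: DERIV_subset)
      show "DERIV F y :> 0" if "1 < y" "y < x" for y using F[of y] b0[of y] that by simp
    qed
  qed simp
  \<comment> \<open>The mean value is attained strictly inside the bump, where b is positive; hence
    the normalising constant is nonzero.\<close>
  have "\<exists>z>1/2. z < 1 \<and> F 1 - F (1/2) = (1 - 1/2) * b z"
    by (rule MVT2) (use F in auto)
  then obtain z where "1/2 < z" "z < 1" "F 1 - F (1/2) = (1 - 1/2) * b z" by blast
  then have pos: "F 1 - F (1/2) > 0" using bpos[of z] by simp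
  define d where "d = F 1 - F (1/2)"
  define G where "G = (\<lambda>x. (1/d) * (F x + (- F (1/2))))"
  define G' where "G' = (\<lambda>x. (1/d) * b x)"
  have dpos: "d > 0" using pos by (simp add: d_def)
  have sF: "C_k_real k F" for k
    using C_k_real_pred[of k F] F sb by auto
  have "DERIV G x :> G' x" for x
    unfolding G_def G'_def using F dpos by (auto intro!: derivative_eq_intros)
  moreover have "C_k_real k G" "C_k_real k G'" for k
    unfolding G_def G'_def by (intro C_k_real_mult C_k_real_add C_k_real_const sF sb)+
  moreover have "G x = 0" if "x \<le> 1/2" for x using c1[OF that] by (simp add: G_def)
  moreover have "G x = 1" if "x \<ge> 1" for x using c2[OF that] dpos by (simp add: G_def d_def)
  moreover have "0 \<le> G' x" for x using bp dpos by (simp add: G'_def)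
  moreover have "G' x = 0" if "x \<le> 1/2 \<or> 1 \<le> x" for x using b0[OF that] by (simp add: G'_def)
  ultimately show ?thesis by blast
qed

text \<open>The step and its derivative are chosen together, so that the derivative is a named
  function whose sign, support and smoothness are known.\<close>

definition smooth_step_pair :: "(real \<Rightarrow> real) \<times> (real \<Rightarrow> real)" where
  "smooth_step_pair = (SOME p. (\<forall>x. DERIV (fst p) x :> snd p x) \<and> (\<forall>k. C_k_real k (fst p)) \<and> (\<forall>k. C_k_real k (snd p)) \<and>
     (\<forall>x\<le>1/2. fst p x = 0) \<and> (\<forall>x\<ge>1. fst p x = 1) \<and>
     (\<forall>x. 0 \<le> snd p x) \<and> (\<forall>x. x \<le> 1/2 \<or> 1 \<le> x \<longrightarrow> snd p x = 0))"

definition step :: "real \<Rightarrow> real" where "step = fst smooth_step_pair"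
definition step' :: "real \<Rightarrow> real" where "step' = snd smooth_step_pair"

lemma step_props:
  shows DERIV_step: "DERIV step x :> step' x"
    and C_k_step: "C_k_real k step" and C_k_step': "C_k_real k step'"
    and step_eq_0: "x \<le> 1/2 \<Longrightarrow> step x = 0" and step_eq_1: "1 \<le> x \<Longrightarrow> step x = 1"
    and step'_nonneg: "0 \<le> step' x" and step'_eq_0: "x \<le> 1/2 \<or> 1 \<le> x \<Longrightarrow> step' x = 0"
proof -
  have "(\<forall>x. DERIV step x :> step' x) \<and> (\<forall>k. C_k_real k step) \<and> (\<forall>k. C_k_real k step') \<and>
     (\<forall>x\<le>1/2. step x = 0) \<and> (\<forall>x\<ge>1. step x = 1) \<and>
     (\<forall>x. 0 \<le> step' x) \<and> (\<forall>x. x \<le> 1/2 \<or> 1 \<le> x \<longrightarrow> step' x = 0)"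
    unfolding step_def step'_def smooth_step_pair_def
    by (rule someI_ex) (use smooth_step_exists in auto)
  then show "DERIV step x :> step' x" "C_k_real k step" "C_k_real k step'"
     "x \<le> 1/2 \<Longrightarrow> step x = 0" "1 \<le> x \<Longrightarrow> step x = 1"
    "0 \<le> step' x" "x \<le> 1/2 \<or> 1 \<le> x \<Longrightarrow> step' x = 0" by auto
qed

lemma step_mono: "x \<le> y \<Longrightarrow> step x \<le> step y"
  by (rule DERIV_nonneg_imp_nondecreasing) (use DERIV_step step'_nonneg in auto)

lemma step_nonneg: "0 \<le> step x"
  by (metis step_mono step_eq_0 linear)

lemma step_le_1: "step x \<le> 1"
  by (metis step_mono step_eq_1 linear)

lemma continuous_step: "continuous_on UNIV step" and continuous_step': "continuous_on UNIV step'"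
  using C_k_step[of 0] C_k_step'[of 0] by auto

lemma step_measurable [measurable]: "step \<in> borel_measurable borel" "step' \<in> borel_measurable borel"
  by (simp_all add: borel_measurable_continuous_onI continuous_step continuous_step')

lemma step'_bounded: "\<exists>M>0. \<forall>x. step' x \<le> M"
proof -
  have "compact (step' ` {0..1})"
    by (intro compact_continuous_image continuous_on_subset[OF continuous_step']) auto
  then have "bounded (step' ` {0..1})" by (rule compact_imp_bounded)
  then obtain B where B: "\<forall>x\<in>{0..1}. norm (step' x) \<le> B" by (auto simp: bounded_iff)
  have "step' x \<le> max B 1" for x
  proof (cases "x \<in> {0..1}")
    case True
    have "norm (step' x) \<le> B" using B True by blast
    then show ?thesis by (simp add: real_norm_def)
  next
    case False
    then have "x \<le> 1/2 \<or> 1 \<le> x" by auto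
    then have "step' x = 0" by (rule step'_eq_0)
    then show ?thesis by simp
  qed
  then show ?thesis by (intro exI[of _ "max B 1"]) auto
qed

definition step'_sup :: real where "step'_sup = (SOME M. M > 0 \<and> (\<forall>x. step' x \<le> M))"

lemma step'_sup: "step'_sup > 0" "step' x \<le> step'_sup"
  using someI_ex[OF step'_bounded] by (auto simp: step'_sup_def)

text \<open>The profile \<open>\<bar>r\<bar> \<mapsto> step \<bar>r\<bar>\<close>, written so that smoothness at the origin is visible.\<close>

definition notch :: "real \<Rightarrow> real" where "notch r = step r + step (- r)"

lemma notch_eq: "notch r = step \<bar>r\<bar>"
  using step_eq_0[of r] step_eq_0[of "-r"] by (auto simp: notch_def abs_if)

lemma C_k_notch: "C_k_real k notch"
proof -
  have "C_k_real k (\<lambda>r. step r + step ((-1) * r + 0))"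
    by (intro C_k_real_add C_k_real_affine C_k_step)
  then show ?thesis by (simp add: notch_def[abs_def])
qed

lemma DERIV_notch: "DERIV notch r :> step' r - step' (- r)"
  unfolding notch_def[abs_def]
  by (auto intro!: derivative_eq_intros DERIV_chain2[OF DERIV_step] DERIV_step)

section \<open>Smooth functions of several variables\<close>

lemma GDERIV_unique: "GDERIV \<phi> x :> D \<Longrightarrow> GDERIV \<phi> x :> D' \<Longrightarrow> D = D'"
  unfolding gderiv_def by (metis has_derivative_unique inner_commute vector_eq_ldot)

lemma GDERIV_continuous: "(\<And>x. GDERIV \<phi> x :> D x) \<Longrightarrow> continuous_on UNIV \<phi>"
  unfolding gderiv_def by (auto simp: continuous_on_eq_continuous_at intro: has_derivative_continuous)

lemma C_k_pred: "C_k (Suc k) f \<Longrightarrow> C_k k f"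
proof (induction k arbitrary: f)
  case 0
  then show ?case using GDERIV_continuous by auto
next
  case (Suc k)
  then obtain D where "\<forall>x. GDERIV f x :> D x" "\<forall>i. C_k (Suc k) (\<lambda>x. D x $ i)" by auto
  with Suc.IH show ?case by auto
qed

lemma C_k_const: "C_k k (\<lambda>x. c)"
  by (induction k arbitrary: c) (auto intro!: exI[of _ "\<lambda>x. 0"] GDERIV_const)

lemma C_k_add: "C_k k f \<Longrightarrow> C_k k g \<Longrightarrow> C_k k (\<lambda>x. f x + g x)"
proof (induction k arbitrary: f g)
  case (Suc k)
  then obtain f' g' where "\<forall>x. GDERIV f x :> f' x" "\<forall>i. C_k k (\<lambda>x. f' x $ i)" "\<forall>x. GDERIV g x :> g' x" "\<forall>i. C_k k (\<lambda>x. g' x $ i)"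
    by auto
  with Suc.IH show ?case by (auto intro!: exI[of _ "\<lambda>x. f' x + g' x"] GDERIV_add)
qed (auto intro: continuous_intros)

lemma C_k_mult: "C_k k f \<Longrightarrow> C_k k g \<Longrightarrow> C_k k (\<lambda>x. f x * g x)"
proof (induction k arbitrary: f g)
  case (Suc k)
  then obtain f' g' where d: "\<forall>x. GDERIV f x :> f' x" "\<forall>i. C_k k (\<lambda>x. f' x $ i)" "\<forall>x. GDERIV g x :> g' x" "\<forall>i. C_k k (\<lambda>x. g' x $ i)"
    by auto
  have "C_k k f" "C_k k g" using Suc.prems C_k_pred by blast+
  then have "C_k k (\<lambda>x. f x * g' x $ i + g x * f' x $ i)" for i
    using d Suc.IH by (intro C_k_add) auto
  moreover have "\<forall>x. GDERIV (\<lambda>x. f x * g x) x :> f x *\<^sub>R g' x + g x *\<^sub>R f' x"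
    using d by (auto intro!: GDERIV_mult)
  ultimately show ?case by (auto intro!: exI[of _ "\<lambda>x. f x *\<^sub>R g' x + g x *\<^sub>R f' x"])
qed (auto intro: continuous_intros)

lemma C_k_prod: "finite I \<Longrightarrow> (\<And>i. i \<in> I \<Longrightarrow> C_k k (f i)) \<Longrightarrow> C_k k (\<lambda>x. \<Prod>i\<in>I. f i x)"
  by (induction I rule: finite_induct) (auto intro: C_k_const C_k_mult)

lemma GDERIV_inner: "GDERIV (\<lambda>x. a \<bullet> x + b) x :> a"
  unfolding gderiv_def by (auto intro!: derivative_eq_intros simp: inner_commute)

lemma C_k_ridge: "C_k_real k f \<Longrightarrow> C_k k (\<lambda>x. f (a \<bullet> x + b))"
proof (induction k arbitrary: f)
  case 0
  then show ?case by (auto intro!: continuous_on_compose2[where f="\<lambda>x. a \<bullet> x + b" and t=UNIV] continuous_intros)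
next
  case (Suc k)
  then obtain f' where d: "\<forall>x. DERIV f x :> f' x" "C_k_real k f'" by auto
  have "GDERIV (\<lambda>x. f (a \<bullet> x + b)) x :> f' (a \<bullet> x + b) *\<^sub>R a" for x
    by (rule GDERIV_DERIV_compose[OF GDERIV_inner]) (use d in auto)
  moreover have "C_k k (\<lambda>x. (f' (a \<bullet> x + b) *\<^sub>R a) $ i)" for i
    using C_k_mult[OF Suc.IH[OF d(2)] C_k_const[of k "a $ i"]] by simp
  ultimately show ?case
    unfolding C_k.simps by (intro exI[of _ "\<lambda>x. f' (a \<bullet> x + b) *\<^sub>R a"]) blast
qed

lemma GDERIV_shift: "GDERIV f (x + a) :> d \<Longrightarrow> GDERIV (\<lambda>x. f (x + a)) x :> d"
  unfolding gderiv_def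
  by (rule has_derivative_compose[of "\<lambda>x. x + a" "\<lambda>h. h" x UNIV f "\<lambda>h. h \<bullet> d"])
    (auto intro!: derivative_eq_intros)

lemma C_k_shift: "C_k k f \<Longrightarrow> C_k k (\<lambda>x. f (x + a))"
proof (induction k arbitrary: f)
  case 0
  then show ?case by (auto intro!: continuous_on_compose2[where f="\<lambda>x. x + a" and t=UNIV] continuous_intros)
next
  case (Suc k)
  then obtain f' where d: "\<forall>x. GDERIV f x :> f' x" "\<forall>i. C_k k (\<lambda>x. f' x $ i)" by auto
  then show ?case using Suc.IH by (auto intro!: exI[of _ "\<lambda>x. f' (x + a)"] GDERIV_shift)
qed

lemma GDERIV_cong_open:
  assumes "open U" "x \<in> U" "\<And>y. y \<in> U \<Longrightarrow> f y = g y" "GDERIV f x :> d"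
  shows "GDERIV g x :> d"
  using assms has_derivative_transform_within_open unfolding gderiv_def by metis

text \<open>Every point lies in T, off its closure, or in the neighbourhood N of the frontier; near
  each such point the truncated function coincides with f or with 0. This is what allows a cut-off
  built from whole hyperplanes to be restricted to a single cell of arbitrary shape.\<close>

lemma C_k_restrict:
  assumes "open N" "frontier T \<subseteq> N" "open T"
  shows "C_k k f \<Longrightarrow> (\<And>x. x \<in> N \<Longrightarrow> f x = 0) \<Longrightarrow> C_k k (\<lambda>x. if x \<in> T then f x else 0)"
    and "(\<And>x. x \<in> N \<Longrightarrow> f x = 0) \<Longrightarrow> GDERIV f x :> d \<Longrightarrow> GDERIV (\<lambda>x. if x \<in> T then f x else 0) x :> (if x \<in> T then d else 0)"
proof -
  have G: "GDERIV (\<lambda>x. if x \<in> T then f x else 0) x :> (if x \<in> T then d else 0)"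
    if N: "\<And>x. x \<in> N \<Longrightarrow> f x = 0" and d: "GDERIV f x :> d" for f x d
  proof -
    consider "x \<in> T" | "x \<notin> closure T" | "x \<in> N" "x \<notin> T"
      using assms by (auto simp: frontier_def interior_open)
    then show ?thesis
    proof cases
      case 1
      show ?thesis using 1 d by (auto intro: GDERIV_cong_open[of T x f] simp: assms)
    next
      case 2
      have "GDERIV (\<lambda>x. if x \<in> T then f x else 0) x :> 0"
      proof (rule GDERIV_cong_open)
        show "open (- closure T)" "x \<in> - closure T" using 2 by auto
        show "0 = (if y \<in> T then f y else 0)" if "y \<in> - closure T" for y
          using that closure_subset[of T] by auto
      qed (rule GDERIV_const)
      then show ?thesis using 2 closure_subset[of T] by auto
    next
      case 3
      then show ?thesis
        using N GDERIV_cong_open[of N x "\<lambda>x. 0" "\<lambda>x. if x \<in> T then f x else 0" 0]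
        by (auto simp: GDERIV_const assms)
    qed
  qed
  then show "(\<And>x. x \<in> N \<Longrightarrow> f x = 0) \<Longrightarrow> GDERIV f x :> d \<Longrightarrow> GDERIV (\<lambda>x. if x \<in> T then f x else 0) x :> (if x \<in> T then d else 0)" .
  show "C_k k f \<Longrightarrow> (\<And>x. x \<in> N \<Longrightarrow> f x = 0) \<Longrightarrow> C_k k (\<lambda>x. if x \<in> T then f x else 0)"
  proof (induction k arbitrary: f)
    case 0
    have "isCont (\<lambda>x. if x \<in> T then f x else 0) x" for x
    proof -
      have "isCont f x" using 0 by (auto simp: continuous_on_eq_continuous_at)
      consider "x \<in> T" | "x \<notin> closure T" | "x \<in> N" "x \<notin> T"
        using assms by (auto simp: frontier_def interior_open)
      then show ?thesis
      proof cases
        case 1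
        have "eventually (\<lambda>x. (if x \<in> T then f x else 0) = f x) (nhds x)"
          using eventually_nhds_in_open[OF \<open>open T\<close> 1] by (auto elim: eventually_mono)
        then show ?thesis using \<open>isCont f x\<close> isCont_cong by fastforce
      next
        case 2
        have "eventually (\<lambda>x. (if x \<in> T then f x else 0) = 0) (nhds x)"
          using eventually_nhds_in_open[OF open_Compl[OF closed_closure[of T]], of x] 2 closure_subset[of T]
          by (auto elim!: eventually_mono)
        then show ?thesis using isCont_cong[of _ "\<lambda>x. 0"] by fastforce
      next
        case 3
        have "eventually (\<lambda>x. (if x \<in> T then f x else 0) = 0) (nhds x)"
          using eventually_nhds_in_open[OF \<open>open N\<close> 3(1)] 0(2) by (auto elim!: eventually_mono)
        then show ?thesis using isCont_cong[of _ "\<lambda>x. 0"] by fastforce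
      qed
    qed
    then show ?case by (auto simp: continuous_on_eq_continuous_at)
  next
    case (Suc k)
    then obtain f' where d: "\<And>x. GDERIV f x :> f' x" "\<And>i. C_k k (\<lambda>x. f' x $ i)" by auto
    \<comment> \<open>The gradient inherits the vanishing on the open set N, so the induction
      hypothesis applies to its components.\<close>
    have "f' x = 0" if "x \<in> N" for x
    proof -
      have "GDERIV f x :> 0"
        using GDERIV_cong_open[of N x "\<lambda>x. 0" f 0] Suc.prems that assms by (auto simp: GDERIV_const)
      then show ?thesis using d GDERIV_unique by metis
    qed
    then have "C_k k (\<lambda>x. if x \<in> T then f' x $ i else 0)" for i
      using Suc.IH[OF d(2)] by auto
    then have "C_k k (\<lambda>x. (if x \<in> T then f' x else 0) $ i)" for i
      by (simp add: if_distrib[of "\<lambda>v. v $ i"] cong: if_cong)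
    then show ?case using G[OF Suc.prems(2) d(1)] by (auto intro!: exI[of _ "\<lambda>x. if x \<in> T then f' x else 0"])
  qed
qed

section \<open>Test functions\<close>

lemma test_functions_mono: "A \<subseteq> B \<Longrightarrow> test_functions A \<subseteq> test_functions B"
  by (auto simp: test_functions_def)

lemma test_function_gderiv:
  assumes "\<phi> \<in> test_functions \<Omega>"
  obtains D where "\<And>x. GDERIV \<phi> x :> D x" "\<And>i. (\<lambda>x. D x $ i) \<in> test_functions \<Omega>"
proof -
  have c: "\<And>k. C_k k \<phi>" "compact (closure {x. \<phi> x \<noteq> 0})" "closure {x. \<phi> x \<noteq> 0} \<subseteq> \<Omega>"
    using assms by (auto simp: test_functions_def)
  from c(1)[of 1] obtain D where D: "\<And>x. GDERIV \<phi> x :> D x" by auto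
  \<comment> \<open>\<open>C_k\<close> only asserts that some gradient exists at each order;
    uniqueness of gradients identifies all of them with D.\<close>
  have Dk: "C_k k (\<lambda>x. D x $ i)" for k i
  proof -
    from c(1)[of "Suc k"] obtain D' where D': "\<And>x. GDERIV \<phi> x :> D' x" "\<And>i. C_k k (\<lambda>x. D' x $ i)" by auto
    then have "D' = D" using D GDERIV_unique by blast
    with D' show ?thesis by auto
  qed
  have "D x = 0" if "x \<notin> closure {x. \<phi> x \<noteq> 0}" for x
  proof -
    have "GDERIV \<phi> x :> 0"
    proof (rule GDERIV_cong_open)
      show "open (- closure {x. \<phi> x \<noteq> 0})" "x \<in> - closure {x. \<phi> x \<noteq> 0}" using that by auto
      show "0 = \<phi> y" if "y \<in> - closure {x. \<phi> x \<noteq> 0}" for y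
        using that closure_subset[of "{x. \<phi> x \<noteq> 0}"] by auto
    qed (rule GDERIV_const)
    then show ?thesis using D GDERIV_unique by blast
  qed
  then have "{x. D x $ i \<noteq> 0} \<subseteq> closure {x. \<phi> x \<noteq> 0}" for i by force
  then have "closure {x. D x $ i \<noteq> 0} \<subseteq> closure {x. \<phi> x \<noteq> 0}" for i
    by (simp add: closure_minimal)
  then have "(\<lambda>x. D x $ i) \<in> test_functions \<Omega>" for i
  proof -
    have "bounded {x. D x $ i \<noteq> 0}"
      using c(2) \<open>\<And>i. {x. D x $ i \<noteq> 0} \<subseteq> _\<close> by (metis bounded_subset compact_imp_bounded)
    then show ?thesis
      using c(3) Dk \<open>\<And>i. closure {x. D x $ i \<noteq> 0} \<subseteq> _\<close>[of i] by (auto simp: test_functions_def)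
  qed
  with D that show ?thesis by blast
qed

lemma test_functions_shift:
  assumes "\<phi> \<in> test_functions A" "\<And>x. x \<in> A \<Longrightarrow> x - a \<in> B"
  shows "(\<lambda>x. \<phi> (x + a)) \<in> test_functions B"
proof -
  have "{x. \<phi> (x + a) \<noteq> 0} = (\<lambda>x. -a + x) ` {x. \<phi> x \<noteq> 0}"
    by (auto simp: image_iff intro!: exI[of _ "_ + a"])
  then have *: "closure {x. \<phi> (x + a) \<noteq> 0} = (\<lambda>x. -a + x) ` closure {x. \<phi> x \<noteq> 0}"
    by (simp only: closure_translation)
  have "compact ((\<lambda>x. -a + x) ` closure {x. \<phi> x \<noteq> 0})"
    using assms by (intro compact_translation) (auto simp: test_functions_def)
  then show ?thesis
    using assms unfolding test_functions_def mem_Collect_eq *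
    by (intro conjI allI C_k_shift) auto
qed

lemma test_function_mult:
  assumes "\<phi> \<in> test_functions A" "\<And>k. C_k k \<psi>"
  shows "(\<lambda>x. \<psi> x * \<phi> x) \<in> test_functions A"
proof -
  have *: "closure {x. \<psi> x * \<phi> x \<noteq> 0} \<subseteq> closure {x. \<phi> x \<noteq> 0}"
    by (rule closure_mono) auto
  moreover have "compact (closure {x. \<psi> x * \<phi> x \<noteq> 0})"
    using compact_Int_closed[of "closure {x. \<phi> x \<noteq> 0}" "closure {x. \<psi> x * \<phi> x \<noteq> 0}"] assms *
    by (auto simp: test_functions_def inf.absorb2)
  ultimately show ?thesis using assms by (auto simp: test_functions_def intro!: C_k_mult)
qed

lemma test_function_continuous: "\<phi> \<in> test_functions A \<Longrightarrow> continuous_on UNIV \<phi>"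
  unfolding test_functions_def using C_k.simps(1) by blast

lemma test_function_eq_0: "\<phi> \<in> test_functions A \<Longrightarrow> x \<notin> A \<Longrightarrow> \<phi> x = 0"
  using closure_subset[of "{x. \<phi> x \<noteq> 0}"] by (auto simp: test_functions_def)

lemma test_function_bounded:
  assumes "\<phi> \<in> test_functions A" obtains B where "B > 0" "\<And>x. \<bar>\<phi> x\<bar> \<le> B"
proof -
  have "compact (\<phi> ` closure {x. \<phi> x \<noteq> 0})"
    using assms by (intro compact_continuous_image continuous_on_subset[OF test_function_continuous[OF assms]])
      (auto simp: test_functions_def)
  then have "bounded (\<phi> ` closure {x. \<phi> x \<noteq> 0})" by (rule compact_imp_bounded)
  then obtain B where B: "\<And>x. x \<in> closure {x. \<phi> x \<noteq> 0} \<Longrightarrow> \<bar>\<phi> x\<bar> \<le> B" by (auto simp: bounded_iff)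
  have "\<bar>\<phi> x\<bar> \<le> max B 1" for x
    using B[of x] closure_subset[of "{x. \<phi> x \<noteq> 0}"] by (cases "\<phi> x = 0") force+
  then show ?thesis using that[of "max B 1"] by auto
qed

lemma test_function_gderiv_bounded:
  assumes "\<phi> \<in> test_functions A" "\<And>x. GDERIV \<phi> x :> D x"
  obtains B where "B > 0" "\<And>x. norm (D x) \<le> B"
proof -
  obtain D' where D': "\<And>x. GDERIV \<phi> x :> D' x" "\<And>i. (\<lambda>x. D' x $ i) \<in> test_functions A"
    using test_function_gderiv[OF assms(1)] by blast
  then have [simp]: "D' = D" using assms GDERIV_unique by blast
  have "\<exists>B>0. \<forall>x. \<bar>D x $ i\<bar> \<le> B" for i
    using test_function_bounded[OF D'(2)] by (metis \<open>D' = D\<close>)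
  then obtain B where B: "\<And>i. B i > 0" "\<And>i x. \<bar>D x $ i\<bar> \<le> B i" by metis
  have "norm (D x) \<le> (\<Sum>i\<in>UNIV. B i) + 1" for x
    using norm_le_l1_cart[of "D x"] sum_mono[of UNIV "\<lambda>i. \<bar>D x $ i\<bar>" B] B(2) by force
  moreover have "(\<Sum>i\<in>UNIV. B i) + 1 > 0"
    using sum_nonneg[of UNIV B] B(1) by (smt (verit) less_imp_le)
  ultimately show ?thesis using that by blast
qed

lemma test_function_gderiv_eq_0:
  assumes "\<phi> \<in> test_functions A" "\<And>x. GDERIV \<phi> x :> D x" "x \<notin> A"
  shows "D x = 0"
proof -
  obtain D' where D': "\<And>x. GDERIV \<phi> x :> D' x" "\<And>i. (\<lambda>x. D' x $ i) \<in> test_functions A"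
    using test_function_gderiv[OF assms(1)] by blast
  then have [simp]: "D' = D" using assms GDERIV_unique by blast
  show ?thesis using test_function_eq_0[OF D'(2) assms(3)] by (simp add: vec_eq_iff)
qed

lemma test_function_gderiv_continuous:
  assumes "\<phi> \<in> test_functions A" "\<And>x. GDERIV \<phi> x :> D x"
  shows "continuous_on UNIV D"
proof -
  obtain D' where D': "\<And>x. GDERIV \<phi> x :> D' x" "\<And>i. (\<lambda>x. D' x $ i) \<in> test_functions A"
    using test_function_gderiv[OF assms(1)] by blast
  then have [simp]: "D' = D" using assms GDERIV_unique by blast
  have "continuous_on UNIV (\<lambda>x. \<chi> i. D x $ i)"
    using D'(2) test_function_continuous by (intro continuous_on_vec_lambda) auto
  then show ?thesis by simp
qed

lemma step_scale_tendsto_indicator: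
  "(\<lambda>m. step (real m * t)) \<longlonglongrightarrow> (if t > 0 then 1 else 0)"
proof (cases "t > 0")
  case True
  have "eventually (\<lambda>m. 1 \<le> real m * t) sequentially"
  proof -
    have "filterlim (\<lambda>m. real m * t) at_top sequentially"
      using True filterlim_real_sequentially
      by (auto intro!: filterlim_at_top_mult_tendsto_pos tendsto_const)
    then show ?thesis by (simp add: filterlim_at_top)
  qed
  then have "eventually (\<lambda>m. step (real m * t) = 1) sequentially"
    by eventually_elim (simp add: step_eq_1)
  then show ?thesis using True by (simp add: tendsto_eventually)
next
  case False
  then have "step (real m * t) = 0" for m
    by (intro step_eq_0) (smt (verit) mult_nonneg_nonpos of_nat_0_le_iff divide_nonneg_nonneg)
  then show ?thesis using False by simp
qed

section \<open>Smooth approximation of boxes and the fundamental lemma of the calculus of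
  variations\<close>

definition smooth_box :: "real^'n \<Rightarrow> real^'n \<Rightarrow> nat \<Rightarrow> real^'n \<Rightarrow> real" where
  "smooth_box a b m x = (\<Prod>i\<in>UNIV. step (real m * (x $ i - a $ i)) * step (real m * (b $ i - x $ i)))"

lemma smooth_box_tendsto: "(\<lambda>m. smooth_box a b m x) \<longlonglongrightarrow> indicator (box a b) x"
proof -
  have "(\<lambda>m. smooth_box a b m x) \<longlonglongrightarrow>
      (\<Prod>i\<in>UNIV. (if x $ i - a $ i > 0 then 1 else 0) * (if b $ i - x $ i > 0 then 1 else 0))"
    unfolding smooth_box_def by (intro tendsto_prod tendsto_mult step_scale_tendsto_indicator)
  also have "(\<Prod>i\<in>UNIV. (if x $ i - a $ i > 0 then 1 else 0) * (if b $ i - x $ i > 0 then 1 else 0))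
      = (indicator (box a b) x :: real)"
    by (auto simp: indicator_def mem_box_cart intro!: prod.neutral)
  finally show ?thesis .
qed

lemma smooth_box_bounds: "0 \<le> smooth_box a b m x" "smooth_box a b m x \<le> 1"
  unfolding smooth_box_def
  by (auto intro!: prod_nonneg prod_le_1 mult_nonneg_nonneg mult_le_one step_nonneg step_le_1)

lemma C_k_smooth_box: "C_k k (smooth_box a b m)"
proof -
  have "C_k k (\<lambda>x. \<Prod>i\<in>UNIV. step ((real m *\<^sub>R axis i 1) \<bullet> x + (- real m * a $ i))
      * step ((- real m *\<^sub>R axis i 1) \<bullet> x + real m * b $ i))" (is "C_k k ?f")
    by (intro C_k_prod C_k_mult C_k_ridge C_k_step) auto
  also have "?f = smooth_box a b m"
    by (auto simp: smooth_box_def inner_axis' algebra_simps fun_eq_iff)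
  finally show ?thesis .
qed

lemma smooth_box_support: "closure {x. smooth_box a b m x \<noteq> 0} \<subseteq> box a b"
  "compact (closure {x. smooth_box a b m x \<noteq> 0})"
proof -
  \<comment> \<open>The factor \<open>step (m * t)\<close> vanishes for t up to 1/(2m), which leaves
    this margin inside the box. For m = 0 the product is identically zero, so the case is separated
    below.\<close>
  define e where "e = 1 / (2 * real m)"
  have 1: "{x. smooth_box a b m x \<noteq> 0} \<subseteq> (if m = 0 then {} else cbox (\<chi> i. a $ i + e) (\<chi> i. b $ i - e))"
  proof (cases "m = 0")
    case True then show ?thesis by (auto simp: smooth_box_def step_eq_0)
  next
    case False
    have "a $ i + e \<le> x $ i \<and> x $ i \<le> b $ i - e" if "smooth_box a b m x \<noteq> 0" for x i
    proof -
      have "step (real m * (x $ i - a $ i)) \<noteq> 0" "step (real m * (b $ i - x $ i)) \<noteq> 0"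
        using that by (auto simp: smooth_box_def)
      then have "real m * (x $ i - a $ i) > 1/2" "real m * (b $ i - x $ i) > 1/2"
        using step_eq_0 not_le by blast+
      then show ?thesis using False by (simp add: e_def field_simps)
    qed
    then have "{x. smooth_box a b m x \<noteq> 0} \<subseteq> cbox (\<chi> i. a $ i + e) (\<chi> i. b $ i - e)"
      by (simp only: subset_iff mem_box_cart vec_lambda_beta mem_Collect_eq) blast
    then show ?thesis using False by simp
  qed
  then have 2: "closure {x. smooth_box a b m x \<noteq> 0} \<subseteq> (if m = 0 then {} else cbox (\<chi> i. a $ i + e) (\<chi> i. b $ i - e))"
    by (intro closure_minimal) (auto simp: closed_cbox)
  also have "\<dots> \<subseteq> box a b"
  proof (cases "m = 0")
    case False
    then have "e > 0" by (simp add: e_def)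
    have "cbox (\<chi> i. a $ i + e) (\<chi> i. b $ i - e) \<subseteq> box a b"
    proof
      fix x assume "x \<in> cbox (\<chi> i. a $ i + e) (\<chi> i. b $ i - e)"
      then have *: "\<forall>i. a $ i + e \<le> x $ i \<and> x $ i \<le> b $ i - e"
        by (simp only: mem_box_cart vec_lambda_beta) blast
      have "a $ i < x $ i \<and> x $ i < b $ i" for i
        using spec[OF *, of i] \<open>e > 0\<close> by linarith
      then show "x \<in> box a b" unfolding mem_box_cart by blast
    qed
    then show ?thesis using False by simp
  qed simp
  finally show "closure {x. smooth_box a b m x \<noteq> 0} \<subseteq> box a b" .
  show "compact (closure {x. smooth_box a b m x \<noteq> 0})"
  proof -
    have "bounded (if m = 0 then {} else cbox (\<chi> i. a $ i + e) (\<chi> i. b $ i - e))" by (simp add: bounded_cbox)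
    from bounded_subset[OF this 1] show ?thesis by (simp add: compact_closure)
  qed
qed

lemma smooth_box_test: "box a b \<subseteq> T \<Longrightarrow> smooth_box a b m \<in> test_functions T"
  using smooth_box_support[of a b m] C_k_smooth_box unfolding test_functions_def by blast

lemma Int_box_cart: "box a b \<inter> box c d = box (\<chi> i. max (a $ i) (c $ i)) (\<chi> i. min (b $ i) (d $ i))" for a b c d :: "real^'n"
  by (auto simp: mem_box_cart)

text \<open>Boxes generate the Borel sets and are stable under intersection, so Dynkin's induction
  carries the vanishing integral from boxes to all Borel sets.\<close>

lemma integral_zero_on_boxes_imp_AE_0:
  fixes g :: "real^'n \<Rightarrow> real"
  assumes g: "integrable lborel g"
    and 0: "\<And>a b. (LBINT x. indicator (box a b) x * g x) = 0"
  shows "AE x in lborel. g x = 0"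
proof -
  let ?G = "range (\<lambda>(a, b). box a b :: (real^'n) set)"
  have [measurable]: "g \<in> borel_measurable borel" using g by auto
  have int: "integrable lborel (\<lambda>x. indicator A x * g x)" if "A \<in> sets borel" for A
    using integrable_mult_indicator[OF _ g, of A] that by simp
  \<comment> \<open>The whole space is not a box, but complements in the induction need its
    integral; it is the limit over growing boxes.\<close>
  have univ: "(LBINT x. indicator (UNIV::(real^'n) set) x * g x) = 0"
  proof -
    have "(\<lambda>m. LINT x|lborel. indicator (box (\<chi> i. - real m) (\<chi> i. real m)) x * g x) \<longlonglongrightarrow> (LBINT x. indicator UNIV x * g x)"
    proof (rule integral_dominated_convergence[where w="\<lambda>x. norm (g x)"])
      show "AE x in lborel. (\<lambda>m. indicator (box (\<chi> i. - real m) (\<chi> i. real m)) x * g x) \<longlonglongrightarrow> indicator UNIV x * g x"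
      proof (intro AE_I2 tendsto_mult tendsto_const tendsto_eventually)
        fix x :: "real^'n"
        obtain N :: nat where N: "norm x < real N" using reals_Archimedean2 by blast
        have "x \<in> box (\<chi> i. - real m) (\<chi> i. real m)" if "m \<ge> N" for m
        proof -
          have "\<bar>x $ i\<bar> < real m" for i
            using N that component_le_norm_cart[of x i] of_nat_le_iff[of N m, where 'a=real] by linarith
          then show ?thesis unfolding mem_box_cart by (auto simp: abs_less_iff minus_less_iff)
        qed
        then show "eventually (\<lambda>m. indicator (box (\<chi> i. - real m) (\<chi> i. real m)) x = (indicator UNIV x::real)) sequentially"
          by (auto simp: eventually_sequentially indicator_def intro!: exI[of _ N])
      qed
    qed (use g in \<open>auto simp: indicator_def\<close>)
    then show ?thesis unfolding 0 by (rule LIMSEQ_unique[OF _ tendsto_const])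
  qed
  have "(LBINT x. indicator A x * g x) = 0" if "A \<in> sets borel" for A
  proof -
    have eq: "sets borel = sigma_sets UNIV ?G"
      by (subst borel_eq_box) (simp add: sets_measure_of)
    have "Int_stable ?G"
      by (auto simp: Int_stable_def Int_box_cart)
    moreover have "?G \<subseteq> Pow UNIV" by simp
    moreover have "A \<in> sigma_sets UNIV ?G" using that eq by simp
    ultimately show ?thesis
    proof (induction A rule: sigma_sets_induct_disjoint[of ?G UNIV, consumes 3, case_names basic empty compl union])
      case (basic A)
      then obtain a b where "A = box a b" by auto
      then show ?case using 0[of a b] by simp
    next
      case empty show ?case by simp
    next
      case (compl A)
      then have A: "A \<in> sets borel" using eq by simp
      have "(LBINT x. indicator (UNIV - A) x * g x) = (LBINT x. indicator UNIV x * g x - indicator A x * g x)"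
        by (intro Bochner_Integration.integral_cong) (auto simp: indicator_def)
      also have "\<dots> = 0" 
        using int[OF A] int[of UNIV] univ compl(2) by (subst Bochner_Integration.integral_diff) (auto simp del: indicator_UNIV)
      finally show ?case .
    next
      case (union A)
      then have A: "A i \<in> sets borel" for i using eq by auto
      have "(\<Sum>i. LINT x:A i|lborel. g x) = (LINT x:(\<Union>i. A i)|lborel. g x)"
      proof (rule lebesgue_integral_countable_add[symmetric])
        show "A i \<in> sets lborel" for i using A by simp
        show "A i \<inter> A j = {}" if "i \<noteq> j" for i j
          using union(1) that by (auto simp: disjoint_family_on_def)
        show "set_integrable lborel (\<Union>i. A i) g"
          unfolding set_integrable_def real_scaleR_def by (rule int) (use A in auto)
      qed
      then show ?case using union(3) by (simp add: set_lebesgue_integral_def)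
    qed
  qed
  then show ?thesis
    using g by (intro density_unique_real) (auto simp: set_lebesgue_integral_def)
qed

text \<open>Local integrability suffices. Inside a compact box contained in T the test functions
  \<open>smooth_box\<close> tend boundedly to indicators of smaller boxes, so g integrates to zero
  over these and vanishes almost everywhere there; countably many boxes exhaust T.\<close>

lemma fundamental_lemma:
  fixes g :: "real^'n \<Rightarrow> real"
  assumes "open T"
    and g: "\<And>a b. cbox a b \<subseteq> T \<Longrightarrow> integrable lborel (\<lambda>x. indicator (cbox a b) x * g x)"
    and 0: "\<And>\<phi>. \<phi> \<in> test_functions T \<Longrightarrow> (LBINT x. g x * \<phi> x) = 0"
  shows "AE x in lborel. x \<in> T \<longrightarrow> g x = 0"
proof -
  have *: "AE x in lborel. x \<in> box a b \<longrightarrow> g x = 0" if ab: "cbox a b \<subseteq> T" for a b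
  proof -
    have intg: "integrable lborel (\<lambda>x. indicator (box c d \<inter> box a b) x * g x)" for c d
    proof -
      have "integrable lborel (\<lambda>x. indicator (box c d \<inter> box a b) x *\<^sub>R (indicator (cbox a b) x * g x))"
        by (rule integrable_mult_indicator[OF _ g[OF ab]]) auto
      moreover have "indicator (box c d \<inter> box a b) x *\<^sub>R (indicator (cbox a b) x * g x) = indicator (box c d \<inter> box a b) x * g x" for x
        using box_subset_cbox[of a b] by (auto simp: indicator_def)
      ultimately show ?thesis by (simp only:)
    qed
    have "AE x in lborel. indicator (box a b) x * g x = 0"
    proof (rule integral_zero_on_boxes_imp_AE_0)
      show "integrable lborel (\<lambda>x. indicator (box a b) x * g x)" using intg[of a b] by simp
      fix c d :: "real^'n"
      obtain p q where pq: "box c d \<inter> box a b = box p q" using Int_box_cart by blast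
      have sub: "box p q \<subseteq> T" "box p q \<subseteq> cbox a b" using pq ab box_subset_cbox[of a b] by auto
      have "(\<lambda>m. LINT x|lborel. g x * smooth_box p q m x) \<longlonglongrightarrow> (LBINT x. indicator (box p q) x * g x)"
      proof (rule integral_dominated_convergence[where w="\<lambda>x. norm (indicator (cbox a b) x * g x)"])
        have [measurable]: "(\<lambda>x. indicator (cbox a b) x * g x) \<in> borel_measurable borel"
          using g[OF ab] by auto
        have [measurable]: "smooth_box p q m \<in> borel_measurable borel" for m
          using C_k_smooth_box[of 0 p q m] by (auto intro: borel_measurable_continuous_onI)
        \<comment> \<open>The function g itself need not be measurable; only its products with
          indicators of boxes in T are known to be, so every integrand is rewritten through such a
          product.\<close>
        have eq: "g x * smooth_box p q m x = (indicator (cbox a b) x * g x) * smooth_box p q m x" for x m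
          using test_function_eq_0[OF smooth_box_test[of p q "cbox a b" m]] sub(2) by (auto simp: indicator_def)
        show "(\<lambda>x. g x * smooth_box p q m x) \<in> borel_measurable lborel" for m unfolding eq by measurable
        show "(\<lambda>x. indicator (box p q) x * g x) \<in> borel_measurable lborel"
          using intg[of c d] pq by auto
        show "integrable lborel (\<lambda>x. norm (indicator (cbox a b) x * g x))" using g[OF ab] by auto
        show "AE x in lborel. (\<lambda>m. g x * smooth_box p q m x) \<longlonglongrightarrow> indicator (box p q) x * g x"
          by (intro AE_I2) (simp only: mult.commute[of "g _"], intro tendsto_mult smooth_box_tendsto tendsto_const)
        show "AE x in lborel. norm (g x * smooth_box p q m x) \<le> norm (indicator (cbox a b) x * g x)" for m
          unfolding eq norm_mult using smooth_box_bounds[of p q m] by (auto intro!: mult_left_le)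
      qed
      then have "(LBINT x. indicator (box p q) x * g x) = 0"
        unfolding 0[OF smooth_box_test[OF sub(1)]] by (rule LIMSEQ_unique[OF _ tendsto_const])
      moreover have "indicator (box c d) x * (indicator (box a b) x * g x) = indicator (box p q) x * g x" for x
        using pq by (auto simp: indicator_def)
      ultimately show "(LBINT x. indicator (box c d) x * (indicator (box a b) x * g x)) = 0" by (simp only:)
    qed
    then show ?thesis by eventually_elim (auto simp: indicator_def split: if_splits)
  qed
  obtain D where D: "countable D" "D \<subseteq> Pow T" "\<And>X. X \<in> D \<Longrightarrow> \<exists>a b. X = cbox a b" "\<Union>D = T"
    using open_countable_Union_open_cbox[OF \<open>open T\<close>] by metis
  have "AE x in lborel. x \<in> X \<longrightarrow> g x = 0" if "X \<in> D" for X
  proof -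
    from D(3)[OF that] obtain a b where X: "X = cbox a b" by blast
    \<comment> \<open>The covering uses closed boxes while the previous claim concerns open ones;
      the difference has measure zero.\<close>
    have "AE x in lborel. x \<notin> cbox a b - box a b"
    proof (rule AE_not_in, rule null_setsI)
      have "emeasure lborel (cbox a b - box a b) = emeasure lborel (cbox a b) - emeasure lborel (box a b)"
        by (rule emeasure_Diff) (auto simp: box_subset_cbox emeasure_lborel_box_eq)
      also have "\<dots> = 0"
        unfolding emeasure_lborel_cbox_eq emeasure_lborel_box_eq by (simp add: diff_eq_0_ennreal)
      finally show "emeasure lborel (cbox a b - box a b) = 0" .
    qed simp
    moreover have "AE x in lborel. x \<in> box a b \<longrightarrow> g x = 0"
      using * D(2) that X by blast
    ultimately show ?thesis unfolding X by eventually_elim blast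
  qed
  then have "AE x in lborel. \<forall>X\<in>D. x \<in> X \<longrightarrow> g x = 0"
    using AE_ball_countable[OF D(1), of "\<lambda>x X. x \<in> X \<longrightarrow> g x = 0" lborel] by blast
  then show ?thesis using D(4) by auto
qed

section \<open>Weak gradients with Borel representatives\<close>

lemma lborel_translate: "distr lborel borel (\<lambda>x. x + c) = (lborel :: (real^'n) measure)"
  using lborel_distr_plus[of c] unfolding add.commute[of _ c] by simp

lemma nn_integral_translate:
  assumes [measurable]: "f \<in> borel_measurable borel"
  shows "(\<integral>\<^sup>+x. f (x + c :: real^'n) \<partial>lborel) = (\<integral>\<^sup>+x. f x \<partial>lborel)"
  by (subst (2) lborel_translate[of c, symmetric]) (simp add: nn_integral_distr)

lemma integral_translate:
  fixes f :: "real^'n \<Rightarrow> 'b::{banach, second_countable_topology}"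
  assumes [measurable]: "f \<in> borel_measurable borel"
  shows "(LBINT x. f (x + c)) = (LBINT x. f x)"
  by (subst (2) lborel_translate[of c, symmetric]) (simp add: integral_distr)

lemma integrable_translate:
  fixes f :: "real^'n \<Rightarrow> 'b::{banach, second_countable_topology}"
  assumes "integrable lborel f"
  shows "integrable lborel (\<lambda>x. f (x + c))"
  using integrable_distr[of "\<lambda>x. x + c" lborel borel f] assms by (simp add: lborel_translate)

text \<open>By Tonelli and translation invariance, the integral of the norm is the measure of A
  times that of k. This justifies the exchanges of integrals along segments.\<close>

lemma integrable_shear:
  fixes k :: "real^'n \<Rightarrow> real"
  assumes k: "integrable lborel k" and [measurable]: "A \<in> sets borel" and A: "emeasure lborel A < \<infinity>"
  shows "integrable (lborel \<Otimes>\<^sub>M lborel) (\<lambda>(x, q). indicator A q * k (x + q *\<^sub>R e))"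
proof (rule integrableI_bounded)
  have [measurable]: "k \<in> borel_measurable borel" using k by auto
  show "(\<lambda>(x, q). indicator A q * k (x + q *\<^sub>R e)) \<in> borel_measurable (lborel \<Otimes>\<^sub>M lborel)"
    by measurable
  have "(\<integral>\<^sup>+z. ennreal (norm (case z of (x, q) \<Rightarrow> indicator A q * k (x + q *\<^sub>R e))) \<partial>(lborel \<Otimes>\<^sub>M lborel))
     = (\<integral>\<^sup>+q. \<integral>\<^sup>+x. ennreal (norm (indicator A q * k (x + q *\<^sub>R e))) \<partial>lborel \<partial>lborel)"
    by (subst lborel_pair.nn_integral_snd[symmetric]) (auto simp: case_prod_beta')
  also have "\<dots> = (\<integral>\<^sup>+q. indicator A q * (\<integral>\<^sup>+x. ennreal (norm (k (x + q *\<^sub>R e))) \<partial>lborel) \<partial>lborel)"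
    by (intro nn_integral_cong) (auto simp: indicator_def)
  also have "\<dots> = (\<integral>\<^sup>+q. indicator A q * (\<integral>\<^sup>+x. ennreal (norm (k x)) \<partial>lborel) \<partial>lborel)"
    using nn_integral_translate[of "\<lambda>x. ennreal (norm (k x))"] by (intro nn_integral_cong) auto
  also have "\<dots> = emeasure lborel A * (\<integral>\<^sup>+x. ennreal (norm (k x)) \<partial>lborel)"
    by (subst nn_integral_multc) auto
  also have "\<dots> < \<infinity>" using k A by (auto simp: integrable_iff_bounded ennreal_mult_less_top)
  finally show "(\<integral>\<^sup>+z. ennreal (norm (case z of (x, q) \<Rightarrow> indicator A q * k (x + q *\<^sub>R e))) \<partial>(lborel \<Otimes>\<^sub>M lborel)) < \<infinity>" .
qed

text \<open>Both functions are Borel representatives extended by zero outside T. Then all integrals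
  run over the whole space with respect to \<open>lborel\<close>, where translations and Fubini
  apply directly, without completions.\<close>

definition borel_weak_gradient ::
    "(real^'n) set \<Rightarrow> (real^'n \<Rightarrow> real) \<Rightarrow> (real^'n \<Rightarrow> real^'n) \<Rightarrow> bool" where
  "borel_weak_gradient T g h \<longleftrightarrow>
     g \<in> borel_measurable borel \<and> h \<in> borel_measurable borel \<and>
     integrable lborel (\<lambda>x. (g x)\<^sup>2) \<and> integrable lborel (\<lambda>x. (norm (h x))\<^sup>2) \<and>
     (\<forall>x. x \<notin> T \<longrightarrow> g x = 0 \<and> h x = 0) \<and>
     (\<forall>\<phi> D. \<phi> \<in> test_functions T \<and> (\<forall>x. GDERIV \<phi> x :> D x) \<longrightarrow>
        (LBINT x. g x *\<^sub>R D x) = - (LBINT x. \<phi> x *\<^sub>R h x))"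

lemma integrable_of_square_bounded_support:
  fixes g :: "real^'n \<Rightarrow> 'b::{banach, second_countable_topology}"
  assumes [measurable]: "g \<in> borel_measurable borel"
    and "integrable lborel (\<lambda>x. (norm (g x))\<^sup>2)" and "bounded T" and "\<And>x. x \<notin> T \<Longrightarrow> g x = 0"
  shows "integrable lborel g"
proof -
  obtain a b where ab: "T \<subseteq> cbox a b"
    using bounded_subset_cbox_symmetric[OF \<open>bounded T\<close>] by blast
  have "integrable lborel (\<lambda>x. indicator (cbox a b) x + (norm (g x))\<^sup>2 :: real)"
    using assms(2) by (intro Bochner_Integration.integrable_add integrable_real_indicator)
      (auto simp: emeasure_lborel_cbox_eq)
  then show ?thesis
  proof (rule Bochner_Integration.integrable_bound)
    show "AE x in lborel. norm (g x) \<le> norm (indicator (cbox a b) x + (norm (g x))\<^sup>2 :: real)"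
    proof (rule AE_I2)
      fix x
      have "norm (g x) \<le> 1 + (norm (g x))\<^sup>2"
      proof -
        have "0 \<le> (norm (g x))\<^sup>2 + 1 - 2 * norm (g x)"
          using zero_le_power2[of "norm (g x) - 1"] by (simp add: power2_diff)
        then show ?thesis using norm_ge_zero[of "g x"] by linarith
      qed
      then show "norm (g x) \<le> norm (indicator (cbox a b) x + (norm (g x))\<^sup>2 :: real)"
        using assms(4)[of x] ab by (cases "x \<in> T") (auto simp: indicator_def)
    qed
  qed measurable
qed

lemma borel_weak_gradientD:
  assumes "borel_weak_gradient T g h"
  shows "g \<in> borel_measurable borel" "h \<in> borel_measurable borel"
    "integrable lborel (\<lambda>x. (g x)\<^sup>2)" "integrable lborel (\<lambda>x. (norm (h x))\<^sup>2)"
    "\<And>x. x \<notin> T \<Longrightarrow> g x = 0" "\<And>x. x \<notin> T \<Longrightarrow> h x = 0"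
    "\<And>\<phi> D. \<phi> \<in> test_functions T \<Longrightarrow> (\<And>x. GDERIV \<phi> x :> D x) \<Longrightarrow>
        (LBINT x. g x *\<^sub>R D x) = - (LBINT x. \<phi> x *\<^sub>R h x)"
  using assms unfolding borel_weak_gradient_def by blast+

lemma borel_weak_gradient_integrable:
  assumes "borel_weak_gradient T g h" "bounded T"
  shows "integrable lborel g" "integrable lborel h"
proof -
  show "integrable lborel g"
    by (rule integrable_of_square_bounded_support[OF _ _ assms(2)])
      (use borel_weak_gradientD(1,3,5)[OF assms(1)] in simp_all)
  show "integrable lborel h"
    by (rule integrable_of_square_bounded_support[OF _ _ assms(2)])
      (use borel_weak_gradientD(2,4,6)[OF assms(1)] in simp_all)
qed

lemma integrable_mult_bounded:
  fixes f :: "'a \<Rightarrow> real"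
  assumes f: "integrable M f" and [measurable]: "b \<in> borel_measurable M" and "\<And>x. \<bar>b x\<bar> \<le> B"
  shows "integrable M (\<lambda>x. f x * b x)"
proof (rule Bochner_Integration.integrable_bound[of M "\<lambda>x. B * f x"])
  have "0 \<le> B" using assms(3)[of undefined] by linarith
  have [measurable]: "f \<in> borel_measurable M" using f by auto
  show "integrable M (\<lambda>x. B * f x)" using f by auto
  show "(\<lambda>x. f x * b x) \<in> borel_measurable M" by measurable
  show "AE x in M. norm (f x * b x) \<le> norm (B * f x)"
    using assms(3) \<open>0 \<le> B\<close> by (auto simp: abs_mult mult.commute[of B] intro!: mult_left_mono)
qed

text \<open>The complement is the sum of a compact segment and the closed complement of T, and such
  sums are closed.\<close>

lemma open_translates:
  assumes "open T" shows "open {x :: real^'n. \<forall>q\<in>{0..1}. x + q *\<^sub>R e \<in> T}"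
proof -
  have "compact ((\<lambda>q. - (q *\<^sub>R e)) ` {0..1::real})"
    by (intro compact_continuous_image continuous_intros) auto
  then have "closed (\<Union>x\<in>(\<lambda>q. - (q *\<^sub>R e)) ` {0..1}. \<Union>y\<in>- T. {x + y})"
    by (rule compact_closed_sums) (use assms in \<open>auto simp: closed_Compl\<close>)
  also have "(\<Union>x\<in>(\<lambda>q. - (q *\<^sub>R e)) ` {0..1}. \<Union>y\<in>- T. {x + y}) = - {x. \<forall>q\<in>{0..1}. x + q *\<^sub>R e \<in> T}"
  proof (intro set_eqI iffI)
    fix x assume "x \<in> - {x. \<forall>q\<in>{0..1}. x + q *\<^sub>R e \<in> T}"
    then obtain q where "q \<in> {0..1}" "x + q *\<^sub>R e \<notin> T" by blast
    then show "x \<in> (\<Union>x\<in>(\<lambda>q. - (q *\<^sub>R e)) ` {0..1}. \<Union>y\<in>- T. {x + y})"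
      by (auto intro!: bexI[of _ q] bexI[of _ "x + q *\<^sub>R e"])
  next
    fix x assume "x \<in> (\<Union>x\<in>(\<lambda>q. - (q *\<^sub>R e)) ` {0..1}. \<Union>y\<in>- T. {x + y})"
    then obtain q y where "q \<in> {0..1}" "y \<notin> T" "x + q *\<^sub>R e = y" by auto
    then show "x \<in> - {x. \<forall>q\<in>{0..1}. x + q *\<^sub>R e \<in> T}" by blast
  qed
  finally show ?thesis by (simp add: open_closed)
qed

text \<open>
  Integrating the weak gradient along a segment: testing against \<open>\<phi>\<close> and moving the translation to
  \<open>\<phi>\<close> reduces the claim to the fundamental theorem of calculus for \<open>\<phi>\<close>.
\<close>

lemma weak_gradient_translation:
  assumes w: "borel_weak_gradient T g h" and T: "open T" "bounded T"
  shows "AE x in lborel. (\<forall>q\<in>{0..1}. x + q *\<^sub>R e \<in> T) \<longrightarrow>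
    g (x + e) - g x = (LBINT q. indicator {0..1} q * (h (x + q *\<^sub>R e) \<bullet> e))"
proof -
  note [measurable] = borel_weak_gradientD(1,2)[OF w]
  have ig: "integrable lborel g" and ih: "integrable lborel h"
    using borel_weak_gradient_integrable[OF w T(2)] by auto
  have ihe: "integrable lborel (\<lambda>x. h x \<bullet> e)" using ih by auto
  define V where "V = {x. \<forall>q\<in>{0..1}. x + q *\<^sub>R e \<in> T}"
  define H where "H = (\<lambda>x. LINT q|lborel. indicator {0..1} q * (h (x + q *\<^sub>R e) \<bullet> e))"
  have shear: "integrable (lborel \<Otimes>\<^sub>M lborel) (\<lambda>(x, q). indicator {0..1} q * (h (x + q *\<^sub>R e) \<bullet> e))"
    using integrable_shear[OF ihe, of "{0..1}" e] by simp
  have iH: "integrable lborel H"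
    unfolding H_def using lborel_pair.integrable_fst'[OF shear] by simp
  have ige: "integrable lborel (\<lambda>x. g (x + e))" using integrable_translate[OF ig] .
  have "AE x in lborel. x \<in> V \<longrightarrow> g (x + e) - g x - H x = 0"
  proof (rule fundamental_lemma)
    show "open V" unfolding V_def using T(1) by (rule open_translates)
    have "integrable lborel (\<lambda>x. g (x + e) - g x - H x)" using ige ig iH by auto
    from integrable_mult_indicator[OF _ this]
    show "integrable lborel (\<lambda>x. indicator (cbox a b) x * (g (x + e) - g x - H x))" for a b by simp
    fix \<phi> assume \<phi>: "\<phi> \<in> test_functions V"
    obtain D where D: "\<And>x. GDERIV \<phi> x :> D x" "\<And>i. (\<lambda>x. D x $ i) \<in> test_functions V"
      using test_function_gderiv[OF \<phi>] by blast
    have [measurable]: "\<phi> \<in> borel_measurable borel" "D \<in> borel_measurable borel"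
      using test_function_continuous[OF \<phi>] test_function_gderiv_continuous[OF \<phi> D(1)]
      by (auto intro: borel_measurable_continuous_onI)
    obtain B where B: "\<And>x. \<bar>\<phi> x\<bar> \<le> B" using test_function_bounded[OF \<phi>] by metis
    obtain B' where B': "\<And>x. norm (D x) \<le> B'" using test_function_gderiv_bounded[OF \<phi> D(1)] by metis
    have ftc: "\<phi> (x - e) - \<phi> x = - (LBINT q. indicator {0..1} q * (D (x - q *\<^sub>R e) \<bullet> e))" for x
    proof -
      have der: "((\<lambda>q. \<phi> (x - q *\<^sub>R e)) has_vector_derivative - (D (x - q *\<^sub>R e) \<bullet> e)) (at q)" for q
      proof -
        have "((\<lambda>q. x - q *\<^sub>R e) has_derivative (\<lambda>t. - (t *\<^sub>R e))) (at q)"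
          by (auto intro!: derivative_eq_intros)
        from has_derivative_compose[OF this D(1)[unfolded gderiv_def]]
        show ?thesis by (simp add: has_vector_derivative_def inner_commute)
      qed
      have "(LBINT q. indicator {0..1} q *\<^sub>R (- (D (x - q *\<^sub>R e) \<bullet> e))) = \<phi> (x - 1 *\<^sub>R e) - \<phi> (x - 0 *\<^sub>R e)"
      proof (rule integral_FTC_Icc)
        show "continuous_on {0..1} (\<lambda>q. - (D (x - q *\<^sub>R e) \<bullet> e))"
          by (intro continuous_intros continuous_on_compose2[OF test_function_gderiv_continuous[OF \<phi> D(1)]]) auto
      qed (use der in \<open>auto intro: has_vector_derivative_at_within\<close>)
      then show ?thesis by simp
    qed
    have i1: "integrable lborel (\<lambda>x. g (x + e) * \<phi> x)" "integrable lborel (\<lambda>x. g x * \<phi> x)" "integrable lborel (\<lambda>x. H x * \<phi> x)"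
      using ige ig iH B by (auto intro!: integrable_mult_bounded)
    have "(LBINT x. g (x + e) * \<phi> x) = (LBINT x. g (x + e) * \<phi> (x + e - e))" by simp
    also have "\<dots> = (LBINT x. g x * \<phi> (x - e))"
      by (rule integral_translate[of "\<lambda>x. g x * \<phi> (x - e)"]) measurable
    finally have 1: "(LBINT x. g (x + e) * \<phi> x) = (LBINT x. g x * \<phi> (x - e))" .
    have i2: "integrable lborel (\<lambda>x. g x * \<phi> (x - e))"
      using ig B by (auto intro!: integrable_mult_bounded)
    have DeB: "\<bar>D (x - q *\<^sub>R e) \<bullet> e\<bar> \<le> B' * norm e" for x q
      using Cauchy_Schwarz_ineq2[of "D (x - q *\<^sub>R e)" e] mult_right_mono[OF B'[of "x - q *\<^sub>R e"], of "norm e"]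
      by simp
    have sh2: "integrable (lborel \<Otimes>\<^sub>M lborel) (\<lambda>(x, q). g x * (indicator {0..1} q * (D (x - q *\<^sub>R e) \<bullet> e)))"
    proof -
      have "integrable (lborel \<Otimes>\<^sub>M lborel) (\<lambda>z. (case z of (x, q) \<Rightarrow> indicator {0..1} q * g (x + q *\<^sub>R 0)) * (D (fst z - snd z *\<^sub>R e) \<bullet> e))"
        using integrable_shear[OF ig, of "{0..1}" 0] DeB by (intro integrable_mult_bounded) auto
      then show ?thesis by (simp add: case_prod_beta' mult_ac)
    qed
    have sh3: "integrable (lborel \<Otimes>\<^sub>M lborel) (\<lambda>(x, q). \<phi> x * (indicator {0..1} q * (h (x + q *\<^sub>R e) \<bullet> e)))"
    proof -
      have "integrable (lborel \<Otimes>\<^sub>M lborel) (\<lambda>z. (case z of (x, q) \<Rightarrow> indicator {0..1} q * (h (x + q *\<^sub>R e) \<bullet> e)) * \<phi> (fst z))"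
        using shear B by (intro integrable_mult_bounded) auto
      then show ?thesis by (simp add: case_prod_beta' mult_ac)
    qed
    \<comment> \<open>Here the choice of V matters: \<phi> is supported where the whole segment
      stays in T, so for each q in [0,1] its translate is a test function of T.\<close>
    have test: "(LBINT x. g x * (D (x - q *\<^sub>R e) \<bullet> e)) = - (LBINT x. \<phi> x * (h (x + q *\<^sub>R e) \<bullet> e))"
      if q: "q \<in> {0..1}" for q
    proof -
      have t: "(\<lambda>x. \<phi> (x + - (q *\<^sub>R e))) \<in> test_functions T"
        by (rule test_functions_shift[OF \<phi>]) (use q in \<open>auto simp: V_def\<close>)
      have Dt: "GDERIV (\<lambda>x. \<phi> (x + - (q *\<^sub>R e))) x :> D (x + - (q *\<^sub>R e))" for x
        by (rule GDERIV_shift) (rule D)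
      have eq: "(LBINT x. g x *\<^sub>R D (x + - (q *\<^sub>R e))) = - (LBINT x. \<phi> (x + - (q *\<^sub>R e)) *\<^sub>R h x)"
        by (rule borel_weak_gradientD(7)[OF w t Dt])
      have ia: "integrable lborel (\<lambda>x. g x *\<^sub>R D (x + - (q *\<^sub>R e)))"
      proof (rule Bochner_Integration.integrable_bound[of _ "\<lambda>x. B' * g x"])
        show "AE x in lborel. norm (g x *\<^sub>R D (x + - (q *\<^sub>R e))) \<le> norm (B' * g x)"
          using B' norm_ge_zero[of "D _"] order_trans[OF norm_ge_zero B']
          by (auto simp: abs_mult mult.commute[of B'] intro!: mult_left_mono)
      qed (use ig in auto)
      have ib: "integrable lborel (\<lambda>x. \<phi> (x + - (q *\<^sub>R e)) *\<^sub>R h x)"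
      proof (rule Bochner_Integration.integrable_bound[of _ "\<lambda>x. B * norm (h x)"])
        show "AE x in lborel. norm (\<phi> (x + - (q *\<^sub>R e)) *\<^sub>R h x) \<le> norm (B * norm (h x))"
          using B order_trans[OF abs_ge_zero B] by (auto simp: abs_mult intro!: mult_right_mono)
      qed (use ih in auto)
      have "(LBINT x. g x * (D (x - q *\<^sub>R e) \<bullet> e)) = (LBINT x. g x *\<^sub>R D (x + - (q *\<^sub>R e))) \<bullet> e"
        using ia by (subst integral_inner_left[symmetric]) auto
      also have "\<dots> = - (LBINT x. \<phi> (x + - (q *\<^sub>R e)) * (h x \<bullet> e))"
        unfolding eq inner_minus_left using ib by (subst integral_inner_left[symmetric]) auto
      also have "(LBINT x. \<phi> (x + - (q *\<^sub>R e)) * (h x \<bullet> e)) =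
          (LBINT x. \<phi> (x + q *\<^sub>R e + - (q *\<^sub>R e)) * (h (x + q *\<^sub>R e) \<bullet> e))"
        by (rule integral_translate[symmetric]) measurable
      finally show ?thesis by simp
    qed
    \<comment> \<open>Write the difference of \<phi> as an integral over q, exchange the integrals,
      test the weak gradient for each fixed q, and exchange back.\<close>
    have "(LBINT x. g x * \<phi> (x - e)) - (LBINT x. g x * \<phi> x) = (LBINT x. g x * (\<phi> (x - e) - \<phi> x))"
      using i1 i2 by (simp add: right_diff_distrib)
    also have "\<dots> = - (LBINT x. LINT q|lborel. g x * (indicator {0..1} q * (D (x - q *\<^sub>R e) \<bullet> e)))"
      unfolding ftc by simp
    also have "(LBINT x. LINT q|lborel. g x * (indicator {0..1} q * (D (x - q *\<^sub>R e) \<bullet> e)))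
       = (LBINT q. LINT x|lborel. g x * (indicator {0..1} q * (D (x - q *\<^sub>R e) \<bullet> e)))"
      using lborel_pair.Fubini_integral[OF sh2] by simp
    also have "\<dots> = (LBINT q. indicator {0..1} q * (LBINT x. g x * (D (x - q *\<^sub>R e) \<bullet> e)))"
      by (intro Bochner_Integration.integral_cong) (auto simp: indicator_def)
    also have "\<dots> = (LBINT q. indicator {0..1} q * (- (LBINT x. \<phi> x * (h (x + q *\<^sub>R e) \<bullet> e))))"
      using test by (intro Bochner_Integration.integral_cong) (auto simp: indicator_def)
    also have "\<dots> = - (LBINT q. LINT x|lborel. \<phi> x * (indicator {0..1} q * (h (x + q *\<^sub>R e) \<bullet> e)))"
      unfolding mult_minus_right Bochner_Integration.integral_minus
      by (intro arg_cong[of _ _ uminus] Bochner_Integration.integral_cong) (auto simp: indicator_def)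
    also have "(LBINT q. LINT x|lborel. \<phi> x * (indicator {0..1} q * (h (x + q *\<^sub>R e) \<bullet> e)))
       = (LBINT x. LINT q|lborel. \<phi> x * (indicator {0..1} q * (h (x + q *\<^sub>R e) \<bullet> e)))"
      using lborel_pair.Fubini_integral[OF sh3] by simp
    also have "\<dots> = (LBINT x. H x * \<phi> x)"
      by (simp add: H_def mult.commute)
    finally have 2: "(LBINT x. g x * \<phi> (x - e)) - (LBINT x. g x * \<phi> x) = (LBINT x. H x * \<phi> x)"
      by simp
    have "(LBINT x. (g (x + e) - g x - H x) * \<phi> x) =
        (LBINT x. g (x + e) * \<phi> x) - (LBINT x. g x * \<phi> x) - (LBINT x. H x * \<phi> x)"
      using i1 by (simp add: left_diff_distrib)
    then show "(LBINT x. (g (x + e) - g x - H x) * \<phi> x) = 0" using 1 2 by simp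
  qed
  then show ?thesis unfolding V_def H_def by eventually_elim auto
qed

section \<open>Fubini's theorem along the normal of a hyperplane\<close>

definition hyperplane :: "real^'n \<Rightarrow> real \<Rightarrow> (real^'n) set" where
  "hyperplane n b = {x. n \<bullet> x = b}"

definition hproj :: "real^'n \<Rightarrow> real \<Rightarrow> real^'n \<Rightarrow> real^'n" where
  "hproj n b z = z - (n \<bullet> z - b) *\<^sub>R n"

text \<open>The Borel part of \<open>hyperplane_measure\<close>, with projection and slab in
  coordinates; the completion is restored in \<open>hyperplane_measure_eq\<close>.\<close>

definition hmeas :: "real^'n \<Rightarrow> real \<Rightarrow> (real^'n) measure" where
  "hmeas n b = distr (restrict_space lborel {z. \<bar>n \<bullet> z - b\<bar> \<le> 1/2}) borel (hproj n b)"

lemma hproj_measurable [measurable]: "hproj n b \<in> borel_measurable borel"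
  unfolding hproj_def[abs_def] by measurable

lemma sets_hmeas [simp, measurable_cong]: "sets (hmeas n b) = sets borel"
  by (simp add: hmeas_def)

lemma space_hmeas [simp]: "space (hmeas n b) = UNIV"
  by (simp add: hmeas_def)

context
  fixes n :: "real^'n" assumes n: "norm n = 1"
begin

lemma unit_inner [simp]: "n \<bullet> n = 1"
  using n by (simp add: dot_square_norm)

lemma hproj_in: "n \<bullet> hproj n b z = b"
  by (simp add: hproj_def inner_diff_right)

lemma hproj_normal: "n \<bullet> x = b \<Longrightarrow> hproj n b (x + s *\<^sub>R n) = x"
  by (simp add: hproj_def inner_add_right)

lemma closest_point_hyperplane: "closest_point (hyperplane n b) z = hproj n b z"
proof (rule closest_point_unique[symmetric])
  show "convex (hyperplane n b)" "closed (hyperplane n b)"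
    by (auto simp: hyperplane_def convex_hyperplane closed_hyperplane)
  show "hproj n b z \<in> hyperplane n b" by (simp add: hyperplane_def hproj_in)
  show "\<forall>y\<in>hyperplane n b. dist z (hproj n b z) \<le> dist z y"
  proof
    fix y assume "y \<in> hyperplane n b"
    then have "n \<bullet> (z - y) = n \<bullet> z - b" by (simp add: hyperplane_def inner_diff_right)
    then have "\<bar>n \<bullet> z - b\<bar> \<le> norm (z - y)"
      using Cauchy_Schwarz_ineq2[of n "z - y"] n by simp
    then show "dist z (hproj n b z) \<le> dist z y" by (simp add: dist_norm hproj_def n)
  qed
qed

lemma infdist_hyperplane: "infdist z (hyperplane n b) = \<bar>n \<bullet> z - b\<bar>"
proof -
  have ne: "closed (hyperplane n b)" "hyperplane n b \<noteq> {}"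
    using hproj_in[of b z] by (auto simp: hyperplane_def closed_hyperplane)
  have "infdist z (hyperplane n b) = dist z (closest_point (hyperplane n b) z)"
    using infdist_eq_setdist[of z "hyperplane n b"] setdist_closest_point[OF ne, of z] by simp
  then show ?thesis by (simp add: closest_point_hyperplane dist_norm hproj_def n)
qed

lemma hyperplane_measure_eq: "hyperplane_measure (hyperplane n b) = completion (hmeas n b)"
proof -
  have "closest_point (hyperplane n b) = hproj n b" by (auto simp: closest_point_hyperplane)
  then show ?thesis
    unfolding hyperplane_measure_def hmeas_def by (simp add: infdist_hyperplane)
qed

lemma nn_integral_hmeas:
  assumes [measurable]: "f \<in> borel_measurable borel"
  shows "(\<integral>\<^sup>+x. f x \<partial>hmeas n b) = (\<integral>\<^sup>+z. indicator {z. \<bar>n \<bullet> z - b\<bar> \<le> 1/2} z * f (hproj n b z) \<partial>lborel)"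
proof -
  have "(\<integral>\<^sup>+x. f x \<partial>hmeas n b) = (\<integral>\<^sup>+z. f (hproj n b z) \<partial>restrict_space lborel {z. \<bar>n \<bullet> z - b\<bar> \<le> 1/2})"
    unfolding hmeas_def by (intro nn_integral_distr) (auto intro!: measurable_restrict_space1)
  also have "\<dots> = (\<integral>\<^sup>+z. f (hproj n b z) * indicator {z. \<bar>n \<bullet> z - b\<bar> \<le> 1/2} z \<partial>lborel)"
    by (rule nn_integral_restrict_space) auto
  finally show ?thesis by (simp add: mult.commute)
qed

lemma emeasure_hmeas:
  assumes [measurable]: "A \<in> sets borel"
  shows "emeasure (hmeas n b) A = emeasure lborel {z. \<bar>n \<bullet> z - b\<bar> \<le> 1/2 \<and> hproj n b z \<in> A}"
proof -
  have "emeasure (hmeas n b) A = (\<integral>\<^sup>+x. indicator A x \<partial>hmeas n b)" by simp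
  also have "\<dots> = (\<integral>\<^sup>+z. indicator {z. \<bar>n \<bullet> z - b\<bar> \<le> 1/2 \<and> hproj n b z \<in> A} z \<partial>lborel)"
    by (subst nn_integral_hmeas, measurable, intro nn_integral_cong) (simp add: indicator_def)
  also have "\<dots> = emeasure lborel {z. \<bar>n \<bullet> z - b\<bar> \<le> 1/2 \<and> hproj n b z \<in> A}" by simp
  finally show ?thesis .
qed

lemma emeasure_hmeas_bounded:
  assumes [measurable]: "A \<in> sets borel" and "bounded A"
  shows "emeasure (hmeas n b) A < \<infinity>"
proof -
  obtain r where r: "\<And>x. x \<in> A \<Longrightarrow> norm x \<le> r" using \<open>bounded A\<close> by (auto simp: bounded_iff)
  have "norm z \<le> r + 1" if "\<bar>n \<bullet> z - b\<bar> \<le> 1/2" "hproj n b z \<in> A" for z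
  proof -
    have "norm z \<le> norm (hproj n b z) + norm ((n \<bullet> z - b) *\<^sub>R n)"
      using norm_triangle_ineq[of "hproj n b z" "(n \<bullet> z - b) *\<^sub>R n"] by (simp add: hproj_def)
    then show ?thesis using that r[OF that(2)] by (simp add: n)
  qed
  then have "{z. \<bar>n \<bullet> z - b\<bar> \<le> 1/2 \<and> hproj n b z \<in> A} \<subseteq> cball 0 (r + 1)" by auto
  then have "emeasure (hmeas n b) A \<le> emeasure lborel (cball (0::real^'n) (r + 1))"
    unfolding emeasure_hmeas[OF assms(1)] by (intro emeasure_mono) auto
  also have "\<dots> < \<infinity>" using emeasure_bounded_finite[OF bounded_cball] by blast
  finally show ?thesis .
qed

lemma sigma_finite_hmeas: "sigma_finite_measure (hmeas n b)"
proof
  show "\<exists>A. countable A \<and> A \<subseteq> sets (hmeas n b) \<and> \<Union>A = space (hmeas n b) \<and> (\<forall>a\<in>A. emeasure (hmeas n b) a \<noteq> \<infinity>)"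
  proof (intro exI conjI)
    show "countable (range (\<lambda>m. cball 0 (real m) :: (real^'n) set))" by simp
    show "\<Union>(range (\<lambda>m. cball 0 (real m) :: (real^'n) set)) = space (hmeas n b)"
      using real_arch_simple by auto
    show "\<forall>a\<in>range (\<lambda>m. cball 0 (real m) :: (real^'n) set). emeasure (hmeas n b) a \<noteq> \<infinity>"
    proof
      fix a assume "a \<in> range (\<lambda>m. cball 0 (real m) :: (real^'n) set)"
      then have "emeasure (hmeas n b) a < \<infinity>" by (intro emeasure_hmeas_bounded) auto
      then show "emeasure (hmeas n b) a \<noteq> \<infinity>" by simp
    qed
  qed auto
qed

lemma AE_hmeas_hyperplane: "AE x in hmeas n b. n \<bullet> x = b"
proof (rule AE_I')
  show "{x. n \<bullet> x \<noteq> b} \<in> null_sets (hmeas n b)"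
    by (auto simp: null_sets_def emeasure_hmeas hproj_in)
qed auto

text \<open>Fubini in the coordinates foot point and signed distance. Since \<open>hmeas\<close> is
  an image of the unit slab, the measure of A on the left is a double integral over z in the slab
  and s on the line. Translating by s n and exchanging the integrals leaves, for each z, the length
  of the set of s with z - s n in the slab, which is 1.\<close>

lemma lborel_eq_hmeas_prod:
  "distr (hmeas n b \<Otimes>\<^sub>M lborel) borel (\<lambda>(x, s). x + s *\<^sub>R n) = lborel"
proof (rule measure_eqI)
  interpret h: sigma_finite_measure "hmeas n b" by (rule sigma_finite_hmeas)
  let ?S = "{z. \<bar>n \<bullet> z - b\<bar> \<le> 1/2}"
  fix A assume "A \<in> sets (distr (hmeas n b \<Otimes>\<^sub>M lborel) borel (\<lambda>(x, s). x + s *\<^sub>R n))"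
  then have [measurable]: "A \<in> sets borel" by simp
  have "emeasure (distr (hmeas n b \<Otimes>\<^sub>M lborel) borel (\<lambda>(x, s). x + s *\<^sub>R n)) A
      = (\<integral>\<^sup>+p. indicator A (fst p + snd p *\<^sub>R n) \<partial>(hmeas n b \<Otimes>\<^sub>M lborel))"
    by (subst nn_integral_indicator[symmetric], simp, subst nn_integral_distr) (auto simp: case_prod_beta')
  also have "\<dots> = (\<integral>\<^sup>+x. \<integral>\<^sup>+s. indicator A (x + s *\<^sub>R n) \<partial>lborel \<partial>hmeas n b)"
    by (subst lborel.nn_integral_fst[symmetric]) auto
  also have "\<dots> = (\<integral>\<^sup>+z. indicator ?S z * (\<integral>\<^sup>+s. indicator A (hproj n b z + s *\<^sub>R n) \<partial>lborel) \<partial>lborel)"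
    by (subst nn_integral_hmeas) auto
  also have "\<dots> = (\<integral>\<^sup>+z. indicator ?S z * (\<integral>\<^sup>+s. indicator A (z + s *\<^sub>R n) \<partial>lborel) \<partial>lborel)"
  proof (intro nn_integral_cong)
    \<comment> \<open>On a normal line the base point may be moved from the projection of z to z
      itself by a translation of s.\<close>
    fix z :: "real^'n"
    have "(\<integral>\<^sup>+s. indicator A (hproj n b z + s *\<^sub>R n) \<partial>lborel)
        = (\<integral>\<^sup>+s. indicator A (hproj n b z + ((n \<bullet> z - b) + 1 * s) *\<^sub>R n) \<partial>lborel)"
      by (subst nn_integral_real_affine[of _ 1 "n \<bullet> z - b"]) auto
    then show "indicator ?S z * (\<integral>\<^sup>+s. indicator A (hproj n b z + s *\<^sub>R n) \<partial>lborel) = indicator ?S z * (\<integral>\<^sup>+s. indicator A (z + s *\<^sub>R n) \<partial>lborel)"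
      by (simp add: hproj_def scaleR_add_left)
  qed
  also have "\<dots> = (\<integral>\<^sup>+z. \<integral>\<^sup>+s. indicator ?S z * indicator A (z + s *\<^sub>R n) \<partial>lborel \<partial>lborel)"
    by (subst nn_integral_cmult) auto
  also have "\<dots> = (\<integral>\<^sup>+s. \<integral>\<^sup>+z. indicator ?S z * indicator A (z + s *\<^sub>R n) \<partial>lborel \<partial>lborel)"
    by (rule lborel_pair.Fubini'[symmetric]) measurable
  also have "\<dots> = (\<integral>\<^sup>+s. \<integral>\<^sup>+z. indicator ?S (z - s *\<^sub>R n) * indicator A z \<partial>lborel \<partial>lborel)"
  proof (rule nn_integral_cong)
    fix s :: real
    have "(\<integral>\<^sup>+z. indicator ?S (z + s *\<^sub>R n - s *\<^sub>R n) * indicator A (z + s *\<^sub>R n) \<partial>lborel)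
       = (\<integral>\<^sup>+z. indicator ?S (z - s *\<^sub>R n) * indicator A z \<partial>lborel)"
      by (rule nn_integral_translate[of "\<lambda>z. indicator ?S (z - s *\<^sub>R n) * indicator A z"]) measurable
    then show "(\<integral>\<^sup>+z. indicator ?S z * indicator A (z + s *\<^sub>R n) \<partial>lborel) = (\<integral>\<^sup>+z. indicator ?S (z - s *\<^sub>R n) * indicator A z \<partial>lborel)"
      by simp
  qed
  also have "\<dots> = (\<integral>\<^sup>+z. \<integral>\<^sup>+s. indicator ?S (z - s *\<^sub>R n) * indicator A z \<partial>lborel \<partial>lborel)"
    by (rule lborel_pair.Fubini') measurable
  also have "\<dots> = (\<integral>\<^sup>+z. indicator A z \<partial>lborel)"
  proof (intro nn_integral_cong)
    fix z :: "real^'n"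
    have "(\<integral>\<^sup>+s. indicator ?S (z - s *\<^sub>R n) * indicator A z \<partial>lborel) = (\<integral>\<^sup>+s. indicator {n \<bullet> z - b - 1/2 .. n \<bullet> z - b + 1/2} s \<partial>lborel) * indicator A z"
    proof (subst nn_integral_multc[symmetric])
      have "\<bar>n \<bullet> (z - s *\<^sub>R n) - b\<bar> \<le> 1/2 \<longleftrightarrow> s \<in> {n \<bullet> z - b - 1/2 .. n \<bullet> z - b + 1/2}" for s
        unfolding inner_diff_right inner_scaleR_right unit_inner atLeastAtMost_iff abs_le_iff by linarith
      then show "(\<integral>\<^sup>+s. indicator ?S (z - s *\<^sub>R n) * indicator A z \<partial>lborel) = (\<integral>\<^sup>+s. indicator {n \<bullet> z - b - 1/2 .. n \<bullet> z - b + 1/2} s * indicator A z \<partial>lborel)"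
        by (intro nn_integral_cong) (simp add: indicator_def)
    qed simp
    then show "(\<integral>\<^sup>+s. indicator ?S (z - s *\<^sub>R n) * indicator A z \<partial>lborel) = indicator A z"
      by simp
  qed
  finally show "emeasure (distr (hmeas n b \<Otimes>\<^sub>M lborel) borel (\<lambda>(x, s). x + s *\<^sub>R n)) A = emeasure lborel A"
    by simp
qed simp

lemma normal_Fubini_nn:
  assumes [measurable]: "f \<in> borel_measurable borel"
  shows "(\<integral>\<^sup>+x. \<integral>\<^sup>+s. f (x + s *\<^sub>R n) \<partial>lborel \<partial>hmeas n b) = (\<integral>\<^sup>+z. f z \<partial>lborel)"
proof -
  have "(\<integral>\<^sup>+z. f z \<partial>lborel) = (\<integral>\<^sup>+z. f z \<partial>distr (hmeas n b \<Otimes>\<^sub>M lborel) borel (\<lambda>(x, s). x + s *\<^sub>R n))"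
    by (simp add: lborel_eq_hmeas_prod)
  also have "\<dots> = (\<integral>\<^sup>+p. f (fst p + snd p *\<^sub>R n) \<partial>(hmeas n b \<Otimes>\<^sub>M lborel))"
    by (subst nn_integral_distr) (auto simp: case_prod_beta')
  also have "\<dots> = (\<integral>\<^sup>+x. \<integral>\<^sup>+s. f (x + s *\<^sub>R n) \<partial>lborel \<partial>hmeas n b)"
    by (subst lborel.nn_integral_fst[symmetric]) auto
  finally show ?thesis ..
qed

lemma normal_Fubini_integrable:
  fixes f :: "real^'n \<Rightarrow> 'b::{banach, second_countable_topology}"
  assumes f: "integrable lborel f"
  shows "integrable (hmeas n b \<Otimes>\<^sub>M lborel) (\<lambda>(x, s). f (x + s *\<^sub>R n))"
proof -
  have "integrable (distr (hmeas n b \<Otimes>\<^sub>M lborel) borel (\<lambda>(x, s). x + s *\<^sub>R n)) f"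
    using f by (simp add: lborel_eq_hmeas_prod)
  then have "integrable (hmeas n b \<Otimes>\<^sub>M lborel) (\<lambda>p. f (case p of (x, s) \<Rightarrow> x + s *\<^sub>R n))"
    by (rule integrable_distr[rotated]) measurable
  then show ?thesis by (simp add: case_prod_beta')
qed

lemma normal_Fubini:
  fixes f :: "real^'n \<Rightarrow> 'b::{banach, second_countable_topology}"
  assumes f: "integrable lborel f"
  shows "AE x in hmeas n b. integrable lborel (\<lambda>s. f (x + s *\<^sub>R n))"
    "integrable (hmeas n b) (\<lambda>x. LINT s|lborel. f (x + s *\<^sub>R n))"
    "(LINT x|hmeas n b. LINT s|lborel. f (x + s *\<^sub>R n)) = (LBINT z. f z)"
    "(LBINT s. LINT x|hmeas n b. f (x + s *\<^sub>R n)) = (LBINT z. f z)"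
proof -
  interpret h: sigma_finite_measure "hmeas n b" by (rule sigma_finite_hmeas)
  interpret p: pair_sigma_finite "hmeas n b" lborel ..
  note i = normal_Fubini_integrable[OF f, of b]
  have [measurable]: "f \<in> borel_measurable borel" using f by auto
  have eq: "(LINT p|(hmeas n b \<Otimes>\<^sub>M lborel). (case p of (x, s) \<Rightarrow> f (x + s *\<^sub>R n))) = (LBINT z. f z)"
  proof -
    have "(LBINT z. f z) = (LINT z|distr (hmeas n b \<Otimes>\<^sub>M lborel) borel (\<lambda>(x, s). x + s *\<^sub>R n). f z)"
      by (simp add: lborel_eq_hmeas_prod)
    also have "\<dots> = (LINT p|(hmeas n b \<Otimes>\<^sub>M lborel). (case p of (x, s) \<Rightarrow> f (x + s *\<^sub>R n)))"
      by (subst integral_distr) (auto simp: case_prod_beta')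
    finally show ?thesis ..
  qed
  show "AE x in hmeas n b. integrable lborel (\<lambda>s. f (x + s *\<^sub>R n))"
    using p.AE_integrable_fst'[OF i] by simp
  show "integrable (hmeas n b) (\<lambda>x. LINT s|lborel. f (x + s *\<^sub>R n))"
    using p.integrable_fst'[OF i] by simp
  show "(LINT x|hmeas n b. LINT s|lborel. f (x + s *\<^sub>R n)) = (LBINT z. f z)"
    using p.integral_fst'[OF i] eq by simp
  show "(LBINT s. LINT x|hmeas n b. f (x + s *\<^sub>R n)) = (LBINT z. f z)"
    using p.integral_snd[OF i] eq by simp
qed

text \<open>The property P may be non-measurable, so a Borel null set containing its exceptional set
  is transported to the product instead.\<close>

lemma normal_Fubini_AE:
  assumes "AE z in lborel. P z"
  shows "AE x in hmeas n b. AE s in lborel. P (x + s *\<^sub>R n)"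
proof -
  interpret h: sigma_finite_measure "hmeas n b" by (rule sigma_finite_hmeas)
  from assms obtain N where N: "{z. \<not> P z} \<subseteq> N" "N \<in> null_sets lborel"
    unfolding eventually_ae_filter by auto
  interpret p: pair_sigma_finite "hmeas n b" lborel ..
  have [measurable]: "N \<in> sets borel" using N(2) by auto
  have "AE z in lborel. z \<notin> N" using N(2) by (rule AE_not_in)
  then have "AE z in distr (hmeas n b \<Otimes>\<^sub>M lborel) borel (\<lambda>(x, s). x + s *\<^sub>R n). z \<notin> N"
    by (subst lborel_eq_hmeas_prod)
  then have "AE p in hmeas n b \<Otimes>\<^sub>M lborel. (case p of (x, s) \<Rightarrow> x + s *\<^sub>R n) \<notin> N"
    by (subst (asm) AE_distr_iff) auto
  then have "AE x in hmeas n b. AE s in lborel. (case (x, s) of (x, s) \<Rightarrow> x + s *\<^sub>R n) \<notin> N"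
    by (rule p.AE_pair)
  then show ?thesis
  proof eventually_elim
    case (elim x)
    then have "AE s in lborel. x + s *\<^sub>R n \<notin> N" by simp
    then show ?case by eventually_elim (use N(1) in auto)
  qed
qed

end

section \<open>One-sided traces on hyperplanes\<close>

lemma AE_lborel_translate:
  fixes c :: "'a::euclidean_space"
  assumes "AE x in lborel. P x" shows "AE x in lborel. P (c + x)"
proof (rule AE_distrD[of "(+) c" lborel borel P])
  show "AE x in distr lborel borel ((+) c). P x"
    using assms by (subst lborel_distr_plus)
qed simp

text \<open>Turns an integral over the parameter of a segment into a difference of values of a
  primitive, for increments r of either sign. A negative increment is the reversed segment, obtained
  by replacing q with 1 - q.\<close>

lemma integral_segment_scaled:
  fixes \<phi> :: "real \<Rightarrow> real"
  assumes \<phi>: "integrable lborel \<phi>" and "a < s" "a < s + r"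
  shows "(LBINT q. indicator {0..1} q * (\<phi> (s + q * r) * r)) =
    (LBINT q. indicator {a..s + r} q * \<phi> q) - (LBINT q. indicator {a..s} q * \<phi> q)"
proof -
  have ind: "integrable lborel (\<lambda>q. indicator A q * \<phi> q)" if "A \<in> sets borel" for A
    using integrable_mult_indicator[OF _ \<phi>, of A] that by simp
  have pos: "(LBINT q. indicator {0..1} q * (\<phi> (s + q * r) * r)) =
    (LBINT q. indicator {a..s + r} q * \<phi> q) - (LBINT q. indicator {a..s} q * \<phi> q)"
    if "r > 0" "a < s" for s r
  proof -
    have "(LBINT q. indicator {a..s + r} q * \<phi> q) - (LBINT q. indicator {a..s} q * \<phi> q)
        = (LBINT q. indicator {a..s + r} q * \<phi> q - indicator {a..s} q * \<phi> q)"
      using ind by simp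
    also have "\<dots> = (LBINT q. indicator {s..s + r} q * \<phi> q)"
    proof (rule integral_cong_AE)
      have [measurable]: "\<phi> \<in> borel_measurable borel" using \<phi> by auto
      show "AE q in lborel. indicator {a..s + r} q * \<phi> q - indicator {a..s} q * \<phi> q = indicator {s..s + r} q * \<phi> q"
        using AE_lborel_singleton[of s] by eventually_elim (use that in \<open>auto simp: indicator_def\<close>)
    qed (use \<phi> in auto)
    also have "\<dots> = \<bar>r\<bar> *\<^sub>R (LBINT q. indicator {s..s + r} (s + r * q) * \<phi> (s + r * q))"
      using that by (subst lborel_integral_real_affine[where c=r and t=s]) auto
    also have "\<dots> = (LBINT q. indicator {0..1} q * (\<phi> (s + q * r) * r))"
      unfolding real_scaleR_def Bochner_Integration.integral_mult_right_zero[symmetric]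
    proof (intro Bochner_Integration.integral_cong refl)
      fix q
      have "s + r * q \<in> {s..s + r} \<longleftrightarrow> q \<in> {0..1}" using \<open>r > 0\<close> by (auto simp: zero_le_mult_iff)
      then show "\<bar>r\<bar> * (indicator {s..s + r} (s + r * q) * \<phi> (s + r * q)) = indicator {0..1} q * (\<phi> (s + q * r) * r)"
        using \<open>r > 0\<close> by (auto simp: indicator_def mult.commute)
    qed
    finally show ?thesis ..
  qed
  consider "r > 0" | "r = 0" | "r < 0" by linarith
  then show ?thesis
  proof cases
    case 3
    have "(LBINT q. indicator {0..1} q * (\<phi> (s + q * r) * r)) =
       \<bar>-1\<bar> *\<^sub>R (LBINT q. indicator {0..1} (1 + (-1) * q) * (\<phi> (s + (1 + (-1) * q) * r) * r))"
      by (subst lborel_integral_real_affine[where c="-1" and t=1]) auto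
    also have "\<dots> = - (LBINT q. indicator {0..1} q * (\<phi> ((s + r) + q * (- r)) * (- r)))"
      by (auto simp: indicator_def algebra_simps simp flip: Bochner_Integration.integral_minus intro!: Bochner_Integration.integral_cong)
    also have "\<dots> = - ((LBINT q. indicator {a..(s + r) + - r} q * \<phi> q) - (LBINT q. indicator {a..s + r} q * \<phi> q))"
      using 3 assms by (subst pos) auto
    finally show ?thesis by simp
  qed (use pos assms in auto)
qed

lemma AE_Ioo_imp_exists:
  assumes "AE s in lborel. a < s \<and> s < b \<longrightarrow> P s" "a < (b::real)"
  shows "\<exists>s. a < s \<and> s < b \<and> P s"
proof (rule ccontr)
  assume "\<not> ?thesis"
  from assms(1) have "AE s in lborel. s \<notin> {a<..<b}"
    by eventually_elim (use \<open>\<not> _\<close> in auto)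
  then have "{a<..<b} \<in> null_sets lborel" by (simp add: AE_iff_null_sets)
  then show False using assms(2) by auto
qed

text \<open>Absolute continuity on almost every normal line. The translation formula holds for each
  step r at almost every point; exchanging the quantifiers makes it hold at almost every point for
  almost every r. On almost every line there is then a base point from which the formula reaches
  almost all of the line.\<close>

lemma weak_gradient_on_normals:
  assumes w: "borel_weak_gradient T g h" and T: "open T" "bounded T" and n: "norm n = 1"
    and [measurable]: "\<Gamma> \<in> sets borel" and \<Gamma>: "\<And>x s. x \<in> \<Gamma> \<Longrightarrow> \<alpha> < s \<Longrightarrow> s < \<beta> \<Longrightarrow> x + s *\<^sub>R n \<in> T"
    and "\<alpha> < \<beta>"
  shows "AE x in hmeas n b. x \<in> \<Gamma> \<longrightarrow> (\<exists>v. AE s in lborel. \<alpha> < s \<and> s < \<beta> \<longrightarrow>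
      g (x + s *\<^sub>R n) = v + (LBINT q. indicator {\<alpha>..s} q * (h (x + q *\<^sub>R n) \<bullet> n)))"
proof -
  note [measurable] = borel_weak_gradientD(1,2)[OF w]
  have ih: "integrable lborel (\<lambda>z. h z \<bullet> n)"
    using borel_weak_gradient_integrable(2)[OF w T(2)] by auto
  \<comment> \<open>The guard speaks of the foot point and the signed distance, not of a segment
    lying in T, so that Q is visibly measurable in z and r together and the quantifiers can be
    exchanged.\<close>
  define Q where "Q = (\<lambda>z r. hproj n b z \<in> \<Gamma> \<and> \<alpha> < n \<bullet> z - b \<and> n \<bullet> z - b < \<beta> \<and> \<alpha> < n \<bullet> z - b + r \<and> n \<bullet> z - b + r < \<beta> \<longrightarrow>
     g (z + r *\<^sub>R n) - g z = (LBINT q. indicator {0..1} q * (h (z + (q * r) *\<^sub>R n) \<bullet> n * r)))"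
  have "AE z in lborel. Q z r" for r
    using weak_gradient_translation[OF w T, of "r *\<^sub>R n"]
  proof eventually_elim
    case (elim z)
    show ?case unfolding Q_def
    proof (intro impI)
      assume z: "hproj n b z \<in> \<Gamma> \<and> \<alpha> < n \<bullet> z - b \<and> n \<bullet> z - b < \<beta> \<and> \<alpha> < n \<bullet> z - b + r \<and> n \<bullet> z - b + r < \<beta>"
      have "z + q *\<^sub>R r *\<^sub>R n \<in> T" if q: "q \<in> {0..1}" for q
      proof -
        have "0 \<le> q * r \<and> q * r \<le> r \<or> r \<le> q * r \<and> q * r \<le> 0"
        proof (cases "r \<ge> 0")
          case True
          then show ?thesis using q mult_right_mono[of q 1 r] by auto
        next
          case False
          then show ?thesis using q mult_right_mono_neg[of q 1 r] by (auto simp: mult_nonneg_nonpos)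
        qed
        then have "\<alpha> < n \<bullet> z - b + q * r" "n \<bullet> z - b + q * r < \<beta>" using z by linarith+
        then have "hproj n b z + (n \<bullet> z - b + q * r) *\<^sub>R n \<in> T"
          using \<Gamma> z by auto
        then show ?thesis by (simp add: hproj_def algebra_simps)
      qed
      with elim show "g (z + r *\<^sub>R n) - g z = (LBINT q. indicator {0..1} q * (h (z + (q * r) *\<^sub>R n) \<bullet> n * r))"
        by (simp add: mult.commute)
    qed
  qed
  then have "AE r in lborel. AE z in lborel. Q z r" by simp
  then have "AE z in lborel. AE r in lborel. Q z r"
    unfolding Q_def by (subst lborel_pair.AE_commute) measurable
  from normal_Fubini_AE[OF n this, of b] AE_hmeas_hyperplane[OF n, of b] normal_Fubini(1)[OF n ih, of b]
  show ?thesis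
  proof eventually_elim
    case (elim x)
    define I where "I = (\<lambda>s. LINT q|lborel. indicator {\<alpha>..s} q * (h (x + q *\<^sub>R n) \<bullet> n))"
    show ?case
    proof (intro impI)
      assume x: "x \<in> \<Gamma>"
      \<comment> \<open>Almost every height is a good base point; one is fixed, and the constant v
        will be the value of g there minus the primitive.\<close>
      have "AE s in lborel. \<alpha> < s \<and> s < \<beta> \<longrightarrow> (AE r in lborel. Q (x + s *\<^sub>R n) r)"
        using elim(1) by eventually_elim simp
      from AE_Ioo_imp_exists[OF this \<open>\<alpha> < \<beta>\<close>]
      obtain s0 where s0: "\<alpha> < s0" "s0 < \<beta>" "AE r in lborel. Q (x + s0 *\<^sub>R n) r" by blast
      have "AE r in lborel. \<alpha> < s0 + r \<and> s0 + r < \<beta> \<longrightarrow> g (x + (s0 + r) *\<^sub>R n) = g (x + s0 *\<^sub>R n) - I s0 + I (s0 + r)"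
        using s0(3)
      proof eventually_elim
        case (elim r)
        show ?case
        proof
          assume r: "\<alpha> < s0 + r \<and> s0 + r < \<beta>"
          have "n \<bullet> (x + s0 *\<^sub>R n) - b = s0"
            using \<open>n \<bullet> x = b\<close> by (simp add: inner_add_right unit_inner[OF n])
          then have "g (x + s0 *\<^sub>R n + r *\<^sub>R n) - g (x + s0 *\<^sub>R n) =
             (LBINT q. indicator {0..1} q * (h (x + s0 *\<^sub>R n + (q * r) *\<^sub>R n) \<bullet> n * r))"
            using elim r x s0 \<open>n \<bullet> x = b\<close> by (auto simp: Q_def hproj_normal[OF n])
          also have "\<dots> = (LBINT q. indicator {0..1} q * (h (x + (s0 + q * r) *\<^sub>R n) \<bullet> n * r))"
            by (simp add: scaleR_add_left add.assoc)
          also have "\<dots> = I (s0 + r) - I s0"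
            unfolding I_def
            by (rule integral_segment_scaled[where \<phi>="\<lambda>q. h (x + q *\<^sub>R n) \<bullet> n"])
              (use \<open>integrable lborel (\<lambda>s. h (x + s *\<^sub>R n) \<bullet> n)\<close> s0 r in auto)
          finally show "g (x + (s0 + r) *\<^sub>R n) = g (x + s0 *\<^sub>R n) - I s0 + I (s0 + r)"
            by (simp add: scaleR_add_left add.assoc)
        qed
      qed
      from AE_lborel_translate[OF this, of "- s0"]
      show "\<exists>v. AE s in lborel. \<alpha> < s \<and> s < \<beta> \<longrightarrow>
          g (x + s *\<^sub>R n) = v + (LBINT q. indicator {\<alpha>..s} q * (h (x + q *\<^sub>R n) \<bullet> n))"
        by (intro exI[of _ "g (x + s0 *\<^sub>R n) - I s0"]) (simp add: I_def)
    qed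
  qed
qed

text \<open>A one-sided essential limit along the ray. Null sets of the line do not affect it, and
  for a function measurable on the ray it implies convergence of the means that define
  \<open>face_trace\<close>.\<close>

definition ess_trace :: "'a::real_vector \<Rightarrow> ('a \<Rightarrow> 'b::real_normed_vector) \<Rightarrow> 'a \<Rightarrow> 'b \<Rightarrow> bool" where
  "ess_trace n g x v \<longleftrightarrow> (\<forall>\<eta>>0. \<exists>\<delta>>0. AE s in lborel. 0 < s \<and> s < \<delta> \<longrightarrow> norm (g (x + s *\<^sub>R n) - v) \<le> \<eta>)"

lemma small_interval_integral:
  fixes \<phi> :: "real \<Rightarrow> real"
  assumes \<phi>: "integrable lborel \<phi>" and "\<eta> > 0"
  shows "\<exists>\<delta>>0. (LBINT q. indicator {a - \<delta>..a + \<delta>} q * \<bar>\<phi> q\<bar>) \<le> \<eta>"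
proof -
  have [measurable]: "\<phi> \<in> borel_measurable borel" using \<phi> by auto
  have "(\<lambda>m. LINT q|lborel. indicator {a - 1 / real (Suc m)..a + 1 / real (Suc m)} q * \<bar>\<phi> q\<bar>) \<longlonglongrightarrow> (LINT (q::real)|lborel. 0)"
  proof (rule integral_dominated_convergence[where w="\<lambda>q. \<bar>\<phi> q\<bar>"])
    show "AE q in lborel. (\<lambda>m. indicator {a - 1 / real (Suc m)..a + 1 / real (Suc m)} q * \<bar>\<phi> q\<bar>) \<longlonglongrightarrow> 0"
      using AE_lborel_singleton[of a]
    proof eventually_elim
      case (elim q)
      then have "\<bar>q - a\<bar> > 0" by simp
      then obtain N where N: "1 / real (Suc N) < \<bar>q - a\<bar>" using nat_approx_posE by metis
      have "q \<notin> {a - 1 / real (Suc m)..a + 1 / real (Suc m)}" if "m \<ge> N" for m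
      proof -
        have "1 / real (Suc m) \<le> 1 / real (Suc N)" using that by (simp add: frac_le)
        then show ?thesis using N by auto
      qed
      then show ?case
        by (intro tendsto_eventually) (auto simp: eventually_sequentially indicator_def intro!: exI[of _ N])
    qed
  qed (use \<phi> in \<open>auto simp: indicator_def\<close>)
  then have "(\<lambda>m. LINT q|lborel. indicator {a - 1 / real (Suc m)..a + 1 / real (Suc m)} q * \<bar>\<phi> q\<bar>) \<longlonglongrightarrow> 0" by simp
  from order_tendstoD(2)[OF this \<open>\<eta> > 0\<close>] obtain m where
    "(LBINT q. indicator {a - 1 / real (Suc m)..a + 1 / real (Suc m)} q * \<bar>\<phi> q\<bar>) < \<eta>"
    by (auto simp: eventually_sequentially)
  then show ?thesis by (intro exI[of _ "1 / real (Suc m)"]) auto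
qed

text \<open>A primitive of an integrable function is continuous, so its value at 0 is the essential
  limit there. With \<alpha> = 0 this yields a one-sided trace; with \<alpha> < 0 the line continues
  through the hyperplane and both one-sided traces are the same number.\<close>

lemma ess_trace_of_primitive:
  fixes \<phi> :: "real \<Rightarrow> real" and g :: "'a::real_vector \<Rightarrow> real"
  assumes \<phi>: "integrable lborel \<phi>" and "\<alpha> \<le> 0" "0 < \<beta>"
    and rep: "AE s in lborel. \<alpha> < s \<and> s < \<beta> \<longrightarrow> g (x + s *\<^sub>R n) = v + (LBINT q. indicator {\<alpha>..s} q * \<phi> q)"
  shows "ess_trace n g x (v + (LBINT q. indicator {\<alpha>..0} q * \<phi> q))"
    and "\<alpha> < 0 \<Longrightarrow> ess_trace (- n) g x (v + (LBINT q. indicator {\<alpha>..0} q * \<phi> q))"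
proof -
  have [measurable]: "\<phi> \<in> borel_measurable borel" using \<phi> by auto
  define I where "I = (\<lambda>s. LINT q|lborel. indicator {\<alpha>..s} q * \<phi> q)"
  have I_eq: "(LBINT q. indicator {\<alpha>..s} q * \<phi> q) = I s" for s by (simp only: I_def)
  have rep': "AE s in lborel. \<alpha> < s \<and> s < \<beta> \<longrightarrow> g (x + s *\<^sub>R n) = v + I s"
    using rep unfolding I_eq .
  have ind: "integrable lborel (\<lambda>q. indicator A q * \<phi> q)" "integrable lborel (\<lambda>q. indicator A q * \<bar>\<phi> q\<bar>)" if "A \<in> sets borel" for A
    using integrable_mult_indicator[OF _ \<phi>, of A] integrable_mult_indicator[OF _ integrable_abs[OF \<phi>], of A] that
    unfolding real_scaleR_def sets_lborel by blast+
  have small: "\<bar>I s - I 0\<bar> \<le> (LBINT q. indicator {0 - \<delta>..0 + \<delta>} q * \<bar>\<phi> q\<bar>)" if "\<bar>s\<bar> < \<delta>" for s \<delta>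
  proof -
    have "I s - I 0 = (LBINT q. indicator {\<alpha>..s} q * \<phi> q - indicator {\<alpha>..0} q * \<phi> q)"
      unfolding I_def using ind by simp
    also have "\<bar>\<dots>\<bar> \<le> (LBINT q. indicator {0 - \<delta>..0 + \<delta>} q * \<bar>\<phi> q\<bar>)"
    proof (rule integral_abs_bound_integral)
      show "integrable lborel (\<lambda>q. indicator {\<alpha>..s} q * \<phi> q - indicator {\<alpha>..0} q * \<phi> q)"
        using ind(1)[of "{\<alpha>..s}"] ind(1)[of "{\<alpha>..0}"] by simp
      show "integrable lborel (\<lambda>q. indicator {0 - \<delta>..0 + \<delta>} q * \<bar>\<phi> q\<bar>)"
        by (rule ind(2)) simp
      show "\<bar>indicator {\<alpha>..s} q * \<phi> q - indicator {\<alpha>..0} q * \<phi> q\<bar> \<le> indicator {0 - \<delta>..0 + \<delta>} q * \<bar>\<phi> q\<bar>" for q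
        using that by (cases "q \<in> {\<alpha>..s}"; cases "q \<in> {\<alpha>..0}"; cases "q \<in> {0 - \<delta>..0 + \<delta>}") simp_all
    qed
    finally show ?thesis .
  qed
  have *: "\<exists>\<delta>>0. \<delta> \<le> \<beta> \<and> (\<alpha> < 0 \<longrightarrow> \<delta> \<le> - \<alpha>) \<and> (\<forall>s. \<bar>s\<bar> < \<delta> \<longrightarrow> \<bar>I s - I 0\<bar> \<le> \<eta>)" if \<eta>: "\<eta> > 0" for \<eta>
  proof -
    obtain \<delta> where \<delta>: "\<delta> > 0" "(LBINT q. indicator {0 - \<delta>..0 + \<delta>} q * \<bar>\<phi> q\<bar>) \<le> \<eta>"
      using small_interval_integral[OF \<phi> \<eta>] by blast
    define d where "d = min \<delta> (min \<beta> (if \<alpha> < 0 then - \<alpha> else \<beta>))"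
    have "d > 0" "d \<le> \<beta>" "\<alpha> < 0 \<longrightarrow> d \<le> - \<alpha>" using \<delta>(1) assms(3) by (auto simp: d_def)
    moreover have "\<bar>I s - I 0\<bar> \<le> \<eta>" if "\<bar>s\<bar> < d" for s
      by (rule order_trans[OF small \<delta>(2)]) (use that in \<open>auto simp: d_def\<close>)
    ultimately show ?thesis by blast
  qed
  show "ess_trace n g x (v + (LBINT q. indicator {\<alpha>..0} q * \<phi> q))"
    unfolding ess_trace_def I_eq
  proof (intro allI impI)
    fix \<eta> :: real assume "\<eta> > 0"
    then obtain \<delta> where \<delta>: "\<delta> > 0" "\<delta> \<le> \<beta>" "\<forall>s. \<bar>s\<bar> < \<delta> \<longrightarrow> \<bar>I s - I 0\<bar> \<le> \<eta>" using * by blast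
    have "AE s in lborel. 0 < s \<and> s < \<delta> \<longrightarrow> norm (g (x + s *\<^sub>R n) - (v + I 0)) \<le> \<eta>"
      using rep'
    proof eventually_elim
      case (elim s)
      show ?case
      proof
        assume s: "0 < s \<and> s < \<delta>"
        then have "g (x + s *\<^sub>R n) = v + I s" using elim \<delta>(2) assms(2) by simp
        moreover have "\<bar>I s - I 0\<bar> \<le> \<eta>" using \<delta>(3) s by simp
        ultimately show "norm (g (x + s *\<^sub>R n) - (v + I 0)) \<le> \<eta>" by simp
      qed
    qed
    with \<delta>(1) show "\<exists>\<delta>>0. AE s in lborel. 0 < s \<and> s < \<delta> \<longrightarrow> norm (g (x + s *\<^sub>R n) - (v + I 0)) \<le> \<eta>"
      by (intro exI[of _ \<delta>] conjI)
  qed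
  show "ess_trace (- n) g x (v + (LBINT q. indicator {\<alpha>..0} q * \<phi> q))" if neg: "\<alpha> < 0"
    unfolding ess_trace_def I_eq
  proof (intro allI impI)
    fix \<eta> :: real assume "\<eta> > 0"
    then obtain \<delta> where \<delta>: "\<delta> > 0" "\<delta> \<le> - \<alpha>" "\<forall>s. \<bar>s\<bar> < \<delta> \<longrightarrow> \<bar>I s - I 0\<bar> \<le> \<eta>" using *[OF \<open>\<eta> > 0\<close>] neg by blast
    \<comment> \<open>The ray in direction -n is the negative half of the same line; reflection
      preserves null sets.\<close>
    have "AE s in distr lborel borel uminus. \<alpha> < s \<and> s < \<beta> \<longrightarrow> g (x + s *\<^sub>R n) = v + I s"
      unfolding lborel_distr_uminus by (rule rep')
    then have "AE s in lborel. \<alpha> < - s \<and> - s < \<beta> \<longrightarrow> g (x + (- s) *\<^sub>R n) = v + I (- s)"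
      by (rule AE_distrD[of uminus lborel borel "\<lambda>s. \<alpha> < s \<and> s < \<beta> \<longrightarrow> g (x + s *\<^sub>R n) = v + I s", rotated]) simp
    then have "AE s in lborel. 0 < s \<and> s < \<delta> \<longrightarrow> norm (g (x + s *\<^sub>R (- n)) - (v + I 0)) \<le> \<eta>"
    proof eventually_elim
      case (elim s)
      show ?case
      proof
        assume s: "0 < s \<and> s < \<delta>"
        then have "\<alpha> < - s" "- s < \<beta>" using \<delta>(2) assms(3) by linarith+
        then have "g (x + (- s) *\<^sub>R n) = v + I (- s)" using elim by blast
        then have "norm (g (x + s *\<^sub>R (- n)) - (v + I 0)) = \<bar>I (- s) - I 0\<bar>" by simp
        moreover have "\<bar>- s\<bar> < \<delta>" using s by simp
        then have "\<bar>I (- s) - I 0\<bar> \<le> \<eta>" using \<delta>(3) by blast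
        ultimately show "norm (g (x + s *\<^sub>R (- n)) - (v + I 0)) \<le> \<eta>" by simp
      qed
    qed
    with \<delta>(1) show "\<exists>\<delta>>0. AE s in lborel. 0 < s \<and> s < \<delta> \<longrightarrow> norm (g (x + s *\<^sub>R (- n)) - (v + I 0)) \<le> \<eta>"
      by (intro exI[of _ \<delta>] conjI)
  qed
qed

text \<open>Measurability near 0 has to be assumed: the Bochner integral of a non-measurable
  function is a default value, and the means would carry no information about f.\<close>

lemma average_tendsto_ess_limit:
  fixes f :: "real \<Rightarrow> 'b::euclidean_space"
  assumes f: "f \<in> borel_measurable (lebesgue_on {0<..<\<delta>0})" and "\<delta>0 > 0"
    and lim: "\<And>\<eta>. \<eta> > 0 \<Longrightarrow> \<exists>\<delta>>0. AE s in lborel. 0 < s \<and> s < \<delta> \<longrightarrow> norm (f s - v) \<le> \<eta>"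
  shows "((\<lambda>\<epsilon>. (1/\<epsilon>) *\<^sub>R (LINT t|lebesgue_on {0<..<\<epsilon>}. f t)) \<longlongrightarrow> v) (at_right 0)"
proof (rule tendstoI)
  fix e :: real assume "e > 0"
  then obtain \<delta> where \<delta>: "\<delta> > 0" "AE s in lborel. 0 < s \<and> s < \<delta> \<longrightarrow> norm (f s - v) \<le> e / 2"
    using lim[of "e/2"] by auto
  have "dist ((1/\<epsilon>) *\<^sub>R (LINT t|lebesgue_on {0<..<\<epsilon>}. f t)) v < e" if \<epsilon>: "0 < \<epsilon>" "\<epsilon> < min \<delta> \<delta>0" for \<epsilon>
  proof -
    have ms: "measure (lebesgue_on {0<..<\<epsilon>}) {0<..<\<epsilon>} = \<epsilon>" "emeasure (lebesgue_on {0<..<\<epsilon>}) {0<..<\<epsilon>} < \<infinity>"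
      using \<epsilon> by (auto simp: measure_restrict_space emeasure_restrict_space)
    have fin: "finite_measure (lebesgue_on {0<..<\<epsilon>})"
      using ms by (intro finite_measureI) (auto simp: space_restrict_space)
    have meas: "f \<in> borel_measurable (lebesgue_on {0<..<\<epsilon>})"
      by (rule measurable_restrict_mono[OF f]) (use \<epsilon> in auto)
    have AE: "AE s in lebesgue_on {0<..<\<epsilon>}. norm (f s - v) \<le> e / 2"
    proof -
      have "AE s in lebesgue. 0 < s \<and> s < \<delta> \<longrightarrow> norm (f s - v) \<le> e / 2"
        using \<delta>(2) by (rule AE_completion)
      then have "AE s in lebesgue. s \<in> {0<..<\<epsilon>} \<longrightarrow> norm (f s - v) \<le> e / 2"
        by eventually_elim (use \<epsilon> in auto)
      then show ?thesis by (subst AE_restrict_space_iff) auto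
    qed
    have iv: "integrable (lebesgue_on {0<..<\<epsilon>}) (\<lambda>s. v)"
      by (rule finite_measure.integrable_const[OF fin])
    have ifv: "integrable (lebesgue_on {0<..<\<epsilon>}) (\<lambda>s. f s - v)"
      by (rule finite_measure.integrable_const_bound[OF fin AE borel_measurable_diff[OF meas borel_measurable_const]])
    then have if': "integrable (lebesgue_on {0<..<\<epsilon>}) f"
      using Bochner_Integration.integrable_add[OF ifv iv] by simp
    have "(LINT t|lebesgue_on {0<..<\<epsilon>}. f t) = (LINT t|lebesgue_on {0<..<\<epsilon>}. f t - v) + \<epsilon> *\<^sub>R v"
      using if' iv ms by (simp add: space_restrict_space)
    then have "(1/\<epsilon>) *\<^sub>R (LINT t|lebesgue_on {0<..<\<epsilon>}. f t) - v = (1/\<epsilon>) *\<^sub>R (LINT t|lebesgue_on {0<..<\<epsilon>}. f t - v)"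
      using \<epsilon> by (simp add: scaleR_add_right)
    moreover have "norm (LINT t|lebesgue_on {0<..<\<epsilon>}. f t - v) \<le> (LINT t|lebesgue_on {0<..<\<epsilon>}. norm (f t - v))"
      by (rule integral_norm_bound)
    moreover have "(LINT t|lebesgue_on {0<..<\<epsilon>}. norm (f t - v)) \<le> (LINT t|lebesgue_on {0<..<\<epsilon>}. e / 2)"
      by (rule integral_mono_AE[OF integrable_norm[OF ifv] finite_measure.integrable_const[OF fin] AE])
    moreover have "(LINT t|lebesgue_on {0<..<\<epsilon>}. e / 2) = \<epsilon> * (e / 2)"
      using ms by (simp add: space_restrict_space)
    ultimately have *: "(1/\<epsilon>) *\<^sub>R (LINT t|lebesgue_on {0<..<\<epsilon>}. f t) - v = (1/\<epsilon>) *\<^sub>R (LINT t|lebesgue_on {0<..<\<epsilon>}. f t - v)"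
      "norm (LINT t|lebesgue_on {0<..<\<epsilon>}. f t - v) \<le> \<epsilon> * (e/2)" by linarith+
    have "norm ((1/\<epsilon>) *\<^sub>R (LINT t|lebesgue_on {0<..<\<epsilon>}. f t) - v) \<le> e/2"
      unfolding *(1) using *(2) \<epsilon> by (simp add: divide_le_eq mult.commute)
    then show ?thesis using \<epsilon> \<open>e > 0\<close> by (simp add: dist_norm)
  qed
  then show "\<forall>\<^sub>F \<epsilon> in at_right 0. dist ((1/\<epsilon>) *\<^sub>R (LINT t|lebesgue_on {0<..<\<epsilon>}. f t)) v < e"
    using \<delta>(1) \<open>\<delta>0 > 0\<close> unfolding eventually_at_right_field by (intro exI[of _ "min \<delta> \<delta>0"]) auto
qed

text \<open>\<open>face_trace\<close> receives an outward normal and moves against it, whereas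
  \<open>ess_trace\<close> moves along its direction; hence the sign.\<close>

lemma face_trace_eqI:
  assumes "(\<lambda>s. g (x + s *\<^sub>R n)) \<in> borel_measurable (lebesgue_on {0<..<\<delta>})" "\<delta> > 0" "ess_trace n g x v"
  shows "face_trace (- n) g x = v"
proof -
  have "((\<lambda>\<epsilon>. (1/\<epsilon>) *\<^sub>R (LINT t|lebesgue_on {0<..<\<epsilon>}. g (x + t *\<^sub>R n))) \<longlongrightarrow> v) (at_right 0)"
    using assms by (intro average_tendsto_ess_limit) (auto simp: ess_trace_def)
  then show ?thesis unfolding face_trace_def by (intro tendsto_Lim) auto
qed

text \<open>The limit is taken along a sequence, which makes \<open>btrace\<close> Borel measurable without completion.\<close>

definition btrace :: "real^'n \<Rightarrow> (real^'n \<Rightarrow> real) \<Rightarrow> real^'n \<Rightarrow> real" where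
  "btrace n g x = lim (\<lambda>m. real (Suc m) * (LBINT s. indicator {0<..<1 / real (Suc m)} s * g (x + s *\<^sub>R n)))"

lemma btrace_measurable [measurable]:
  assumes [measurable]: "g \<in> borel_measurable borel" shows "btrace n g \<in> borel_measurable borel"
  unfolding btrace_def[abs_def] by measurable

lemma btrace_eqI:
  assumes [measurable]: "g \<in> borel_measurable borel" and "ess_trace n g x v"
  shows "btrace n g x = v"
proof -
  have meas: "(\<lambda>s. g (x + s *\<^sub>R n)) \<in> borel_measurable lborel" by measurable
  have "((\<lambda>\<epsilon>. (1/\<epsilon>) *\<^sub>R (LINT t|lebesgue_on {0<..<\<epsilon>}. g (x + t *\<^sub>R n))) \<longlongrightarrow> v) (at_right 0)"
    using assms(2) meas
    by (intro average_tendsto_ess_limit[of _ 1]) (auto simp: ess_trace_def intro!: measurable_restrict_space1 measurable_completion)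
  moreover have "filterlim (\<lambda>m. 1 / real (Suc m)) (at_right 0) sequentially"
    unfolding filterlim_at using LIMSEQ_inverse_real_of_nat by (auto simp: inverse_eq_divide)
  ultimately have "(\<lambda>m. (1 / (1 / real (Suc m))) *\<^sub>R (LINT t|lebesgue_on {0<..<1 / real (Suc m)}. g (x + t *\<^sub>R n))) \<longlonglongrightarrow> v"
    by (rule filterlim_compose)
  moreover have "(LINT t|lebesgue_on {0<..<1 / real (Suc m)}. g (x + t *\<^sub>R n))
      = (LBINT s. indicator {0<..<1 / real (Suc m)} s * g (x + s *\<^sub>R n))" for m
    by (subst integral_restrict_space) (auto simp: integral_completion)
  ultimately show ?thesis unfolding btrace_def by (intro limI) (simp add: mult.commute)
qed

section \<open>Integrals over thin strips\<close>

text \<open>A gains a factor from its thinness: translate it by r m, with r ranging over [0,1], and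
  integrate over r. A given point y is reached only for r in an interval of length w / (n \<bullet>
  m), because A has width w in direction n, while all the translates stay in A'.\<close>

lemma nn_integral_shear_le:
  fixes k :: "real^'n \<Rightarrow> ennreal"
  assumes [measurable]: "A \<in> sets borel" "A' \<in> sets borel" "k \<in> borel_measurable borel"
    and A: "\<And>z. z \<in> A \<Longrightarrow> c1 < n \<bullet> z \<and> n \<bullet> z < c1 + w" and m: "n \<bullet> m > 0" and "w \<ge> 0"
    and A': "\<And>z r. z \<in> A \<Longrightarrow> r \<in> {0..1} \<Longrightarrow> z + r *\<^sub>R m \<in> A'"
  shows "(\<integral>\<^sup>+r. indicator {0..1} r * (\<integral>\<^sup>+z. indicator A z * k (z + r *\<^sub>R m) \<partial>lborel) \<partial>lborel)
    \<le> ennreal (w / (n \<bullet> m)) * (\<integral>\<^sup>+y. indicator A' y * k y \<partial>lborel)"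
proof -
  have "(\<integral>\<^sup>+r. indicator {0..1} r * (\<integral>\<^sup>+z. indicator A z * k (z + r *\<^sub>R m) \<partial>lborel) \<partial>lborel)
      = (\<integral>\<^sup>+r. indicator {0..1::real} r * (\<integral>\<^sup>+y. indicator A (y - r *\<^sub>R m) * k y \<partial>lborel) \<partial>lborel)"
  proof (rule nn_integral_cong)
    fix r :: real
    have "(\<integral>\<^sup>+z. indicator A (z + r *\<^sub>R m - r *\<^sub>R m) * k (z + r *\<^sub>R m) \<partial>lborel) = (\<integral>\<^sup>+y. indicator A (y - r *\<^sub>R m) * k y \<partial>lborel)"
      by (rule nn_integral_translate[of "\<lambda>y. indicator A (y - r *\<^sub>R m) * k y"]) measurable
    then show "indicator {0..1} r * (\<integral>\<^sup>+z. indicator A z * k (z + r *\<^sub>R m) \<partial>lborel) = indicator {0..1} r * (\<integral>\<^sup>+y. indicator A (y - r *\<^sub>R m) * k y \<partial>lborel)"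
      by simp
  qed
  also have "\<dots> = (\<integral>\<^sup>+r. \<integral>\<^sup>+y. indicator {0..1::real} r * (indicator A (y - r *\<^sub>R m) * k y) \<partial>lborel \<partial>lborel)"
    by (subst nn_integral_cmult) auto
  also have "\<dots> = (\<integral>\<^sup>+y. \<integral>\<^sup>+r. indicator {0..1::real} r * (indicator A (y - r *\<^sub>R m) * k y) \<partial>lborel \<partial>lborel)"
    by (rule lborel_pair.Fubini') measurable
  also have "\<dots> \<le> (\<integral>\<^sup>+y. ennreal (w / (n \<bullet> m)) * (indicator A' y * k y) \<partial>lborel)"
  proof (rule nn_integral_mono)
    fix y :: "real^'n"
    define lo where "lo = (n \<bullet> y - c1 - w) / (n \<bullet> m)"
    define hi where "hi = (n \<bullet> y - c1) / (n \<bullet> m)"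
    have "hi - lo = w / (n \<bullet> m)" unfolding hi_def lo_def by (simp add: diff_divide_distrib)
    have "lo \<le> hi" using m \<open>w \<ge> 0\<close> unfolding hi_def lo_def by (simp add: divide_right_mono)
    have "indicator {0..1::real} r * (indicator A (y - r *\<^sub>R m) * k y) \<le> indicator {lo..hi} r * (indicator A' y * k y)" for r
    proof (cases "r \<in> {0..1} \<and> y - r *\<^sub>R m \<in> A")
      case True
      then have "y \<in> A'" using A'[of "y - r *\<^sub>R m" r] by simp
      moreover have "c1 < n \<bullet> y - r * (n \<bullet> m)" "n \<bullet> y - r * (n \<bullet> m) < c1 + w"
        using A[of "y - r *\<^sub>R m"] True by (simp_all add: inner_diff_right)
      then have "lo \<le> r" "r \<le> hi" using m by (simp_all add: lo_def hi_def field_simps)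
      ultimately show ?thesis by (auto simp: indicator_def)
    qed (auto simp: indicator_def)
    then have "(\<integral>\<^sup>+r. indicator {0..1::real} r * (indicator A (y - r *\<^sub>R m) * k y) \<partial>lborel)
        \<le> (\<integral>\<^sup>+r. indicator {lo..hi} r * (indicator A' y * k y) \<partial>lborel)"
      by (rule nn_integral_mono)
    also have "\<dots> = ennreal (hi - lo) * (indicator A' y * k y)"
      using \<open>lo \<le> hi\<close> by (subst nn_integral_multc) auto
    finally show "(\<integral>\<^sup>+r. indicator {0..1::real} r * (indicator A (y - r *\<^sub>R m) * k y) \<partial>lborel)
        \<le> ennreal (w / (n \<bullet> m)) * (indicator A' y * k y)"
      using \<open>hi - lo = w / (n \<bullet> m)\<close> by simp
  qed
  also have "\<dots> = ennreal (w / (n \<bullet> m)) * (\<integral>\<^sup>+y. indicator A' y * k y \<partial>lborel)"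
    by (rule nn_integral_cmult) measurable
  finally show ?thesis .
qed

lemma emeasure_shear_le:
  fixes A :: "(real^'n) set"
  assumes [measurable]: "A \<in> sets borel" "A' \<in> sets borel"
    and A: "\<And>z. z \<in> A \<Longrightarrow> c1 < n \<bullet> z \<and> n \<bullet> z < c1 + w" and m: "n \<bullet> m > 0" and "w \<ge> 0"
    and A': "\<And>z r. z \<in> A \<Longrightarrow> r \<in> {0..1} \<Longrightarrow> z + r *\<^sub>R m \<in> A'"
  shows "emeasure lborel A \<le> ennreal (w / (n \<bullet> m)) * emeasure lborel A'"
proof -
  have "emeasure lborel A = (\<integral>\<^sup>+r. indicator {0..1::real} r * (\<integral>\<^sup>+z. indicator A z * 1 \<partial>lborel) \<partial>lborel)"
    by (subst nn_integral_multc) auto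
  also have "\<dots> \<le> ennreal (w / (n \<bullet> m)) * (\<integral>\<^sup>+y. indicator A' y * 1 \<partial>lborel)"
    using nn_integral_shear_le[of A A' "\<lambda>_. 1" c1 n w m] assms by auto
  finally show ?thesis by simp
qed

text \<open>If the normals are not parallel, two shears gain a factor \<epsilon> each: the first
  along a direction tangent to the second hyperplane and transversal to the first one, the second
  along n'. If they are parallel, the distinct hyperplanes have a positive distance and thin strips
  are disjoint.\<close>

lemma emeasure_strip_intersection:
  fixes n n' :: "real^'n"
  assumes n: "norm n = 1" "norm n' = 1" and ne: "hyperplane n b \<noteq> hyperplane n' b'"
  shows "\<exists>C \<epsilon>0. C > 0 \<and> \<epsilon>0 > 0 \<and> (\<forall>\<epsilon>. 0 < \<epsilon> \<and> \<epsilon> < \<epsilon>0 \<longrightarrow>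
    emeasure lborel ({z. \<bar>n \<bullet> z - b\<bar> < \<epsilon>} \<inter> {z. \<bar>n' \<bullet> z - b'\<bar> < \<epsilon>} \<inter> cball 0 R) \<le> ennreal (C * \<epsilon>\<^sup>2))"
proof -
  define c where "c = n \<bullet> n'"
  have abs: "\<bar>c\<bar> \<le> 1" using Cauchy_Schwarz_ineq2[of n n'] n by (simp add: c_def)
  show ?thesis
  proof (cases "\<bar>c\<bar> = 1")
    case True
    have cc: "c * c = 1" using abs_mult_self_eq[of c] True by simp
    have "norm (n' - c *\<^sub>R n) ^ 2 = n' \<bullet> n' - 2 * c * (n \<bullet> n') + c * c * (n \<bullet> n)"
      by (simp add: power2_norm_eq_inner inner_diff_left inner_diff_right inner_commute[of n' n] algebra_simps)
    also have "\<dots> = 1 - 2 * (c * c) + c * c"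
      using unit_inner[OF n(1)] unit_inner[OF n(2)] by (simp add: c_def)
    also have "\<dots> = 0" by (simp add: cc)
    finally have n'c: "n' = c *\<^sub>R n" by simp
    have "b' \<noteq> c * b"
    proof
      assume "b' = c * b"
      then have "hyperplane n b = hyperplane n' b'"
        using True unfolding hyperplane_def n'c by auto
      then show False using ne by simp
    qed
    define \<epsilon>0 where "\<epsilon>0 = \<bar>b' - c * b\<bar> / 2"
    have "\<epsilon>0 > 0" using \<open>b' \<noteq> c * b\<close> by (simp add: \<epsilon>0_def)
    have empty: "{z. \<bar>n \<bullet> z - b\<bar> < \<epsilon>} \<inter> {z. \<bar>n' \<bullet> z - b'\<bar> < \<epsilon>} \<inter> cball 0 R = {}" if "\<epsilon> < \<epsilon>0" for \<epsilon>
    proof -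
      have False if z: "\<bar>n \<bullet> z - b\<bar> < \<epsilon>" "\<bar>n' \<bullet> z - b'\<bar> < \<epsilon>" for z
      proof -
        have "\<bar>c * (n \<bullet> z) - c * b\<bar> = \<bar>n \<bullet> z - b\<bar>"
          using True by (simp add: right_diff_distrib[symmetric] abs_mult)
        then have "\<bar>b' - c * b\<bar> < 2 * \<epsilon>" using z by (simp add: n'c)
        then show False using \<open>\<epsilon> < \<epsilon>0\<close> by (simp add: \<epsilon>0_def)
      qed
      then show ?thesis by auto
    qed
    show ?thesis using \<open>\<epsilon>0 > 0\<close> by (intro exI[of _ 1] exI[of _ \<epsilon>0]) (simp add: empty)
  next
    case False
    with abs have c1: "1 - c * c > 0" using abs_square_less_1[of c] by (simp add: power2_eq_square)
    \<comment> \<open>The component of n orthogonal to n': moving along it preserves the second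
      strip and crosses the first one.\<close>
    define m where "m = n - c *\<^sub>R n'"
    have nm: "n \<bullet> m = 1 - c * c" "n' \<bullet> m = 0"
      using unit_inner[OF n(1)] unit_inner[OF n(2)] by (simp_all add: m_def inner_diff_right c_def inner_commute[of n' n])
    define B where "B = measure lborel (cball 0 (\<bar>R\<bar> + norm m + norm n') :: (real^'n) set)"
    have fin: "emeasure lborel (cball 0 (\<bar>R\<bar> + norm m + norm n') :: (real^'n) set) = ennreal B"
      unfolding B_def by (rule emeasure_eq_ennreal_measure) (use emeasure_bounded_finite[OF bounded_cball] in \<open>auto simp: less_top[symmetric]\<close>)
    \<comment> \<open>The 4 is the product of the two widths 2 \<epsilon> without \<epsilon>^2, and
      B is the volume of the ball that contains all translates; adding 1 makes C positive.\<close>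
    define C where "C = 4 * B / (1 - c * c) + 1"
    have "B \<ge> 0" by (simp add: B_def)
    have "emeasure lborel ({z. \<bar>n \<bullet> z - b\<bar> < \<epsilon>} \<inter> {z. \<bar>n' \<bullet> z - b'\<bar> < \<epsilon>} \<inter> cball 0 R) \<le> ennreal (C * \<epsilon>\<^sup>2)"
      if \<epsilon>: "\<epsilon> > 0" for \<epsilon>
    proof -
      have "emeasure lborel ({z. \<bar>n \<bullet> z - b\<bar> < \<epsilon>} \<inter> {z. \<bar>n' \<bullet> z - b'\<bar> < \<epsilon>} \<inter> cball 0 R)
         \<le> ennreal (2 * \<epsilon> / (n \<bullet> m)) * emeasure lborel ({z. \<bar>n' \<bullet> z - b'\<bar> < \<epsilon>} \<inter> cball 0 (\<bar>R\<bar> + norm m))"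
      proof (rule emeasure_shear_le)
        fix z r assume z: "z \<in> {z. \<bar>n \<bullet> z - b\<bar> < \<epsilon>} \<inter> {z. \<bar>n' \<bullet> z - b'\<bar> < \<epsilon>} \<inter> cball 0 R" and r: "r \<in> {0..1::real}"
        have "norm (z + r *\<^sub>R m) \<le> norm z + \<bar>r\<bar> * norm m" by (metis norm_scaleR norm_triangle_ineq)
        also have "\<dots> \<le> \<bar>R\<bar> + norm m" using z r mult_right_mono[of "\<bar>r\<bar>" 1 "norm m"] by auto
        finally show "z + r *\<^sub>R m \<in> {z. \<bar>n' \<bullet> z - b'\<bar> < \<epsilon>} \<inter> cball 0 (\<bar>R\<bar> + norm m)"
          using z by (simp add: inner_add_right nm)
      next
        show "b - \<epsilon> < n \<bullet> z \<and> n \<bullet> z < b - \<epsilon> + 2 * \<epsilon>" if "z \<in> {z. \<bar>n \<bullet> z - b\<bar> < \<epsilon>} \<inter> {z. \<bar>n' \<bullet> z - b'\<bar> < \<epsilon>} \<inter> cball 0 R" for z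
          using that by auto
      qed (use \<epsilon> c1 in \<open>simp_all add: nm\<close>)
      also have "emeasure lborel ({z. \<bar>n' \<bullet> z - b'\<bar> < \<epsilon>} \<inter> cball 0 (\<bar>R\<bar> + norm m))
         \<le> ennreal (2 * \<epsilon> / (n' \<bullet> n')) * emeasure lborel (cball 0 (\<bar>R\<bar> + norm m + norm n') :: (real^'n) set)"
      proof (rule emeasure_shear_le)
        fix z r assume z: "z \<in> {z. \<bar>n' \<bullet> z - b'\<bar> < \<epsilon>} \<inter> cball 0 (\<bar>R\<bar> + norm m)" and r: "r \<in> {0..1::real}"
        have "norm (z + r *\<^sub>R n') \<le> norm z + \<bar>r\<bar> * norm n'" by (metis norm_scaleR norm_triangle_ineq)
        also have "\<dots> \<le> \<bar>R\<bar> + norm m + norm n'" using z r mult_right_mono[of "\<bar>r\<bar>" 1 "norm n'"] by auto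
        finally show "z + r *\<^sub>R n' \<in> cball 0 (\<bar>R\<bar> + norm m + norm n')" by simp
      next
        show "b' - \<epsilon> < n' \<bullet> z \<and> n' \<bullet> z < b' - \<epsilon> + 2 * \<epsilon>" if "z \<in> {z. \<bar>n' \<bullet> z - b'\<bar> < \<epsilon>} \<inter> cball 0 (\<bar>R\<bar> + norm m)" for z
          using that by auto
      qed (use \<epsilon> unit_inner[OF n(2)] in simp_all)
      also have "ennreal (2 * \<epsilon> / (n \<bullet> m)) * (ennreal (2 * \<epsilon> / (n' \<bullet> n')) * emeasure lborel (cball 0 (\<bar>R\<bar> + norm m + norm n') :: (real^'n) set))
         = ennreal (4 * B / (1 - c * c) * \<epsilon>\<^sup>2)"
        unfolding fin using \<epsilon> c1 \<open>B \<ge> 0\<close>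
        unfolding nm unit_inner[OF n(2)]
        by (simp add: ennreal_mult[symmetric] power2_eq_square mult_ac)
      also have "\<dots> \<le> ennreal (C * \<epsilon>\<^sup>2)" by (intro ennreal_leI mult_right_mono) (auto simp: C_def)
      finally show ?thesis by (simp add: mult_left_mono)
    qed
    moreover have "C > 0" using c1 \<open>B \<ge> 0\<close> by (simp add: C_def add_nonneg_pos)
    ultimately show ?thesis by (intro exI[of _ C] exI[of _ 1]) auto
  qed
qed

text \<open>
  Moving a point of a convex cell by \<open>c - x\<close>, where \<open>c\<close> is an inner point and \<open>x\<close> is near the point,
  stays in the cell; finitely many such translations suffice by compactness.
\<close>

lemma strip_integral_bound:
  assumes w: "borel_weak_gradient T g h" and T: "open T" "bounded T" and n: "norm n = 1"
    and C: "convex C" "open C" "C \<subseteq> T" "\<And>z. z \<in> C \<Longrightarrow> n \<bullet> z > b"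
  shows "\<exists>K \<epsilon>0. \<epsilon>0 > 0 \<and> (\<forall>\<epsilon>. 0 < \<epsilon> \<and> \<epsilon> < \<epsilon>0 \<longrightarrow>
    (\<integral>\<^sup>+z. indicator (C \<inter> {z. n \<bullet> z < b + \<epsilon>}) z * ennreal \<bar>g z\<bar> \<partial>lborel) \<le> ennreal (K * \<epsilon>))"
proof (cases "C = {}")
  case True then show ?thesis by (intro exI[of _ 0] exI[of _ 1]) auto
next
  case False
  note [measurable] = borel_weak_gradientD(1,2)[OF w]
  have [measurable]: "C \<in> sets borel" using C by auto
  have ig: "integrable lborel g" and ih: "integrable lborel h"
    using borel_weak_gradient_integrable[OF w T(2)] by auto
  from False obtain c where c: "c \<in> C" by auto
  define d0 where "d0 = n \<bullet> c - b"
  have "d0 > 0" using C(4)[OF c] by (simp add: d0_def)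
  obtain \<rho>0 where \<rho>0: "\<rho>0 > 0" "ball c \<rho>0 \<subseteq> C" using C c by (meson openE)
  \<comment> \<open>If the ball about x meets the strip, then with \<rho> and \<epsilon> at most
    d0/4 the translation c - x has normal component at least d0/2, so the shear is uniformly
    transversal.\<close>
  define \<rho> where "\<rho> = min \<rho>0 (d0/4)"
  have \<rho>: "\<rho> > 0" "\<rho> \<le> d0/4" "ball c \<rho> \<subseteq> C" using \<rho>0 \<open>d0 > 0\<close> by (auto simp: \<rho>_def)
  have "compact (closure C)" using bounded_subset[OF T(2) C(3)] by (simp add: compact_closure)
  moreover have "closure C \<subseteq> (\<Union>x\<in>closure C. ball x \<rho>)" using \<rho> by auto
  ultimately obtain X where X: "X \<subseteq> closure C" "finite X" "closure C \<subseteq> (\<Union>x\<in>X. ball x \<rho>)"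
    by (rule compactE_image[OF _ open_ball])
  define M where "M = (\<lambda>x. (\<integral>\<^sup>+y. ennreal (\<bar>g y\<bar> + \<bar>h y \<bullet> (c - x)\<bar>) \<partial>lborel))"
  have M: "M x < \<infinity>" for x
  proof -
    have "integrable lborel (\<lambda>y. \<bar>g y\<bar> + \<bar>h y \<bullet> (c - x)\<bar>)" using ig ih by auto
    then show ?thesis unfolding M_def by (simp add: integrable_iff_bounded)
  qed
  have piece: "(\<integral>\<^sup>+z. indicator (C \<inter> {z. n \<bullet> z < b + \<epsilon>} \<inter> ball x \<rho>) z * ennreal \<bar>g z\<bar> \<partial>lborel) \<le> ennreal (2 * \<epsilon> / d0) * M x"
    if \<epsilon>: "0 < \<epsilon>" "\<epsilon> < d0/4" for x \<epsilon>
  proof (cases "C \<inter> {z. n \<bullet> z < b + \<epsilon>} \<inter> ball x \<rho> = {}")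
    case True then show ?thesis by simp
  next
    case False
    define A where "A = C \<inter> {z. n \<bullet> z < b + \<epsilon>} \<inter> ball x \<rho>"
    have [measurable]: "A \<in> sets borel" unfolding A_def by auto
    define e where "e = c - x"
    obtain z0 where z0: "z0 \<in> A" using False unfolding A_def by blast
    have "\<bar>n \<bullet> (x - z0)\<bar> \<le> norm (x - z0)" using Cauchy_Schwarz_ineq2[of n "x - z0"] n by simp
    then have "n \<bullet> x < b + \<epsilon> + \<rho>" using z0 by (auto simp: A_def dist_norm inner_diff_right)
    then have ne: "n \<bullet> e \<ge> d0/2" using \<epsilon> \<rho> by (simp add: e_def inner_diff_right d0_def)
    \<comment> \<open>The point z + r e is a convex combination of z and c + (z - x); the latter
      lies in the ball of radius \<rho> about c.\<close>
    have inC: "z + r *\<^sub>R e \<in> C" if "z \<in> A" "r \<in> {0..1}" for z r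
    proof -
      have "z \<in> C" using that by (simp add: A_def)
      moreover have "c + (z - x) \<in> C"
        using that \<rho>(3) by (auto simp: A_def dist_norm norm_minus_commute subset_eq)
      ultimately have "(1 - r) *\<^sub>R z + r *\<^sub>R (c + (z - x)) \<in> C"
        using C(1) that(2) by (intro convexD) auto
      also have "(1 - r) *\<^sub>R z + r *\<^sub>R (c + (z - x)) = z + r *\<^sub>R e" by (simp add: e_def algebra_simps)
      finally show ?thesis .
    qed
    define J where "J = (\<lambda>z. \<integral>\<^sup>+q. indicator {0..1} q * ennreal \<bar>h (z + q *\<^sub>R e) \<bullet> e\<bar> \<partial>lborel)"
    have [measurable]: "J \<in> borel_measurable borel" unfolding J_def by measurable
    have pt: "AE z in lborel. indicator A z * ennreal \<bar>g z\<bar> \<le> indicator A z * ennreal \<bar>g (z + r *\<^sub>R e)\<bar> + indicator A z * J z"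
      if r: "r \<in> {0..1}" for r
      using weak_gradient_translation[OF w T, of "r *\<^sub>R e"]
    proof eventually_elim
      case (elim z)
      show ?case
      proof (cases "z \<in> A")
        case True
        have "z + q *\<^sub>R r *\<^sub>R e \<in> T" if "q \<in> {0..1}" for q
          using inC[OF True, of "q * r"] r that C(3) by (auto simp: mult_le_one)
        with elim have eq: "g (z + r *\<^sub>R e) - g z = (LBINT q. indicator {0..1} q * (h (z + q *\<^sub>R r *\<^sub>R e) \<bullet> (r *\<^sub>R e)))"
          by blast
        have "ennreal \<bar>g (z + r *\<^sub>R e) - g z\<bar> \<le> (\<integral>\<^sup>+q. ennreal (norm (indicator {0..1} q * (h (z + q *\<^sub>R r *\<^sub>R e) \<bullet> (r *\<^sub>R e)))) \<partial>lborel)"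
        proof (cases "integrable lborel (\<lambda>q. indicator {0..1} q * (h (z + q *\<^sub>R r *\<^sub>R e) \<bullet> (r *\<^sub>R e)))")
          case True
          then show ?thesis unfolding eq real_norm_def[symmetric] by (rule integral_norm_bound_ennreal)
        next
          \<comment> \<open>If the segment integral does not exist, its default value 0 equals the
            difference of g, and the bound is trivial.\<close>
          case False
          then show ?thesis unfolding eq by (simp add: not_integrable_integral_eq)
        qed
        also have "\<dots> \<le> J z"
        proof (cases "r = 0")
          case False
          then have "r > 0" using r by simp
          have "(\<integral>\<^sup>+q. ennreal (norm (indicator {0..1} q * (h (z + q *\<^sub>R r *\<^sub>R e) \<bullet> (r *\<^sub>R e)))) \<partial>lborel)
              = (\<integral>\<^sup>+q. ennreal r * (indicator {0..r} (0 + r * q) * ennreal \<bar>h (z + (0 + r * q) *\<^sub>R e) \<bullet> e\<bar>) \<partial>lborel)"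
          proof (rule nn_integral_cong)
            fix q
            have "0 + r * q \<in> {0..r} \<longleftrightarrow> q \<in> {0..1}" using \<open>r > 0\<close> by (auto simp: zero_le_mult_iff)
            then show "ennreal (norm (indicator {0..1} q * (h (z + q *\<^sub>R r *\<^sub>R e) \<bullet> (r *\<^sub>R e))))
               = ennreal r * (indicator {0..r} (0 + r * q) * ennreal \<bar>h (z + (0 + r * q) *\<^sub>R e) \<bullet> e\<bar>)"
              using \<open>r > 0\<close> by (auto simp: indicator_def abs_mult ennreal_mult mult.commute)
          qed
          also have "\<dots> = ennreal \<bar>r\<bar> * (\<integral>\<^sup>+q. indicator {0..r} (0 + r * q) * ennreal \<bar>h (z + (0 + r * q) *\<^sub>R e) \<bullet> e\<bar> \<partial>lborel)"
            using \<open>r > 0\<close> by (subst nn_integral_cmult) auto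
          also have "\<dots> = (\<integral>\<^sup>+q. indicator {0..r} q * ennreal \<bar>h (z + q *\<^sub>R e) \<bullet> e\<bar> \<partial>lborel)"
            by (rule nn_integral_real_affine[symmetric, where f="\<lambda>q. indicator {0..r} q * ennreal \<bar>h (z + q *\<^sub>R e) \<bullet> e\<bar>"])
              (use False in auto)
          also have "\<dots> \<le> J z" unfolding J_def
            using r by (intro nn_integral_mono mult_right_mono) (auto simp: indicator_def)
          finally show ?thesis .
        qed simp
        finally have "ennreal \<bar>g (z + r *\<^sub>R e) - g z\<bar> \<le> J z" .
        moreover have "ennreal \<bar>g z\<bar> \<le> ennreal \<bar>g (z + r *\<^sub>R e)\<bar> + ennreal \<bar>g (z + r *\<^sub>R e) - g z\<bar>"
          by (simp add: ennreal_plus[symmetric] del: ennreal_plus)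
        ultimately show ?thesis using True
          by (simp add: add_left_mono order_trans[OF _ add_left_mono])
      qed simp
    qed
    \<comment> \<open>This bound holds for every r; averaging it over r in [0,1] lets
      \<open>nn_integral_shear_le\<close> produce the factor \<epsilon> for both terms.\<close>
    have one: "(\<integral>\<^sup>+z. indicator A z * ennreal \<bar>g z\<bar> \<partial>lborel) \<le>
       (\<integral>\<^sup>+z. indicator A z * ennreal \<bar>g (z + r *\<^sub>R e)\<bar> \<partial>lborel) + (\<integral>\<^sup>+z. indicator A z * J z \<partial>lborel)" if "r \<in> {0..1}" for r
      using nn_integral_mono_AE[OF pt[OF that]] by (subst (asm) nn_integral_add) auto
    have "(\<integral>\<^sup>+z. indicator A z * ennreal \<bar>g z\<bar> \<partial>lborel)
       = (\<integral>\<^sup>+r. indicator {0..1::real} r * (\<integral>\<^sup>+z. indicator A z * ennreal \<bar>g z\<bar> \<partial>lborel) \<partial>lborel)"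
      by (subst nn_integral_multc) auto
    also have "\<dots> \<le> (\<integral>\<^sup>+r. indicator {0..1::real} r * (\<integral>\<^sup>+z. indicator A z * ennreal \<bar>g (z + r *\<^sub>R e)\<bar> \<partial>lborel) +
        indicator {0..1::real} r * (\<integral>\<^sup>+z. indicator A z * J z \<partial>lborel) \<partial>lborel)"
      using one by (intro nn_integral_mono) (auto simp: indicator_def)
    also have "\<dots> = (\<integral>\<^sup>+r. indicator {0..1::real} r * (\<integral>\<^sup>+z. indicator A z * ennreal \<bar>g (z + r *\<^sub>R e)\<bar> \<partial>lborel) \<partial>lborel) +
        (\<integral>\<^sup>+z. indicator A z * J z \<partial>lborel)"
      by (subst nn_integral_add) (auto simp: nn_integral_multc)
    also have "(\<integral>\<^sup>+z. indicator A z * J z \<partial>lborel) =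
        (\<integral>\<^sup>+z. \<integral>\<^sup>+q. indicator A z * (indicator {0..1::real} q * ennreal \<bar>h (z + q *\<^sub>R e) \<bullet> e\<bar>) \<partial>lborel \<partial>lborel)"
      unfolding J_def by (subst nn_integral_cmult) auto
    also have "\<dots> = (\<integral>\<^sup>+q. \<integral>\<^sup>+z. indicator A z * (indicator {0..1::real} q * ennreal \<bar>h (z + q *\<^sub>R e) \<bullet> e\<bar>) \<partial>lborel \<partial>lborel)"
      by (rule lborel_pair.Fubini'[symmetric]) measurable
    also have "\<dots> = (\<integral>\<^sup>+q. indicator {0..1::real} q * (\<integral>\<^sup>+z. indicator A z * ennreal \<bar>h (z + q *\<^sub>R e) \<bullet> e\<bar> \<partial>lborel) \<partial>lborel)"
      by (intro nn_integral_cong) (auto simp: indicator_def)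
    also have "(\<integral>\<^sup>+r. indicator {0..1::real} r * (\<integral>\<^sup>+z. indicator A z * ennreal \<bar>g (z + r *\<^sub>R e)\<bar> \<partial>lborel) \<partial>lborel) + \<dots>
       = (\<integral>\<^sup>+r. indicator {0..1::real} r * (\<integral>\<^sup>+z. indicator A z * ennreal (\<bar>g (z + r *\<^sub>R e)\<bar> + \<bar>h (z + r *\<^sub>R e) \<bullet> e\<bar>) \<partial>lborel) \<partial>lborel)"
      by (simp add: nn_integral_add[symmetric] distrib_left[symmetric])
    also have "\<dots> \<le> ennreal (\<epsilon> / (n \<bullet> e)) * (\<integral>\<^sup>+y. indicator UNIV y * ennreal (\<bar>g y\<bar> + \<bar>h y \<bullet> e\<bar>) \<partial>lborel)"
      by (rule nn_integral_shear_le[of A UNIV "\<lambda>y. ennreal (\<bar>g y\<bar> + \<bar>h y \<bullet> e\<bar>)" b])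
        (use C(4) ne \<open>d0 > 0\<close> \<epsilon> in \<open>auto simp: A_def\<close>)
    also have "\<dots> = ennreal (\<epsilon> / (n \<bullet> e)) * M x" by (simp add: M_def e_def)
    also have "\<dots> \<le> ennreal (2 * \<epsilon> / d0) * M x"
      using ne \<epsilon> \<open>d0 > 0\<close> by (intro mult_right_mono ennreal_leI) (auto simp: field_simps)
    finally show ?thesis by (simp add: A_def)
  qed
  define K where "K = (\<Sum>x\<in>X. 2 / d0 * enn2real (M x))"
  have "(\<integral>\<^sup>+z. indicator (C \<inter> {z. n \<bullet> z < b + \<epsilon>}) z * ennreal \<bar>g z\<bar> \<partial>lborel) \<le> ennreal (K * \<epsilon>)"
    if \<epsilon>: "0 < \<epsilon>" "\<epsilon> < d0/4" for \<epsilon>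
  proof -
    have "(\<integral>\<^sup>+z. indicator (C \<inter> {z. n \<bullet> z < b + \<epsilon>}) z * ennreal \<bar>g z\<bar> \<partial>lborel)
       \<le> (\<integral>\<^sup>+z. (\<Sum>x\<in>X. indicator (C \<inter> {z. n \<bullet> z < b + \<epsilon>} \<inter> ball x \<rho>) z * ennreal \<bar>g z\<bar>) \<partial>lborel)"
    proof (rule nn_integral_mono)
      fix z
      show "indicator (C \<inter> {z. n \<bullet> z < b + \<epsilon>}) z * ennreal \<bar>g z\<bar> \<le> (\<Sum>x\<in>X. indicator (C \<inter> {z. n \<bullet> z < b + \<epsilon>} \<inter> ball x \<rho>) z * ennreal \<bar>g z\<bar>)"
      proof (cases "z \<in> C \<inter> {z. n \<bullet> z < b + \<epsilon>}")
        case True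
        then obtain x where x: "x \<in> X" "z \<in> ball x \<rho>" using X(3) closure_subset[of C] by blast
        have "indicator (C \<inter> {z. n \<bullet> z < b + \<epsilon>} \<inter> ball x \<rho>) z * ennreal \<bar>g z\<bar> \<le> (\<Sum>x\<in>X. indicator (C \<inter> {z. n \<bullet> z < b + \<epsilon>} \<inter> ball x \<rho>) z * ennreal \<bar>g z\<bar>)"
          by (rule member_le_sum) (use X x in auto)
        then show ?thesis using True x by simp
      qed simp
    qed
    also have "\<dots> = (\<Sum>x\<in>X. \<integral>\<^sup>+z. indicator (C \<inter> {z. n \<bullet> z < b + \<epsilon>} \<inter> ball x \<rho>) z * ennreal \<bar>g z\<bar> \<partial>lborel)"
      by (rule nn_integral_sum) (intro borel_measurable_times_ennreal borel_measurable_indicator, auto)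
    also have "\<dots> \<le> (\<Sum>x\<in>X. ennreal (2 * \<epsilon> / d0) * M x)"
      by (intro sum_mono piece \<epsilon>)
    also have "\<dots> = (\<Sum>x\<in>X. ennreal (2 / d0 * enn2real (M x) * \<epsilon>))"
    proof (rule sum.cong[OF refl])
      fix x
      have Mx: "M x = ennreal (enn2real (M x))" using M[of x] by simp
      then show "ennreal (2 * \<epsilon> / d0) * M x = ennreal (2 / d0 * enn2real (M x) * \<epsilon>)"
        using \<epsilon> \<open>d0 > 0\<close> by (subst Mx, subst ennreal_mult[symmetric]) (auto simp: mult_ac)
    qed
    also have "\<dots> = ennreal (K * \<epsilon>)"
      using \<epsilon> \<open>d0 > 0\<close> by (simp add: K_def sum_distrib_right sum_ennreal)
    finally show ?thesis .
  qed
  then show ?thesis using \<open>d0 > 0\<close> by (intro exI[of _ K] exI[of _ "d0/4"]) auto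
qed

section \<open>Polyhedral sets bounded by finitely many hyperplanes\<close>

text \<open>T may be non-convex, and a hyperplane may also pass through its interior. Distinct
  indices carry distinct hyperplanes, so that different strips overlap little. The condition
  \<open>interior (closure T) = T\<close> excludes slits, across which the traces from the two sides
  could differ.\<close>

locale polyhedral_set =
  fixes T :: "(real^'n) set" and J :: "'j set" and nv :: "'j \<Rightarrow> real^'n" and bv :: "'j \<Rightarrow> real"
  assumes open_T: "open T" and bounded_T: "bounded T" and regular_T: "interior (closure T) = T"
    and finite_J: "finite J" and unit_nv: "\<And>j. j \<in> J \<Longrightarrow> norm (nv j) = 1"
    and distinct_hyperplanes: "\<And>j k. j \<in> J \<Longrightarrow> k \<in> J \<Longrightarrow> j \<noteq> k \<Longrightarrow> hyperplane (nv j) (bv j) \<noteq> hyperplane (nv k) (bv k)"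
    and frontier_T: "frontier T \<subseteq> (\<Union>j\<in>J. hyperplane (nv j) (bv j))"
begin

lemma T_borel [measurable]: "T \<in> sets borel"
  using open_T by auto

text \<open>The frontier lies on the hyperplanes, so a connected set that avoids them cannot leave
  T.\<close>

lemma connected_off_hyperplanes:
  assumes "connected C" "\<And>z k. z \<in> C \<Longrightarrow> k \<in> J \<Longrightarrow> nv k \<bullet> z \<noteq> bv k" "z \<in> C" "z \<in> T"
  shows "C \<subseteq> T"
proof -
  have "C \<inter> frontier T = {}" using frontier_T assms(2) by (fastforce simp: hyperplane_def)
  then show ?thesis using connected_Int_frontier[OF assms(1), of T] assms(3,4) by blast
qed

text \<open>S lists the hyperplanes on whose positive side the cell lies. These cells are open and
  convex, and each nonempty one is either contained in T or disjoint from it, so they provide a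
  convex decomposition of T up to a null set.\<close>

definition arrangement_cell :: "'j set \<Rightarrow> (real^'n) set" where
  "arrangement_cell S = (\<Inter>k\<in>S. {z. nv k \<bullet> z > bv k}) \<inter> (\<Inter>k\<in>J - S. {z. nv k \<bullet> z < bv k})"

lemma arrangement_cell_convex: "convex (arrangement_cell S)"
  unfolding arrangement_cell_def
  by (intro convex_Int convex_INT) (simp_all add: convex_halfspace_lt convex_halfspace_gt)

lemma arrangement_cell_open: "S \<subseteq> J \<Longrightarrow> open (arrangement_cell S)"
  unfolding arrangement_cell_def using finite_J finite_subset[of S J]
  by (intro open_Int open_INT) (auto simp: open_halfspace_lt open_halfspace_gt)

lemma arrangement_cell_off: "S \<subseteq> J \<Longrightarrow> z \<in> arrangement_cell S \<Longrightarrow> k \<in> J \<Longrightarrow> nv k \<bullet> z \<noteq> bv k"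
  unfolding arrangement_cell_def by (cases "k \<in> S") force+

lemma mem_arrangement_cell:
  assumes "\<And>k. k \<in> J \<Longrightarrow> nv k \<bullet> z \<noteq> bv k"
  shows "z \<in> arrangement_cell {k\<in>J. nv k \<bullet> z > bv k}"
  using assms by (force simp: arrangement_cell_def)

end

text \<open>Both orientations of hyperplane j are covered, since T may lie on either side of it, or
  on both.\<close>

locale polyhedral_side = polyhedral_set T J nv bv
  for T :: "(real^'n) set" and J :: "'j set" and nv :: "'j \<Rightarrow> real^'n" and bv :: "'j \<Rightarrow> real" +
  fixes j :: 'j and n :: "real^'n" and b :: real and g :: "real^'n \<Rightarrow> real" and h :: "real^'n \<Rightarrow> real^'n"
  assumes j: "j \<in> J" and oriented: "n = nv j \<and> b = bv j \<or> n = - nv j \<and> b = - bv j"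
    and weak: "borel_weak_gradient T g h"
begin

lemma unit_n: "norm n = 1"
  using oriented unit_nv[OF j] by auto

lemmas [simp] = unit_inner[OF unit_n]

lemma g_measurable [measurable]: "g \<in> borel_measurable borel"
  and h_measurable [measurable]: "h \<in> borel_measurable borel"
  using borel_weak_gradientD(1,2)[OF weak] .

lemma integrable_g: "integrable lborel g" and integrable_h: "integrable lborel h"
  using borel_weak_gradient_integrable[OF weak bounded_T] .

lemma side_j: "n \<bullet> z = b \<longleftrightarrow> nv j \<bullet> z = bv j"
  using oriented by auto

text \<open>The factor 2 leaves room to move: for \<delta> > 0, on the normal segment above a clear
  point the other hyperplanes are avoided up to height 2 \<delta>, and up to height \<delta> they
  stay at distance at least \<delta>, where the cut-offs at scale \<delta> equal 1.\<close>

definition clear :: "real \<Rightarrow> (real^'n) set" where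
  "clear \<delta> = {x. \<forall>k\<in>J - {j}. 2 * \<delta> \<le> \<bar>nv k \<bullet> x - bv k\<bar>}"

text \<open>The point at height \<delta>/2 represents the whole open segment of length 2 \<delta>,
  see \<open>segment_T_iff\<close>; testing a single point makes the set obviously Borel.\<close>

definition side_at :: "real \<Rightarrow> (real^'n) set" where
  "side_at \<delta> = {x. n \<bullet> x = b \<and> x \<in> clear \<delta> \<and> x + (\<delta>/2) *\<^sub>R n \<in> T}"

definition side :: "(real^'n) set" where
  "side = (\<Union>m. side_at (1 / real (Suc m)))"

lemma clear_borel [measurable]: "clear \<delta> \<in> sets borel"
proof -
  have "clear \<delta> = (\<Inter>k\<in>J - {j}. {x. 2 * \<delta> \<le> \<bar>nv k \<bullet> x - bv k\<bar>})" by (auto simp: clear_def)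
  also have "closed \<dots>"
    by (intro closed_INT ballI closed_Collect_le continuous_intros)
  finally show ?thesis by auto
qed

lemma side_at_borel [measurable]: "side_at \<delta> \<in> sets borel"
  unfolding side_at_def by measurable

lemma side_borel [measurable]: "side \<in> sets borel"
  unfolding side_def by measurable

lemma clear_shift:
  assumes "x \<in> clear \<delta>" "k \<in> J" "k \<noteq> j" "0 \<le> s"
  shows "2 * \<delta> - s \<le> \<bar>nv k \<bullet> (x + s *\<^sub>R n) - bv k\<bar>"
proof -
  have "2 * \<delta> \<le> \<bar>nv k \<bullet> x - bv k\<bar>" using assms by (auto simp: clear_def)
  moreover have "\<bar>nv k \<bullet> n\<bar> \<le> 1" using Cauchy_Schwarz_ineq2[of "nv k" n] unit_n unit_nv[OF assms(2)] by simp
  then have "\<bar>s * (nv k \<bullet> n)\<bar> \<le> s" using assms(4) by (simp add: abs_mult mult_left_le)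
  ultimately show ?thesis by (simp add: inner_add_right)
qed

lemma segment_off:
  assumes "n \<bullet> x = b" "x \<in> clear \<delta>" "0 < s" "s < 2 * \<delta>" "k \<in> J"
  shows "nv k \<bullet> (x + s *\<^sub>R n) \<noteq> bv k"
proof (cases "k = j")
  case True
  have "n \<bullet> (x + s *\<^sub>R n) \<noteq> b" using assms by (simp add: inner_add_right)
  then show ?thesis using side_j True by simp
next
  case False
  then show ?thesis using clear_shift[OF assms(2,5), of s] assms by auto
qed

lemma segment_T_iff:
  assumes "n \<bullet> x = b" "x \<in> clear \<delta>" "0 < s" "s < 2 * \<delta>"
  shows "x + s *\<^sub>R n \<in> T \<longleftrightarrow> x \<in> side_at \<delta>"
proof -
  define C where "C = (\<lambda>s. x + s *\<^sub>R n) ` {0<..<2*\<delta>}"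
  have "connected C" unfolding C_def by (intro connected_continuous_image continuous_intros) auto
  moreover have "nv k \<bullet> z \<noteq> bv k" if "z \<in> C" "k \<in> J" for z k
    using that segment_off[OF assms(1,2)] by (auto simp: C_def)
  ultimately have "C \<subseteq> T" if "z \<in> C" "z \<in> T" for z using connected_off_hyperplanes[of C z] that by blast
  moreover have "x + s *\<^sub>R n \<in> C" "x + (\<delta>/2) *\<^sub>R n \<in> C" using assms unfolding C_def by (auto intro!: imageI)
  ultimately have "x + s *\<^sub>R n \<in> T \<longleftrightarrow> x + (\<delta>/2) *\<^sub>R n \<in> T" by blast
  then show ?thesis using assms by (simp add: side_at_def)
qed

lemma side_atD:
  assumes "x \<in> side_at \<delta>"
  shows "n \<bullet> x = b" "x \<in> clear \<delta>" "0 < s \<Longrightarrow> s < 2 * \<delta> \<Longrightarrow> x + s *\<^sub>R n \<in> T"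
  using assms segment_T_iff[of x \<delta> s] by (auto simp: side_at_def)

lemma side_at_mono:
  assumes "0 < \<delta>'" "\<delta>' \<le> \<delta>" shows "side_at \<delta> \<subseteq> side_at \<delta>'"
proof
  fix x assume x: "x \<in> side_at \<delta>"
  have "x \<in> clear \<delta>'" using side_atD(2)[OF x] assms by (force simp: clear_def)
  moreover have "x + (\<delta>'/2) *\<^sub>R n \<in> T" using side_atD(3)[OF x, of "\<delta>'/2"] assms by simp
  ultimately show "x \<in> side_at \<delta>'" using side_atD(1)[OF x] by (simp add: side_at_def)
qed

lemma side_iff: "x \<in> side \<longleftrightarrow> (\<exists>\<delta>>0. x \<in> side_at \<delta>)"
proof
  assume "\<exists>\<delta>>0. x \<in> side_at \<delta>"
  then obtain \<delta> where "\<delta> > 0" "x \<in> side_at \<delta>" by blast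
  moreover obtain m where "1 / real (Suc m) < \<delta>" using nat_approx_posE[OF \<open>\<delta> > 0\<close>] by blast
  ultimately have "x \<in> side_at (1 / real (Suc m))" using side_at_mono[of "1 / real (Suc m)" \<delta>] by auto
  then show "x \<in> side" by (auto simp: side_def)
next
  assume "x \<in> side"
  then obtain m where "x \<in> side_at (1 / real (Suc m))" by (auto simp: side_def)
  then show "\<exists>\<delta>>0. x \<in> side_at \<delta>" by (intro exI[of _ "1 / real (Suc m)"]) auto
qed

text \<open>The hyperplanes other than j are finitely many and miss x, so they keep a positive
  distance from it; this yields one \<delta> for all of them. In this form \<open>side\<close> is
  recognised as a \<open>half_side\<close> later.\<close>

lemma side_characterization:
  "x \<in> side \<longleftrightarrow> n \<bullet> x = b \<and> (\<forall>k\<in>J - {j}. nv k \<bullet> x \<noteq> bv k) \<and> (\<exists>\<delta>>0. \<forall>s. 0 < s \<and> s < \<delta> \<longrightarrow> x + s *\<^sub>R n \<in> T)"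
proof
  assume "x \<in> side"
  then obtain \<delta> where "\<delta> > 0" "x \<in> side_at \<delta>" using side_iff by blast
  then show "n \<bullet> x = b \<and> (\<forall>k\<in>J - {j}. nv k \<bullet> x \<noteq> bv k) \<and> (\<exists>\<delta>>0. \<forall>s. 0 < s \<and> s < \<delta> \<longrightarrow> x + s *\<^sub>R n \<in> T)"
  proof (intro conjI ballI)
    show "n \<bullet> x = b" using \<open>x \<in> side_at \<delta>\<close> by (rule side_atD)
    show "nv k \<bullet> x \<noteq> bv k" if "k \<in> J - {j}" for k
    proof -
      have "2 * \<delta> \<le> \<bar>nv k \<bullet> x - bv k\<bar>"
        using side_atD(2)[OF \<open>x \<in> side_at \<delta>\<close>] that unfolding clear_def by blast
      then show ?thesis using \<open>\<delta> > 0\<close> by auto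
    qed
    show "\<exists>\<delta>>0. \<forall>s. 0 < s \<and> s < \<delta> \<longrightarrow> x + s *\<^sub>R n \<in> T"
    proof (intro exI[of _ \<delta>] conjI allI impI)
      fix s assume "0 < s \<and> s < \<delta>"
      then show "x + s *\<^sub>R n \<in> T" by (intro side_atD(3)[OF \<open>x \<in> side_at \<delta>\<close>]) auto
    qed fact
  qed
next
  assume R: "n \<bullet> x = b \<and> (\<forall>k\<in>J - {j}. nv k \<bullet> x \<noteq> bv k) \<and> (\<exists>\<delta>>0. \<forall>s. 0 < s \<and> s < \<delta> \<longrightarrow> x + s *\<^sub>R n \<in> T)"
  then obtain \<delta> where \<delta>: "\<delta> > 0" "\<And>s. 0 < s \<Longrightarrow> s < \<delta> \<Longrightarrow> x + s *\<^sub>R n \<in> T" by blast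
  have "\<exists>r>0. \<forall>k\<in>J - {j}. r \<le> \<bar>nv k \<bullet> x - bv k\<bar>"
  proof (cases "J - {j} = {}")
    case True show ?thesis unfolding True by (intro exI[of _ 1]) simp
  next
    case False
    define r where "r = Min ((\<lambda>k. \<bar>nv k \<bullet> x - bv k\<bar>) ` (J - {j}))"
    have "r > 0" unfolding r_def using False finite_J R by (subst Min_gr_iff) auto
    moreover have "r \<le> \<bar>nv k \<bullet> x - bv k\<bar>" if "k \<in> J - {j}" for k
      unfolding r_def using that finite_J by (intro Min_le) auto
    ultimately show ?thesis by blast
  qed
  then obtain r where r: "r > 0" "\<And>k. k \<in> J - {j} \<Longrightarrow> r \<le> \<bar>nv k \<bullet> x - bv k\<bar>" by blast
  define d where "d = min (r/2) \<delta>"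
  have "d > 0" "2 * d \<le> r" "d \<le> \<delta>" using r(1) \<delta>(1) by (auto simp: d_def)
  then have "x \<in> side_at d"
    unfolding side_at_def clear_def mem_Collect_eq
  proof (intro conjI ballI)
    show "2 * d \<le> \<bar>nv k \<bullet> x - bv k\<bar>" if "k \<in> J - {j}" for k
      using r(2)[OF that] \<open>2 * d \<le> r\<close> by linarith
    show "x + (d/2) *\<^sub>R n \<in> T" using \<open>d > 0\<close> \<open>d \<le> \<delta>\<close> by (intro \<delta>(2)) auto
  qed (use R in blast)
  then show "x \<in> side" using \<open>d > 0\<close> side_iff by blast
qed

lemma line_integrable: "AE x in hmeas n b. integrable lborel (\<lambda>s. h (x + s *\<^sub>R n) \<bullet> n)"
  by (rule normal_Fubini(1)[OF unit_n, of "\<lambda>z. h z \<bullet> n"]) (use integrable_h in auto)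

text \<open>For lines that start at the hyperplane, the constant in the representation by a
  primitive is the essential limit at the foot point, hence the trace itself.\<close>

lemma trace_on_side_at:
  assumes "\<delta> > 0"
  shows "AE x in hmeas n b. x \<in> side_at \<delta> \<longrightarrow> ess_trace n g x (btrace n g x) \<and>
     (AE s in lborel. 0 < s \<and> s < 2 * \<delta> \<longrightarrow>
        g (x + s *\<^sub>R n) = btrace n g x + (LBINT q. indicator {0..s} q * (h (x + q *\<^sub>R n) \<bullet> n)))"
proof -
  have "AE x in hmeas n b. x \<in> side_at \<delta> \<longrightarrow> (\<exists>v. AE s in lborel. 0 < s \<and> s < 2 * \<delta> \<longrightarrow>
      g (x + s *\<^sub>R n) = v + (LBINT q. indicator {0..s} q * (h (x + q *\<^sub>R n) \<bullet> n)))"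
  proof (rule weak_gradient_on_normals[OF weak open_T bounded_T unit_n side_at_borel])
    show "x + s *\<^sub>R n \<in> T" if "x \<in> side_at \<delta>" "0 < s" "s < 2 * \<delta>" for x s
      using side_atD(3) that by blast
    show "0 < 2 * \<delta>" using assms by simp
  qed
  with line_integrable show ?thesis
  proof eventually_elim
    case (elim x)
    show ?case
    proof
      assume "x \<in> side_at \<delta>"
      with elim(2) obtain v where v: "AE s in lborel. 0 < s \<and> s < 2 * \<delta> \<longrightarrow>
        g (x + s *\<^sub>R n) = v + (LBINT q. indicator {0..s} q * (h (x + q *\<^sub>R n) \<bullet> n))" by blast
      have "ess_trace n g x (v + (LBINT q. indicator {0..0} q * (h (x + q *\<^sub>R n) \<bullet> n)))"
        by (rule ess_trace_of_primitive(1)[OF elim(1) _ _ v]) (use assms in auto)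
      moreover have "(LBINT q. indicator {0..0} q * (h (x + q *\<^sub>R n) \<bullet> n)) = 0"
      proof (rule integral_eq_zero_AE)
        show "AE q in lborel. indicator {0..0} q * (h (x + q *\<^sub>R n) \<bullet> n) = 0"
          using AE_lborel_singleton[of "0::real"] by eventually_elim auto
      qed
      ultimately have e: "ess_trace n g x v" by simp
      have "btrace n g x = v" by (rule btrace_eqI[OF g_measurable e])
      with e v show "ess_trace n g x (btrace n g x) \<and>
        (AE s in lborel. 0 < s \<and> s < 2 * \<delta> \<longrightarrow>
        g (x + s *\<^sub>R n) = btrace n g x + (LBINT q. indicator {0..s} q * (h (x + q *\<^sub>R n) \<bullet> n)))"
        by simp
    qed
  qed
qed

lemma trace_on_side: "AE x in hmeas n b. x \<in> side \<longrightarrow> ess_trace n g x (btrace n g x)"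
proof -
  have "AE x in hmeas n b. \<forall>m. x \<in> side_at (1 / real (Suc m)) \<longrightarrow> ess_trace n g x (btrace n g x)"
    unfolding AE_all_countable
  proof
    fix m
    show "AE x in hmeas n b. x \<in> side_at (1 / real (Suc m)) \<longrightarrow> ess_trace n g x (btrace n g x)"
    proof -
      have "1 / real (Suc m) > 0" by simp
      from trace_on_side_at[OF this] show ?thesis by eventually_elim blast
    qed
  qed
  then show ?thesis by eventually_elim (unfold side_def, blast)
qed

lemma primitive_bound:
  assumes "integrable lborel (\<lambda>s. h (x + s *\<^sub>R n) \<bullet> n)" "s \<le> \<epsilon>"
  shows "\<bar>LINT q|lborel. indicator {0..s} q * (h (x + q *\<^sub>R n) \<bullet> n)\<bar> \<le> (LBINT q. indicator {0..\<epsilon>} q * \<bar>h (x + q *\<^sub>R n) \<bullet> n\<bar>)"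
proof (rule integral_abs_bound_integral)
  show "integrable lborel (\<lambda>q. indicator {0..s} q * (h (x + q *\<^sub>R n) \<bullet> n))"
    using integrable_mult_indicator[OF _ assms(1), of "{0..s}"] by simp
  show "integrable lborel (\<lambda>q. indicator {0..\<epsilon>} q * \<bar>h (x + q *\<^sub>R n) \<bullet> n\<bar>)"
    using integrable_mult_indicator[OF _ integrable_abs[OF assms(1)], of "{0..\<epsilon>}"] by simp
qed (use assms(2) in \<open>auto simp: indicator_def\<close>)

text \<open>Each point of the layer lies in a cell of the arrangement that is contained in T and
  lies on the positive side of the hyperplane. There are finitely many such cells and all are
  convex, so \<open>strip_integral_bound\<close> can be summed over them.\<close>

lemma layer_bound:
  "\<exists>K \<epsilon>0. \<epsilon>0 > 0 \<and> (\<forall>\<delta>. 0 < \<delta> \<and> \<delta> < \<epsilon>0 \<longrightarrow>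
     (\<integral>\<^sup>+z. indicator {z. hproj n b z \<in> side_at \<delta> \<and> b < n \<bullet> z \<and> n \<bullet> z < b + \<delta>} z * ennreal \<bar>g z\<bar> \<partial>lborel) \<le> ennreal (K * \<delta>))"
proof -
  define \<S> where "\<S> = {S. S \<subseteq> J \<and> arrangement_cell S \<subseteq> T \<and> (\<forall>z\<in>arrangement_cell S. n \<bullet> z > b)}"
  have fin: "finite \<S>" unfolding \<S>_def by (rule finite_subset[of _ "Pow J"]) (use finite_J in auto)
  have "\<forall>S\<in>\<S>. \<exists>K \<epsilon>0. \<epsilon>0 > 0 \<and> (\<forall>\<epsilon>. 0 < \<epsilon> \<and> \<epsilon> < \<epsilon>0 \<longrightarrow>
    (\<integral>\<^sup>+z. indicator (arrangement_cell S \<inter> {z. n \<bullet> z < b + \<epsilon>}) z * ennreal \<bar>g z\<bar> \<partial>lborel) \<le> ennreal (K * \<epsilon>))"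
  proof
    fix S assume "S \<in> \<S>"
    then show "\<exists>K \<epsilon>0. \<epsilon>0 > 0 \<and> (\<forall>\<epsilon>. 0 < \<epsilon> \<and> \<epsilon> < \<epsilon>0 \<longrightarrow>
      (\<integral>\<^sup>+z. indicator (arrangement_cell S \<inter> {z. n \<bullet> z < b + \<epsilon>}) z * ennreal \<bar>g z\<bar> \<partial>lborel) \<le> ennreal (K * \<epsilon>))"
      unfolding \<S>_def mem_Collect_eq
      by (intro strip_integral_bound[OF weak open_T bounded_T unit_n arrangement_cell_convex arrangement_cell_open]) blast+
  qed
  from bchoice[OF this] obtain K where K: "\<forall>S\<in>\<S>. \<exists>\<epsilon>0. \<epsilon>0 > 0 \<and> (\<forall>\<epsilon>. 0 < \<epsilon> \<and> \<epsilon> < \<epsilon>0 \<longrightarrow>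
    (\<integral>\<^sup>+z. indicator (arrangement_cell S \<inter> {z. n \<bullet> z < b + \<epsilon>}) z * ennreal \<bar>g z\<bar> \<partial>lborel) \<le> ennreal (K S * \<epsilon>))" ..
  from bchoice[OF K] obtain e where e: "\<forall>S\<in>\<S>. e S > 0 \<and> (\<forall>\<epsilon>. 0 < \<epsilon> \<and> \<epsilon> < e S \<longrightarrow>
    (\<integral>\<^sup>+z. indicator (arrangement_cell S \<inter> {z. n \<bullet> z < b + \<epsilon>}) z * ennreal \<bar>g z\<bar> \<partial>lborel) \<le> ennreal (K S * \<epsilon>))" ..
  have Ke: "e S > 0" "0 < \<epsilon> \<Longrightarrow> \<epsilon> < e S \<Longrightarrow>
    (\<integral>\<^sup>+z. indicator (arrangement_cell S \<inter> {z. n \<bullet> z < b + \<epsilon>}) z * ennreal \<bar>g z\<bar> \<partial>lborel) \<le> ennreal (K S * \<epsilon>)" if "S \<in> \<S>" for S \<epsilon>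
    using bspec[OF e that] by blast+
  define e0 where "e0 = Min (insert 1 (e ` \<S>))"
  have "e0 > 0" unfolding e0_def using fin Ke(1) by (subst Min_gr_iff) auto
  have e0: "e0 \<le> e S" if "S \<in> \<S>" for S unfolding e0_def using fin that by (intro Min_le) auto
  have "(\<integral>\<^sup>+z. indicator {z. hproj n b z \<in> side_at \<delta> \<and> b < n \<bullet> z \<and> n \<bullet> z < b + \<delta>} z * ennreal \<bar>g z\<bar> \<partial>lborel)
      \<le> ennreal ((\<Sum>S\<in>\<S>. \<bar>K S\<bar>) * \<delta>)" if \<delta>: "0 < \<delta>" "\<delta> < e0" for \<delta>
  proof -
    have "(\<integral>\<^sup>+z. indicator {z. hproj n b z \<in> side_at \<delta> \<and> b < n \<bullet> z \<and> n \<bullet> z < b + \<delta>} z * ennreal \<bar>g z\<bar> \<partial>lborel)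
      \<le> (\<integral>\<^sup>+z. (\<Sum>S\<in>\<S>. indicator (arrangement_cell S \<inter> {z. n \<bullet> z < b + \<delta>}) z * ennreal \<bar>g z\<bar>) \<partial>lborel)"
    proof (rule nn_integral_mono)
      fix z
      show "indicator {z. hproj n b z \<in> side_at \<delta> \<and> b < n \<bullet> z \<and> n \<bullet> z < b + \<delta>} z * ennreal \<bar>g z\<bar>
        \<le> (\<Sum>S\<in>\<S>. indicator (arrangement_cell S \<inter> {z. n \<bullet> z < b + \<delta>}) z * ennreal \<bar>g z\<bar>)"
      proof (cases "hproj n b z \<in> side_at \<delta> \<and> b < n \<bullet> z \<and> n \<bullet> z < b + \<delta>")
        case True
        define S where "S = {k\<in>J. nv k \<bullet> z > bv k}"
        have z: "z = hproj n b z + (n \<bullet> z - b) *\<^sub>R n" by (simp add: hproj_def)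
        have s: "0 < n \<bullet> z - b" "n \<bullet> z - b < 2 * \<delta>" using True by auto
        have off: "nv k \<bullet> z \<noteq> bv k" if "k \<in> J" for k
          by (subst z, rule segment_off[OF side_atD(1,2) s that]) (use True in blast)+
        have zT: "z \<in> T" by (subst z, rule side_atD(3)[OF _ s]) (use True in blast)
        have zS: "z \<in> arrangement_cell S" unfolding S_def by (rule mem_arrangement_cell[OF off])
        have SJ: "S \<subseteq> J" by (auto simp: S_def)
        have "arrangement_cell S \<subseteq> T"
          using connected_off_hyperplanes[OF convex_connected[OF arrangement_cell_convex] _ zS zT]
            arrangement_cell_off[OF SJ] by blast
        moreover have "n \<bullet> y > b" if "y \<in> arrangement_cell S" for y
          using oriented
        proof
          assume o: "n = nv j \<and> b = bv j"
          then have "j \<in> S" using j True by (simp add: S_def)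
          then show ?thesis using that o by (auto simp: arrangement_cell_def)
        next
          assume o: "n = - nv j \<and> b = - bv j"
          then have "j \<in> J - S" using j True by (simp add: S_def)
          then show ?thesis using that o by (auto simp: arrangement_cell_def)
        qed
        ultimately have "S \<in> \<S>" using SJ by (simp add: \<S>_def)
        have "indicator (arrangement_cell S \<inter> {z. n \<bullet> z < b + \<delta>}) z * ennreal \<bar>g z\<bar>
           \<le> (\<Sum>S\<in>\<S>. indicator (arrangement_cell S \<inter> {z. n \<bullet> z < b + \<delta>}) z * ennreal \<bar>g z\<bar>)"
          by (rule member_le_sum) (use fin \<open>S \<in> \<S>\<close> in auto)
        then show ?thesis using True zS by simp
      qed simp
    qed
    also have "\<dots> = (\<Sum>S\<in>\<S>. \<integral>\<^sup>+z. indicator (arrangement_cell S \<inter> {z. n \<bullet> z < b + \<delta>}) z * ennreal \<bar>g z\<bar> \<partial>lborel)"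
    proof (rule nn_integral_sum)
      fix S assume "S \<in> \<S>"
      then have [measurable]: "arrangement_cell S \<in> sets borel" using arrangement_cell_open[of S] by (auto simp: \<S>_def)
      show "(\<lambda>z. indicator (arrangement_cell S \<inter> {z. n \<bullet> z < b + \<delta>}) z * ennreal \<bar>g z\<bar>) \<in> borel_measurable lborel"
        by measurable
    qed
    also have "\<dots> \<le> (\<Sum>S\<in>\<S>. ennreal (\<bar>K S\<bar> * \<delta>))"
    proof (rule sum_mono)
      fix S assume S: "S \<in> \<S>"
      have "(\<integral>\<^sup>+z. indicator (arrangement_cell S \<inter> {z. n \<bullet> z < b + \<delta>}) z * ennreal \<bar>g z\<bar> \<partial>lborel) \<le> ennreal (K S * \<delta>)"
        by (rule Ke(2)[OF S \<delta>(1)]) (use e0[OF S] \<delta>(2) in linarith)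
      also have "\<dots> \<le> ennreal (\<bar>K S\<bar> * \<delta>)" using \<delta> by (intro ennreal_leI mult_right_mono) auto
      finally show "(\<integral>\<^sup>+z. indicator (arrangement_cell S \<inter> {z. n \<bullet> z < b + \<delta>}) z * ennreal \<bar>g z\<bar> \<partial>lborel) \<le> ennreal (\<bar>K S\<bar> * \<delta>)" .
    qed
    also have "\<dots> = ennreal ((\<Sum>S\<in>\<S>. \<bar>K S\<bar>) * \<delta>)"
      using \<delta> by (simp add: sum_ennreal sum_distrib_right)
    finally show ?thesis .
  qed
  then show ?thesis using \<open>e0 > 0\<close>
    by (intro exI[of _ "\<Sum>S\<in>\<S>. \<bar>K S\<bar>"] exI[of _ e0] conjI allI impI) (assumption, elim conjE)
qed

text \<open>Integrating the representation over heights in (0, \<delta>) bounds \<delta> times the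
  integral of the trace by the integral of g over the layer, which is of order \<delta>, plus
  \<delta> times the integral of the normal derivative. Dividing by \<delta> gives a bound
  independent of \<delta>, and the sets \<open>side_at\<close> increase to
  \<open>side\<close>.\<close>

lemma integrable_trace: "integrable (hmeas n b) (\<lambda>x. indicator side x * btrace n g x)"
proof -
  obtain K \<epsilon>0 where K: "\<epsilon>0 > 0" "\<And>\<delta>. 0 < \<delta> \<Longrightarrow> \<delta> < \<epsilon>0 \<Longrightarrow>
     (\<integral>\<^sup>+z. indicator {z. hproj n b z \<in> side_at \<delta> \<and> b < n \<bullet> z \<and> n \<bullet> z < b + \<delta>} z * ennreal \<bar>g z\<bar> \<partial>lborel) \<le> ennreal (K * \<delta>)"
    using layer_bound by blast
  define N where "N = (\<integral>\<^sup>+z. ennreal \<bar>h z \<bullet> n\<bar> \<partial>lborel)"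
  have "integrable lborel (\<lambda>z. h z \<bullet> n)" using integrable_h by auto
  then have N: "N < \<infinity>" unfolding N_def by (simp add: integrable_iff_bounded)
  define f where "f = (\<lambda>m x. indicator (side_at (1 / real (Suc m))) x * ennreal \<bar>btrace n g x\<bar>)"
  have bd: "(\<integral>\<^sup>+x. f m x \<partial>hmeas n b) \<le> ennreal \<bar>K\<bar> + N" if "1 / real (Suc m) < \<epsilon>0" for m
  proof -
    define \<delta> where "\<delta> = 1 / real (Suc m)"
    have \<delta>: "0 < \<delta>" "\<delta> < \<epsilon>0" using that by (auto simp: \<delta>_def)
    have f\<delta>: "f m x = indicator (side_at \<delta>) x * ennreal \<bar>btrace n g x\<bar>" for x
      by (simp only: f_def \<delta>_def)
    define L where "L = (\<lambda>x. \<integral>\<^sup>+q. ennreal \<bar>h (x + q *\<^sub>R n) \<bullet> n\<bar> \<partial>lborel)"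
    define G where "G = (\<lambda>x. \<integral>\<^sup>+s. indicator {0<..<\<delta>} s * (indicator (side_at \<delta>) x * ennreal \<bar>g (x + s *\<^sub>R n)\<bar>) \<partial>lborel)"
    have [measurable]: "L \<in> borel_measurable borel" "G \<in> borel_measurable borel" unfolding L_def G_def by measurable
    \<comment> \<open>On the line above x the trace is g at height s minus a primitive bounded by
      \<open>L x\<close>, for almost every s; integrate over s in (0, \<delta>).\<close>
    have "AE x in hmeas n b. ennreal \<delta> * f m x \<le> G x + ennreal \<delta> * L x"
      using trace_on_side_at[OF \<delta>(1)] line_integrable
    proof eventually_elim
      case (elim x)
      show ?case
      proof (cases "x \<in> side_at \<delta>")
        case True
        with elim(1) have rep: "AE s in lborel. 0 < s \<and> s < 2 * \<delta> \<longrightarrow>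
          g (x + s *\<^sub>R n) = btrace n g x + (LBINT q. indicator {0..s} q * (h (x + q *\<^sub>R n) \<bullet> n))" by blast
        have le: "ennreal \<bar>LINT q|lborel. indicator {0..s} q * (h (x + q *\<^sub>R n) \<bullet> n)\<bar> \<le> L x" for s
        proof -
          have "integrable lborel (\<lambda>q. indicator {0..s} q * (h (x + q *\<^sub>R n) \<bullet> n))"
            using integrable_mult_indicator[OF _ elim(2), of "{0..s}"] by simp
          then have "ennreal \<bar>LINT q|lborel. indicator {0..s} q * (h (x + q *\<^sub>R n) \<bullet> n)\<bar> \<le> (\<integral>\<^sup>+q. ennreal \<bar>indicator {0..s} q * (h (x + q *\<^sub>R n) \<bullet> n)\<bar> \<partial>lborel)"
            using integral_norm_bound_ennreal[of lborel "\<lambda>q. indicator {0..s} q * (h (x + q *\<^sub>R n) \<bullet> n)"]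
            unfolding real_norm_def by blast
          also have "\<dots> \<le> L x" unfolding L_def by (intro nn_integral_mono) (auto simp: indicator_def)
          finally show ?thesis .
        qed
        have "ennreal \<delta> * f m x = (\<integral>\<^sup>+s. indicator {0<..<\<delta>} s * ennreal \<bar>btrace n g x\<bar> \<partial>lborel)"
          using True \<delta> by (subst nn_integral_multc) (auto simp: f\<delta>)
        also have "\<dots> \<le> (\<integral>\<^sup>+s. indicator {0<..<\<delta>} s * (indicator (side_at \<delta>) x * ennreal \<bar>g (x + s *\<^sub>R n)\<bar>) + indicator {0<..<\<delta>} s * L x \<partial>lborel)"
        proof (rule nn_integral_mono_AE)
          show "AE s in lborel. indicator {0<..<\<delta>} s * ennreal \<bar>btrace n g x\<bar> \<le>
             indicator {0<..<\<delta>} s * (indicator (side_at \<delta>) x * ennreal \<bar>g (x + s *\<^sub>R n)\<bar>) + indicator {0<..<\<delta>} s * L x"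
            using rep
          proof eventually_elim
            case (elim s)
            show ?case
            proof (cases "0 < s \<and> s < \<delta>")
              case s: True
              define I where "I = (LBINT q. indicator {0..s} q * (h (x + q *\<^sub>R n) \<bullet> n))"
              have "btrace n g x = g (x + s *\<^sub>R n) - I" using elim s by (simp add: I_def)
              then have "ennreal \<bar>btrace n g x\<bar> \<le> ennreal \<bar>g (x + s *\<^sub>R n)\<bar> + ennreal \<bar>I\<bar>"
                by (simp add: ennreal_plus[symmetric] del: ennreal_plus)
              also have "\<dots> \<le> ennreal \<bar>g (x + s *\<^sub>R n)\<bar> + L x" using le[of s] by (simp add: I_def add_left_mono)
              finally show ?thesis using s True by simp
            qed simp
          qed
        qed
        also have "\<dots> = G x + ennreal \<delta> * L x"
          unfolding G_def using \<delta> by (subst nn_integral_add) (auto simp: nn_integral_multc)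
        finally show ?thesis .
      qed (simp add: f\<delta>)
    qed
    then have "ennreal \<delta> * (\<integral>\<^sup>+x. f m x \<partial>hmeas n b) \<le> (\<integral>\<^sup>+x. G x \<partial>hmeas n b) + ennreal \<delta> * (\<integral>\<^sup>+x. L x \<partial>hmeas n b)"
      using nn_integral_mono_AE[of "\<lambda>x. ennreal \<delta> * f m x" "\<lambda>x. G x + ennreal \<delta> * L x" "hmeas n b"]
      by (subst (asm) nn_integral_add, measurable, subst (asm) nn_integral_cmult) (auto simp: f_def nn_integral_cmult)
    also have "(\<integral>\<^sup>+x. L x \<partial>hmeas n b) = N"
      unfolding L_def N_def by (rule normal_Fubini_nn[OF unit_n]) measurable
    also have "(\<integral>\<^sup>+x. G x \<partial>hmeas n b) = (\<integral>\<^sup>+z. indicator {z. hproj n b z \<in> side_at \<delta> \<and> b < n \<bullet> z \<and> n \<bullet> z < b + \<delta>} z * ennreal \<bar>g z\<bar> \<partial>lborel)"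
    proof -
      have "(\<integral>\<^sup>+x. G x \<partial>hmeas n b) = (\<integral>\<^sup>+x. \<integral>\<^sup>+s. indicator {z. hproj n b z \<in> side_at \<delta> \<and> b < n \<bullet> z \<and> n \<bullet> z < b + \<delta>} (x + s *\<^sub>R n) * ennreal \<bar>g (x + s *\<^sub>R n)\<bar> \<partial>lborel \<partial>hmeas n b)"
        unfolding G_def
      proof (rule nn_integral_cong_AE)
        show "AE x in hmeas n b. (\<integral>\<^sup>+s. indicator {0<..<\<delta>} s * (indicator (side_at \<delta>) x * ennreal \<bar>g (x + s *\<^sub>R n)\<bar>) \<partial>lborel) =
          (\<integral>\<^sup>+s. indicator {z. hproj n b z \<in> side_at \<delta> \<and> b < n \<bullet> z \<and> n \<bullet> z < b + \<delta>} (x + s *\<^sub>R n) * ennreal \<bar>g (x + s *\<^sub>R n)\<bar> \<partial>lborel)"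
          using AE_hmeas_hyperplane[OF unit_n]
        proof eventually_elim
          case (elim x)
          then show ?case
            by (intro nn_integral_cong) (auto simp: indicator_def hproj_normal[OF unit_n] inner_add_right)
        qed
      qed
      also have "\<dots> = (\<integral>\<^sup>+z. indicator {z. hproj n b z \<in> side_at \<delta> \<and> b < n \<bullet> z \<and> n \<bullet> z < b + \<delta>} z * ennreal \<bar>g z\<bar> \<partial>lborel)"
        by (rule normal_Fubini_nn[OF unit_n, of "\<lambda>z. indicator {z. hproj n b z \<in> side_at \<delta> \<and> b < n \<bullet> z \<and> n \<bullet> z < b + \<delta>} z * ennreal \<bar>g z\<bar>"]) measurable
      finally show ?thesis .
    qed
    also have "\<dots> \<le> ennreal (\<bar>K\<bar> * \<delta>)"
      using K(2)[OF \<delta>] \<delta> by (elim order_trans) (intro ennreal_leI mult_right_mono, auto)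
    finally have "ennreal \<delta> * (\<integral>\<^sup>+x. f m x \<partial>hmeas n b) \<le> ennreal \<delta> * (ennreal \<bar>K\<bar> + N)"
      using \<delta> by (simp add: distrib_left ennreal_mult mult.commute add_right_mono)
    then show ?thesis using \<delta> by (simp add: ennreal_mult_le_mult_iff)
  qed
  have inc: "incseq f"
    unfolding f_def incseq_def le_fun_def
  proof (intro allI impI mult_right_mono)
    fix m k :: nat and x assume "m \<le> k"
    then have "side_at (1 / real (Suc m)) \<subseteq> side_at (1 / real (Suc k))"
      by (intro side_at_mono) (auto simp: frac_le)
    then show "indicator (side_at (1 / real (Suc m))) x \<le> (indicator (side_at (1 / real (Suc k))) x :: ennreal)"
      by (auto simp: indicator_def)
  qed simp
  have sup: "(SUP m. f m x) = ennreal (norm (indicator side x * btrace n g x))" for x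
  proof (cases "x \<in> side")
    case True
    then obtain m0 where m0: "x \<in> side_at (1 / real (Suc m0))" by (auto simp: side_def)
    have "(SUP m. f m x) = ennreal \<bar>btrace n g x\<bar>"
    proof (rule antisym)
      show "(SUP m. f m x) \<le> ennreal \<bar>btrace n g x\<bar>" by (intro SUP_least) (auto simp: f_def indicator_def)
      show "ennreal \<bar>btrace n g x\<bar> \<le> (SUP m. f m x)" by (rule SUP_upper2[of m0]) (use m0 in \<open>auto simp: f_def\<close>)
    qed
    then show ?thesis using True by simp
  next
    case False
    then have "f m x = 0" for m by (auto simp: f_def side_def)
    then show ?thesis using False by simp
  qed
  have [measurable]: "f m \<in> borel_measurable (hmeas n b)" for m unfolding f_def by measurable
  have "(\<integral>\<^sup>+x. ennreal (norm (indicator side x * btrace n g x)) \<partial>hmeas n b) = (SUP m. \<integral>\<^sup>+x. f m x \<partial>hmeas n b)"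
    unfolding sup[symmetric] by (rule nn_integral_monotone_convergence_SUP[OF inc]) measurable
  also have "\<dots> \<le> ennreal \<bar>K\<bar> + N"
  proof (rule SUP_least)
    fix m
    \<comment> \<open>The uniform bound is known only for small \<delta>; monotonicity in m extends
      it to every m.\<close>
    obtain m' where m': "1 / real (Suc m') < \<epsilon>0" using nat_approx_posE[OF K(1)] by blast
    have "1 / real (Suc (max m m')) \<le> 1 / real (Suc m')" by (simp add: frac_le)
    then have "1 / real (Suc (max m m')) < \<epsilon>0" using m' by linarith
    then have "(\<integral>\<^sup>+x. f (max m m') x \<partial>hmeas n b) \<le> ennreal \<bar>K\<bar> + N" by (rule bd)
    moreover have "(\<integral>\<^sup>+x. f m x \<partial>hmeas n b) \<le> (\<integral>\<^sup>+x. f (max m m') x \<partial>hmeas n b)"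
      using inc by (intro nn_integral_mono) (auto simp: incseq_def le_fun_def)
    ultimately show "(\<integral>\<^sup>+x. f m x \<partial>hmeas n b) \<le> ennreal \<bar>K\<bar> + N" by simp
  qed
  also have "\<dots> < \<infinity>" using N by simp
  finally show ?thesis by (intro integrableI_bounded) measurable
qed

end

section \<open>Means over the strip along one side and their limit\<close>

lemma notch_bounds: "0 \<le> notch r" "notch r \<le> 1"
  by (simp_all add: notch_eq step_nonneg step_le_1)

lemma notch_eq_1: "1 \<le> \<bar>r\<bar> \<Longrightarrow> notch r = 1"
  by (simp add: notch_eq step_eq_1)

lemma notch_eq_0: "\<bar>r\<bar> \<le> 1/2 \<Longrightarrow> notch r = 0"
  by (simp add: notch_eq step_eq_0)

lemma notch_measurable [measurable]: "notch \<in> borel_measurable borel"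
  unfolding notch_def[abs_def] by measurable

lemma integral_step': "(LBINT r. step' r) = 1" and integrable_step': "integrable lborel step'"
proof -
  have der: "(step has_vector_derivative step' x) (at x within {0..1})" for x
    using DERIV_step[of x] by (auto simp: has_real_derivative_iff_has_vector_derivative intro: has_vector_derivative_at_within)
  have cont: "continuous_on {0..1} step'" using continuous_step' continuous_on_subset by blast
  have eq: "indicator {0..1} x *\<^sub>R step' x = step' x" for x
    using step'_eq_0[of x] by (cases "0 \<le> x \<and> x \<le> 1") auto
  show "(LBINT r. step' r) = 1"
    using integral_FTC_Icc[of 0 1 step step'] der cont step_eq_0[of 0] step_eq_1[of 1] unfolding eq by simp
  have "set_integrable lborel {0..1} step'" by (rule borel_integrable_atLeastAtMost') (rule cont)
  then show "integrable lborel step'" unfolding set_integrable_def eq .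
qed

lemma step'_scaled:
  assumes "\<epsilon> > 0"
  shows "(LBINT s. step' (s / \<epsilon>) / \<epsilon>) = 1" "integrable lborel (\<lambda>s. step' (s / \<epsilon>) / \<epsilon>)"
proof -
  have "integrable lborel (\<lambda>s. step' (0 + (1 / \<epsilon>) * s))"
    using integrable_step' by (rule lborel_integrable_real_affine) (use assms in auto)
  then show "integrable lborel (\<lambda>s. step' (s / \<epsilon>) / \<epsilon>)" by simp
  have "(LBINT s. step' s) = \<bar>1 / \<epsilon>\<bar> *\<^sub>R (LBINT s. step' (0 + (1 / \<epsilon>) * s))"
    by (rule lborel_integral_real_affine) (use assms in auto)
  also have "\<dots> = (LBINT s. step' (s / \<epsilon>) / \<epsilon>)" using assms by simp
  finally show "(LBINT s. step' (s / \<epsilon>) / \<epsilon>) = 1" unfolding integral_step' by (rule sym)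
qed

lemma AE_not_hyperplane:
  fixes n :: "real^'n" assumes "n \<noteq> 0" shows "AE z in lborel. n \<bullet> z \<noteq> b"
proof -
  have "negligible {z. n \<bullet> z = b}" using assms by (intro negligible_hyperplane) auto
  moreover have "{z. n \<bullet> z = b} \<in> sets borel" by (intro borel_closed closed_hyperplane)
  ultimately have "{z. n \<bullet> z = b} \<in> null_sets lborel"
    by (simp add: negligible_iff_null_sets null_sets_completion_iff)
  from AE_not_in[OF this] show ?thesis by simp
qed

lemma strip_integral_tendsto_0:
  fixes k :: "real^'n \<Rightarrow> real"
  assumes k: "integrable lborel k" and "n \<noteq> 0"
  shows "(\<lambda>m. LINT z|lborel. indicator {z. b \<le> n \<bullet> z \<and> n \<bullet> z \<le> b + 1 / real (Suc m)} z * k z) \<longlonglongrightarrow> 0"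
proof -
  have [measurable]: "k \<in> borel_measurable borel" using k by auto
  have "(\<lambda>m. LINT z|lborel. indicator {z. b \<le> n \<bullet> z \<and> n \<bullet> z \<le> b + 1 / real (Suc m)} z * k z) \<longlonglongrightarrow> (LINT (z::real^'n)|lborel. 0)"
  proof (rule integral_dominated_convergence[where w="\<lambda>z. \<bar>k z\<bar>"])
    show "AE z in lborel. (\<lambda>m. indicator {z. b \<le> n \<bullet> z \<and> n \<bullet> z \<le> b + 1 / real (Suc m)} z * k z) \<longlonglongrightarrow> 0"
      using AE_not_hyperplane[OF assms(2), of b]
    proof eventually_elim
      case (elim z)
      show ?case
      proof (cases "b \<le> n \<bullet> z")
        case True
        then have "n \<bullet> z - b > 0" using elim by simp
        then obtain N where N: "1 / real (Suc N) < n \<bullet> z - b" using nat_approx_posE by metis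
        have "indicator {z. b \<le> n \<bullet> z \<and> n \<bullet> z \<le> b + 1 / real (Suc m)} z * k z = 0" if "N \<le> m" for m
        proof -
          have "1 / real (Suc m) \<le> 1 / real (Suc N)" using that by (simp add: frac_le)
          then show ?thesis using N by simp
        qed
        then show ?thesis by (intro tendsto_eventually) (auto simp only: eventually_sequentially)
      qed simp
    qed
  qed (use k in \<open>auto simp: indicator_def\<close>)
  then show ?thesis by simp
qed

context polyhedral_side
begin

text \<open>The part of the strip along hyperplane j that comes close to another hyperplane. The 3
  is the 2 of \<open>clear\<close> plus 1 for the descent of at most \<epsilon> along the normal to
  the foot point.\<close>

definition tube :: "real \<Rightarrow> (real^'n) set" where
  "tube \<epsilon> = {z \<in> T. b \<le> n \<bullet> z \<and> n \<bullet> z < b + \<epsilon> \<and> (\<exists>k\<in>J - {j}. \<bar>nv k \<bullet> z - bv k\<bar> < 3 * \<epsilon>)}"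

lemma tube_borel [measurable]: "tube \<epsilon> \<in> sets borel"
proof -
  have "tube \<epsilon> = (\<Union>k\<in>J - {j}. {z \<in> T. b \<le> n \<bullet> z \<and> n \<bullet> z < b + \<epsilon> \<and> \<bar>nv k \<bullet> z - bv k\<bar> < 3 * \<epsilon>})"
    by (auto simp: tube_def)
  also have "\<dots> \<in> sets borel"
  proof (rule sets.finite_UN)
    show "{z \<in> T. b \<le> n \<bullet> z \<and> n \<bullet> z < b + \<epsilon> \<and> \<bar>nv k \<bullet> z - bv k\<bar> < 3 * \<epsilon>} \<in> sets borel" for k
      by measurable
  qed (use finite_J in simp)
  finally show ?thesis .
qed

lemma emeasure_tube:
  "\<exists>C \<epsilon>0. C > 0 \<and> \<epsilon>0 > 0 \<and> (\<forall>\<epsilon>. 0 < \<epsilon> \<and> \<epsilon> < \<epsilon>0 \<longrightarrow> emeasure lborel (tube \<epsilon>) \<le> ennreal (C * \<epsilon>\<^sup>2))"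
proof -
  obtain R where R: "T \<subseteq> cball 0 R" using bounded_subset_ballD[OF bounded_T, of 0] ball_subset_cball by blast
  have hyp: "hyperplane n b = hyperplane (nv j) (bv j)"
    unfolding hyperplane_def by (simp add: side_j)
  define S where "S = (\<lambda>k \<epsilon>. {z. \<bar>n \<bullet> z - b\<bar> < \<epsilon>} \<inter> {z. \<bar>nv k \<bullet> z - bv k\<bar> < \<epsilon>} \<inter> cball 0 R)"
  have "\<forall>k\<in>J - {j}. \<exists>C \<epsilon>0. C > 0 \<and> \<epsilon>0 > 0 \<and> (\<forall>\<epsilon>. 0 < \<epsilon> \<and> \<epsilon> < \<epsilon>0 \<longrightarrow> emeasure lborel (S k \<epsilon>) \<le> ennreal (C * \<epsilon>\<^sup>2))"
  proof
    fix k assume k: "k \<in> J - {j}"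
    show "\<exists>C \<epsilon>0. C > 0 \<and> \<epsilon>0 > 0 \<and> (\<forall>\<epsilon>. 0 < \<epsilon> \<and> \<epsilon> < \<epsilon>0 \<longrightarrow> emeasure lborel (S k \<epsilon>) \<le> ennreal (C * \<epsilon>\<^sup>2))"
      unfolding S_def
      by (rule emeasure_strip_intersection) (use k unit_n unit_nv hyp distinct_hyperplanes[OF j, of k] in auto)
  qed
  from bchoice[OF this] obtain C where "\<forall>k\<in>J - {j}. \<exists>\<epsilon>0. C k > 0 \<and> \<epsilon>0 > 0 \<and> (\<forall>\<epsilon>. 0 < \<epsilon> \<and> \<epsilon> < \<epsilon>0 \<longrightarrow> emeasure lborel (S k \<epsilon>) \<le> ennreal (C k * \<epsilon>\<^sup>2))" ..
  from bchoice[OF this] obtain e where "\<forall>k\<in>J - {j}. C k > 0 \<and> e k > 0 \<and> (\<forall>\<epsilon>. 0 < \<epsilon> \<and> \<epsilon> < e k \<longrightarrow> emeasure lborel (S k \<epsilon>) \<le> ennreal (C k * \<epsilon>\<^sup>2))" ..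
  note * = bspec[OF this]
  define e0 where "e0 = Min (insert 1 (e ` (J - {j}))) / 3"
  have "Min (insert 1 (e ` (J - {j}))) > 0" using finite_J * by (subst Min_gr_iff) auto
  then have "e0 > 0" by (simp add: e0_def)
  have e0: "3 * e0 \<le> e k" if "k \<in> J - {j}" for k unfolding e0_def using finite_J that by (simp add: Min_le)
  \<comment> \<open>The strips used have half-width 3 \<epsilon>: this gives 9 here and the division
    by 3 in e0.\<close>
  define C' where "C' = 9 * (\<Sum>k\<in>J - {j}. C k) + 1"
  have "(\<Sum>k\<in>J - {j}. C k) \<ge> 0" using * by (intro sum_nonneg) (simp add: less_imp_le)
  then have "C' > 0" by (simp add: C'_def)
  moreover have "emeasure lborel (tube \<epsilon>) \<le> ennreal (C' * \<epsilon>\<^sup>2)" if \<epsilon>: "0 < \<epsilon>" "\<epsilon> < e0" for \<epsilon>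
  proof -
    have Sb: "S k (3 * \<epsilon>) \<in> sets borel" for k unfolding S_def by measurable
    have "tube \<epsilon> \<subseteq> (\<Union>k\<in>J - {j}. S k (3 * \<epsilon>))"
    proof
      fix z assume "z \<in> tube \<epsilon>"
      then obtain k where "k \<in> J - {j}" "z \<in> T" "b \<le> n \<bullet> z" "n \<bullet> z < b + \<epsilon>" "\<bar>nv k \<bullet> z - bv k\<bar> < 3 * \<epsilon>"
        unfolding tube_def by blast
      moreover then have "\<bar>n \<bullet> z - b\<bar> < 3 * \<epsilon>" by linarith
      ultimately show "z \<in> (\<Union>k\<in>J - {j}. S k (3 * \<epsilon>))" using R by (auto simp: S_def)
    qed
    then have "emeasure lborel (tube \<epsilon>) \<le> emeasure lborel (\<Union>k\<in>J - {j}. S k (3 * \<epsilon>))"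
      using finite_J Sb by (intro emeasure_mono) auto
    also have "\<dots> \<le> (\<Sum>k\<in>J - {j}. emeasure lborel (S k (3 * \<epsilon>)))"
      using finite_J Sb by (intro emeasure_subadditive_finite) auto
    also have "\<dots> \<le> (\<Sum>k\<in>J - {j}. ennreal (C k * (3 * \<epsilon>)\<^sup>2))"
    proof (rule sum_mono)
      fix k assume k: "k \<in> J - {j}"
      have "0 < 3 * \<epsilon> \<and> 3 * \<epsilon> < e k" using \<epsilon> e0[OF k] by linarith
      then show "emeasure lborel (S k (3 * \<epsilon>)) \<le> ennreal (C k * (3 * \<epsilon>)\<^sup>2)" using *[OF k] by blast
    qed
    also have "\<dots> = ennreal (\<Sum>k\<in>J - {j}. C k * (3 * \<epsilon>)\<^sup>2)"
      using * by (intro sum_ennreal) (simp add: less_imp_le)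
    also have "\<dots> \<le> ennreal (C' * \<epsilon>\<^sup>2)"
      by (intro ennreal_leI) (simp add: C'_def sum_distrib_right[symmetric] power_mult_distrib algebra_simps)
    finally show ?thesis .
  qed
  ultimately show ?thesis using \<open>e0 > 0\<close> by (intro exI[of _ C'] exI[of _ e0] conjI allI impI) auto
qed

lemma integrable_indicator_g: "A \<in> sets borel \<Longrightarrow> integrable lborel (\<lambda>z. indicator A z * \<bar>g z\<bar>)"
  using integrable_mult_indicator[OF _ integrable_abs[OF integrable_g], of A] by simp

text \<open>The tube has measure of order \<epsilon>^2. Young's inequality therefore bounds the
  quantity by \<mu> times the integral of g^2 over the strip plus C/(4 \<mu>). For fixed \<mu> the
  first term tends to 0 as the strip shrinks, and the second is small for large \<mu>. Square
  integrability of g is used in full strength here.\<close>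

lemma tube_integral_tendsto_0:
  "(\<lambda>m. real (Suc m) * (LBINT z. indicator (tube (1 / real (Suc m))) z * \<bar>g z\<bar>)) \<longlonglongrightarrow> 0"
proof -
  obtain C \<epsilon>0 where C: "C > 0" "\<epsilon>0 > 0" "\<And>\<epsilon>. 0 < \<epsilon> \<Longrightarrow> \<epsilon> < \<epsilon>0 \<Longrightarrow> emeasure lborel (tube \<epsilon>) \<le> ennreal (C * \<epsilon>\<^sup>2)"
    using emeasure_tube by blast
  have ig2: "integrable lborel (\<lambda>z. (g z)\<^sup>2)" using borel_weak_gradientD(3)[OF weak] .
  define strip where "strip = (\<lambda>m. {z. b \<le> n \<bullet> z \<and> n \<bullet> z \<le> b + 1 / real (Suc m)})"
  have strip: "(\<lambda>m. LINT z|lborel. indicator (strip m) z * (g z)\<^sup>2) \<longlonglongrightarrow> 0"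
    unfolding strip_def by (rule strip_integral_tendsto_0[OF ig2]) (use unit_n in auto)
  have [measurable]: "strip m \<in> sets borel" for m unfolding strip_def by measurable
  have istrip: "integrable lborel (\<lambda>z. indicator (strip m) z * (g z)\<^sup>2)" for m
    using integrable_mult_indicator[OF _ ig2, of "strip m"] by simp
  have est: "real (Suc m) * (LBINT z. indicator (tube (1 / real (Suc m))) z * \<bar>g z\<bar>)
      \<le> \<mu> * (LBINT z. indicator (strip m) z * (g z)\<^sup>2) + C / (4 * \<mu>)"
    if \<mu>: "\<mu> > 0" and m: "1 / real (Suc m) < \<epsilon>0" for \<mu> m
  proof -
    define \<epsilon> where "\<epsilon> = 1 / real (Suc m)"
    have \<epsilon>: "0 < \<epsilon>" "\<epsilon> < \<epsilon>0" "real (Suc m) = 1 / \<epsilon>" using m by (auto simp: \<epsilon>_def)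
    have em: "emeasure lborel (tube \<epsilon>) \<le> ennreal (C * \<epsilon>\<^sup>2)" by (rule C(3)[OF \<epsilon>(1,2)])
    then have fin: "emeasure lborel (tube \<epsilon>) < \<infinity>" by (simp add: le_less_trans)
    have me: "measure lborel (tube \<epsilon>) \<le> C * \<epsilon>\<^sup>2"
      using em C(1) by (simp add: measure_def enn2real_leI)
    have itube: "integrable lborel (\<lambda>z. indicator (tube \<epsilon>) z :: real)" using fin by simp
    have "(1 / \<epsilon>) * (LBINT z. indicator (tube \<epsilon>) z * \<bar>g z\<bar>) = (LBINT z. (1 / \<epsilon>) * (indicator (tube \<epsilon>) z * \<bar>g z\<bar>))"
      by simp
    also have "\<dots> \<le> (LBINT z. \<mu> * (indicator (strip m) z * (g z)\<^sup>2) + 1 / (4 * \<mu> * \<epsilon>\<^sup>2) * indicator (tube \<epsilon>) z)"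
    proof (rule integral_mono)
      show "integrable lborel (\<lambda>z. (1 / \<epsilon>) * (indicator (tube \<epsilon>) z * \<bar>g z\<bar>))"
        by (intro integrable_mult_right integrable_indicator_g) simp
      show "integrable lborel (\<lambda>z. \<mu> * (indicator (strip m) z * (g z)\<^sup>2) + 1 / (4 * \<mu> * \<epsilon>\<^sup>2) * indicator (tube \<epsilon>) z)"
        by (intro Bochner_Integration.integrable_add integrable_mult_right istrip itube)
      fix z
      show "(1 / \<epsilon>) * (indicator (tube \<epsilon>) z * \<bar>g z\<bar>) \<le> \<mu> * (indicator (strip m) z * (g z)\<^sup>2) + 1 / (4 * \<mu> * \<epsilon>\<^sup>2) * indicator (tube \<epsilon>) z"
      proof (cases "z \<in> tube \<epsilon>")
        case True
        then have "z \<in> strip m" by (simp add: tube_def strip_def \<epsilon>_def)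
        \<comment> \<open>Young's inequality, weighted so that its constant term integrates to at
          most C/(4 \<mu>) over the tube.\<close>
        have "0 \<le> (\<mu> * \<bar>g z\<bar> - 1 / (2 * \<epsilon>))\<^sup>2 / \<mu>" using \<mu> by simp
        also have "\<dots> = \<mu> * (g z)\<^sup>2 + 1 / (4 * \<mu> * \<epsilon>\<^sup>2) - (1 / \<epsilon>) * \<bar>g z\<bar>"
          using \<mu> \<epsilon> by (simp add: power2_diff power2_eq_square field_simps)
        finally show ?thesis using True \<open>z \<in> strip m\<close> by simp
      next
        case False
        then show ?thesis using \<mu> by simp
      qed
    qed
    also have "\<dots> = \<mu> * (LBINT z. indicator (strip m) z * (g z)\<^sup>2) + 1 / (4 * \<mu> * \<epsilon>\<^sup>2) * measure lborel (tube \<epsilon>)"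
      using istrip itube by simp
    also have "1 / (4 * \<mu> * \<epsilon>\<^sup>2) * measure lborel (tube \<epsilon>) \<le> 1 / (4 * \<mu> * \<epsilon>\<^sup>2) * (C * \<epsilon>\<^sup>2)"
      using me \<mu> by (intro mult_left_mono) auto
    also have "\<dots> = C / (4 * \<mu>)" using \<epsilon> \<mu> by simp
    finally show ?thesis unfolding \<epsilon>(3) \<epsilon>_def[symmetric] by simp
  qed
  show ?thesis
  proof (rule LIMSEQ_I)
    fix r :: real assume "r > 0"
    \<comment> \<open>With this value the second term of the estimate is r/4, which leaves room for
      r/2 in the first.\<close>
    define \<mu> where "\<mu> = C / r"
    have \<mu>: "\<mu> > 0" "C / (4 * \<mu>) = r / 4" using C \<open>r > 0\<close> by (auto simp: \<mu>_def)
    have "(\<lambda>m. \<mu> * (LBINT z. indicator (strip m) z * (g z)\<^sup>2)) \<longlonglongrightarrow> \<mu> * 0"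
      by (intro tendsto_mult tendsto_const strip)
    then have "(\<lambda>m. \<mu> * (LBINT z. indicator (strip m) z * (g z)\<^sup>2)) \<longlonglongrightarrow> 0" by simp
    from order_tendstoD(2)[OF this, of "r/2"] \<open>r > 0\<close> obtain N1 where
      N1: "\<And>m. m \<ge> N1 \<Longrightarrow> \<mu> * (LBINT z. indicator (strip m) z * (g z)\<^sup>2) < r/2"
      by (auto simp: eventually_sequentially)
    obtain N2 where N2: "1 / real (Suc N2) < \<epsilon>0" using nat_approx_posE[OF C(2)] by blast
    show "\<exists>N. \<forall>m\<ge>N. norm (real (Suc m) * (LBINT z. indicator (tube (1 / real (Suc m))) z * \<bar>g z\<bar>) - 0) < r"
    proof (intro exI allI impI)
      fix m assume m: "m \<ge> max N1 N2"
      have "1 / real (Suc m) \<le> 1 / real (Suc N2)" using m by (simp add: frac_le)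
      then have "1 / real (Suc m) < \<epsilon>0" using N2 by linarith
      from est[OF \<mu>(1) this] N1[of m] m \<mu>(2) \<open>r > 0\<close>
      have "real (Suc m) * (LBINT z. indicator (tube (1 / real (Suc m))) z * \<bar>g z\<bar>) < r" by linarith
      moreover have "0 \<le> real (Suc m) * (LBINT z. indicator (tube (1 / real (Suc m))) z * \<bar>g z\<bar>)"
        by (intro mult_nonneg_nonneg integral_nonneg_AE) auto
      ultimately show "norm (real (Suc m) * (LBINT z. indicator (tube (1 / real (Suc m))) z * \<bar>g z\<bar>) - 0) < r" by simp
    qed
  qed
qed

text \<open>The derivative of the step at scale \<epsilon> across hyperplane j. As a function of the
  signed distance it has integral 1 by \<open>step'_scaled\<close>, so it forms a weighted mean over
  the strip; \<open>cutoff\<close> carries the factors of the other hyperplanes.\<close>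

definition profile :: "real \<Rightarrow> real^'n \<Rightarrow> real" where
  "profile \<epsilon> z = step' ((n \<bullet> z - b) / \<epsilon>) / \<epsilon>"

definition cutoff :: "real \<Rightarrow> real^'n \<Rightarrow> real" where
  "cutoff \<epsilon> z = (\<Prod>k\<in>J - {j}. notch ((nv k \<bullet> z - bv k) / \<epsilon>))"

lemma profile_measurable [measurable]: "profile \<epsilon> \<in> borel_measurable borel"
  unfolding profile_def[abs_def] by measurable

lemma cutoff_measurable [measurable]: "cutoff \<epsilon> \<in> borel_measurable borel"
  unfolding cutoff_def[abs_def] by measurable

lemma cutoff_bounds: "0 \<le> cutoff \<epsilon> z" "cutoff \<epsilon> z \<le> 1"
  unfolding cutoff_def by (auto intro!: prod_nonneg prod_le_1 notch_bounds)

lemma profile_bounds: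
  assumes "\<epsilon> > 0" shows "0 \<le> profile \<epsilon> z" "profile \<epsilon> z \<le> step'_sup / \<epsilon>"
    "profile \<epsilon> z \<noteq> 0 \<Longrightarrow> b < n \<bullet> z \<and> n \<bullet> z < b + \<epsilon>"
proof -
  show "0 \<le> profile \<epsilon> z" "profile \<epsilon> z \<le> step'_sup / \<epsilon>"
    using assms step'_nonneg step'_sup(2) by (auto simp: profile_def divide_right_mono)
  assume "profile \<epsilon> z \<noteq> 0"
  then have "step' ((n \<bullet> z - b) / \<epsilon>) \<noteq> 0" by (auto simp: profile_def)
  then have "1/2 < (n \<bullet> z - b) / \<epsilon>" "(n \<bullet> z - b) / \<epsilon> < 1" using step'_eq_0 by (meson not_le)+
  then have "0 < (n \<bullet> z - b) / \<epsilon>" "(n \<bullet> z - b) / \<epsilon> < 1" by linarith+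
  then show "b < n \<bullet> z \<and> n \<bullet> z < b + \<epsilon>" using assms by (simp add: zero_less_divide_iff divide_less_eq)
qed

lemma profile_cutoff_bound:
  assumes "\<epsilon> > 0" shows "\<bar>profile \<epsilon> z * cutoff \<epsilon> z\<bar> \<le> step'_sup / \<epsilon>"
proof -
  have "profile \<epsilon> z * cutoff \<epsilon> z \<le> profile \<epsilon> z * 1"
    by (intro mult_left_mono cutoff_bounds profile_bounds assms)
  then show ?thesis using profile_bounds[OF assms, of z] cutoff_bounds[of \<epsilon> z] by (simp add: abs_mult)
qed

lemma integrable_profile:
  assumes "\<epsilon> > 0" shows "integrable lborel (\<lambda>z. g z * (profile \<epsilon> z * cutoff \<epsilon> z))"
  by (rule integrable_mult_bounded[OF integrable_g _ profile_cutoff_bound[OF assms]]) measurable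

text \<open>Above a clear foot point all other factors equal 1, and on the normal line the weighted
  mean of g differs from the trace by at most the integral of the normal derivative up to height
  \<epsilon>. The remaining part of the strip inside T lies in the tube, where the weight is at most
  \<open>step'_sup / \<epsilon>\<close>.\<close>

lemma side_error:
  assumes \<epsilon>: "\<epsilon> > 0"
  shows "\<bar>(LBINT z. g z * (profile \<epsilon> z * cutoff \<epsilon> z)) - (LINT x|hmeas n b. indicator (side_at \<epsilon>) x * btrace n g x)\<bar>
    \<le> step'_sup * (1 / \<epsilon> * (LBINT z. indicator (tube \<epsilon>) z * \<bar>g z\<bar>)) +
       (LBINT z. indicator {z. b \<le> n \<bullet> z \<and> n \<bullet> z \<le> b + \<epsilon>} z * \<bar>h z \<bullet> n\<bar>)"
proof -
  \<comment> \<open>Split by the foot point: over R the line argument applies, and off R only the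
    tube contributes.\<close>
  define R where "R = {z. hproj n b z \<in> clear \<epsilon>}"
  have [measurable]: "R \<in> sets borel" unfolding R_def by measurable
  define F where "F = (\<lambda>z. g z * (profile \<epsilon> z * cutoff \<epsilon> z))"
  have iF: "integrable lborel F" unfolding F_def by (rule integrable_profile[OF \<epsilon>])
  define f1 where "f1 = (\<lambda>z. indicator R z * F z)"
  define f2 where "f2 = (\<lambda>z. indicator (- R) z * F z)"
  have i1: "integrable lborel f1" and i2: "integrable lborel f2"
    unfolding f1_def f2_def using integrable_mult_indicator[OF _ iF, of R] integrable_mult_indicator[OF _ iF, of "- R"] by auto
  have "(LBINT z. F z) = (LBINT z. f1 z + f2 z)"
    by (intro Bochner_Integration.integral_cong) (auto simp: f1_def f2_def indicator_def)
  then have split: "(LBINT z. F z) = (LBINT z. f1 z) + (LBINT z. f2 z)"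
    using i1 i2 by simp
  have "\<bar>LINT z|lborel. f2 z\<bar> \<le> (LBINT z. step'_sup * (1 / \<epsilon> * (indicator (tube \<epsilon>) z * \<bar>g z\<bar>)))"
  proof (rule integral_abs_bound_integral[OF i2])
    show "integrable lborel (\<lambda>z. step'_sup * (1 / \<epsilon> * (indicator (tube \<epsilon>) z * \<bar>g z\<bar>)))"
      by (intro integrable_mult_right integrable_indicator_g tube_borel)
    fix z
    show "\<bar>f2 z\<bar> \<le> step'_sup * (1 / \<epsilon> * (indicator (tube \<epsilon>) z * \<bar>g z\<bar>))"
    proof (cases "z \<in> R \<or> F z = 0")
      case True
      then show ?thesis using \<epsilon> step'_sup(1) by (auto simp: f2_def)
    next
      case False
      then have gz: "g z \<noteq> 0" and pz: "profile \<epsilon> z \<noteq> 0" and "z \<notin> R" by (auto simp: F_def)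
      have zT: "z \<in> T" using gz borel_weak_gradientD(5)[OF weak] by blast
      have nz: "b < n \<bullet> z \<and> n \<bullet> z < b + \<epsilon>" by (rule profile_bounds(3)[OF \<epsilon> pz])
      from \<open>z \<notin> R\<close> obtain k where k: "k \<in> J - {j}" "\<bar>nv k \<bullet> hproj n b z - bv k\<bar> < 2 * \<epsilon>"
        unfolding R_def clear_def by (auto simp: not_le)
      have "\<bar>nv k \<bullet> n\<bar> \<le> 1" using Cauchy_Schwarz_ineq2[of "nv k" n] unit_n unit_nv[of k] k by simp
      then have "\<bar>(n \<bullet> z - b) * (nv k \<bullet> n)\<bar> \<le> n \<bullet> z - b" using nz by (simp add: abs_mult mult_left_le)
      then have "\<bar>nv k \<bullet> z - bv k\<bar> < 3 * \<epsilon>"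
        using k(2) nz unfolding hproj_def inner_diff_right inner_scaleR_right by linarith
      then have "z \<in> tube \<epsilon>" using zT nz k(1) by (auto simp: tube_def)
      moreover have "\<bar>F z\<bar> \<le> \<bar>g z\<bar> * (step'_sup / \<epsilon>)"
        unfolding F_def abs_mult[of "g z"] by (intro mult_left_mono profile_cutoff_bound \<epsilon>) simp
      ultimately show ?thesis using \<open>z \<notin> R\<close> by (simp add: f2_def mult.commute)
    qed
  qed
  then have e2: "\<bar>LINT z|lborel. f2 z\<bar> \<le> step'_sup * (1 / \<epsilon> * (LBINT z. indicator (tube \<epsilon>) z * \<bar>g z\<bar>))" by simp
  define k where "k = (\<lambda>z. indicator {z. b \<le> n \<bullet> z \<and> n \<bullet> z \<le> b + \<epsilon>} z * \<bar>h z \<bullet> n\<bar>)"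
  have ihn: "integrable lborel (\<lambda>z. \<bar>h z \<bullet> n\<bar>)" using integrable_h by auto
  have ik: "integrable lborel k"
    unfolding k_def using integrable_mult_indicator[OF _ ihn, of "{z. b \<le> n \<bullet> z \<and> n \<bullet> z \<le> b + \<epsilon>}"] by simp
  note F1 = normal_Fubini[OF unit_n i1, of b] and Fk = normal_Fubini[OF unit_n ik, of b]
  have ib: "integrable (hmeas n b) (\<lambda>x. indicator (side_at \<epsilon>) x * btrace n g x)"
  proof -
    have "integrable (hmeas n b) (\<lambda>x. indicator (side_at \<epsilon>) x *\<^sub>R (indicator side x * btrace n g x))"
      by (rule integrable_mult_indicator[OF _ integrable_trace]) simp
    moreover have "indicator (side_at \<epsilon>) x *\<^sub>R (indicator side x * btrace n g x) = indicator (side_at \<epsilon>) x * btrace n g x" for x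
      using side_iff[of x] \<epsilon> by (auto simp: indicator_def)
    ultimately show ?thesis by (simp only:)
  qed
  have AEx: "AE x in hmeas n b. \<bar>(LBINT s. f1 (x + s *\<^sub>R n)) - indicator (side_at \<epsilon>) x * btrace n g x\<bar> \<le> (LBINT s. k (x + s *\<^sub>R n))"
    using AE_hmeas_hyperplane[OF unit_n, of b] trace_on_side_at[OF \<epsilon>] line_integrable normal_Fubini(1)[OF unit_n integrable_g, of b]
  proof eventually_elim
    case (elim x)
    have nx: "n \<bullet> (x + s *\<^sub>R n) - b = s" "hproj n b (x + s *\<^sub>R n) = x" for s
      using elim(1) by (simp_all add: inner_add_right hproj_normal[OF unit_n])
    have pr: "profile \<epsilon> (x + s *\<^sub>R n) = step' (s / \<epsilon>) / \<epsilon>" for s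
      unfolding profile_def nx ..
    have p0: "step' (s / \<epsilon>) = 0" if "\<not> (0 < s \<and> s < \<epsilon>)" for s
    proof (rule step'_eq_0)
      have "s / \<epsilon> \<le> 0 \<or> 1 \<le> s / \<epsilon>" using that \<epsilon> by (auto simp: divide_nonpos_pos le_divide_eq)
      then show "s / \<epsilon> \<le> 1/2 \<or> 1 \<le> s / \<epsilon>" by linarith
    qed
    have kx: "k (x + s *\<^sub>R n) = indicator {0..\<epsilon>} s * \<bar>h (x + s *\<^sub>R n) \<bullet> n\<bar>" for s
      using nx(1)[of s] by (auto simp: k_def indicator_def)
    have f1x: "f1 (x + s *\<^sub>R n) = indicator (side_at \<epsilon>) x * (g (x + s *\<^sub>R n) * (step' (s / \<epsilon>) / \<epsilon>))" for s
    proof (cases "0 < s \<and> s < \<epsilon> \<and> x \<in> clear \<epsilon>")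
      case True
      have "cutoff \<epsilon> (x + s *\<^sub>R n) = 1"
        unfolding cutoff_def
      proof (rule prod.neutral, rule ballI)
        fix l assume "l \<in> J - {j}"
        then have "\<epsilon> \<le> \<bar>nv l \<bullet> (x + s *\<^sub>R n) - bv l\<bar>" using clear_shift[of x \<epsilon> l s] True by auto
        then show "notch ((nv l \<bullet> (x + s *\<^sub>R n) - bv l) / \<epsilon>) = 1"
          using \<epsilon> by (intro notch_eq_1) (simp add: abs_divide le_divide_eq)
      qed
      \<comment> \<open>Above a clear foot point that is not on the side, the segment misses T,
        where g is zero.\<close>
      moreover have "g (x + s *\<^sub>R n) = 0" if "x \<notin> side_at \<epsilon>"
        using segment_T_iff[OF elim(1), of \<epsilon> s] True that borel_weak_gradientD(5)[OF weak] by auto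
      ultimately show ?thesis using True by (auto simp: f1_def F_def pr R_def nx(2) indicator_def)
    next
      case False
      then show ?thesis
        using p0[of s] side_atD(2)[of x \<epsilon>] by (auto simp: f1_def F_def pr R_def nx(2) indicator_def)
    qed
    show ?case
    proof (cases "x \<in> side_at \<epsilon>")
      case False
      then show ?thesis by (simp add: f1x kx)
    next
      case True
      define L where "L = (LBINT q. indicator {0..\<epsilon>} q * \<bar>h (x + q *\<^sub>R n) \<bullet> n\<bar>)"
      have rep: "AE s in lborel. 0 < s \<and> s < 2 * \<epsilon> \<longrightarrow>
          g (x + s *\<^sub>R n) = btrace n g x + (LBINT q. indicator {0..s} q * (h (x + q *\<^sub>R n) \<bullet> n))"
        using elim(2) True by blast
      have ig: "integrable lborel (\<lambda>s. g (x + s *\<^sub>R n) * (step' (s / \<epsilon>) / \<epsilon>))"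
      proof (rule integrable_mult_bounded[OF elim(4)])
        show "\<bar>step' (s / \<epsilon>) / \<epsilon>\<bar> \<le> step'_sup / \<epsilon>" for s
          using step'_nonneg step'_sup(2) \<epsilon> by (simp add: divide_right_mono)
      qed measurable
      have it: "integrable lborel (\<lambda>s. btrace n g x * (step' (s / \<epsilon>) / \<epsilon>))"
        using step'_scaled(2)[OF \<epsilon>] by (rule integrable_mult_right)
      have "(LBINT s. g (x + s *\<^sub>R n) * (step' (s / \<epsilon>) / \<epsilon>)) - btrace n g x
        = (LBINT s. g (x + s *\<^sub>R n) * (step' (s / \<epsilon>) / \<epsilon>)) - (LBINT s. btrace n g x * (step' (s / \<epsilon>) / \<epsilon>))"
        unfolding integral_mult_right_zero step'_scaled(1)[OF \<epsilon>] by simp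
      also have "\<dots> = (LBINT s. g (x + s *\<^sub>R n) * (step' (s / \<epsilon>) / \<epsilon>) - btrace n g x * (step' (s / \<epsilon>) / \<epsilon>))"
        using ig it by simp
      also have "norm \<dots> \<le> (LBINT s. L * (step' (s / \<epsilon>) / \<epsilon>))"
      proof (rule order_trans[OF integral_norm_bound], rule integral_mono_AE)
        show "AE s in lborel. norm (g (x + s *\<^sub>R n) * (step' (s / \<epsilon>) / \<epsilon>) - btrace n g x * (step' (s / \<epsilon>) / \<epsilon>)) \<le> L * (step' (s / \<epsilon>) / \<epsilon>)"
          using rep
        proof eventually_elim
          case (elim s)
          show ?case
          proof (cases "0 < s \<and> s < \<epsilon>")
            case s: True
            then have eq: "g (x + s *\<^sub>R n) - btrace n g x = (LBINT q. indicator {0..s} q * (h (x + q *\<^sub>R n) \<bullet> n))" using elim by simp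
            have "\<bar>g (x + s *\<^sub>R n) - btrace n g x\<bar> \<le> L"
              unfolding eq L_def by (rule primitive_bound) (use \<open>integrable lborel (\<lambda>s. h (x + s *\<^sub>R n) \<bullet> n)\<close> s in auto)
            then have "\<bar>g (x + s *\<^sub>R n) - btrace n g x\<bar> * (step' (s / \<epsilon>) / \<epsilon>) \<le> L * (step' (s / \<epsilon>) / \<epsilon>)"
              using step'_nonneg \<epsilon> by (intro mult_right_mono) auto
            moreover have "norm (g (x + s *\<^sub>R n) * (step' (s / \<epsilon>) / \<epsilon>) - btrace n g x * (step' (s / \<epsilon>) / \<epsilon>)) =
               \<bar>g (x + s *\<^sub>R n) - btrace n g x\<bar> * (step' (s / \<epsilon>) / \<epsilon>)"
              unfolding left_diff_distrib[symmetric] using step'_nonneg[of "s / \<epsilon>"] \<epsilon> by (simp add: abs_mult)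
            ultimately show ?thesis by simp
          next
            case False
            then show ?thesis by (simp add: p0)
          qed
        qed
        show "integrable lborel (\<lambda>s. norm (g (x + s *\<^sub>R n) * (step' (s / \<epsilon>) / \<epsilon>) - btrace n g x * (step' (s / \<epsilon>) / \<epsilon>)))"
          by (intro integrable_norm Bochner_Integration.integrable_diff ig it)
        show "integrable lborel (\<lambda>s. L * (step' (s / \<epsilon>) / \<epsilon>))" by (intro integrable_mult_right step'_scaled(2) \<epsilon>)
      qed
      also have "\<dots> = L" unfolding integral_mult_right_zero step'_scaled(1)[OF \<epsilon>] by simp
      finally show ?thesis using True by (simp add: f1x kx L_def)
    qed
  qed
  have "(LBINT z. f1 z) - (LINT x|hmeas n b. indicator (side_at \<epsilon>) x * btrace n g x) =
     (LINT x|hmeas n b. (LBINT s. f1 (x + s *\<^sub>R n)) - indicator (side_at \<epsilon>) x * btrace n g x)"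
    using F1(2) ib unfolding F1(3)[symmetric] by simp
  also have "norm \<dots> \<le> (LINT x|hmeas n b. (LBINT s. k (x + s *\<^sub>R n)))"
  proof (rule order_trans[OF integral_norm_bound], rule integral_mono_AE)
    show "integrable (hmeas n b) (\<lambda>x. norm ((LBINT s. f1 (x + s *\<^sub>R n)) - indicator (side_at \<epsilon>) x * btrace n g x))"
      by (intro integrable_norm Bochner_Integration.integrable_diff F1(2) ib)
  qed (use AEx Fk(2) in auto)
  also have "\<dots> = (LBINT z. k z)" by (rule Fk(3))
  finally have "\<bar>(LBINT z. f1 z) - (LINT x|hmeas n b. indicator (side_at \<epsilon>) x * btrace n g x)\<bar> \<le> (LBINT z. k z)"
    by simp
  then show ?thesis
    using e2 split unfolding F_def k_def by linarith
qed

text \<open>Both terms of \<open>side_error\<close> tend to 0. The integrals over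
  \<open>side_at\<close> tend to the one over \<open>side\<close> because the trace is integrable
  and dominates them.\<close>

lemma side_limit:
  "(\<lambda>m. LINT z|lborel. g z * (profile (1 / real (Suc m)) z * cutoff (1 / real (Suc m)) z))
     \<longlonglongrightarrow> (LINT x|hmeas n b. indicator side x * btrace n g x)"
proof -
  let ?e = "\<lambda>m. 1 / real (Suc m)"
  let ?X = "\<lambda>m. LINT z|lborel. g z * (profile (?e m) z * cutoff (?e m) z)"
  let ?Y = "\<lambda>m. LINT x|hmeas n b. indicator (side_at (?e m)) x * btrace n g x"
  have "?Y \<longlonglongrightarrow> (LINT x|hmeas n b. indicator side x * btrace n g x)"
  proof (rule integral_dominated_convergence[where w="\<lambda>x. \<bar>indicator side x * btrace n g x\<bar>"])
    show "AE x in hmeas n b. (\<lambda>m. indicator (side_at (?e m)) x * btrace n g x) \<longlonglongrightarrow> indicator side x * btrace n g x"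
    proof (rule AE_I2)
      fix x
      show "(\<lambda>m. indicator (side_at (?e m)) x * btrace n g x) \<longlonglongrightarrow> indicator side x * btrace n g x"
      proof (cases "x \<in> side")
        case True
        then obtain m0 where m0: "x \<in> side_at (?e m0)" by (auto simp: side_def)
        have "x \<in> side_at (?e m)" if "m \<ge> m0" for m
          using side_at_mono[of "?e m" "?e m0"] that m0 by (auto simp: frac_le)
        then show ?thesis
          using True by (intro tendsto_eventually) (auto simp: eventually_sequentially intro!: exI[of _ m0])
      next
        case False
        then have "x \<notin> side_at (?e m)" for m by (auto simp: side_def)
        then show ?thesis using False by simp
      qed
    qed
    show "integrable (hmeas n b) (\<lambda>x. \<bar>indicator side x * btrace n g x\<bar>)"
      using integrable_trace by (rule integrable_abs)
    show "AE x in hmeas n b. norm (indicator (side_at (?e m)) x * btrace n g x) \<le> \<bar>indicator side x * btrace n g x\<bar>" for m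
    proof (rule AE_I2)
      fix x
      have "x \<in> side_at (?e m) \<Longrightarrow> x \<in> side" by (auto simp: side_def)
      then show "norm (indicator (side_at (?e m)) x * btrace n g x) \<le> \<bar>indicator side x * btrace n g x\<bar>"
        by (auto simp: indicator_def)
    qed
  qed measurable
  moreover have "(\<lambda>m. ?X m - ?Y m) \<longlonglongrightarrow> 0"
  proof (rule Lim_null_comparison)
    show "eventually (\<lambda>m. norm (?X m - ?Y m) \<le> step'_sup * (real (Suc m) * (LBINT z. indicator (tube (?e m)) z * \<bar>g z\<bar>)) +
       (LBINT z. indicator {z. b \<le> n \<bullet> z \<and> n \<bullet> z \<le> b + ?e m} z * \<bar>h z \<bullet> n\<bar>)) sequentially"
    proof (rule always_eventually, rule allI)
      fix m
      have "?e m > 0" "1 / ?e m = real (Suc m)" by simp_all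
      from side_error[OF this(1)] show "norm (?X m - ?Y m) \<le> step'_sup * (real (Suc m) * (LBINT z. indicator (tube (?e m)) z * \<bar>g z\<bar>)) +
       (LBINT z. indicator {z. b \<le> n \<bullet> z \<and> n \<bullet> z \<le> b + ?e m} z * \<bar>h z \<bullet> n\<bar>)"
        unfolding \<open>1 / ?e m = real (Suc m)\<close> real_norm_def .
    qed
    have "(\<lambda>m. step'_sup * (real (Suc m) * (LBINT z. indicator (tube (?e m)) z * \<bar>g z\<bar>)) +
       (LBINT z. indicator {z. b \<le> n \<bullet> z \<and> n \<bullet> z \<le> b + ?e m} z * \<bar>h z \<bullet> n\<bar>)) \<longlonglongrightarrow> step'_sup * 0 + 0"
      by (intro tendsto_add tendsto_mult tendsto_const tube_integral_tendsto_0 strip_integral_tendsto_0)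
        (use integrable_h unit_n in auto)
    then show "(\<lambda>m. step'_sup * (real (Suc m) * (LBINT z. indicator (tube (?e m)) z * \<bar>g z\<bar>)) +
       (LBINT z. indicator {z. b \<le> n \<bullet> z \<and> n \<bullet> z \<le> b + ?e m} z * \<bar>h z \<bullet> n\<bar>)) \<longlonglongrightarrow> 0" by simp
  qed
  ultimately have "(\<lambda>m. (?X m - ?Y m) + ?Y m) \<longlonglongrightarrow> 0 + (LINT x|hmeas n b. indicator side x * btrace n g x)"
    by (intro tendsto_add)
  then show ?thesis by simp
qed

end

section \<open>The divergence theorem on polyhedral sets\<close>

lemma hmeas_minus: "hmeas (- n) (- b) = hmeas n b"
proof -
  have "{z. \<bar>- n \<bullet> z - - b\<bar> \<le> 1/2} = {z. \<bar>n \<bullet> z - b\<bar> \<le> 1/2}" by (simp add: abs_minus_commute)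
  moreover have "hproj (- n) (- b) = hproj n b" by (auto simp: hproj_def algebra_simps)
  ultimately show ?thesis unfolding hmeas_def by simp
qed

context polyhedral_set
begin

definition half_side :: "'j \<Rightarrow> real^'n \<Rightarrow> (real^'n) set" where
  "half_side j n = {x. nv j \<bullet> x = bv j \<and> (\<forall>k\<in>J - {j}. nv k \<bullet> x \<noteq> bv k) \<and> (\<exists>\<delta>>0. \<forall>s. 0 < s \<and> s < \<delta> \<longrightarrow> x + s *\<^sub>R n \<in> T)}"

text \<open>The direction \<open>n\<close> points into \<open>T\<close>.\<close>

definition boundary_side :: "'j \<Rightarrow> real^'n \<Rightarrow> (real^'n) set" where
  "boundary_side j n = half_side j n - half_side j (- n)"

text \<open>Near x only hyperplane j is present, so both open half balls lie in T and the whole ball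
  lies in its closure. Regularity of T then puts x into T.\<close>

lemma both_sides_in_T:
  assumes j: "j \<in> J" and x: "x \<in> half_side j (nv j)" "x \<in> half_side j (- nv j)"
  shows "x \<in> T"
proof -
  have nx: "nv j \<bullet> x = bv j" and off: "\<And>k. k \<in> J - {j} \<Longrightarrow> nv k \<bullet> x \<noteq> bv k"
    using x by (auto simp: half_side_def)
  define U where "U = (\<Inter>k\<in>J - {j}. {z. nv k \<bullet> z \<noteq> bv k})"
  have "open U" unfolding U_def using finite_J
    by (intro open_INT) (auto simp: open_Collect_neq continuous_on_inner continuous_on_id continuous_on_const)
  moreover have "x \<in> U" using off by (simp add: U_def)
  ultimately obtain r where r: "r > 0" "ball x r \<subseteq> U" by (meson openE)
  have half: "ball x r \<inter> {z. m \<bullet> z > c} \<subseteq> T"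
    if m: "m = nv j \<and> c = bv j \<or> m = - nv j \<and> c = - bv j" and xm: "x \<in> half_side j m" for m c
  proof -
    have nm: "norm m = 1" "m \<bullet> m = 1" "m \<bullet> x = c" using m unit_nv[OF j] unit_inner[OF unit_nv[OF j]] nx by auto
    obtain \<delta> where \<delta>: "\<delta> > 0" "\<And>s. 0 < s \<Longrightarrow> s < \<delta> \<Longrightarrow> x + s *\<^sub>R m \<in> T" using xm by (auto simp: half_side_def)
    define s where "s = min \<delta> r / 2"
    have s: "0 < s" "s < \<delta>" "s < r" using \<delta> r by (auto simp: s_def)
    show ?thesis
    proof (rule connected_off_hyperplanes)
      show "connected (ball x r \<inter> {z. m \<bullet> z > c})"
        by (intro convex_connected convex_Int convex_ball convex_halfspace_gt)
      show "x + s *\<^sub>R m \<in> ball x r \<inter> {z. m \<bullet> z > c}"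
        using s nm by (simp add: dist_norm inner_add_right)
      show "x + s *\<^sub>R m \<in> T" using \<delta>(2) s by blast
      show "nv k \<bullet> z \<noteq> bv k" if "z \<in> ball x r \<inter> {z. m \<bullet> z > c}" "k \<in> J" for z k
      proof (cases "k = j")
        case True then show ?thesis using that m by auto
      next
        case False
        then have "k \<in> J - {j}" using that by simp
        moreover have "z \<in> U" using that r by blast
        ultimately show ?thesis unfolding U_def by blast
      qed
    qed
  qed
  have h1: "ball x r \<inter> {z. nv j \<bullet> z > bv j} \<subseteq> T" using half[of "nv j" "bv j"] x by blast
  have h2: "ball x r \<inter> {z. - nv j \<bullet> z > - bv j} \<subseteq> T" using half[of "- nv j" "- bv j"] x by blast
  have "ball x r \<subseteq> closure T"
  proof
    fix y assume y: "y \<in> ball x r"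
    show "y \<in> closure T"
    proof (cases "nv j \<bullet> y = bv j")
      case False
      then have "y \<in> T" using h1 h2 y by (cases "nv j \<bullet> y > bv j") auto
      then show ?thesis using closure_subset by blast
    next
      case True
      show ?thesis unfolding closure_approachable
      proof (intro allI impI)
        fix e :: real assume "e > 0"
        define s where "s = min e (r - dist x y) / 2"
        have s: "0 < s" "s < e" "s < r - dist x y" using \<open>e > 0\<close> y by (auto simp: s_def)
        have nn: "norm (nv j) = 1" by (rule unit_nv[OF j])
        have "dist x (y + s *\<^sub>R nv j) \<le> dist x y + dist y (y + s *\<^sub>R nv j)" by (rule dist_triangle)
        also have "dist y (y + s *\<^sub>R nv j) = s" using s nn by (simp add: dist_norm)
        finally have "y + s *\<^sub>R nv j \<in> ball x r" using s by simp
        moreover have "nv j \<bullet> (y + s *\<^sub>R nv j) > bv j"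
          using True s unit_inner[OF nn] by (simp add: inner_add_right)
        ultimately have "y + s *\<^sub>R nv j \<in> T" using h1 by blast
        moreover have "dist (y + s *\<^sub>R nv j) y < e" using s nn by (simp add: dist_norm)
        ultimately show "\<exists>z\<in>T. dist z y < e" by blast
      qed
    qed
  qed
  then have "x \<in> interior (closure T)" using r(1) by (meson centre_in_ball interiorI open_ball)
  then show ?thesis using regular_T by simp
qed

lemma side_trace:
  assumes w: "borel_weak_gradient T g h" and j: "j \<in> J" and n: "n = nv j \<or> n = - nv j"
  shows "AE x in hmeas (nv j) (bv j). x \<in> half_side j n \<longrightarrow> ess_trace n g x (btrace n g x)"
    and "integrable (hmeas (nv j) (bv j)) (\<lambda>x. indicator (half_side j n) x * btrace n g x)"
    and "half_side j n \<in> sets borel"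
proof -
  \<comment> \<open>A unit vector differs from its negative, so n determines its orientation and
    hence the sign of the offset.\<close>
  define b where "b = (if n = nv j then bv j else - bv j)"
  have nn: "nv j \<noteq> - nv j"
  proof
    assume "nv j = - nv j"
    then have "nv j \<bullet> nv j = - (nv j \<bullet> nv j)" by (metis inner_minus_right)
    then show False using unit_inner[OF unit_nv[OF j]] by simp
  qed
  have nb: "n = nv j \<and> b = bv j \<or> n = - nv j \<and> b = - bv j" using n nn by (auto simp: b_def)
  interpret p: polyhedral_side T J nv bv j n b g h
    by unfold_locales (use j nb w in auto)
  have hm: "hmeas n b = hmeas (nv j) (bv j)" using nb hmeas_minus by auto
  have side: "p.side = half_side j n"
    by (rule set_eqI) (simp only: p.side_characterization half_side_def mem_Collect_eq p.side_j)
  show "AE x in hmeas (nv j) (bv j). x \<in> half_side j n \<longrightarrow> ess_trace n g x (btrace n g x)"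
    using p.trace_on_side unfolding hm side .
  show "integrable (hmeas (nv j) (bv j)) (\<lambda>x. indicator (half_side j n) x * btrace n g x)"
    using p.integrable_trace unfolding hm side .
  show "half_side j n \<in> sets borel" using p.side_borel unfolding side .
qed

lemma boundary_side_borel:
  "borel_weak_gradient T g h \<Longrightarrow> j \<in> J \<Longrightarrow> n = nv j \<or> n = - nv j \<Longrightarrow> boundary_side j n \<in> sets borel"
  unfolding boundary_side_def using side_trace(3)[of g h j n] side_trace(3)[of g h j "- n"] by auto

text \<open>Where T lies on both sides, hyperplane j passes through the interior of T and g is
  absolutely continuous along almost every whole normal segment through it, so the limits from the
  two sides coincide.\<close>

lemma interior_traces_agree:
  assumes w: "borel_weak_gradient T g h" and j: "j \<in> J"
  shows "AE x in hmeas (nv j) (bv j). x \<in> half_side j (nv j) \<and> x \<in> half_side j (- nv j) \<longrightarrow>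
    btrace (nv j) g x = btrace (- nv j) g x"
proof -
  interpret p: polyhedral_side T J nv bv j "nv j" "bv j" g h
    by unfold_locales (use j w in auto)
  interpret q: polyhedral_side T J nv bv j "- nv j" "- bv j" g h
    by unfold_locales (use j w in auto)
  have sp: "p.side = half_side j (nv j)"
    by (rule set_eqI) (simp only: p.side_characterization half_side_def mem_Collect_eq)
  have sq: "q.side = half_side j (- nv j)"
    by (rule set_eqI) (simp only: q.side_characterization half_side_def mem_Collect_eq q.side_j)
  have *: "AE x in hmeas (nv j) (bv j). x \<in> p.side_at \<delta> \<inter> q.side_at \<delta> \<longrightarrow> btrace (nv j) g x = btrace (- nv j) g x"
    if \<delta>: "\<delta> > 0" for \<delta>
  proof -
    have "AE x in hmeas (nv j) (bv j). x \<in> p.side_at \<delta> \<inter> q.side_at \<delta> \<longrightarrow> (\<exists>v. AE s in lborel. - \<delta> < s \<and> s < \<delta> \<longrightarrow>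
      g (x + s *\<^sub>R nv j) = v + (LBINT q. indicator {- \<delta>..s} q * (h (x + q *\<^sub>R nv j) \<bullet> nv j)))"
    proof (rule weak_gradient_on_normals[OF w open_T bounded_T p.unit_n])
      show "p.side_at \<delta> \<inter> q.side_at \<delta> \<in> sets borel" by auto
      show "- \<delta> < \<delta>" using \<delta> by simp
      fix x s assume x: "x \<in> p.side_at \<delta> \<inter> q.side_at \<delta>" and s: "- \<delta> < s" "s < \<delta>"
      consider "s = 0" | "0 < s" | "s < 0" by linarith
      then show "x + s *\<^sub>R nv j \<in> T"
      proof cases
        case 1
        have "x \<in> p.side" "x \<in> q.side" using x \<delta> p.side_iff q.side_iff by blast+
        then show ?thesis using both_sides_in_T[OF j] 1 unfolding sp sq by simp
      next
        case 2 then show ?thesis using p.side_atD(3)[of x \<delta> s] x s by auto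
      next
        case 3 then show ?thesis using q.side_atD(3)[of x \<delta> "- s"] x s by auto
      qed
    qed
    with p.line_integrable show ?thesis
    proof eventually_elim
      case (elim x)
      show ?case
      proof
        assume "x \<in> p.side_at \<delta> \<inter> q.side_at \<delta>"
        with elim(2) obtain v where v: "AE s in lborel. - \<delta> < s \<and> s < \<delta> \<longrightarrow>
          g (x + s *\<^sub>R nv j) = v + (LBINT q. indicator {- \<delta>..s} q * (h (x + q *\<^sub>R nv j) \<bullet> nv j))" by blast
        have d: "- \<delta> \<le> 0" "0 < \<delta>" "- \<delta> < 0" using \<delta> by auto
        show "btrace (nv j) g x = btrace (- nv j) g x"
          using btrace_eqI[OF p.g_measurable ess_trace_of_primitive(1)[OF elim(1) d(1,2) v]]
            btrace_eqI[OF p.g_measurable ess_trace_of_primitive(2)[OF elim(1) d(1,2) v d(3)]] by simp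
      qed
    qed
  qed
  have "AE x in hmeas (nv j) (bv j). \<forall>m. x \<in> p.side_at (1 / real (Suc m)) \<inter> q.side_at (1 / real (Suc m)) \<longrightarrow> btrace (nv j) g x = btrace (- nv j) g x"
    unfolding AE_all_countable by (intro allI *) simp
  then show ?thesis
  proof eventually_elim
    case (elim x)
    show ?case
    proof (intro impI)
      assume "x \<in> half_side j (nv j) \<and> x \<in> half_side j (- nv j)"
      then obtain m m' where m: "x \<in> p.side_at (1 / real (Suc m))" "x \<in> q.side_at (1 / real (Suc m'))"
        unfolding sp[symmetric] sq[symmetric] p.side_def q.side_def by blast
      have "1 / real (Suc (max m m')) \<le> 1 / real (Suc m)" "1 / real (Suc (max m m')) \<le> 1 / real (Suc m')"
        by (simp_all add: frac_le)
      then have "x \<in> p.side_at (1 / real (Suc (max m m')))" "x \<in> q.side_at (1 / real (Suc (max m m')))"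
        using p.side_at_mono[of "1 / real (Suc (max m m'))" "1 / real (Suc m)"]
          q.side_at_mono[of "1 / real (Suc (max m m'))" "1 / real (Suc m')"] m by auto
      then show "btrace (nv j) g x = btrace (- nv j) g x" using elim by blast
    qed
  qed
qed

definition cell_cutoff :: "real \<Rightarrow> real^'n \<Rightarrow> real" where
  "cell_cutoff \<epsilon> z = (if z \<in> T then \<Prod>k\<in>J. notch ((nv k \<bullet> z - bv k) / \<epsilon>) else 0)"

text \<open>At each point at most one of the two \<open>step'\<close> terms is nonzero (for
  \<epsilon> > 0); they are the profiles of the two sides of hyperplane j, with opposite
  normals.\<close>

definition cell_cutoff_gradient :: "real \<Rightarrow> real^'n \<Rightarrow> real^'n" where
  "cell_cutoff_gradient \<epsilon> z = (if z \<in> T then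
     \<Sum>j\<in>J. ((\<Prod>k\<in>J - {j}. notch ((nv k \<bullet> z - bv k) / \<epsilon>)) *
       ((step' ((nv j \<bullet> z - bv j) / \<epsilon>) - step' (- ((nv j \<bullet> z - bv j) / \<epsilon>))) / \<epsilon>)) *\<^sub>R nv j else 0)"

text \<open>The product of notches vanishes within \<epsilon>/2 of each hyperplane, hence near the
  frontier, so restricting it to T by \<open>C_k_restrict\<close> keeps it smooth and gives it
  compact support in T.\<close>

lemma cell_cutoff_test:
  assumes \<epsilon>: "\<epsilon> > 0"
  shows "cell_cutoff \<epsilon> \<in> test_functions T" and "GDERIV (cell_cutoff \<epsilon>) z :> cell_cutoff_gradient \<epsilon> z"
proof -
  define f where "f = (\<lambda>z. \<Prod>k\<in>J. notch ((nv k \<bullet> z - bv k) / \<epsilon>))"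
  define N where "N = (\<Union>k\<in>J. {z. \<bar>nv k \<bullet> z - bv k\<bar> < \<epsilon> / 2})"
  have N: "open N" unfolding N_def by (intro open_UN ballI open_Collect_less continuous_intros)
  have "hyperplane (nv k) (bv k) \<subseteq> N" if "k \<in> J" for k
    using that \<epsilon> unfolding N_def hyperplane_def by auto
  then have fN: "frontier T \<subseteq> N" using frontier_T by blast
  have f0: "f z = 0" if zN: "z \<in> N" for z
  proof -
    obtain k where k: "k \<in> J" "\<bar>nv k \<bullet> z - bv k\<bar> < \<epsilon> / 2" using zN unfolding N_def by blast
    then have "notch ((nv k \<bullet> z - bv k) / \<epsilon>) = 0"
      using \<epsilon> by (intro notch_eq_0) (simp add: abs_divide divide_le_eq)
    then show ?thesis unfolding f_def using finite_J k(1) by (intro prod_zero) auto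
  qed
  have ridge: "(nv k \<bullet> z - bv k) / \<epsilon> = ((1/\<epsilon>) *\<^sub>R nv k) \<bullet> z + (- bv k / \<epsilon>)" for k z
    by (simp add: diff_divide_distrib)
  have fC: "C_k m f" for m
    unfolding f_def ridge by (intro C_k_prod finite_J C_k_ridge C_k_notch)
  have eq: "cell_cutoff \<epsilon> = (\<lambda>z. if z \<in> T then f z else 0)" by (auto simp: cell_cutoff_def f_def)
  have "{z. cell_cutoff \<epsilon> z \<noteq> 0} \<subseteq> closure T - N"
    using f0 closure_subset[of T] by (auto simp: eq split: if_splits)
  moreover have "closed (closure T - N)" using N by (simp add: closed_Diff)
  ultimately have cl: "closure {z. cell_cutoff \<epsilon> z \<noteq> 0} \<subseteq> closure T - N" by (rule closure_minimal)
  also have "\<dots> \<subseteq> T" using fN open_T by (auto simp: frontier_def interior_open)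
  finally have "closure {z. cell_cutoff \<epsilon> z \<noteq> 0} \<subseteq> T" .
  moreover from this have "compact (closure {z. cell_cutoff \<epsilon> z \<noteq> 0})"
    unfolding compact_closure by (rule bounded_subset[OF bounded_T subset_trans[OF closure_subset]])
  moreover have "C_k m (cell_cutoff \<epsilon>)" for m
    unfolding eq by (rule C_k_restrict(1)[OF N fN open_T fC f0])
  ultimately show "cell_cutoff \<epsilon> \<in> test_functions T" by (auto simp: test_functions_def)
  define d where "d = (\<lambda>j z. ((step' ((nv j \<bullet> z - bv j) / \<epsilon>) - step' (- ((nv j \<bullet> z - bv j) / \<epsilon>))) / \<epsilon>) *\<^sub>R nv j)"
  have df: "GDERIV f z :> (\<Sum>j\<in>J. (\<Prod>k\<in>J - {j}. notch ((nv k \<bullet> z - bv k) / \<epsilon>)) *\<^sub>R d j z)" for z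
  proof -
    have g1: "GDERIV (\<lambda>z. notch ((nv j \<bullet> z - bv j) / \<epsilon>)) z :> d j z" for j
    proof -
      have "GDERIV (\<lambda>z. notch (((1/\<epsilon>) *\<^sub>R nv j) \<bullet> z + (- bv j / \<epsilon>))) z :>
         (step' (((1/\<epsilon>) *\<^sub>R nv j) \<bullet> z + (- bv j / \<epsilon>)) - step' (- (((1/\<epsilon>) *\<^sub>R nv j) \<bullet> z + (- bv j / \<epsilon>)))) *\<^sub>R ((1/\<epsilon>) *\<^sub>R nv j)"
        by (rule GDERIV_DERIV_compose[OF GDERIV_inner DERIV_notch])
      then show ?thesis unfolding ridge[symmetric] d_def by simp
    qed
    have "((\<lambda>z. \<Prod>k\<in>J. notch ((nv k \<bullet> z - bv k) / \<epsilon>)) has_derivative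
        (\<lambda>y. \<Sum>j\<in>J. (y \<bullet> d j z) * (\<Prod>k\<in>J - {j}. notch ((nv k \<bullet> z - bv k) / \<epsilon>)))) (at z)"
      by (rule has_derivative_prod) (use g1 in \<open>simp add: gderiv_def\<close>)
    then show ?thesis
      unfolding gderiv_def f_def inner_sum_right by (simp add: mult.commute)
  qed
  show "GDERIV (cell_cutoff \<epsilon>) z :> cell_cutoff_gradient \<epsilon> z"
    using C_k_restrict(2)[OF N fN open_T f0 df, of z] unfolding eq[symmetric] cell_cutoff_gradient_def d_def scaleR_scaleR .
qed

text \<open>The trace taken in direction - nv j carries the factor nv j, since T then lies below the
  hyperplane and nv j points outwards; the opposite trace enters with a minus. Hyperplanes passing
  through T still contribute from both sides at this stage.\<close>

theorem divergence_half_sides: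
  assumes w: "borel_weak_gradient T g h"
  shows "(LBINT z. h z \<bullet> e) = (\<Sum>j\<in>J. (nv j \<bullet> e) *
     ((LINT x|hmeas (nv j) (bv j). indicator (half_side j (- nv j)) x * btrace (- nv j) g x) -
      (LINT x|hmeas (nv j) (bv j). indicator (half_side j (nv j)) x * btrace (nv j) g x)))"
proof -
  note [measurable] = borel_weak_gradientD(1,2)[OF w]
  have ig: "integrable lborel g" and ih: "integrable lborel h"
    using borel_weak_gradient_integrable[OF w bounded_T] .
  let ?e = "\<lambda>m. 1 / real (Suc m)"
  define I where "I = (\<lambda>j n. LINT x|hmeas (nv j) (bv j). indicator (half_side j n) x * btrace n g x)"
  \<comment> \<open>The two factors are written with explicit locale parameters, because both
    orientations of every hyperplane occur in the same sum.\<close>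
  define X where "X = (\<lambda>m j n b. LINT z|lborel. g z * (polyhedral_side.profile n b (?e m) z * polyhedral_side.cutoff J nv bv j (?e m) z))"
  have lim: "(\<lambda>m. X m j n b) \<longlonglongrightarrow> I j n" "integrable lborel (\<lambda>z. g z * (polyhedral_side.profile n b (?e m) z * polyhedral_side.cutoff J nv bv j (?e m) z))"
    if j: "j \<in> J" and nb: "n = nv j \<and> b = bv j \<or> n = - nv j \<and> b = - bv j" for j n b m
  proof -
    interpret p: polyhedral_side T J nv bv j n b g h
      by unfold_locales (use j nb w in auto)
    have hm: "hmeas n b = hmeas (nv j) (bv j)" using nb hmeas_minus by auto
    have side: "p.side = half_side j n"
      by (rule set_eqI) (simp only: p.side_characterization half_side_def mem_Collect_eq p.side_j)
    show "(\<lambda>m. X m j n b) \<longlonglongrightarrow> I j n"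
      using p.side_limit unfolding hm side X_def I_def .
    show "integrable lborel (\<lambda>z. g z * (p.profile (?e m) z * p.cutoff (?e m) z))"
      by (rule p.integrable_profile) simp
  qed
  have A: "(LBINT z. g z * (cell_cutoff_gradient (?e m) z \<bullet> e)) =
      (\<Sum>j\<in>J. (nv j \<bullet> e) * (X m j (nv j) (bv j) - X m j (- nv j) (- bv j)))" for m
  proof -
    define F where "F = (\<lambda>j n b z. g z * (polyhedral_side.profile n b (?e m) z * polyhedral_side.cutoff J nv bv j (?e m) z))"
    have iF: "integrable lborel (F j (nv j) (bv j))" "integrable lborel (F j (- nv j) (- bv j))" if "j \<in> J" for j
      unfolding F_def using lim(2)[OF that] by auto
    have pt: "g z * (cell_cutoff_gradient (?e m) z \<bullet> e) = (\<Sum>j\<in>J. (nv j \<bullet> e) * (F j (nv j) (bv j) z - F j (- nv j) (- bv j) z))" for z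
    proof (cases "z \<in> T")
      case False
      then show ?thesis using borel_weak_gradientD(5)[OF w] by (simp add: F_def)
    next
      case True
      have "g z * (cell_cutoff_gradient (?e m) z \<bullet> e) = (\<Sum>j\<in>J. g z * (((\<Prod>k\<in>J - {j}. notch ((nv k \<bullet> z - bv k) / ?e m)) *
       ((step' ((nv j \<bullet> z - bv j) / ?e m) - step' (- ((nv j \<bullet> z - bv j) / ?e m))) / ?e m)) * (nv j \<bullet> e)))"
        unfolding cell_cutoff_gradient_def if_P[OF True] inner_sum_left inner_scaleR_left sum_distrib_left ..
      also have "\<dots> = (\<Sum>j\<in>J. (nv j \<bullet> e) * (F j (nv j) (bv j) z - F j (- nv j) (- bv j) z))"
      proof (rule sum.cong[OF refl])
        fix j assume j: "j \<in> J"
        interpret p: polyhedral_side T J nv bv j "nv j" "bv j" g h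
          by unfold_locales (use j w in auto)
        interpret q: polyhedral_side T J nv bv j "- nv j" "- bv j" g h
          by unfold_locales (use j w in auto)
        have mi: "(- nv j \<bullet> z - - bv j) / ?e m = - ((nv j \<bullet> z - bv j) / ?e m)"
          by (simp only: inner_minus_left minus_diff_minus minus_divide_left)
        show "g z * (((\<Prod>k\<in>J - {j}. notch ((nv k \<bullet> z - bv k) / ?e m)) *
          ((step' ((nv j \<bullet> z - bv j) / ?e m) - step' (- ((nv j \<bullet> z - bv j) / ?e m))) / ?e m)) * (nv j \<bullet> e))
          = (nv j \<bullet> e) * (F j (nv j) (bv j) z - F j (- nv j) (- bv j) z)"
          unfolding F_def p.profile_def q.profile_def p.cutoff_def mi by (simp add: algebra_simps diff_divide_distrib)
      qed
      finally show ?thesis .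
    qed
    have XF: "X m j n b = (LBINT z. F j n b z)" for j n b by (simp only: X_def F_def)
    show ?thesis
      unfolding pt XF using iF by (subst Bochner_Integration.integral_sum) auto
  qed
  have B: "(LBINT z. g z * (cell_cutoff_gradient (?e m) z \<bullet> e)) = - (LBINT z. cell_cutoff (?e m) z * (h z \<bullet> e))" for m
  proof -
    have em: "?e m > 0" by simp
    note t = cell_cutoff_test[OF em]
    have eq: "(LBINT z. g z *\<^sub>R cell_cutoff_gradient (?e m) z) = - (LBINT z. cell_cutoff (?e m) z *\<^sub>R h z)"
      by (rule borel_weak_gradientD(7)[OF w t])
    obtain B where B: "\<And>x. \<bar>cell_cutoff (?e m) x\<bar> \<le> B" using test_function_bounded[OF t(1)] by blast
    obtain B' where B': "\<And>x. norm (cell_cutoff_gradient (?e m) x) \<le> B'" using test_function_gderiv_bounded[OF t] by blast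
    have [measurable]: "cell_cutoff (?e m) \<in> borel_measurable borel" "cell_cutoff_gradient (?e m) \<in> borel_measurable borel"
      using test_function_continuous[OF t(1)] test_function_gderiv_continuous[OF t]
      by (auto intro: borel_measurable_continuous_onI)
    have ia: "integrable lborel (\<lambda>z. g z *\<^sub>R cell_cutoff_gradient (?e m) z)"
    proof (rule Bochner_Integration.integrable_bound[of _ "\<lambda>x. B' * g x"])
      show "AE x in lborel. norm (g x *\<^sub>R cell_cutoff_gradient (?e m) x) \<le> norm (B' * g x)"
        using B' order_trans[OF norm_ge_zero B'] by (auto simp: abs_mult mult.commute[of B'] intro!: mult_left_mono)
      show "(\<lambda>z. g z *\<^sub>R cell_cutoff_gradient (?e m) z) \<in> borel_measurable lborel" by measurable
    qed (use ig in simp)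
    have ib: "integrable lborel (\<lambda>z. cell_cutoff (?e m) z *\<^sub>R h z)"
    proof (rule Bochner_Integration.integrable_bound[of _ "\<lambda>x. B * norm (h x)"])
      show "AE x in lborel. norm (cell_cutoff (?e m) x *\<^sub>R h x) \<le> norm (B * norm (h x))"
        using B order_trans[OF abs_ge_zero B] by (auto simp: abs_mult intro!: mult_right_mono)
      show "(\<lambda>z. cell_cutoff (?e m) z *\<^sub>R h z) \<in> borel_measurable lborel" by measurable
    qed (use ih in simp)
    have "(LBINT z. g z * (cell_cutoff_gradient (?e m) z \<bullet> e)) = (LBINT z. g z *\<^sub>R cell_cutoff_gradient (?e m) z) \<bullet> e"
      using ia by (subst integral_inner_left[symmetric]) auto
    also have "\<dots> = - (LBINT z. cell_cutoff (?e m) z * (h z \<bullet> e))"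
      unfolding eq inner_minus_left using ib by (subst integral_inner_left[symmetric]) auto
    finally show ?thesis .
  qed
  have "(\<lambda>m. LINT z|lborel. cell_cutoff (?e m) z * (h z \<bullet> e)) \<longlonglongrightarrow> (LBINT z. h z \<bullet> e)"
  proof (rule integral_dominated_convergence[where w="\<lambda>z. \<bar>h z \<bullet> e\<bar>"])
    have cb: "\<bar>cell_cutoff (?e m) z\<bar> \<le> 1" for m z
      unfolding cell_cutoff_def by (auto simp: abs_prod intro!: prod_le_1 notch_bounds abs_of_nonneg) (simp add: abs_of_nonneg[OF notch_bounds(1)] notch_bounds)
    show "AE z in lborel. norm (cell_cutoff (?e m) z * (h z \<bullet> e)) \<le> \<bar>h z \<bullet> e\<bar>" for m
      using cb[of m] by (auto simp: abs_mult intro!: mult_left_le_one_le)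
    have "AE z in lborel. \<forall>k\<in>J. nv k \<bullet> z \<noteq> bv k"
      using finite_J
    proof (rule AE_finite_allI)
      fix k assume "k \<in> J"
      then have "nv k \<noteq> 0" using unit_nv[of k] by auto
      then show "AE z in lborel. nv k \<bullet> z \<noteq> bv k" by (rule AE_not_hyperplane)
    qed
    then show "AE z in lborel. (\<lambda>m. cell_cutoff (?e m) z * (h z \<bullet> e)) \<longlonglongrightarrow> h z \<bullet> e"
    proof eventually_elim
      case (elim z)
      show ?case
      proof (cases "z \<in> T")
        case False
        then show ?thesis using borel_weak_gradientD(6)[OF w] by simp
      next
        case True
        have "(\<lambda>m. notch ((nv k \<bullet> z - bv k) / ?e m)) \<longlonglongrightarrow> 1" if k: "k \<in> J" for k
        proof -
          have "\<bar>nv k \<bullet> z - bv k\<bar> > 0" using elim k by simp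
          then obtain N where N: "1 / real (Suc N) < \<bar>nv k \<bullet> z - bv k\<bar>" using nat_approx_posE by blast
          have "notch ((nv k \<bullet> z - bv k) / ?e m) = 1" if "N \<le> m" for m
          proof (rule notch_eq_1)
            have "?e m \<le> 1 / real (Suc N)" using that by (simp add: frac_le)
            then have "?e m \<le> \<bar>nv k \<bullet> z - bv k\<bar>" using N by linarith
            then show "1 \<le> \<bar>(nv k \<bullet> z - bv k) / ?e m\<bar>" unfolding abs_divide by (subst le_divide_eq_1) simp
          qed
          then show ?thesis by (intro tendsto_eventually) (auto simp only: eventually_sequentially)
        qed
        then have "(\<lambda>m. \<Prod>k\<in>J. notch ((nv k \<bullet> z - bv k) / ?e m)) \<longlonglongrightarrow> (\<Prod>k\<in>J. 1)" by (intro tendsto_prod)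
        then have "(\<lambda>m. cell_cutoff (?e m) z * (h z \<bullet> e)) \<longlonglongrightarrow> 1 * (h z \<bullet> e)"
          using True unfolding cell_cutoff_def by (intro tendsto_mult tendsto_const) simp
        then show ?thesis by simp
      qed
    qed
    show "(\<lambda>z. cell_cutoff (?e m) z * (h z \<bullet> e)) \<in> borel_measurable lborel" for m
      unfolding cell_cutoff_def by measurable
  qed (use ih in auto)
  then have "(\<lambda>m. - (LBINT z. cell_cutoff (?e m) z * (h z \<bullet> e))) \<longlonglongrightarrow> - (LBINT z. h z \<bullet> e)"
    by (rule tendsto_minus)
  moreover have "(\<lambda>m. \<Sum>j\<in>J. (nv j \<bullet> e) * (X m j (nv j) (bv j) - X m j (- nv j) (- bv j))) \<longlonglongrightarrow> (\<Sum>j\<in>J. (nv j \<bullet> e) * (I j (nv j) - I j (- nv j)))"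
    by (intro tendsto_sum tendsto_mult tendsto_const tendsto_diff lim(1)) auto
  ultimately have "- (LBINT z. h z \<bullet> e) = (\<Sum>j\<in>J. (nv j \<bullet> e) * (I j (nv j) - I j (- nv j)))"
    unfolding A[symmetric] B by (rule LIMSEQ_unique)
  then have "(LBINT z. h z \<bullet> e) = (\<Sum>j\<in>J. - ((nv j \<bullet> e) * (I j (nv j) - I j (- nv j))))"
    unfolding sum_negf by simp
  also have "\<dots> = (\<Sum>j\<in>J. (nv j \<bullet> e) * (I j (- nv j) - I j (nv j)))"
    by (intro sum.cong refl) (simp add: algebra_simps)
  finally show ?thesis unfolding I_def .
qed

text \<open>The parts of the half sides that T reaches from both directions cancel by
  \<open>interior_traces_agree\<close>; the boundary sides are what remains.\<close>

theorem divergence_boundary_sides: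
  assumes w: "borel_weak_gradient T g h"
  shows "(LBINT z. h z \<bullet> e) = (\<Sum>j\<in>J. (nv j \<bullet> e) *
     ((LINT x|hmeas (nv j) (bv j). indicator (boundary_side j (- nv j)) x * btrace (- nv j) g x) -
      (LINT x|hmeas (nv j) (bv j). indicator (boundary_side j (nv j)) x * btrace (nv j) g x)))"
  unfolding divergence_half_sides[OF w]
proof (intro sum.cong refl arg_cong2[of _ _ _ _ "(*)"])
  fix j assume j: "j \<in> J"
  note [measurable] = borel_weak_gradientD(1)[OF w]
  let ?M = "hmeas (nv j) (bv j)"
  let ?H = "\<lambda>n x. indicator (half_side j n) x * btrace n g x"
  let ?B = "\<lambda>n x. indicator (boundary_side j n) x * btrace n g x"
  note s = side_trace[OF w j]
  have iH: "integrable ?M (?H (nv j))" "integrable ?M (?H (- nv j))" using s(2) by auto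
  have [measurable]: "half_side j (nv j) \<in> sets borel" "half_side j (- nv j) \<in> sets borel" using s(3) by auto
  have [measurable]: "boundary_side j (nv j) \<in> sets borel" "boundary_side j (- nv j) \<in> sets borel"
    using boundary_side_borel[OF w j] by auto
  have "integrable ?M (\<lambda>x. indicator (boundary_side j n) x *\<^sub>R ?H n x)" if "n = nv j \<or> n = - nv j" for n
    using that iH by (intro integrable_mult_indicator) auto
  moreover have "indicator (boundary_side j n) x *\<^sub>R ?H n x = ?B n x" for n x
    by (auto simp: boundary_side_def indicator_def)
  ultimately have iB: "integrable ?M (?B n)" if "n = nv j \<or> n = - nv j" for n using that by (simp only:)
  have "(LINT x|?M. ?H (- nv j) x) - (LINT x|?M. ?H (nv j) x) = (LINT x|?M. ?H (- nv j) x - ?H (nv j) x)"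
    using iH by simp
  also have "\<dots> = (LINT x|?M. ?B (- nv j) x - ?B (nv j) x)"
  proof (rule integral_cong_AE)
    show "AE x in ?M. ?H (- nv j) x - ?H (nv j) x = ?B (- nv j) x - ?B (nv j) x"
      using interior_traces_agree[OF w j] by eventually_elim (auto simp: boundary_side_def indicator_def)
  qed measurable
  also have "\<dots> = (LINT x|?M. ?B (- nv j) x) - (LINT x|?M. ?B (nv j) x)" using iB by simp
  finally show "(LINT x|?M. ?H (- nv j) x) - (LINT x|?M. ?H (nv j) x) = (LINT x|?M. ?B (- nv j) x) - (LINT x|?M. ?B (nv j) x)" .
qed

end

section \<open>Cells and faces of a polytopal mesh\<close>

text \<open>Composed with the projection, the equation of the second hyperplane is affine in z. If
  its linear part is nonzero, the solutions form a null set. Otherwise the normals are parallel, and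
  the distinct hyperplanes are disjoint.\<close>

lemma AE_hmeas_not_hyperplane:
  fixes n n' :: "real^'n"
  assumes n: "norm n = 1" "norm n' = 1" and ne: "hyperplane n b \<noteq> hyperplane n' b'"
  shows "AE x in hmeas n b. n' \<bullet> x \<noteq> b'"
proof -
  define c where "c = n' \<bullet> n"
  have pr: "n' \<bullet> hproj n b z = (n' - c *\<^sub>R n) \<bullet> z + b * c" for z
    by (simp add: hproj_def c_def inner_diff_left inner_diff_right algebra_simps)
  have "emeasure lborel {z. \<bar>n \<bullet> z - b\<bar> \<le> 1/2 \<and> hproj n b z \<in> {x. n' \<bullet> x = b'}} = 0"
  proof (cases "n' - c *\<^sub>R n = 0")
    case True
    then have n'c: "n' = c *\<^sub>R n" by simp
    have "\<bar>c\<bar> = 1" using n unfolding n'c by simp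
    then have "c * c = 1" using abs_mult_self_eq[of c] by simp
    have "b * c \<noteq> b'"
    proof
      assume b': "b * c = b'"
      have "c \<noteq> 0" using \<open>\<bar>c\<bar> = 1\<close> by auto
      then have "hyperplane n b = hyperplane n' b'"
        unfolding hyperplane_def n'c b'[symmetric] by auto
      then show False using ne by simp
    qed
    then have e: "{z. \<bar>n \<bullet> z - b\<bar> \<le> 1/2 \<and> hproj n b z \<in> {x. n' \<bullet> x = b'}} = {}"
      unfolding mem_Collect_eq pr True by simp
    show ?thesis unfolding e by simp
  next
    case False
    have "AE z in lborel. (n' - c *\<^sub>R n) \<bullet> z \<noteq> b' - b * c" by (rule AE_not_hyperplane[OF False])
    then have "AE z in lborel. z \<notin> {z. \<bar>n \<bullet> z - b\<bar> \<le> 1/2 \<and> hproj n b z \<in> {x. n' \<bullet> x = b'}}"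
      by eventually_elim (simp add: pr)
    then have "{z. \<bar>n \<bullet> z - b\<bar> \<le> 1/2 \<and> hproj n b z \<in> {x. n' \<bullet> x = b'}} \<in> null_sets lborel"
      by (subst AE_iff_null_sets) auto
    then show ?thesis by (rule null_setsD1)
  qed
  then have "{x. n' \<bullet> x = b'} \<in> null_sets (hmeas n b)"
    by (intro null_setsI) (auto simp: emeasure_hmeas[OF n(1)])
  from AE_not_in[OF this] show ?thesis by simp
qed

text \<open>One normal and offset per hyperplane, chosen once for all, so that all faces in it, seen
  from whichever cell, are integrated with the same measure.\<close>

definition hyp_data :: "(real^'n) set \<Rightarrow> (real^'n) \<times> real" where
  "hyp_data H = (SOME p. norm (fst p) = 1 \<and> H = hyperplane (fst p) (snd p))"

definition hyp_normal :: "(real^'n) set \<Rightarrow> real^'n" where "hyp_normal H = fst (hyp_data H)"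
definition hyp_offset :: "(real^'n) set \<Rightarrow> real" where "hyp_offset H = snd (hyp_data H)"

abbreviation hyp_measure :: "(real^'n) set \<Rightarrow> (real^'n) measure" where
  "hyp_measure H \<equiv> hmeas (hyp_normal H) (hyp_offset H)"

lemma hyp_data:
  fixes F :: "(real^'n) set"
  assumes "aff_dim F = int CARD('n) - 1"
  shows "norm (hyp_normal (affine hull F)) = 1"
    and "affine hull F = hyperplane (hyp_normal (affine hull F)) (hyp_offset (affine hull F))"
proof -
  obtain a c where a: "a \<noteq> 0" "affine hull F = {x. a \<bullet> x = c}"
    using assms aff_dim_eq_hyperplane[of F] by auto
  have "affine hull F = hyperplane ((1 / norm a) *\<^sub>R a) (c / norm a)"
    unfolding a(2) hyperplane_def using a(1) by (auto simp: field_simps)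
  moreover have "norm ((1 / norm a) *\<^sub>R a) = 1" using a(1) by simp
  ultimately have "\<exists>p. norm (fst p) = 1 \<and> affine hull F = hyperplane (fst p) (snd p)"
    by (intro exI[of _ "((1 / norm a) *\<^sub>R a, c / norm a)"]) simp
  from someI_ex[OF this] show "norm (hyp_normal (affine hull F)) = 1"
    "affine hull F = hyperplane (hyp_normal (affine hull F)) (hyp_offset (affine hull F))"
    unfolding hyp_normal_def hyp_offset_def hyp_data_def by auto
qed

text \<open>A finite union of polytopes is closed, and the interior of a closed set is regular
  open.\<close>

lemma polytopal_domain_open_bounded:
  assumes "polytopal_domain T"
  shows "open T" "bounded T" "interior (closure T) = T"
proof -
  obtain P where P: "finite P" "\<forall>Q\<in>P. polytope Q" "T = interior (\<Union>P)"
    using assms by (auto simp: polytopal_domain_def)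
  show "open T" using P by simp
  have "bounded (\<Union>P)" using P(1,2) by (intro bounded_Union) (auto intro: polytope_imp_bounded)
  then show "bounded T" using P(3) interior_subset bounded_subset by blast
  have "closed (\<Union>P)" using P(1,2) by (intro closed_Union) (auto intro: polytope_imp_closed)
  then have "closure T \<subseteq> \<Union>P" unfolding P(3) by (intro closure_minimal interior_subset)
  then have "interior (closure T) \<subseteq> T" unfolding P(3) by (rule interior_mono)
  moreover have "T \<subseteq> interior (closure T)" using \<open>open T\<close> closure_subset by (intro interior_maximal)
  ultimately show "interior (closure T) = T" by blast
qed

locale mesh =
  fixes \<Omega> :: "(real^'n) set" and Th Fh :: "(real^'n) set set"
  assumes mesh: "polytopal_mesh \<Omega> Th Fh"
begin

lemma finite_Th: "finite Th" and finite_Fh: "finite Fh"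
  and disjoint_Th: "pairwise disjnt Th" and disjoint_Fh: "pairwise disjnt Fh"
  and cell_domain: "T \<in> Th \<Longrightarrow> polytopal_domain T" and cell_subset: "T \<in> Th \<Longrightarrow> T \<subseteq> \<Omega>"
  and closure_cells: "closure \<Omega> = (\<Union>T\<in>Th. closure T)"
  using mesh by (auto simp: polytopal_mesh_def polytopal_partition_def)

lemma cell_open: "T \<in> Th \<Longrightarrow> open T" and cell_bounded: "T \<in> Th \<Longrightarrow> bounded T"
  using polytopal_domain_open_bounded cell_domain by blast+

lemma face_nonempty: "F \<in> Fh \<Longrightarrow> F \<noteq> {}"
  and face_dim: "F \<in> Fh \<Longrightarrow> aff_dim F = int CARD('n) - 1"
  and face_open: "F \<in> Fh \<Longrightarrow> openin (top_of_set (affine hull F)) F"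
  and face_closure_null: "F \<in> Fh \<Longrightarrow> closure F - F \<in> null_sets (face_measure F)"
  and face_position: "F \<in> Fh \<Longrightarrow> F \<in> internal_faces Th Fh \<and> F \<subseteq> \<Omega> \<or> F \<in> boundary_faces Th Fh \<and> F \<subseteq> frontier \<Omega>"
  and cell_frontier: "T \<in> Th \<Longrightarrow> frontier T = (\<Union>F\<in>faces_of Fh T. closure F)"
  and outward_exists: "T \<in> Th \<Longrightarrow> F \<in> faces_of Fh T \<Longrightarrow> \<exists>n. outward_normal T F n"
  using mesh unfolding polytopal_mesh_def by blast+

lemma faces_of_subset: "F \<in> faces_of Fh T \<Longrightarrow> F \<in> Fh"
  and finite_faces_of: "finite (faces_of Fh T)"
  using finite_Fh by (auto simp: faces_of_def)

lemma face_hyp: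
  assumes "F \<in> Fh"
  shows "norm (hyp_normal (affine hull F)) = 1"
    and "affine hull F = hyperplane (hyp_normal (affine hull F)) (hyp_offset (affine hull F))"
  using hyp_data[OF face_dim[OF assms]] .

lemma face_measure_eq: "F \<in> Fh \<Longrightarrow> face_measure F = completion (hyp_measure (affine hull F))"
  using hyperplane_measure_eq[OF face_hyp(1), of F "hyp_offset (affine hull F)"] face_hyp(2)[of F] by simp

lemma face_borel: "F \<in> Fh \<Longrightarrow> F \<in> sets borel"
proof -
  assume F: "F \<in> Fh"
  obtain U where U: "open U" "F = affine hull F \<inter> U" using face_open[OF F] by (auto simp: openin_open)
  have "affine hull F \<inter> U \<in> sets borel" using U(1) by (intro sets.Int) (auto intro: borel_closed closed_affine_hull)
  then show ?thesis using U(2) by simp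
qed

lemma closure_face_subset: "closure F \<subseteq> affine hull F" for F :: "(real^'n) set"
  by (rule closure_minimal) (auto intro: hull_inc closed_affine_hull)

text \<open>The index set consists of the affine hulls themselves rather than of the faces: several
  faces may lie in one hyperplane, and the hyperplanes of distinct indices must be distinct.\<close>

lemma cell_polyhedral:
  assumes T: "T \<in> Th"
  shows "polyhedral_set T ((hull) affine ` faces_of Fh T) hyp_normal hyp_offset"
proof
  show "open T" "bounded T" "interior (closure T) = T"
    using polytopal_domain_open_bounded[OF cell_domain[OF T]] by auto
  show "finite ((hull) affine ` faces_of Fh T)" using finite_faces_of by simp
  fix H assume H: "H \<in> (hull) affine ` faces_of Fh T"
  then show "norm (hyp_normal H) = 1" using face_hyp(1) faces_of_subset by auto
  fix H' assume H': "H' \<in> (hull) affine ` faces_of Fh T" and "H \<noteq> H'"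
  have "H = hyperplane (hyp_normal H) (hyp_offset H)" "H' = hyperplane (hyp_normal H') (hyp_offset H')"
    using H H' face_hyp(2) faces_of_subset by auto
  then show "hyperplane (hyp_normal H) (hyp_offset H) \<noteq> hyperplane (hyp_normal H') (hyp_offset H')"
    using \<open>H \<noteq> H'\<close> by simp
next
  show "frontier T \<subseteq> (\<Union>H\<in>(hull) affine ` faces_of Fh T. hyperplane (hyp_normal H) (hyp_offset H))"
  proof
    fix x assume "x \<in> frontier T"
    then obtain F where F: "F \<in> faces_of Fh T" "x \<in> closure F" using cell_frontier[OF T] by blast
    then have "x \<in> affine hull F" using closure_face_subset by blast
    then have "x \<in> hyperplane (hyp_normal (affine hull F)) (hyp_offset (affine hull F))"
      using face_hyp(2)[OF faces_of_subset[OF F(1)]] by simp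
    then show "x \<in> (\<Union>H\<in>(hull) affine ` faces_of Fh T. hyperplane (hyp_normal H) (hyp_offset H))" using F(1) by blast
  qed
qed

lemma unit_normal:
  assumes "T \<in> Th" "F \<in> faces_of Fh T" shows "outward_normal T F (unit_normal T F)"
  unfolding unit_normal_def by (rule someI_ex) (rule outward_exists[OF assms])

text \<open>A vector orthogonal to all differences of points of F is constant on the affine hull,
  which is a full hyperplane. Its component tangential to that hyperplane, y in the proof, is
  therefore zero.\<close>

lemma unit_normal_cases:
  assumes "T \<in> Th" "F \<in> faces_of Fh T"
  shows "unit_normal T F = hyp_normal (affine hull F) \<or> unit_normal T F = - hyp_normal (affine hull F)"
proof -
  define n where "n = unit_normal T F"
  define m where "m = hyp_normal (affine hull F)"
  define b where "b = hyp_offset (affine hull F)"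
  note F = faces_of_subset[OF assms(2)]
  have m: "norm m = 1" "affine hull F = hyperplane m b"
    using face_hyp[OF F] by (simp_all add: m_def b_def)
  have n: "norm n = 1" "\<And>x y. x \<in> F \<Longrightarrow> y \<in> F \<Longrightarrow> n \<bullet> (x - y) = 0"
    using unit_normal[OF assms] by (auto simp: outward_normal_def n_def)
  obtain x0 where x0: "x0 \<in> F" using face_nonempty[OF F] by blast
  have "F \<subseteq> {x. n \<bullet> x = n \<bullet> x0}" using n(2)[OF _ x0] by (auto simp: inner_diff_right)
  then have "affine hull F \<subseteq> {x. n \<bullet> x = n \<bullet> x0}" by (rule hull_minimal) (rule affine_hyperplane)
  moreover have x0H: "m \<bullet> x0 = b" using hull_inc[OF x0, of affine] unfolding m(2) hyperplane_def by simp
  define y where "y = n - (n \<bullet> m) *\<^sub>R m"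
  have my: "m \<bullet> y = 0" using unit_inner[OF m(1)] by (simp add: y_def inner_diff_right inner_commute)
  then have "x0 + y \<in> affine hull F" unfolding m(2) hyperplane_def using x0H by (simp add: inner_add_right)
  ultimately have "n \<bullet> y = 0" by (auto simp: inner_add_right)
  then have "y \<bullet> y = 0" using my by (simp add: y_def inner_diff_left inner_commute)
  then have nm: "n = (n \<bullet> m) *\<^sub>R m" by (simp add: y_def)
  then have "\<bar>n \<bullet> m\<bar> = 1" using n(1) m(1) by (metis norm_scaleR mult.right_neutral)
  then have "n \<bullet> m = 1 \<or> n \<bullet> m = -1" by (auto simp: abs_if split: if_splits)
  then show ?thesis using nm unfolding n_def[symmetric] m_def[symmetric] by (metis scaleR_one scaleR_minus1_left)
qed

lemma AE_outward:
  assumes "T \<in> Th" "F \<in> faces_of Fh T"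
  shows "AE x in hyp_measure (affine hull F). x \<in> F \<longrightarrow>
    (\<exists>\<epsilon>>0. \<forall>t\<in>{0<..<\<epsilon>}. x - t *\<^sub>R unit_normal T F \<in> T \<and> x + t *\<^sub>R unit_normal T F \<notin> T)"
  using unit_normal[OF assms] unfolding outward_normal_def face_measure_eq[OF faces_of_subset[OF assms(2)]] AE_completion_iff
  by blast

lemma AE_closure_face:
  assumes "F \<in> Fh" shows "AE x in hyp_measure (affine hull F). x \<in> closure F \<longrightarrow> x \<in> F"
proof -
  have "AE x in face_measure F. x \<notin> closure F - F" by (rule AE_not_in[OF face_closure_null[OF assms]])
  then have "AE x in hyp_measure (affine hull F). x \<notin> closure F - F"
    unfolding face_measure_eq[OF assms] AE_completion_iff .
  then show ?thesis by eventually_elim blast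
qed

lemma AE_off_other_hyperplanes:
  assumes "F \<in> Fh" "F' \<in> Fh" "affine hull F' \<noteq> affine hull F"
  shows "AE x in hyp_measure (affine hull F). x \<notin> affine hull F'"
proof -
  have "AE x in hyp_measure (affine hull F). hyp_normal (affine hull F') \<bullet> x \<noteq> hyp_offset (affine hull F')"
    by (rule AE_hmeas_not_hyperplane[OF face_hyp(1)[OF assms(1)] face_hyp(1)[OF assms(2)]])
      (use assms(3) face_hyp(2)[OF assms(1)] face_hyp(2)[OF assms(2)] in simp)
  then show ?thesis
  proof eventually_elim
    case (elim x)
    then show ?case by (subst face_hyp(2)[OF assms(2)]) (simp add: hyperplane_def)
  qed
qed

lemma face_in_hyperplane:
  assumes "F \<in> Fh" "x \<in> affine hull F"
  shows "hyp_normal (affine hull F) \<bullet> x = hyp_offset (affine hull F)"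
  using assms(2) face_hyp(2)[OF assms(1)] unfolding hyperplane_def by blast

end

locale mesh_cell = mesh \<Omega> Th Fh for \<Omega> :: "(real^'n) set" and Th Fh +
  fixes T assumes T: "T \<in> Th"
begin

sublocale polyhedral_set T "(hull) affine ` faces_of Fh T" hyp_normal hyp_offset
  by (rule cell_polyhedral[OF T])

lemma AE_off_hyperplanes:
  assumes F: "F \<in> faces_of Fh T"
  shows "AE x in hyp_measure (affine hull F). \<forall>H\<in>(hull) affine ` faces_of Fh T - {affine hull F}. hyp_normal H \<bullet> x \<noteq> hyp_offset H"
proof (rule AE_finite_allI)
  show "finite ((hull) affine ` faces_of Fh T - {affine hull F})" using finite_faces_of by simp
  fix H assume "H \<in> (hull) affine ` faces_of Fh T - {affine hull F}"
  then obtain F' where F': "F' \<in> faces_of Fh T" "H = affine hull F'" "affine hull F' \<noteq> affine hull F" by blast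
  note f = faces_of_subset[OF F'(1)]
  show "AE x in hyp_measure (affine hull F). hyp_normal H \<bullet> x \<noteq> hyp_offset H"
    unfolding F'(2)
    by (rule AE_hmeas_not_hyperplane[OF face_hyp(1)[OF faces_of_subset[OF F]] face_hyp(1)[OF f]])
      (use F'(3) face_hyp(2)[OF f] face_hyp(2)[OF faces_of_subset[OF F]] in simp)
qed

text \<open>The almost everywhere one-sidedness in \<open>outward_normal\<close> is exactly what
  excludes the opposite half side; the other hyperplanes are avoided off a null set.\<close>

lemma face_AE_boundary_side:
  assumes F: "F \<in> faces_of Fh T"
  shows "AE x in hyp_measure (affine hull F). x \<in> F \<longrightarrow> x \<in> boundary_side (affine hull F) (- unit_normal T F)"
  using AE_outward[OF T F] AE_off_hyperplanes[OF F]
proof eventually_elim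
  case (elim x)
  show ?case
  proof
    assume x: "x \<in> F"
    with elim(1) obtain \<epsilon> where \<epsilon>: "\<epsilon> > 0" "\<forall>t\<in>{0<..<\<epsilon>}. x - t *\<^sub>R unit_normal T F \<in> T \<and> x + t *\<^sub>R unit_normal T F \<notin> T"
      by blast
    have "hyp_normal (affine hull F) \<bullet> x = hyp_offset (affine hull F)"
      by (rule face_in_hyperplane[OF faces_of_subset[OF F] hull_inc[OF x]])
    moreover have "\<exists>\<delta>>0. \<forall>s. 0 < s \<and> s < \<delta> \<longrightarrow> x + s *\<^sub>R (- unit_normal T F) \<in> T"
      using \<epsilon> by (intro exI[of _ \<epsilon>]) simp
    moreover have "\<not> (\<exists>\<delta>>0. \<forall>s. 0 < s \<and> s < \<delta> \<longrightarrow> x + s *\<^sub>R unit_normal T F \<in> T)"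
    proof
      assume "\<exists>\<delta>>0. \<forall>s. 0 < s \<and> s < \<delta> \<longrightarrow> x + s *\<^sub>R unit_normal T F \<in> T"
      then obtain \<delta> where \<delta>: "\<delta> > 0" "\<And>s. 0 < s \<and> s < \<delta> \<Longrightarrow> x + s *\<^sub>R unit_normal T F \<in> T" by blast
      define s where "s = min \<delta> \<epsilon> / 2"
      have "0 < s" "s < \<delta>" "s < \<epsilon>" using \<delta>(1) \<epsilon>(1) by (auto simp: s_def)
      then show False using \<delta>(2)[of s] bspec[OF \<epsilon>(2), of s] by simp
    qed
    ultimately show "x \<in> boundary_side (affine hull F) (- unit_normal T F)"
      using elim(2) unfolding boundary_side_def half_side_def by simp
  qed
qed

text \<open>A point x of the boundary side is in the frontier of T, hence in the closure of a face
  F. Away from the other hyperplanes F lies in the same hyperplane, and off a null set x belongs to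
  F itself. Since T lies in direction m near x, the outward normal of F cannot be m, so it is
  -m.\<close>

lemma boundary_side_AE_face:
  assumes F0: "F0 \<in> faces_of Fh T" and m: "m = hyp_normal (affine hull F0) \<or> m = - hyp_normal (affine hull F0)"
  shows "AE x in hyp_measure (affine hull F0). x \<in> boundary_side (affine hull F0) m \<longrightarrow>
     (\<exists>F\<in>faces_of Fh T. affine hull F = affine hull F0 \<and> unit_normal T F = - m \<and> x \<in> F)"
proof -
  let ?M = "hyp_measure (affine hull F0)"
  have a1: "AE x in ?M. \<forall>F\<in>{F\<in>faces_of Fh T. affine hull F = affine hull F0}. x \<in> closure F \<longrightarrow> x \<in> F"
  proof (rule AE_finite_allI)
    fix F assume F: "F \<in> {F\<in>faces_of Fh T. affine hull F = affine hull F0}"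
    then have "F \<in> faces_of Fh T" and eq: "affine hull F = affine hull F0" by auto
    from AE_closure_face[OF faces_of_subset[OF this(1)]]
    show "AE x in ?M. x \<in> closure F \<longrightarrow> x \<in> F" unfolding eq .
  qed (use finite_faces_of in simp)
  have a2: "AE x in ?M. \<forall>F\<in>{F\<in>faces_of Fh T. affine hull F = affine hull F0}. x \<in> F \<longrightarrow>
    (\<exists>\<epsilon>>0. \<forall>t\<in>{0<..<\<epsilon>}. x - t *\<^sub>R unit_normal T F \<in> T \<and> x + t *\<^sub>R unit_normal T F \<notin> T)"
  proof (rule AE_finite_allI)
    fix F assume F: "F \<in> {F\<in>faces_of Fh T. affine hull F = affine hull F0}"
    then have "F \<in> faces_of Fh T" and eq: "affine hull F = affine hull F0" by auto
    from AE_outward[OF T this(1)]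
    show "AE x in ?M. x \<in> F \<longrightarrow> (\<exists>\<epsilon>>0. \<forall>t\<in>{0<..<\<epsilon>}. x - t *\<^sub>R unit_normal T F \<in> T \<and> x + t *\<^sub>R unit_normal T F \<notin> T)"
      unfolding eq .
  qed (use finite_faces_of in simp)
  from a1 a2 AE_off_hyperplanes[OF F0] show ?thesis
  proof eventually_elim
    case (elim x)
    show ?case
    proof
      assume x: "x \<in> boundary_side (affine hull F0) m"
      then obtain \<delta> where \<delta>: "\<delta> > 0" "\<And>s. 0 < s \<and> s < \<delta> \<Longrightarrow> x + s *\<^sub>R m \<in> T"
        unfolding boundary_side_def half_side_def by blast
      have nm: "norm m = 1" using m face_hyp(1)[OF faces_of_subset[OF F0]] by auto
      have "x \<in> closure T" unfolding closure_approachable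
      proof (intro allI impI)
        fix e :: real assume "e > 0"
        define s where "s = min \<delta> e / 2"
        have "0 < s" "s < \<delta>" "s < e" using \<delta>(1) \<open>e > 0\<close> by (auto simp: s_def)
        then show "\<exists>y\<in>T. dist y x < e" using \<delta>(2)[of s] nm by (intro bexI[of _ "x + s *\<^sub>R m"]) (auto simp: dist_norm)
      qed
      moreover have "x \<notin> T"
      proof
        assume "x \<in> T"
        then obtain r where r: "r > 0" "ball x r \<subseteq> T" using open_T by (meson openE)
        have "x + s *\<^sub>R (- m) \<in> T" if "0 < s \<and> s < r" for s
          using r(2) that nm by (auto simp: dist_norm subset_eq)
        then have "x \<in> half_side (affine hull F0) (- m)"
          using x r(1) unfolding boundary_side_def half_side_def by blast
        then show False using x unfolding boundary_side_def by blast
      qed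
      ultimately have "x \<in> frontier T" using open_T by (simp add: frontier_def interior_open)
      then obtain F where F: "F \<in> faces_of Fh T" "x \<in> closure F" using cell_frontier[OF T] by blast
      have xF: "hyp_normal (affine hull F) \<bullet> x = hyp_offset (affine hull F)"
        by (rule face_in_hyperplane[OF faces_of_subset[OF F(1)]]) (use F(2) closure_face_subset in blast)
      have hF: "affine hull F = affine hull F0"
      proof (rule ccontr)
        assume "affine hull F \<noteq> affine hull F0"
        then have "affine hull F \<in> (hull) affine ` faces_of Fh T - {affine hull F0}" using F(1) by blast
        with elim(3) xF show False by blast
      qed
      then have "x \<in> F" using elim(1) F by blast
      with elim(2) hF F(1) obtain \<epsilon> where \<epsilon>: "\<epsilon> > 0" "\<forall>t\<in>{0<..<\<epsilon>}. x - t *\<^sub>R unit_normal T F \<in> T \<and> x + t *\<^sub>R unit_normal T F \<notin> T"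
        by blast
      have "unit_normal T F \<noteq> m"
      proof
        assume eq: "unit_normal T F = m"
        define s where "s = min \<delta> \<epsilon> / 2"
        have "0 < s" "s < \<delta>" "s < \<epsilon>" using \<delta>(1) \<epsilon>(1) by (auto simp: s_def)
        then show False using \<delta>(2)[of s] bspec[OF \<epsilon>(2), of s] eq by simp
      qed
      then have "unit_normal T F = - m" using unit_normal_cases[OF T F(1)] m hF by auto
      then show "\<exists>F\<in>faces_of Fh T. affine hull F = affine hull F0 \<and> unit_normal T F = - m \<and> x \<in> F"
        using F(1) hF \<open>x \<in> F\<close> by blast
    qed
  qed
qed

lemma face_trace_borel:
  assumes w: "borel_weak_gradient T g h" and F: "F \<in> faces_of Fh T"
  shows "AE x in hyp_measure (affine hull F). x \<in> F \<longrightarrow>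
      ess_trace (- unit_normal T F) g x (btrace (- unit_normal T F) g x)"
    and "integrable (hyp_measure (affine hull F)) (\<lambda>x. indicator F x * btrace (- unit_normal T F) g x)"
proof -
  let ?H = "affine hull F" and ?n = "- unit_normal T F"
  have HJ: "?H \<in> (hull) affine ` faces_of Fh T" using F by blast
  have n: "?n = hyp_normal ?H \<or> ?n = - hyp_normal ?H" using unit_normal_cases[OF T F] by auto
  note s = side_trace[OF w HJ n]
  have AEs: "AE x in hyp_measure ?H. x \<in> F \<longrightarrow> x \<in> half_side ?H ?n"
    using face_AE_boundary_side[OF F] by eventually_elim (simp add: boundary_side_def)
  from s(1) AEs show "AE x in hyp_measure ?H. x \<in> F \<longrightarrow> ess_trace ?n g x (btrace ?n g x)"
    by eventually_elim blast
  have [measurable]: "F \<in> sets borel" by (rule face_borel[OF faces_of_subset[OF F]])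
  have [measurable]: "half_side ?H ?n \<in> sets borel" by (rule s(3))
  note [measurable] = borel_weak_gradientD(1)[OF w]
  have i: "integrable (hyp_measure ?H) (\<lambda>x. indicator F x *\<^sub>R (indicator (half_side ?H ?n) x * btrace ?n g x))"
    by (rule integrable_mult_indicator[OF _ s(2)]) simp
  have ae: "AE x in hyp_measure ?H. indicator F x *\<^sub>R (indicator (half_side ?H ?n) x * btrace ?n g x) = indicator F x * btrace ?n g x"
    using AEs by eventually_elim (auto simp: indicator_def)
  show "integrable (hyp_measure ?H) (\<lambda>x. indicator F x * btrace ?n g x)"
    by (rule integrable_cong_AE_imp[OF i]) (measurable, rule ae)
qed

text \<open>Up to null sets each boundary side is the disjoint union of the faces in its hyperplane
  whose outward normal is opposite to its direction. Regrouping the sum by faces absorbs the two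
  signs into \<open>unit_normal\<close>.\<close>

theorem divergence_faces:
  assumes w: "borel_weak_gradient T g h"
  shows "(LBINT z. h z \<bullet> e) = (\<Sum>F\<in>faces_of Fh T. (unit_normal T F \<bullet> e) *
    (LINT x|hyp_measure (affine hull F). indicator F x * btrace (- unit_normal T F) g x))"
proof -
  note [measurable] = borel_weak_gradientD(1)[OF w]
  define A where "A = (\<lambda>F. (unit_normal T F \<bullet> e) * (LINT x|hyp_measure (affine hull F). indicator F x * btrace (- unit_normal T F) g x))"
  have one: "(LINT x|hyp_measure H. indicator (boundary_side H m) x * btrace m g x) =
      (\<Sum>F\<in>{F\<in>faces_of Fh T. affine hull F = H \<and> unit_normal T F = - m}. LINT x|hyp_measure H. indicator F x * btrace m g x)"
    if HJ: "H \<in> (hull) affine ` faces_of Fh T" and m: "m = hyp_normal H \<or> m = - hyp_normal H" for H m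
  proof -
    obtain F0 where F0: "F0 \<in> faces_of Fh T" "H = affine hull F0" using HJ by blast
    let ?S = "{F\<in>faces_of Fh T. affine hull F = H \<and> unit_normal T F = - m}"
    have fin: "finite ?S" using finite_faces_of by simp
    have Sb: "F \<in> sets borel" if "F \<in> ?S" for F using that face_borel faces_of_subset by blast
    have iF: "integrable (hyp_measure H) (\<lambda>x. indicator F x * btrace m g x)" if "F \<in> ?S" for F
      using face_trace_borel(2)[OF w, of F] that by auto
    have "AE x in hyp_measure H. \<forall>F\<in>?S. x \<in> F \<longrightarrow> x \<in> boundary_side H m"
    proof (rule AE_finite_allI[OF fin])
      fix F assume "F \<in> ?S"
      then show "AE x in hyp_measure H. x \<in> F \<longrightarrow> x \<in> boundary_side H m"
        using face_AE_boundary_side[of F] by auto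
    qed
    moreover have "AE x in hyp_measure H. x \<in> boundary_side H m \<longrightarrow> (\<exists>F\<in>?S. x \<in> F)"
    proof -
      have "AE x in hyp_measure H. x \<in> boundary_side H m \<longrightarrow> (\<exists>F\<in>faces_of Fh T. affine hull F = H \<and> unit_normal T F = - m \<and> x \<in> F)"
        unfolding F0(2) by (rule boundary_side_AE_face[OF F0(1)]) (use m F0(2) in simp)
      then show ?thesis by eventually_elim blast
    qed
    ultimately have "AE x in hyp_measure H. indicator (boundary_side H m) x * btrace m g x = (\<Sum>F\<in>?S. indicator F x * btrace m g x)"
    proof eventually_elim
      case (elim x)
      show ?case
      proof (cases "x \<in> boundary_side H m")
        case True
        with elim(2) obtain F where F: "F \<in> ?S" "x \<in> F" by blast
        have "(\<Sum>F'\<in>?S. indicator F' x * btrace m g x) = (\<Sum>F'\<in>?S. if F' = F then btrace m g x else 0)"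
        proof (rule sum.cong[OF refl])
          fix F' assume F': "F' \<in> ?S"
          have "x \<notin> F'" if "F' \<noteq> F"
            using disjoint_Fh F F' faces_of_subset that by (auto simp: pairwise_def disjnt_def)
          then show "indicator F' x * btrace m g x = (if F' = F then btrace m g x else 0)" using F by auto
        qed
        then show ?thesis using True F fin by simp
      next
        case False
        then have "x \<notin> F" if "F \<in> ?S" for F using elim(1) that by blast
        then have "(\<Sum>F\<in>?S. indicator F x * btrace m g x) = 0" by (intro sum.neutral) auto
        then show ?thesis using False by simp
      qed
    qed
    then have "(LINT x|hyp_measure H. indicator (boundary_side H m) x * btrace m g x) = (LINT x|hyp_measure H. (\<Sum>F\<in>?S. indicator F x * btrace m g x))"
    proof (rule integral_cong_AE[rotated 2])
      have "boundary_side H m \<in> sets borel" by (rule boundary_side_borel[OF w HJ m])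
      then show "(\<lambda>x. indicator (boundary_side H m) x * btrace m g x) \<in> borel_measurable (hyp_measure H)" by measurable
      show "(\<lambda>x. \<Sum>F\<in>?S. indicator F x * btrace m g x) \<in> borel_measurable (hyp_measure H)"
        using iF by (intro borel_measurable_sum borel_measurable_integrable) auto
    qed
    also have "\<dots> = (\<Sum>F\<in>?S. LINT x|hyp_measure H. indicator F x * btrace m g x)"
      using iF by (intro Bochner_Integration.integral_sum) auto
    finally show ?thesis .
  qed
  have "(LBINT z. h z \<bullet> e) = (\<Sum>H\<in>(hull) affine ` faces_of Fh T. (hyp_normal H \<bullet> e) *
     ((LINT x|hyp_measure H. indicator (boundary_side H (- hyp_normal H)) x * btrace (- hyp_normal H) g x) -
      (LINT x|hyp_measure H. indicator (boundary_side H (hyp_normal H)) x * btrace (hyp_normal H) g x)))"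
    by (rule divergence_boundary_sides[OF w])
  also have "\<dots> = (\<Sum>H\<in>(hull) affine ` faces_of Fh T. sum A {F\<in>faces_of Fh T. affine hull F = H})"
  proof (rule sum.cong[OF refl])
    fix H assume HJ: "H \<in> (hull) affine ` faces_of Fh T"
    let ?n = "hyp_normal H"
    let ?P = "{F\<in>faces_of Fh T. affine hull F = H \<and> unit_normal T F = ?n}"
    let ?N = "{F\<in>faces_of Fh T. affine hull F = H \<and> unit_normal T F = - ?n}"
    have nn: "?n \<noteq> - ?n"
    proof
      assume "?n = - ?n"
      then have "?n \<bullet> ?n = - (?n \<bullet> ?n)" by (metis inner_minus_right)
      then show False using unit_inner[OF unit_nv[OF HJ]] by simp
    qed
    have split: "{F\<in>faces_of Fh T. affine hull F = H} = ?P \<union> ?N" using unit_normal_cases[OF T] by auto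
    have "sum A {F\<in>faces_of Fh T. affine hull F = H} = sum A ?P + sum A ?N"
      unfolding split using finite_faces_of nn by (intro sum.union_disjoint) auto
    moreover have "sum A ?P = (?n \<bullet> e) * (LINT x|hyp_measure H. indicator (boundary_side H (- ?n)) x * btrace (- ?n) g x)"
      using one[OF HJ, of "- ?n"] by (simp add: A_def sum_distrib_left)
    moreover have "sum A ?N = - (?n \<bullet> e) * (LINT x|hyp_measure H. indicator (boundary_side H ?n) x * btrace ?n g x)"
      using one[OF HJ, of "?n"] by (simp add: A_def sum_distrib_left sum_negf)
    ultimately show "(?n \<bullet> e) *
     ((LINT x|hyp_measure H. indicator (boundary_side H (- ?n)) x * btrace (- ?n) g x) -
      (LINT x|hyp_measure H. indicator (boundary_side H ?n) x * btrace ?n g x)) = sum A {F\<in>faces_of Fh T. affine hull F = H}"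
      by (simp add: algebra_simps)
  qed
  also have "\<dots> = sum A (faces_of Fh T)"
    by (rule sum.image_gen[OF finite_faces_of, symmetric])
  finally show ?thesis by (simp only: A_def)
qed

end

section \<open>Borel representatives\<close>

text \<open>The bridge between \<open>lebesgue_on T\<close>, in which the problem is stated, and
  \<open>lborel\<close> integrals of Borel representatives, in which the argument runs.\<close>

lemma lebesgue_on_AE_eq_borel:
  fixes f f' :: "'a::euclidean_space \<Rightarrow> 'b::euclidean_space"
  assumes [measurable]: "T \<in> sets borel" "f' \<in> borel_measurable borel"
    and eq: "AE x in lborel. x \<in> T \<longrightarrow> f x = f' x" and 0: "\<And>x. x \<notin> T \<Longrightarrow> f' x = 0"
  shows "f \<in> borel_measurable (lebesgue_on T)"
    and "(LINT x|lebesgue_on T. f x) = (LBINT x. f' x)"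
    and "integrable (lebesgue_on T) f \<longleftrightarrow> integrable lborel f'"
proof -
  have T: "T \<in> sets lebesgue" using assms(1) by simp
  have f': "f' \<in> borel_measurable lebesgue" using assms(2) by (simp add: measurable_completion)
  have "AE x in lebesgue. x \<in> T \<longrightarrow> f x = f' x" using eq by (rule AE_completion)
  then have ae: "AE x in lebesgue. f' x = (if x \<in> T then f x else 0)"
    by eventually_elim (use 0 in auto)
  then have ae': "AE x in lebesgue. (if x \<in> T then f x else 0) = f' x" by eventually_elim simp
  have m: "(\<lambda>x. if x \<in> T then f x else 0) \<in> borel_measurable lebesgue"
    by (rule borel_measurable_AE[OF f' ae])
  then show "f \<in> borel_measurable (lebesgue_on T)" using borel_measurable_if[OF T] by blast
  have ind: "(\<lambda>x. indicator T x *\<^sub>R f x) = (\<lambda>x. if x \<in> T then f x else 0)" by (auto simp: indicator_def)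
  have "(LINT x|lebesgue_on T. f x) = (LINT x|lebesgue. (if x \<in> T then f x else 0))"
    using T by (simp add: integral_restrict_space ind)
  also have "\<dots> = (LINT x|lebesgue. f' x)"
    by (rule integral_cong_AE[OF m f' ae'])
  also have "\<dots> = (LBINT x. f' x)" by (simp add: integral_completion)
  finally show "(LINT x|lebesgue_on T. f x) = (LBINT x. f' x)" .
  have "integrable (lebesgue_on T) f \<longleftrightarrow> integrable lebesgue (\<lambda>x. if x \<in> T then f x else 0)"
    using T by (simp add: integrable_restrict_space ind)
  also have "\<dots> \<longleftrightarrow> integrable lebesgue f'"
    by (rule integrable_cong_AE[OF m f' ae'])
  also have "\<dots> \<longleftrightarrow> integrable lborel f'" by (simp add: integrable_completion)
  finally show "integrable (lebesgue_on T) f \<longleftrightarrow> integrable lborel f'" .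
qed

lemma borel_representative_real:
  fixes f :: "real^'n \<Rightarrow> real"
  assumes T: "T \<in> sets borel" and f: "f \<in> borel_measurable (lebesgue_on T)"
  shows "\<exists>f'. f' \<in> borel_measurable borel \<and> (AE x in lborel. x \<in> T \<longrightarrow> f x = f' x) \<and> (\<forall>x. x \<notin> T \<longrightarrow> f' x = 0)"
proof -
  have "(\<lambda>x. if x \<in> T then f x else 0) \<in> borel_measurable lebesgue"
    using f T borel_measurable_if[of T f] by simp
  from completion_ex_borel_measurable_real[OF this] obtain g where g: "g \<in> borel_measurable lborel"
    "AE x in lborel. (if x \<in> T then f x else 0) = g x" by blast
  have [measurable]: "g \<in> borel_measurable borel" "T \<in> sets borel" using g(1) T by simp_all
  have "(\<lambda>x. indicator T x * g x) \<in> borel_measurable borel" by measurable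
  moreover have "AE x in lborel. x \<in> T \<longrightarrow> f x = indicator T x * g x"
    using g(2) by eventually_elim auto
  ultimately show ?thesis by (intro exI[of _ "\<lambda>x. indicator T x * g x"]) auto
qed

lemma borel_representative_vec:
  fixes f :: "real^'n \<Rightarrow> real^'n"
  assumes T: "T \<in> sets borel" and f: "f \<in> borel_measurable (lebesgue_on T)"
  shows "\<exists>f'. f' \<in> borel_measurable borel \<and> (AE x in lborel. x \<in> T \<longrightarrow> f x = f' x) \<and> (\<forall>x. x \<notin> T \<longrightarrow> f' x = 0)"
proof -
  have "(\<lambda>x. f x $ i) \<in> borel_measurable (lebesgue_on T)" for i
    using f by (rule measurable_compose) simp
  then have "\<forall>i. \<exists>f'. f' \<in> borel_measurable borel \<and> (AE x in lborel. x \<in> T \<longrightarrow> f x $ i = f' x) \<and> (\<forall>x. x \<notin> T \<longrightarrow> f' x = 0)"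
    using borel_representative_real[OF T] by blast
  from choice[OF this] obtain f' where f': "\<And>i. f' i \<in> borel_measurable borel"
    "\<And>i. AE x in lborel. x \<in> T \<longrightarrow> f x $ i = f' i x" "\<And>i x. x \<notin> T \<Longrightarrow> f' i x = 0" by blast
  have m: "(\<lambda>x. \<Sum>i\<in>UNIV. f' i x *\<^sub>R (axis i 1 :: real^'n)) \<in> borel_measurable borel"
    by (intro borel_measurable_sum borel_measurable_scaleR borel_measurable_const f'(1))
  have eq: "(\<Sum>i\<in>UNIV. c i *\<^sub>R (axis i 1 :: real^'n)) = (\<chi> i. c i)" for c :: "'n \<Rightarrow> real"
    by (simp add: vec_eq_iff axis_def if_distrib cong: if_cong)
  have "AE x in lborel. \<forall>i\<in>UNIV. x \<in> T \<longrightarrow> f x $ i = f' i x" by (rule AE_finite_allI) (use f'(2) in auto)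
  then have "AE x in lborel. x \<in> T \<longrightarrow> f x = (\<chi> i. f' i x)"
    by eventually_elim (auto simp: vec_eq_iff)
  then show ?thesis using m f'(3) unfolding eq by (intro exI[of _ "\<lambda>x. \<chi> i. f' i x"]) (auto simp: vec_eq_iff)
qed

lemma has_weak_gradient_borel:
  assumes T: "open T" and w: "has_weak_gradient T v G"
  shows "\<exists>g h. borel_weak_gradient T g h \<and> (AE x in lborel. x \<in> T \<longrightarrow> v x = g x) \<and> (AE x in lborel. x \<in> T \<longrightarrow> G x = h x)"
proof -
  have Tb [measurable]: "T \<in> sets borel" using T by auto
  have v: "v \<in> L2 T" "G \<in> L2 T" using w by (auto simp: has_weak_gradient_def)
  obtain g where g [measurable]: "g \<in> borel_measurable borel" and ge: "AE x in lborel. x \<in> T \<longrightarrow> v x = g x" and g0: "\<And>x. x \<notin> T \<Longrightarrow> g x = 0"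
    using borel_representative_real[OF Tb, of v] v by (auto simp: L2_def)
  obtain h where h [measurable]: "h \<in> borel_measurable borel" and he: "AE x in lborel. x \<in> T \<longrightarrow> G x = h x" and h0: "\<And>x. x \<notin> T \<Longrightarrow> h x = 0"
    using borel_representative_vec[OF Tb, of G] v by (auto simp: L2_def)
  have "integrable lborel (\<lambda>x. (g x)\<^sup>2)"
  proof -
    have "AE x in lborel. x \<in> T \<longrightarrow> (norm (v x))\<^sup>2 = (g x)\<^sup>2" using ge by eventually_elim auto
    from lebesgue_on_AE_eq_borel(3)[OF Tb _ this] g0 v(1) show ?thesis by (simp add: L2_def)
  qed
  moreover have "integrable lborel (\<lambda>x. (norm (h x))\<^sup>2)"
  proof -
    have "AE x in lborel. x \<in> T \<longrightarrow> (norm (G x))\<^sup>2 = (norm (h x))\<^sup>2" using he by eventually_elim auto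
    from lebesgue_on_AE_eq_borel(3)[OF Tb _ this] h0 v(2) show ?thesis by (simp add: L2_def)
  qed
  moreover have "(LBINT x. g x *\<^sub>R D x) = - (LBINT x. \<phi> x *\<^sub>R h x)"
    if \<phi>: "\<phi> \<in> test_functions T" and D: "\<And>x. GDERIV \<phi> x :> D x" for \<phi> D
  proof -
    have [measurable]: "\<phi> \<in> borel_measurable borel" "D \<in> borel_measurable borel"
      using test_function_continuous[OF \<phi>] test_function_gderiv_continuous[OF \<phi> D]
      by (auto intro: borel_measurable_continuous_onI)
    have "AE x in lborel. x \<in> T \<longrightarrow> v x *\<^sub>R D x = g x *\<^sub>R D x" using ge by eventually_elim simp
    from lebesgue_on_AE_eq_borel(2)[OF Tb _ this] g0
    have "(LINT x|lebesgue_on T. v x *\<^sub>R D x) = (LBINT x. g x *\<^sub>R D x)" by simp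
    moreover have "AE x in lborel. x \<in> T \<longrightarrow> \<phi> x *\<^sub>R G x = \<phi> x *\<^sub>R h x" using he by eventually_elim simp
    from lebesgue_on_AE_eq_borel(2)[OF Tb _ this] h0
    have "(LINT x|lebesgue_on T. \<phi> x *\<^sub>R G x) = (LBINT x. \<phi> x *\<^sub>R h x)" by simp
    moreover have "(LINT x|lebesgue_on T. v x *\<^sub>R D x) = - (LINT x|lebesgue_on T. \<phi> x *\<^sub>R G x)"
      using w \<phi> D unfolding has_weak_gradient_def by blast
    ultimately show ?thesis by simp
  qed
  ultimately have "borel_weak_gradient T g h"
    using g h g0 h0 unfolding borel_weak_gradient_def by blast
  then show ?thesis using ge he by blast
qed

lemma integrable_cbox_of_integrable:
  fixes g :: "real^'n \<Rightarrow> real"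
  shows "integrable lborel g \<Longrightarrow> integrable lborel (\<lambda>x. indicator (cbox a b) x * g x)"
  using integrable_mult_indicator[of "cbox a b" lborel g] by simp

lemma integrable_of_square:
  fixes h :: "real^'n \<Rightarrow> 'b::euclidean_space"
  assumes [measurable]: "h \<in> borel_measurable borel" and sq: "integrable lborel (\<lambda>x. (norm (h x))\<^sup>2)"
  shows "integrable lborel (\<lambda>x. indicator (cbox a b) x *\<^sub>R h x)"
proof (rule integrable_of_square_bounded_support[OF _ _ bounded_cbox[of a b]])
  have "integrable lborel (\<lambda>x. indicator (cbox a b) x *\<^sub>R (norm (h x))\<^sup>2)"
    by (rule integrable_mult_indicator[OF _ sq]) simp
  moreover have "indicator (cbox a b) x *\<^sub>R (norm (h x))\<^sup>2 = (norm (indicator (cbox a b) x *\<^sub>R h x))\<^sup>2" for x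
    by (auto simp: indicator_def)
  ultimately show "integrable lborel (\<lambda>x. (norm (indicator (cbox a b) x *\<^sub>R h x))\<^sup>2)" by (simp only:)
qed auto

lemma integrable_test_mult:
  fixes h :: "real^'n \<Rightarrow> 'b::euclidean_space"
  assumes h [measurable]: "h \<in> borel_measurable borel" and sq: "integrable lborel (\<lambda>x. (norm (h x))\<^sup>2)" and \<phi>: "\<phi> \<in> test_functions T"
  shows "integrable lborel (\<lambda>x. \<phi> x *\<^sub>R h x)"
proof -
  have [measurable]: "\<phi> \<in> borel_measurable borel"
    using test_function_continuous[OF \<phi>] by (rule borel_measurable_continuous_onI)
  obtain B where B: "\<And>x. \<bar>\<phi> x\<bar> \<le> B" using test_function_bounded[OF \<phi>] by blast
  have "bounded {x. \<phi> x \<noteq> 0}" using \<phi> by (auto simp: test_functions_def compact_closure)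
  then obtain a b where ab: "{x. \<phi> x \<noteq> 0} \<subseteq> cbox a b" by (metis bounded_subset_cbox_symmetric)
  show ?thesis
  proof (rule Bochner_Integration.integrable_bound[of _ "\<lambda>x. B *\<^sub>R (indicator (cbox a b) x *\<^sub>R h x)"])
    show "integrable lborel (\<lambda>x. B *\<^sub>R (indicator (cbox a b) x *\<^sub>R h x))"
      by (intro integrable_scaleR_right integrable_of_square sq h)
    show "AE x in lborel. norm (\<phi> x *\<^sub>R h x) \<le> norm (B *\<^sub>R (indicator (cbox a b) x *\<^sub>R h x))"
    proof (rule AE_I2)
      fix x
      show "norm (\<phi> x *\<^sub>R h x) \<le> norm (B *\<^sub>R (indicator (cbox a b) x *\<^sub>R h x))"
      proof (cases "\<phi> x = 0")
        case False
        then have "x \<in> cbox a b" using ab by blast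
        then show ?thesis using B[of x] by (auto intro!: mult_right_mono)
      qed simp
    qed
  qed measurable
qed

lemma integrable_nth:
  fixes f :: "'a \<Rightarrow> real^'n"
  assumes "integrable M f"
  shows "integrable M (\<lambda>x. f x $ i)" and "(LINT x|M. f x $ i) = (LINT x|M. f x) $ i"
  using integrable_bounded_linear[OF bounded_linear_vec_nth assms] integral_bounded_linear[OF bounded_linear_vec_nth assms]
  by blast+

text \<open>\<open>weak_grad\<close> is an arbitrary choice, made separately for each set;
  uniqueness is what relates the choice on \<Omega> to that on a cell, and the choice for a test
  function to its classical gradient.\<close>

lemma weak_gradient_unique:
  fixes T :: "(real^'n) set"
  assumes T: "open T" and w: "has_weak_gradient T v G" "has_weak_gradient T v G'"
  shows "AE x in lborel. x \<in> T \<longrightarrow> G x = G' x"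
proof -
  obtain g h where gh: "borel_weak_gradient T g h" "AE x in lborel. x \<in> T \<longrightarrow> v x = g x" "AE x in lborel. x \<in> T \<longrightarrow> G x = h x"
    using has_weak_gradient_borel[OF T w(1)] by blast
  obtain g' h' where gh': "borel_weak_gradient T g' h'" "AE x in lborel. x \<in> T \<longrightarrow> v x = g' x" "AE x in lborel. x \<in> T \<longrightarrow> G' x = h' x"
    using has_weak_gradient_borel[OF T w(2)] by blast
  note [measurable] = borel_weak_gradientD(1,2)[OF gh(1)] borel_weak_gradientD(1,2)[OF gh'(1)]
  have gg: "AE x in lborel. g x = g' x"
    using gh(2) gh'(2)
  proof eventually_elim
    case (elim x)
    then show ?case using borel_weak_gradientD(5)[OF gh(1), of x] borel_weak_gradientD(5)[OF gh'(1), of x] by (cases "x \<in> T") auto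
  qed
  have "AE x in lborel. x \<in> T \<longrightarrow> h x $ i - h' x $ i = 0" for i
  proof (rule fundamental_lemma[OF T])
    fix a b :: "real^'n"
    have "integrable lborel (\<lambda>x. (indicator (cbox a b) x *\<^sub>R h x) $ i - (indicator (cbox a b) x *\<^sub>R h' x) $ i)"
      by (intro Bochner_Integration.integrable_diff integrable_nth(1)
        integrable_of_square[OF borel_weak_gradientD(2,4)[OF gh(1)]] integrable_of_square[OF borel_weak_gradientD(2,4)[OF gh'(1)]])
    then show "integrable lborel (\<lambda>x. indicator (cbox a b) x * (h x $ i - h' x $ i))"
      by (simp add: right_diff_distrib)
  next
    fix \<phi> assume \<phi>: "\<phi> \<in> test_functions T"
    obtain D where D: "\<And>x. GDERIV \<phi> x :> D x" using test_function_gderiv[OF \<phi>] by metis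
    have [measurable]: "D \<in> borel_measurable borel"
      using test_function_gderiv_continuous[OF \<phi> D] by (rule borel_measurable_continuous_onI)
    have i1: "integrable lborel (\<lambda>x. \<phi> x *\<^sub>R h x)" "integrable lborel (\<lambda>x. \<phi> x *\<^sub>R h' x)"
      using integrable_test_mult[OF borel_weak_gradientD(2,4)[OF gh(1)] \<phi>] integrable_test_mult[OF borel_weak_gradientD(2,4)[OF gh'(1)] \<phi>] by auto
    have "(LBINT x. g x *\<^sub>R D x) = (LBINT x. g' x *\<^sub>R D x)"
    proof (rule integral_cong_AE)
      show "AE x in lborel. g x *\<^sub>R D x = g' x *\<^sub>R D x" using gg by eventually_elim simp
    qed measurable
    then have "(LBINT x. \<phi> x *\<^sub>R h x) = (LBINT x. \<phi> x *\<^sub>R h' x)"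
      using borel_weak_gradientD(7)[OF gh(1) \<phi> D] borel_weak_gradientD(7)[OF gh'(1) \<phi> D] by simp
    then have "(LBINT x. \<phi> x *\<^sub>R h x) $ i - (LBINT x. \<phi> x *\<^sub>R h' x) $ i = 0" by simp
    moreover have "(LBINT x. \<phi> x *\<^sub>R h x) $ i = (LBINT x. (\<phi> x *\<^sub>R h x) $ i)"
      "(LBINT x. \<phi> x *\<^sub>R h' x) $ i = (LBINT x. (\<phi> x *\<^sub>R h' x) $ i)"
      using integrable_nth(2)[OF i1(1), of i] integrable_nth(2)[OF i1(2), of i] by auto
    moreover have "(LBINT x. (h x $ i - h' x $ i) * \<phi> x) = (LBINT x. (\<phi> x *\<^sub>R h x) $ i - (\<phi> x *\<^sub>R h' x) $ i)"
      by (intro Bochner_Integration.integral_cong refl) (simp add: algebra_simps)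
    moreover have "\<dots> = (LBINT x. (\<phi> x *\<^sub>R h x) $ i) - (LBINT x. (\<phi> x *\<^sub>R h' x) $ i)"
      by (intro Bochner_Integration.integral_diff integrable_nth(1) i1)
    ultimately show "(LBINT x. (h x $ i - h' x $ i) * \<phi> x) = 0" by linarith
  qed
  then have "AE x in lborel. \<forall>i\<in>UNIV. x \<in> T \<longrightarrow> h x $ i - h' x $ i = 0" by (intro AE_finite_allI) auto
  with gh(3) gh'(3) show ?thesis
    by eventually_elim (auto simp: vec_eq_iff)
qed

lemma has_weak_gradient_mono:
  fixes T :: "(real^'n) set"
  assumes S: "open S" "S \<subseteq> T" "open T" and w: "has_weak_gradient T v G"
  shows "has_weak_gradient S v G"
proof -
  have Sb [measurable]: "S \<in> sets borel" using S by auto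
  have restrict: "f \<in> L2 S" if "f \<in> L2 T" for f :: "real^'n \<Rightarrow> 'b::euclidean_space"
  proof -
    have m: "f \<in> borel_measurable (lebesgue_on T)" and i: "integrable (lebesgue_on T) (\<lambda>x. (norm (f x))\<^sup>2)"
      using that by (auto simp: L2_def)
    have "f \<in> borel_measurable (lebesgue_on S)" by (rule measurable_restrict_mono[OF m S(2)])
    moreover have "integrable (lebesgue_on S) (\<lambda>x. (norm (f x))\<^sup>2)"
    proof -
      have "integrable lebesgue (\<lambda>x. indicator T x *\<^sub>R (norm (f x))\<^sup>2)"
        using i S by (simp add: integrable_restrict_space)
      from integrable_mult_indicator[OF _ this, of S] Sb
      have "integrable lebesgue (\<lambda>x. indicator S x *\<^sub>R (indicator T x *\<^sub>R (norm (f x))\<^sup>2))" by simp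
      moreover have "indicator S x *\<^sub>R (indicator T x *\<^sub>R (norm (f x))\<^sup>2) = indicator S x *\<^sub>R (norm (f x))\<^sup>2" for x
        using S(2) by (auto simp: indicator_def)
      ultimately have "integrable lebesgue (\<lambda>x. indicator S x *\<^sub>R (norm (f x))\<^sup>2)" by (simp only:)
      then show ?thesis using Sb by (simp add: integrable_restrict_space)
    qed
    ultimately show ?thesis by (simp add: L2_def)
  qed
  have int: "(LINT x|lebesgue_on S. f x) = (LINT x|lebesgue_on T. f x)" if "\<And>x. x \<notin> S \<Longrightarrow> f x = 0" for f :: "real^'n \<Rightarrow> real^'n"
  proof -
    have eq: "indicator S x *\<^sub>R f x = indicator T x *\<^sub>R f x" for x using that[of x] S(2) by (auto simp: indicator_def)
    have "T \<in> sets lebesgue" "S \<in> sets lebesgue" using S by auto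
    then show ?thesis by (subst (1 2) integral_restrict_space) (simp_all add: eq)
  qed
  show ?thesis unfolding has_weak_gradient_def
  proof (intro conjI allI impI)
    show "v \<in> L2 S" "G \<in> L2 S" using restrict w by (auto simp: has_weak_gradient_def)
    fix \<phi> D assume \<phi>: "\<phi> \<in> test_functions S \<and> (\<forall>x. GDERIV \<phi> x :> D x)"
    then have "(LINT x|lebesgue_on T. v x *\<^sub>R D x) = - (LINT x|lebesgue_on T. \<phi> x *\<^sub>R G x)"
      using w test_functions_mono[OF S(2)] unfolding has_weak_gradient_def by blast
    moreover have "D x = 0" "\<phi> x = 0" if "x \<notin> S" for x
      using test_function_gderiv_eq_0[of \<phi> S D x] test_function_eq_0[of \<phi> S x] \<phi> that by auto
    ultimately show "(LINT x|lebesgue_on S. v x *\<^sub>R D x) = - (LINT x|lebesgue_on S. \<phi> x *\<^sub>R G x)"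
      by (subst int, simp)+
  qed
qed

lemma weak_grad: "v \<in> H1 T \<Longrightarrow> has_weak_gradient T v (weak_grad T v)"
  unfolding H1_def weak_grad_def mem_Collect_eq using someI_ex[of "has_weak_gradient T v"] by simp

section \<open>Test functions as Sobolev functions\<close>

lemma test_function_integrable:
  assumes \<phi>: "\<phi> \<in> test_functions T" shows "integrable lborel \<phi>"
proof -
  have "bounded {x. \<phi> x \<noteq> 0}" using \<phi> by (auto simp: test_functions_def compact_closure)
  then obtain a b where ab: "{x. \<phi> x \<noteq> 0} \<subseteq> cbox a b" by (metis bounded_subset_cbox_symmetric)
  obtain C where C: "\<And>x. \<bar>\<phi> x\<bar> \<le> C" using test_function_bounded[OF \<phi>] by blast
  show ?thesis
  proof (rule Bochner_Integration.integrable_bound[of _ "\<lambda>x. C * indicator (cbox a b) x"])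
    show "integrable lborel (\<lambda>x. C * indicator (cbox a b) x)"
      by (intro integrable_mult_right integrable_real_indicator) (auto simp: emeasure_lborel_cbox_eq)
    show "AE x in lborel. norm (\<phi> x) \<le> norm (C * indicator (cbox a b) x)"
    proof (rule AE_I2)
      fix x show "norm (\<phi> x) \<le> norm (C * indicator (cbox a b) x)"
        using C[of x] ab by (cases "\<phi> x = 0") auto
    qed
    show "\<phi> \<in> borel_measurable lborel"
      using test_function_continuous[OF \<phi>] by (simp add: borel_measurable_continuous_onI)
  qed
qed

lemma integrable_vec_components:
  fixes f :: "'a \<Rightarrow> real^'n"
  assumes "\<And>i. integrable M (\<lambda>x. f x $ i)" shows "integrable M f"
proof -
  have "integrable M (\<lambda>x. \<Sum>i\<in>UNIV. (f x $ i) *\<^sub>R (axis i 1 :: real^'n))"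
    using assms by (intro Bochner_Integration.integrable_sum integrable_scaleR_left) auto
  moreover have "(\<Sum>i\<in>UNIV. (f x $ i) *\<^sub>R (axis i 1 :: real^'n)) = f x" for x
    by (simp add: vec_eq_iff axis_def if_distrib cong: if_cong)
  ultimately show ?thesis by simp
qed

lemma test_function_gderiv_components:
  assumes "\<phi> \<in> test_functions T" "\<And>x. GDERIV \<phi> x :> D x"
  shows "(\<lambda>x. D x $ i) \<in> test_functions T"
proof -
  obtain D' where D': "\<And>x. GDERIV \<phi> x :> D' x" "\<And>i. (\<lambda>x. D' x $ i) \<in> test_functions T"
    using test_function_gderiv[OF assms(1)] by blast
  have "D' = D" using D'(1) assms(2) GDERIV_unique by blast
  then show ?thesis using D'(2) by simp
qed

text \<open>This is translation invariance of the integral of \<open>\<zeta>\<close>.\<close>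

lemma integral_test_gradient:
  fixes T :: "(real^'n) set"
  assumes \<zeta>: "\<zeta> \<in> test_functions T" and D: "\<And>x. GDERIV \<zeta> x :> D x"
  shows "(LBINT x. D x) = 0"
proof -
  have iD: "integrable lborel D"
    by (rule integrable_vec_components) (rule test_function_integrable[OF test_function_gderiv_components[OF \<zeta> D]])
  note i\<zeta> = test_function_integrable[OF \<zeta>]
  have [measurable]: "\<zeta> \<in> borel_measurable borel" "D \<in> borel_measurable borel" using iD i\<zeta> by auto
  have "(LBINT x. D x) \<bullet> e = 0" for e
  proof -
    have iDe: "integrable lborel (\<lambda>x. D x \<bullet> e)" using iD by auto
    have shear: "integrable (lborel \<Otimes>\<^sub>M lborel) (\<lambda>(x, q). indicator {0..1} q * (D (x + q *\<^sub>R e) \<bullet> e))"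
      using integrable_shear[OF iDe, of "{0..1}" e] by simp
    have ftc: "(LBINT q. indicator {0..1} q * (D (x + q *\<^sub>R e) \<bullet> e)) = \<zeta> (x + e) - \<zeta> x" for x
    proof -
      have der: "((\<lambda>q. \<zeta> (x + q *\<^sub>R e)) has_vector_derivative (D (x + q *\<^sub>R e) \<bullet> e)) (at q)" for q
      proof -
        have "((\<lambda>q. x + q *\<^sub>R e) has_derivative (\<lambda>t. t *\<^sub>R e)) (at q)"
          by (auto intro!: derivative_eq_intros)
        from has_derivative_compose[OF this D[unfolded gderiv_def]]
        show ?thesis by (simp add: has_vector_derivative_def inner_commute)
      qed
      have "(LBINT q. indicator {0..1} q *\<^sub>R (D (x + q *\<^sub>R e) \<bullet> e)) = \<zeta> (x + 1 *\<^sub>R e) - \<zeta> (x + 0 *\<^sub>R e)"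
      proof (rule integral_FTC_Icc)
        show "continuous_on {0..1} (\<lambda>q. D (x + q *\<^sub>R e) \<bullet> e)"
          by (intro continuous_intros continuous_on_compose2[OF test_function_gderiv_continuous[OF \<zeta> D]]) auto
      qed (use der in \<open>auto intro: has_vector_derivative_at_within\<close>)
      then show ?thesis by simp
    qed
    have "0 = (LBINT x. \<zeta> (x + e) - \<zeta> x)"
      using i\<zeta> integrable_translate[OF i\<zeta>, of e] integral_translate[of \<zeta> e] by simp
    also have "\<dots> = (LBINT x. LINT q|lborel. indicator {0..1} q * (D (x + q *\<^sub>R e) \<bullet> e))"
      unfolding ftc ..
    also have "\<dots> = (LBINT q. LINT x|lborel. indicator {0..1} q * (D (x + q *\<^sub>R e) \<bullet> e))"
      using lborel_pair.Fubini_integral[OF shear] by simp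
    also have "\<dots> = (LBINT q. indicator {0..1::real} q * (LBINT x. D x \<bullet> e))"
      using integral_translate[of "\<lambda>x. D x \<bullet> e"] by (intro Bochner_Integration.integral_cong) auto
    also have "\<dots> = (LBINT x. D x \<bullet> e)" by simp
    also have "\<dots> = (LBINT x. D x) \<bullet> e" using iD by simp
    finally show ?thesis by simp
  qed
  then show ?thesis by (metis inner_eq_zero_iff)
qed

text \<open>Integration by parts for two test functions is \<open>integral_test_gradient\<close>
  applied to their product.\<close>

lemma test_function_weak_gradient:
  fixes T :: "(real^'n) set"
  assumes T: "open T" and \<phi>: "\<phi> \<in> test_functions T" and D: "\<And>x. GDERIV \<phi> x :> D x"
  shows "has_weak_gradient T \<phi> D"
proof -
  have Tb [measurable]: "T \<in> sets borel" using T by auto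
  have [measurable]: "\<phi> \<in> borel_measurable borel" "D \<in> borel_measurable borel"
    using test_function_continuous[OF \<phi>] test_function_gderiv_continuous[OF \<phi> D]
    by (auto intro: borel_measurable_continuous_onI)
  have test2: "integrable lborel (\<lambda>x. \<psi> x * \<eta> x)" if \<psi>: "\<psi> \<in> test_functions T" and \<eta>: "\<eta> \<in> test_functions T" for \<psi> \<eta> :: "real^'n \<Rightarrow> real"
  proof -
    obtain B where B: "\<And>x. \<bar>\<eta> x\<bar> \<le> B" using test_function_bounded[OF \<eta>] by blast
    have m: "\<eta> \<in> borel_measurable lborel"
      using test_function_continuous[OF \<eta>] by (simp add: borel_measurable_continuous_onI)
    show ?thesis by (rule integrable_mult_bounded[OF test_function_integrable[OF \<psi>] m B])
  qed
  have di: "(\<lambda>x. D x $ i) \<in> test_functions T" for i by (rule test_function_gderiv_components[OF \<phi> D])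
  have D0: "x \<notin> T \<Longrightarrow> D x = 0" for x by (rule test_function_gderiv_eq_0[OF \<phi> D])
  have \<phi>0: "x \<notin> T \<Longrightarrow> \<phi> x = 0" for x by (rule test_function_eq_0[OF \<phi>])
  have L2\<phi>: "\<phi> \<in> L2 T"
  proof -
    have "integrable (lebesgue_on T) (\<lambda>x. (norm (\<phi> x))\<^sup>2) \<longleftrightarrow> integrable lborel (\<lambda>x. \<phi> x * \<phi> x)"
      by (rule lebesgue_on_AE_eq_borel(3)[OF Tb]) (auto simp: power2_eq_square \<phi>0)
    moreover have "\<phi> \<in> borel_measurable (lebesgue_on T)" by (rule lebesgue_on_AE_eq_borel(1)[OF Tb, of \<phi>]) (auto simp: \<phi>0)
    ultimately show ?thesis using test2[OF \<phi> \<phi>] by (simp add: L2_def)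
  qed
  have L2D: "D \<in> L2 T"
  proof -
    have i: "integrable lborel (\<lambda>x. \<Sum>i\<in>UNIV. D x $ i * D x $ i)"
      by (intro Bochner_Integration.integrable_sum test2 di)
    then have m: "(\<lambda>x. \<Sum>i\<in>UNIV. D x $ i * D x $ i) \<in> borel_measurable borel" by auto
    have "integrable (lebesgue_on T) (\<lambda>x. (norm (D x))\<^sup>2) \<longleftrightarrow> integrable lborel (\<lambda>x. \<Sum>i\<in>UNIV. D x $ i * D x $ i)"
      by (rule lebesgue_on_AE_eq_borel(3)[OF Tb m]) (auto simp: power2_norm_eq_inner inner_vec_def D0)
    with i have "integrable (lebesgue_on T) (\<lambda>x. (norm (D x))\<^sup>2)" by simp
    moreover have "D \<in> borel_measurable (lebesgue_on T)" by (rule lebesgue_on_AE_eq_borel(1)[OF Tb, of D]) (auto simp: D0)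
    ultimately show ?thesis by (simp add: L2_def)
  qed
  show ?thesis unfolding has_weak_gradient_def
  proof (intro conjI allI impI L2\<phi> L2D)
    fix \<psi> E assume "\<psi> \<in> test_functions T \<and> (\<forall>x. GDERIV \<psi> x :> E x)"
    then have \<psi>: "\<psi> \<in> test_functions T" and E: "\<And>x. GDERIV \<psi> x :> E x" by auto
    have [measurable]: "\<psi> \<in> borel_measurable borel" "E \<in> borel_measurable borel"
      using test_function_continuous[OF \<psi>] test_function_gderiv_continuous[OF \<psi> E]
      by (auto intro: borel_measurable_continuous_onI)
    have ei: "(\<lambda>x. E x $ i) \<in> test_functions T" for i by (rule test_function_gderiv_components[OF \<psi> E])
    have i1: "integrable lborel (\<lambda>x. \<phi> x *\<^sub>R E x)" by (rule integrable_vec_components) (use test2[OF \<phi> ei] in simp)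
    have i2: "integrable lborel (\<lambda>x. \<psi> x *\<^sub>R D x)" by (rule integrable_vec_components) (use test2[OF \<psi> di] in simp)
    have bw: "(LBINT x. \<phi> x *\<^sub>R E x + \<psi> x *\<^sub>R D x) = 0"
    proof -
      have g: "GDERIV (\<lambda>x. \<phi> x * \<psi> x) x :> \<phi> x *\<^sub>R E x + \<psi> x *\<^sub>R D x" for x by (rule GDERIV_mult[OF D E])
      have "(\<lambda>x. \<phi> x * \<psi> x) \<in> test_functions T"
        by (rule test_function_mult[OF \<psi>]) (use \<phi> in \<open>auto simp: test_functions_def\<close>)
      from this have t: "(\<lambda>x. \<phi> x * \<psi> x) \<in> test_functions T" .
      show ?thesis by (rule integral_test_gradient[OF t g])
    qed
    have "(LBINT x. \<phi> x *\<^sub>R E x) = - (LBINT x. \<psi> x *\<^sub>R D x)"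
      using bw i1 i2 by (simp add: eq_neg_iff_add_eq_0)
    moreover have "(LINT x|lebesgue_on T. \<phi> x *\<^sub>R E x) = (LBINT x. \<phi> x *\<^sub>R E x)"
      by (rule lebesgue_on_AE_eq_borel(2)[OF Tb]) (auto simp: \<phi>0)
    moreover have "(LINT x|lebesgue_on T. \<psi> x *\<^sub>R D x) = (LBINT x. \<psi> x *\<^sub>R D x)"
      by (rule lebesgue_on_AE_eq_borel(2)[OF Tb]) (auto simp: D0)
    ultimately show "(LINT x|lebesgue_on T. \<phi> x *\<^sub>R E x) = - (LINT x|lebesgue_on T. \<psi> x *\<^sub>R D x)" by simp
  qed
qed

text \<open>The constant sequence approximates \<phi>. Test functions are thereby admissible in the
  variational equation.\<close>

lemma test_function_H10:
  fixes T :: "(real^'n) set"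
  assumes T: "open T" and \<phi>: "\<phi> \<in> test_functions T" and D: "\<And>x. GDERIV \<phi> x :> D x"
  shows "\<phi> \<in> H10 T" and "AE x in lborel. x \<in> T \<longrightarrow> weak_grad T \<phi> x = D x"
proof -
  have w: "has_weak_gradient T \<phi> D" by (rule test_function_weak_gradient[OF T \<phi> D])
  then have H1: "\<phi> \<in> H1 T" by (auto simp: H1_def)
  show eq: "AE x in lborel. x \<in> T \<longrightarrow> weak_grad T \<phi> x = D x"
    by (rule weak_gradient_unique[OF T weak_grad[OF H1] w])
  have "(LINT x|lebesgue_on T. (norm (D x - weak_grad T \<phi> x))\<^sup>2) = (LINT (x::real^'n)|lborel. 0)"
  proof (rule lebesgue_on_AE_eq_borel(2))
    show "AE x in lborel. x \<in> T \<longrightarrow> (norm (D x - weak_grad T \<phi> x))\<^sup>2 = 0"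
      using eq by eventually_elim simp
  qed (use T in auto)
  then have "(LINT x|lebesgue_on T. (norm (D x - weak_grad T \<phi> x))\<^sup>2) = 0" by simp
  then show "\<phi> \<in> H10 T"
    unfolding H10_def using H1 \<phi> D by (auto intro!: exI[of _ "\<lambda>_. \<phi>"] exI[of _ "\<lambda>_. D"])
qed

section \<open>Normal fluxes through the faces of a cell\<close>

text \<open>The trace of a Lebesgue measurable gradient agrees only almost everywhere with a Borel
  function; in the completed face measure this is enough for measurability, and so for evaluating
  the face integrals.\<close>

lemma completion_measurable_AE:
  assumes f': "f' \<in> measurable M N" and ae: "AE x in M. f x = f' x" and f: "f \<in> space M \<rightarrow> space N"
  shows "f \<in> measurable (completion M) N"
proof (rule measurableI)
  fix x assume "x \<in> space (completion M)" then show "f x \<in> space N" using f by auto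
next
  fix A assume A: "A \<in> sets N"
  have "f' -` A \<inter> space M \<in> sets (completion M)" using measurable_sets[OF f' A] by auto
  moreover have "AE x in completion M. x \<in> f' -` A \<inter> space M \<longleftrightarrow> x \<in> f -` A \<inter> space (completion M)"
    using AE_completion[OF ae] by eventually_elim auto
  ultimately show "f -` A \<inter> space (completion M) \<in> sets (completion M)"
    by (intro completion.in_sets_AE[of "f' -` A \<inter> space M" "f -` A \<inter> space (completion M)" M]) auto
qed

lemma integral_completion_AE:
  fixes f f' :: "'a \<Rightarrow> real"
  assumes f': "f' \<in> borel_measurable M" and ae: "AE x in M. f x = f' x"
  shows "(LINT x|completion M. f x) = (LINT x|M. f' x)"
proof -
  have "f \<in> borel_measurable (completion M)" by (rule completion_measurable_AE[OF f' ae]) auto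
  then have "(LINT x|completion M. f x) = (LINT x|completion M. f' x)"
    using f' AE_completion[OF ae] by (intro integral_cong_AE) (auto intro: measurable_completion)
  then show ?thesis using f' by (simp add: integral_completion)
qed

text \<open>The product \<psi> \<phi> is again a test function, although \<psi> need not vanish near
  the boundary of T. This product rule turns the divergence theorem into Green's formula.\<close>

lemma weak_gradient_mult:
  assumes w: "borel_weak_gradient T g h" and T: "open T" "bounded T"
    and \<psi>: "\<And>k. C_k k \<psi>" "\<And>x. \<bar>\<psi> x\<bar> \<le> B" and D: "\<And>x. GDERIV \<psi> x :> D x" "\<And>x. norm (D x) \<le> B'" "D \<in> borel_measurable borel"
  shows "borel_weak_gradient T (\<lambda>x. \<psi> x * g x) (\<lambda>x. \<psi> x *\<^sub>R h x + g x *\<^sub>R D x)"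
proof -
  note [measurable] = borel_weak_gradientD(1,2)[OF w] D(3)
  have [measurable]: "\<psi> \<in> borel_measurable borel"
    using \<psi>(1)[of 0] by (simp add: borel_measurable_continuous_onI)
  have ig: "integrable lborel g" and ih: "integrable lborel h"
    using borel_weak_gradient_integrable[OF w T(2)] .
  have sq: "integrable lborel (\<lambda>x. (\<psi> x * g x)\<^sup>2)"
  proof (rule Bochner_Integration.integrable_bound[of _ "\<lambda>x. B\<^sup>2 * (g x)\<^sup>2"])
    show "integrable lborel (\<lambda>x. B\<^sup>2 * (g x)\<^sup>2)" using borel_weak_gradientD(3)[OF w] by auto
    show "AE x in lborel. norm ((\<psi> x * g x)\<^sup>2) \<le> norm (B\<^sup>2 * (g x)\<^sup>2)"
    proof (rule AE_I2)
      fix x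
      have "(\<psi> x)\<^sup>2 \<le> B\<^sup>2" using \<psi>(2)[of x] by (metis abs_ge_zero power2_abs power_mono)
      then show "norm ((\<psi> x * g x)\<^sup>2) \<le> norm (B\<^sup>2 * (g x)\<^sup>2)"
        by (simp add: power_mult_distrib mult_right_mono)
    qed
  qed measurable
  have sqh: "integrable lborel (\<lambda>x. (norm (\<psi> x *\<^sub>R h x + g x *\<^sub>R D x))\<^sup>2)"
  proof (rule Bochner_Integration.integrable_bound[of _ "\<lambda>x. 2 * B\<^sup>2 * (norm (h x))\<^sup>2 + 2 * B'\<^sup>2 * (g x)\<^sup>2"])
    show "integrable lborel (\<lambda>x. 2 * B\<^sup>2 * (norm (h x))\<^sup>2 + 2 * B'\<^sup>2 * (g x)\<^sup>2)"
      using borel_weak_gradientD(3,4)[OF w] by auto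
    show "AE x in lborel. norm ((norm (\<psi> x *\<^sub>R h x + g x *\<^sub>R D x))\<^sup>2) \<le> norm (2 * B\<^sup>2 * (norm (h x))\<^sup>2 + 2 * B'\<^sup>2 * (g x)\<^sup>2)"
    proof (rule AE_I2)
      fix x
      have a: "norm (\<psi> x *\<^sub>R h x + g x *\<^sub>R D x) \<le> B * norm (h x) + B' * \<bar>g x\<bar>"
      proof -
        have "norm (\<psi> x *\<^sub>R h x + g x *\<^sub>R D x) \<le> \<bar>\<psi> x\<bar> * norm (h x) + \<bar>g x\<bar> * norm (D x)"
          using norm_triangle_ineq[of "\<psi> x *\<^sub>R h x" "g x *\<^sub>R D x"] by simp
        also have "\<dots> \<le> B * norm (h x) + \<bar>g x\<bar> * B'"
          by (intro add_mono mult_right_mono mult_left_mono \<psi>(2) D(2)) auto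
        finally show ?thesis by (simp add: mult.commute)
      qed
      have "(norm (\<psi> x *\<^sub>R h x + g x *\<^sub>R D x))\<^sup>2 \<le> (B * norm (h x) + B' * \<bar>g x\<bar>)\<^sup>2"
        using a by (intro power_mono) auto
      also have "\<dots> \<le> 2 * B\<^sup>2 * (norm (h x))\<^sup>2 + 2 * B'\<^sup>2 * (g x)\<^sup>2"
        using sum_squares_bound[of "B * norm (h x)" "B' * \<bar>g x\<bar>"]
        by (simp add: power2_sum power_mult_distrib)
      finally show "norm ((norm (\<psi> x *\<^sub>R h x + g x *\<^sub>R D x))\<^sup>2) \<le> norm (2 * B\<^sup>2 * (norm (h x))\<^sup>2 + 2 * B'\<^sup>2 * (g x)\<^sup>2)"
        by simp
    qed
  qed measurable
  have main: "(LBINT x. (\<psi> x * g x) *\<^sub>R E x) = - (LBINT x. \<phi> x *\<^sub>R (\<psi> x *\<^sub>R h x + g x *\<^sub>R D x))"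
    if \<phi>: "\<phi> \<in> test_functions T" and E: "\<And>x. GDERIV \<phi> x :> E x" for \<phi> E
  proof -
    have [measurable]: "\<phi> \<in> borel_measurable borel" "E \<in> borel_measurable borel"
      using test_function_continuous[OF \<phi>] test_function_gderiv_continuous[OF \<phi> E]
      by (auto intro: borel_measurable_continuous_onI)
    obtain C where C: "\<And>x. \<bar>\<phi> x\<bar> \<le> C" using test_function_bounded[OF \<phi>] by metis
    obtain C' where C': "\<And>x. norm (E x) \<le> C'" using test_function_gderiv_bounded[OF \<phi> E] by metis
    have t: "(\<lambda>x. \<psi> x * \<phi> x) \<in> test_functions T" by (rule test_function_mult[OF \<phi> \<psi>(1)])
    have dt: "GDERIV (\<lambda>x. \<psi> x * \<phi> x) x :> \<psi> x *\<^sub>R E x + \<phi> x *\<^sub>R D x" for x by (rule GDERIV_mult[OF D(1) E])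
    have eq: "(LBINT x. g x *\<^sub>R (\<psi> x *\<^sub>R E x + \<phi> x *\<^sub>R D x)) = - (LBINT x. (\<psi> x * \<phi> x) *\<^sub>R h x)"
      by (rule borel_weak_gradientD(7)[OF w t dt])
    have B0: "0 \<le> B" "0 \<le> B'" "0 \<le> C" "0 \<le> C'"
      using order_trans[OF abs_ge_zero \<psi>(2)] order_trans[OF norm_ge_zero D(2)] order_trans[OF abs_ge_zero C] order_trans[OF norm_ge_zero C'] by auto
    have i1: "integrable lborel (\<lambda>x. (\<psi> x * g x) *\<^sub>R E x)"
    proof (rule Bochner_Integration.integrable_bound[of _ "\<lambda>x. (B * C') * g x"])
      show "AE x in lborel. norm ((\<psi> x * g x) *\<^sub>R E x) \<le> norm ((B * C') * g x)"
      proof (rule AE_I2)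
        fix x
        have "\<bar>\<psi> x\<bar> * norm (E x) \<le> B * C'" by (intro mult_mono \<psi>(2) C') (use B0 in auto)
        then have "(\<bar>\<psi> x\<bar> * norm (E x)) * \<bar>g x\<bar> \<le> (B * C') * \<bar>g x\<bar>" by (rule mult_right_mono) simp
        then show "norm ((\<psi> x * g x) *\<^sub>R E x) \<le> norm ((B * C') * g x)" using B0 by (simp add: abs_mult mult_ac)
      qed
    qed (use ig in auto)
    have i2: "integrable lborel (\<lambda>x. \<phi> x *\<^sub>R g x *\<^sub>R D x)"
    proof (rule Bochner_Integration.integrable_bound[of _ "\<lambda>x. (C * B') * g x"])
      show "AE x in lborel. norm (\<phi> x *\<^sub>R g x *\<^sub>R D x) \<le> norm ((C * B') * g x)"
      proof (rule AE_I2)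
        fix x
        have "\<bar>\<phi> x\<bar> * norm (D x) \<le> C * B'" by (intro mult_mono C D(2)) (use B0 in auto)
        then have "(\<bar>\<phi> x\<bar> * norm (D x)) * \<bar>g x\<bar> \<le> (C * B') * \<bar>g x\<bar>" by (rule mult_right_mono) simp
        then show "norm (\<phi> x *\<^sub>R g x *\<^sub>R D x) \<le> norm ((C * B') * g x)" using B0 by (simp add: abs_mult mult_ac)
      qed
    qed (use ig in auto)
    have i3: "integrable lborel (\<lambda>x. \<phi> x *\<^sub>R \<psi> x *\<^sub>R h x)"
      using integrable_test_mult[OF borel_weak_gradientD(2,4)[OF w] t] by (simp add: mult.commute)
    have "(LBINT x. g x *\<^sub>R (\<psi> x *\<^sub>R E x + \<phi> x *\<^sub>R D x)) = (LBINT x. (\<psi> x * g x) *\<^sub>R E x + \<phi> x *\<^sub>R g x *\<^sub>R D x)"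
      by (intro Bochner_Integration.integral_cong refl) (simp add: scaleR_add_right mult.commute)
    also have "\<dots> = (LBINT x. (\<psi> x * g x) *\<^sub>R E x) + (LBINT x. \<phi> x *\<^sub>R g x *\<^sub>R D x)"
      by (rule Bochner_Integration.integral_add[OF i1 i2])
    finally have a: "(LBINT x. (\<psi> x * g x) *\<^sub>R E x) + (LBINT x. \<phi> x *\<^sub>R g x *\<^sub>R D x) = - (LBINT x. \<phi> x *\<^sub>R \<psi> x *\<^sub>R h x)"
      unfolding eq by (simp add: mult.commute)
    have "(LBINT x. \<phi> x *\<^sub>R (\<psi> x *\<^sub>R h x + g x *\<^sub>R D x)) = (LBINT x. \<phi> x *\<^sub>R \<psi> x *\<^sub>R h x) + (LBINT x. \<phi> x *\<^sub>R g x *\<^sub>R D x)"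
      unfolding scaleR_add_right[of "\<phi> _"] by (rule Bochner_Integration.integral_add[OF i3 i2])
    then have b: "- (LBINT x. \<phi> x *\<^sub>R (\<psi> x *\<^sub>R h x + g x *\<^sub>R D x)) = - (LBINT x. \<phi> x *\<^sub>R \<psi> x *\<^sub>R h x) - (LBINT x. \<phi> x *\<^sub>R g x *\<^sub>R D x)"
      by (simp only: minus_add_distrib diff_conv_add_uminus add.commute)
    show ?thesis unfolding b using a by (simp only: eq_diff_eq)
  qed
  show ?thesis
    unfolding borel_weak_gradient_def
  proof (intro conjI allI impI)
    show "(\<lambda>x. \<psi> x * g x) \<in> borel_measurable borel" "(\<lambda>x. \<psi> x *\<^sub>R h x + g x *\<^sub>R D x) \<in> borel_measurable borel"
      by measurable
    show "\<psi> x * g x = 0" "\<psi> x *\<^sub>R h x + g x *\<^sub>R D x = 0" if "x \<notin> T" for x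
      using borel_weak_gradientD(5,6)[OF w that] by auto
    show "(LBINT x. (\<psi> x * g x) *\<^sub>R E x) = - (LBINT x. \<phi> x *\<^sub>R (\<psi> x *\<^sub>R h x + g x *\<^sub>R D x))"
      if "\<phi> \<in> test_functions T \<and> (\<forall>x. GDERIV \<phi> x :> E x)" for \<phi> E
      using main that by blast
  qed (rule sq, rule sqh)
qed

lemma ess_trace_mult:
  fixes g \<psi> :: "'a::real_normed_vector \<Rightarrow> real"
  assumes e: "ess_trace n g x v" and c: "isCont \<psi> x" and n: "norm n = 1"
  shows "ess_trace n (\<lambda>y. \<psi> y * g y) x (\<psi> x * v)"
  unfolding ess_trace_def
proof (intro allI impI)
  fix \<eta> :: real assume "\<eta> > 0"
  \<comment> \<open>The bound 1 on a keeps |g| below |v| + 1 near x; with that, a and c' each leave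
    \<eta>/2 to one of the two terms of the product difference.\<close>
  define a where "a = min 1 (\<eta> / (2 * (\<bar>\<psi> x\<bar> + 1)))"
  define c' where "c' = \<eta> / (2 * (\<bar>v\<bar> + 1))"
  have ac: "a > 0" "c' > 0" using \<open>\<eta> > 0\<close> by (auto simp: a_def c'_def)
  obtain \<delta>1 where \<delta>1: "\<delta>1 > 0" "AE s in lborel. 0 < s \<and> s < \<delta>1 \<longrightarrow> norm (g (x + s *\<^sub>R n) - v) \<le> a"
    using e ac(1) unfolding ess_trace_def by blast
  obtain \<delta>2 where \<delta>2: "\<delta>2 > 0" "\<And>y. dist y x < \<delta>2 \<Longrightarrow> dist (\<psi> y) (\<psi> x) < c'"
    using c ac(2) unfolding continuous_at_eps_delta by blast
  have "AE s in lborel. 0 < s \<and> s < min \<delta>1 \<delta>2 \<longrightarrow> norm (\<psi> (x + s *\<^sub>R n) * g (x + s *\<^sub>R n) - \<psi> x * v) \<le> \<eta>"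
    using \<delta>1(2)
  proof eventually_elim
    case (elim s)
    show ?case
    proof
      assume s: "0 < s \<and> s < min \<delta>1 \<delta>2"
      define y where "y = x + s *\<^sub>R n"
      have g1: "\<bar>g y - v\<bar> \<le> a" using elim s by (simp add: y_def)
      have "dist y x < \<delta>2" using s n by (simp add: y_def dist_norm)
      then have p1: "\<bar>\<psi> y - \<psi> x\<bar> \<le> c'" using \<delta>2(2) by (force simp: dist_real_def)
      have "a \<le> 1" by (simp add: a_def)
      then have g2: "\<bar>g y\<bar> \<le> \<bar>v\<bar> + 1" using g1 by linarith
      have "\<psi> y * g y - \<psi> x * v = (\<psi> y - \<psi> x) * g y + \<psi> x * (g y - v)" by (simp add: algebra_simps)
      then have "\<bar>\<psi> y * g y - \<psi> x * v\<bar> \<le> \<bar>\<psi> y - \<psi> x\<bar> * \<bar>g y\<bar> + \<bar>\<psi> x\<bar> * \<bar>g y - v\<bar>"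
        by (metis abs_mult abs_triangle_ineq)
      also have "\<dots> \<le> c' * (\<bar>v\<bar> + 1) + (\<bar>\<psi> x\<bar> + 1) * (\<eta> / (2 * (\<bar>\<psi> x\<bar> + 1)))"
        using p1 g2 g1 ac by (intro add_mono mult_mono) (auto simp: a_def)
      also have "\<dots> = \<eta>"
      proof -
        have half: "\<eta> / (2 * p) * p = \<eta> / 2" if "p > 0" for p using that by simp
        show ?thesis
          using half[of "\<bar>v\<bar> + 1"] half[of "\<bar>\<psi> x\<bar> + 1"] unfolding c'_def mult.commute[of "\<bar>\<psi> x\<bar> + 1"] by linarith
      qed
      finally show "norm (\<psi> (x + s *\<^sub>R n) * g (x + s *\<^sub>R n) - \<psi> x * v) \<le> \<eta>" by (simp add: y_def)
    qed
  qed
  then show "\<exists>\<delta>>0. AE s in lborel. 0 < s \<and> s < \<delta> \<longrightarrow> norm (\<psi> (x + s *\<^sub>R n) * g (x + s *\<^sub>R n) - \<psi> x * v) \<le> \<eta>"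
    using \<delta>1(1) \<delta>2(1) by (intro exI[of _ "min \<delta>1 \<delta>2"] conjI) auto
qed

lemma ess_trace_vec:
  fixes g :: "'a::real_normed_vector \<Rightarrow> real^'n"
  assumes e: "\<And>i. ess_trace n (\<lambda>y. g y $ i) x (v $ i)"
  shows "ess_trace n g x v"
  unfolding ess_trace_def
proof (intro allI impI)
  fix \<eta> :: real assume "\<eta> > 0"
  define a where "a = \<eta> / real CARD('n)"
  have a: "a > 0" using \<open>\<eta> > 0\<close> by (simp add: a_def)
  have "\<forall>i. \<exists>\<delta>>0. AE s in lborel. 0 < s \<and> s < \<delta> \<longrightarrow> norm (g (x + s *\<^sub>R n) $ i - v $ i) \<le> a"
    using e a unfolding ess_trace_def by blast
  from choice[OF this] obtain \<delta> where \<delta>: "\<And>i. \<delta> i > 0"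
    "\<And>i. AE s in lborel. 0 < s \<and> s < \<delta> i \<longrightarrow> norm (g (x + s *\<^sub>R n) $ i - v $ i) \<le> a" by blast
  define d where "d = Min (range \<delta>)"
  have d: "d > 0" "\<And>i. d \<le> \<delta> i" unfolding d_def using \<delta>(1) by (auto simp: Min_gr_iff)
  have "AE s in lborel. \<forall>i\<in>UNIV. 0 < s \<and> s < \<delta> i \<longrightarrow> norm (g (x + s *\<^sub>R n) $ i - v $ i) \<le> a"
    by (rule AE_finite_allI) (use \<delta>(2) in auto)
  then have "AE s in lborel. 0 < s \<and> s < d \<longrightarrow> norm (g (x + s *\<^sub>R n) - v) \<le> \<eta>"
  proof eventually_elim
    case (elim s)
    show ?case
    proof
      assume s: "0 < s \<and> s < d"
      have "norm (g (x + s *\<^sub>R n) - v) \<le> (\<Sum>i\<in>UNIV. \<bar>(g (x + s *\<^sub>R n) - v) $ i\<bar>)" by (rule norm_le_l1_cart)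
      also have "\<dots> \<le> (\<Sum>i\<in>(UNIV::'n set). a)"
      proof (rule sum_mono)
        fix i
        have "s < \<delta> i" using s d(2)[of i] by linarith
        then show "\<bar>(g (x + s *\<^sub>R n) - v) $ i\<bar> \<le> a" using elim s by simp
      qed
      also have "\<dots> = \<eta>" by (simp add: a_def)
      finally show "norm (g (x + s *\<^sub>R n) - v) \<le> \<eta>" .
    qed
  qed
  then show "\<exists>\<delta>>0. AE s in lborel. 0 < s \<and> s < \<delta> \<longrightarrow> norm (g (x + s *\<^sub>R n) - v) \<le> \<eta>" using d(1) by blast
qed

text \<open>Writes the normal component of a vector field through its scalar components, to which
  the divergence theorem for scalar functions applies.\<close>

lemma matrix_inner_expand:
  fixes A :: "real^'n^'n"
  shows "(A *v w) \<bullet> m = (\<Sum>l\<in>UNIV. w $ l * ((A *v axis l 1) \<bullet> m))"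
proof -
  have w: "(\<Sum>l\<in>UNIV. (w $ l) *\<^sub>R (axis l 1 :: real^'n)) = w"
    by (simp add: vec_eq_iff axis_def if_distrib cong: if_cong)
  have "A *v w = A *v (\<Sum>l\<in>UNIV. (w $ l) *\<^sub>R (axis l 1 :: real^'n))" by (simp only: w)
  also have "\<dots> = (\<Sum>l\<in>UNIV. A *v ((w $ l) *\<^sub>R (axis l 1 :: real^'n)))"
    by (rule linear_sum[OF matrix_vector_mul_linear])
  also have "\<dots> = (\<Sum>l\<in>UNIV. (w $ l) *\<^sub>R (A *v axis l 1))"
    by (simp only: matrix_vector_mult_scaleR)
  finally show ?thesis by (simp add: inner_sum_left)
qed

text \<open>
  \<open>v F\<close> is a Borel version of the normal component of \<open>A\<nabla>u\<close> on \<open>F\<close>, and Green's formula holds for it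
  against all smooth \<open>\<psi>\<close>, not only those vanishing on the boundary.
\<close>

definition (in mesh) normal_flux ::
    "real^'n^'n \<Rightarrow> (real^'n \<Rightarrow> real) \<Rightarrow> (real^'n \<Rightarrow> real) \<Rightarrow> (real^'n) set \<Rightarrow> ((real^'n) set \<Rightarrow> real^'n \<Rightarrow> real) \<Rightarrow> bool" where
  "normal_flux A u f T v \<longleftrightarrow>
     (\<forall>F\<in>faces_of Fh T. v F \<in> borel_measurable borel \<and>
        integrable (hyp_measure (affine hull F)) (\<lambda>x. indicator F x * v F x) \<and>
        (AE x in hyp_measure (affine hull F). x \<in> F \<longrightarrow>
           (A *v face_trace (unit_normal T F) (weak_grad T u) x) \<bullet> unit_normal T F = v F x)) \<and>
     (\<forall>\<psi> D B B'. (\<forall>k. C_k k \<psi>) \<and> (\<forall>x. \<bar>\<psi> x\<bar> \<le> B) \<and> (\<forall>x. GDERIV \<psi> x :> D x) \<and> (\<forall>x. norm (D x) \<le> B') \<and> D \<in> borel_measurable borel \<longrightarrow>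
        (LINT x|lebesgue_on T. (A *v weak_grad T u x) \<bullet> D x) - (LINT x|lebesgue_on T. f x * \<psi> x) =
        (\<Sum>F\<in>faces_of Fh T. LINT x|hyp_measure (affine hull F). indicator F x * (\<psi> x * v F x)))"

context mesh_cell
begin

text \<open>Since u is in \<open>H2 T\<close>, each component of its gradient has traces on the
  faces, and A\<nabla>u has a square integrable divergence, identified with -f by the equation
  tested inside T. Green's formula is then \<open>divergence_faces\<close> for \<psi> times each
  component, in the direction of the corresponding column of A.\<close>

theorem cell_flux:
  assumes u: "u \<in> H2 T" and f: "f \<in> borel_measurable (lebesgue_on T)" "integrable (lebesgue_on T) f"
    and pde: "\<And>\<phi> D. \<phi> \<in> test_functions T \<Longrightarrow> (\<And>x. GDERIV \<phi> x :> D x) \<Longrightarrow>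
      (LINT x|lebesgue_on T. (A *v weak_grad T u x) \<bullet> D x) = (LINT x|lebesgue_on T. f x * \<phi> x)"
  shows "\<exists>v. normal_flux A u f T v"
proof -
  define G where "G = weak_grad T u"
  have wl: "has_weak_gradient T (\<lambda>x. G x $ l) (weak_grad T (\<lambda>x. G x $ l))" for l
    using u weak_grad[of "\<lambda>x. G x $ l" T] by (auto simp: H2_def G_def)
  have "\<forall>l. \<exists>g h. borel_weak_gradient T g h \<and> (AE x in lborel. x \<in> T \<longrightarrow> G x $ l = g x)"
    using has_weak_gradient_borel[OF open_T wl] by blast
  from choice[OF this] obtain g where "\<forall>l. \<exists>h. borel_weak_gradient T (g l) h \<and> (AE x in lborel. x \<in> T \<longrightarrow> G x $ l = g l x)"
    by (elim exE)
  from choice[OF this] obtain h where gh0: "\<forall>l. borel_weak_gradient T (g l) (h l) \<and> (AE x in lborel. x \<in> T \<longrightarrow> G x $ l = g l x)"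
    by (elim exE)
  have gh: "borel_weak_gradient T (g l) (h l)" "AE x in lborel. x \<in> T \<longrightarrow> G x $ l = g l x" for l :: 'n
    using spec[OF gh0, of l] by (rule conjunct1, rule conjunct2)
  have gm [measurable]: "g l \<in> borel_measurable borel" and hm [measurable]: "h l \<in> borel_measurable borel" for l
    using borel_weak_gradientD(1,2)[OF gh(1)] .
  have ig: "integrable lborel (g l)" and ih: "integrable lborel (h l)" for l
    using borel_weak_gradient_integrable[OF gh(1) bounded_T] .
  \<comment> \<open>Column l of A, so that A\<nabla>u is the sum of the vectors
    \<open>g l x *\<^sub>R a l\<close> almost everywhere in T.\<close>
  define a where "a = (\<lambda>l. A *v axis l 1)"
  obtain f' where f' [measurable]: "f' \<in> borel_measurable borel" and fe: "AE x in lborel. x \<in> T \<longrightarrow> f x = f' x" and f0: "\<And>x. x \<notin> T \<Longrightarrow> f' x = 0"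
    using borel_representative_real[OF T_borel f(1)] by blast
  have if': "integrable lborel f'" using lebesgue_on_AE_eq_borel(3)[OF T_borel f' fe f0] f(2) by simp
  have Gg: "AE x in lborel. x \<in> T \<longrightarrow> (\<forall>l. G x $ l = g l x)"
  proof -
    have "AE x in lborel. \<forall>l\<in>UNIV. x \<in> T \<longrightarrow> G x $ l = g l x" by (rule AE_finite_allI) (use gh(2) in auto)
    then show ?thesis by eventually_elim blast
  qed
  have lhs: "(LINT x|lebesgue_on T. (A *v weak_grad T u x) \<bullet> D x) = (LBINT x. (\<Sum>l\<in>UNIV. g l x * (a l \<bullet> D x)))"
    if [measurable]: "D \<in> borel_measurable borel" for D
  proof (rule lebesgue_on_AE_eq_borel(2)[OF T_borel])
    show "(\<lambda>x. \<Sum>l\<in>UNIV. g l x * (a l \<bullet> D x)) \<in> borel_measurable borel" by measurable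
    show "AE x in lborel. x \<in> T \<longrightarrow> (A *v weak_grad T u x) \<bullet> D x = (\<Sum>l\<in>UNIV. g l x * (a l \<bullet> D x))"
      using Gg by eventually_elim (subst matrix_inner_expand, simp add: G_def a_def)
    show "(\<Sum>l\<in>UNIV. g l x * (a l \<bullet> D x)) = 0" if "x \<notin> T" for x
      using borel_weak_gradientD(5)[OF gh(1) that] by simp
  qed
  have rhs: "(LINT x|lebesgue_on T. f x * \<psi> x) = (LBINT x. f' x * \<psi> x)" if [measurable]: "\<psi> \<in> borel_measurable borel" for \<psi>
  proof (rule lebesgue_on_AE_eq_borel(2)[OF T_borel])
    show "(\<lambda>x. f' x * \<psi> x) \<in> borel_measurable borel" by measurable
    show "AE x in lborel. x \<in> T \<longrightarrow> f x * \<psi> x = f' x * \<psi> x" using fe by eventually_elim simp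
    show "f' x * \<psi> x = 0" if "x \<notin> T" for x using f0[OF that] by simp
  qed
  have igD: "integrable lborel (\<lambda>x. g l x * (a l \<bullet> D x))" if [measurable]: "D \<in> borel_measurable borel" and B: "\<And>x. norm (D x) \<le> B'" for l D B'
  proof (rule integrable_mult_bounded[OF ig])
    show "\<bar>a l \<bullet> D x\<bar> \<le> norm (a l) * B'" for x
      using Cauchy_Schwarz_ineq2[of "a l" "D x"] mult_left_mono[OF B[of x], of "norm (a l)"] by simp
  qed measurable
  \<comment> \<open>The sum over l is the weak divergence of A\<nabla>u; the fundamental lemma turns
    the tested equation into a pointwise one.\<close>
  have div: "AE x in lborel. x \<in> T \<longrightarrow> (\<Sum>l\<in>UNIV. h l x \<bullet> a l) + f' x = 0"
  proof (rule fundamental_lemma[OF open_T])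
    have "integrable lborel (\<lambda>x. (\<Sum>l\<in>UNIV. h l x \<bullet> a l) + f' x)"
      using ih if' by (intro Bochner_Integration.integrable_add Bochner_Integration.integrable_sum integrable_inner_left) auto
    then show "integrable lborel (\<lambda>x. indicator (cbox c d) x * ((\<Sum>l\<in>UNIV. h l x \<bullet> a l) + f' x))" for c d
      by (rule integrable_cbox_of_integrable)
    fix \<phi> assume \<phi>: "\<phi> \<in> test_functions T"
    obtain D where D: "\<And>x. GDERIV \<phi> x :> D x" using test_function_gderiv[OF \<phi>] by metis
    have mD [measurable]: "D \<in> borel_measurable borel" and [measurable]: "\<phi> \<in> borel_measurable borel"
      using test_function_continuous[OF \<phi>] test_function_gderiv_continuous[OF \<phi> D]
      by (auto intro: borel_measurable_continuous_onI)
    obtain C where C: "\<And>x. \<bar>\<phi> x\<bar> \<le> C" using test_function_bounded[OF \<phi>] by metis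
    obtain C' where C': "\<And>x. norm (D x) \<le> C'" using test_function_gderiv_bounded[OF \<phi> D] by metis
    have i1: "integrable lborel (\<lambda>x. \<phi> x *\<^sub>R h l x)" for l
      by (rule integrable_test_mult[OF borel_weak_gradientD(2,4)[OF gh(1)] \<phi>])
    have iD: "integrable lborel (\<lambda>x. g l x *\<^sub>R D x)" for l
    proof (rule integrable_vec_components)
      fix i
      have "\<bar>D x $ i\<bar> \<le> C'" for x using component_le_norm_cart[of "D x" i] C'[of x] by linarith
      then show "integrable lborel (\<lambda>x. (g l x *\<^sub>R D x) $ i)"
        unfolding vector_scaleR_component real_scaleR_def
        by (intro integrable_mult_bounded[OF ig] borel_measurable_integrable integrable_nth(1)
            test_function_integrable[OF test_function_gderiv_components[OF \<phi> D]])
    qed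
    have one: "(LBINT x. g l x * (a l \<bullet> D x)) = - (LBINT x. (h l x \<bullet> a l) * \<phi> x)" for l
    proof -
      have "(LBINT x. g l x * (a l \<bullet> D x)) = (LBINT x. (g l x *\<^sub>R D x) \<bullet> a l)"
        by (simp add: inner_commute)
      also have "\<dots> = (LBINT x. g l x *\<^sub>R D x) \<bullet> a l" by (rule integral_inner_left) (rule iD)
      also have "\<dots> = - ((LBINT x. \<phi> x *\<^sub>R h l x) \<bullet> a l)"
        using borel_weak_gradientD(7)[OF gh(1) \<phi> D] by simp
      also have "(LBINT x. \<phi> x *\<^sub>R h l x) \<bullet> a l = (LBINT x. (\<phi> x *\<^sub>R h l x) \<bullet> a l)" by (rule integral_inner_left[symmetric]) (rule i1)
      also have "\<dots> = (LBINT x. (h l x \<bullet> a l) * \<phi> x)" by (simp add: mult.commute)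
      finally show ?thesis .
    qed
    have i3: "integrable lborel (\<lambda>x. (h l x \<bullet> a l) * \<phi> x)" for l
      by (rule integrable_mult_bounded[OF _ _ C]) (use ih in auto)
    have i4: "integrable lborel (\<lambda>x. f' x * \<phi> x)" by (rule integrable_mult_bounded[OF if' _ C]) auto
    have "(LBINT x. f' x * \<phi> x) = (LBINT x. (\<Sum>l\<in>UNIV. g l x * (a l \<bullet> D x)))"
      using pde[OF \<phi> D] lhs[OF mD] rhs[of \<phi>] by simp
    also have "\<dots> = (\<Sum>l\<in>UNIV. LINT x|lborel. g l x * (a l \<bullet> D x))"
      by (rule Bochner_Integration.integral_sum) (rule igD[OF mD C'])
    also have "\<dots> = - (\<Sum>l\<in>UNIV. LINT x|lborel. (h l x \<bullet> a l) * \<phi> x)" unfolding one by (rule sum_negf)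
    finally have "(\<Sum>l\<in>UNIV. LINT x|lborel. (h l x \<bullet> a l) * \<phi> x) + (LBINT x. f' x * \<phi> x) = 0" by simp
    then show "(LBINT x. ((\<Sum>l\<in>UNIV. h l x \<bullet> a l) + f' x) * \<phi> x) = 0"
      using i3 i4 by (simp add: distrib_right sum_distrib_right)
  qed
  define v where "v = (\<lambda>F x. \<Sum>l\<in>UNIV. btrace (- unit_normal T F) (g l) x * (a l \<bullet> unit_normal T F))"
  have vm: "v F \<in> borel_measurable borel" for F unfolding v_def by measurable
  have iv: "integrable (hyp_measure (affine hull F)) (\<lambda>x. indicator F x * v F x)" if F: "F \<in> faces_of Fh T" for F
  proof -
    have "integrable (hyp_measure (affine hull F)) (\<lambda>x. \<Sum>l\<in>UNIV. (indicator F x * btrace (- unit_normal T F) (g l) x) * (a l \<bullet> unit_normal T F))"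
      by (intro Bochner_Integration.integrable_sum integrable_mult_left face_trace_borel(2)[OF gh(1) F])
    then show ?thesis by (simp add: v_def sum_distrib_left mult.assoc)
  qed
  \<comment> \<open>\<open>face_trace\<close> is applied to the chosen gradient G, not to its Borel
    representatives. By Fubini the two agree almost everywhere on almost every normal line inside T,
    and essential limits do not see the difference.\<close>
  have tr: "AE x in hyp_measure (affine hull F). x \<in> F \<longrightarrow>
      (A *v face_trace (unit_normal T F) G x) \<bullet> unit_normal T F = v F x" if F: "F \<in> faces_of Fh T" for F
  proof -
    let ?m = "- unit_normal T F" and ?M = "hyp_measure (affine hull F)"
    have Fh: "F \<in> Fh" by (rule faces_of_subset[OF F])
    have "AE x in ?M. \<forall>l\<in>UNIV. x \<in> F \<longrightarrow> ess_trace ?m (g l) x (btrace ?m (g l) x)"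
      by (rule AE_finite_allI) (use face_trace_borel(1)[OF gh(1) F] in auto)
    moreover have "AE x in ?M. AE s in lborel. x + s *\<^sub>R hyp_normal (affine hull F) \<in> T \<longrightarrow> (\<forall>l. G (x + s *\<^sub>R hyp_normal (affine hull F)) $ l = g l (x + s *\<^sub>R hyp_normal (affine hull F)))"
      by (rule normal_Fubini_AE[OF face_hyp(1)[OF Fh] Gg])
    ultimately show ?thesis using face_AE_boundary_side[OF F]
    proof eventually_elim
      case (elim x)
      show ?case
      proof
        assume x: "x \<in> F"
        have line: "AE s in lborel. x + s *\<^sub>R ?m \<in> T \<longrightarrow> (\<forall>l. G (x + s *\<^sub>R ?m) $ l = g l (x + s *\<^sub>R ?m))"
        proof -
          \<comment> \<open>The lines are parametrised by \<open>hyp_normal\<close>, which may be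
            opposite to the inward direction of this cell; in that case the line is
            reflected.\<close>
          consider "?m = hyp_normal (affine hull F)" | "?m = - hyp_normal (affine hull F)"
            using unit_normal_cases[OF T F] by auto
          then show ?thesis
          proof cases
            case 1 show ?thesis unfolding 1 by (rule elim(2))
          next
            case 2
            have "AE s in distr lborel borel uminus. x + s *\<^sub>R hyp_normal (affine hull F) \<in> T \<longrightarrow> (\<forall>l. G (x + s *\<^sub>R hyp_normal (affine hull F)) $ l = g l (x + s *\<^sub>R hyp_normal (affine hull F)))"
              unfolding lborel_distr_uminus by (rule elim(2))
            from AE_distrD[OF _ this] have "AE s in lborel. x + (- s) *\<^sub>R hyp_normal (affine hull F) \<in> T \<longrightarrow> (\<forall>l. G (x + (- s) *\<^sub>R hyp_normal (affine hull F)) $ l = g l (x + (- s) *\<^sub>R hyp_normal (affine hull F)))"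
              by simp
            then show ?thesis unfolding 2 by simp
          qed
        qed
        obtain \<delta> where \<delta>: "\<delta> > 0" "\<And>s. 0 < s \<and> s < \<delta> \<Longrightarrow> x + s *\<^sub>R ?m \<in> T"
          using elim(3) x unfolding boundary_side_def half_side_def by blast
        from line have lineG: "AE s in lborel. 0 < s \<and> s < \<delta> \<longrightarrow> G (x + s *\<^sub>R ?m) = (\<chi> l. g l (x + s *\<^sub>R ?m))"
          by eventually_elim (use \<delta>(2) in \<open>auto simp: vec_eq_iff\<close>)
        define w where "w = (\<chi> l. btrace ?m (g l) x)"
        have e1: "ess_trace ?m (\<lambda>y. \<chi> l. g l y) x w"
        proof (rule ess_trace_vec)
          show "ess_trace ?m (\<lambda>y. (\<chi> l. g l y) $ i) x (w $ i)" for i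
            using bspec[OF elim(1), of i] x by (simp add: w_def)
        qed
        have e2: "ess_trace ?m G x w"
          unfolding ess_trace_def
        proof (intro allI impI)
          fix \<eta> :: real assume "\<eta> > 0"
          then obtain d where d: "d > 0" "AE s in lborel. 0 < s \<and> s < d \<longrightarrow> norm ((\<chi> l. g l (x + s *\<^sub>R ?m)) - w) \<le> \<eta>"
            using e1 unfolding ess_trace_def by blast
          have "AE s in lborel. 0 < s \<and> s < min d \<delta> \<longrightarrow> norm (G (x + s *\<^sub>R ?m) - w) \<le> \<eta>"
            using d(2) lineG by eventually_elim simp
          then show "\<exists>d>0. AE s in lborel. 0 < s \<and> s < d \<longrightarrow> norm (G (x + s *\<^sub>R ?m) - w) \<le> \<eta>"
            using d(1) \<delta>(1) by (intro exI[of _ "min d \<delta>"] conjI) auto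
        qed
        have meas: "(\<lambda>s. G (x + s *\<^sub>R ?m)) \<in> borel_measurable (lebesgue_on {0<..<\<delta>})"
        proof (rule lebesgue_on_AE_eq_borel(1)[of _ "\<lambda>s. indicator {0<..<\<delta>} s *\<^sub>R (\<Sum>l\<in>UNIV. g l (x + s *\<^sub>R ?m) *\<^sub>R (axis l 1 :: real^'n))"])
          show "AE s in lborel. s \<in> {0<..<\<delta>} \<longrightarrow> G (x + s *\<^sub>R ?m) = indicator {0<..<\<delta>} s *\<^sub>R (\<Sum>l\<in>UNIV. g l (x + s *\<^sub>R ?m) *\<^sub>R (axis l 1 :: real^'n))"
            using lineG by eventually_elim (auto simp: vec_eq_iff axis_def if_distrib cong: if_cong)
        qed auto
        have "face_trace (unit_normal T F) G x = w"
          using face_trace_eqI[OF meas \<delta>(1) e2] by simp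
        then show "(A *v face_trace (unit_normal T F) G x) \<bullet> unit_normal T F = v F x"
          using matrix_inner_expand[of A w "unit_normal T F"] by (simp add: w_def v_def a_def)
      qed
    qed
  qed
  have ident: "(LINT x|lebesgue_on T. (A *v weak_grad T u x) \<bullet> D x) - (LINT x|lebesgue_on T. f x * \<psi> x) =
        (\<Sum>F\<in>faces_of Fh T. LINT x|hyp_measure (affine hull F). indicator F x * (\<psi> x * v F x))"
    if \<psi>: "\<And>k. C_k k \<psi>" "\<And>x. \<bar>\<psi> x\<bar> \<le> B" and D: "\<And>x. GDERIV \<psi> x :> D x" "\<And>x. norm (D x) \<le> B'" "D \<in> borel_measurable borel" for \<psi> D B B'
  proof -
    note [measurable] = D(3)
    have c\<psi>: "continuous_on UNIV \<psi>" using \<psi>(1)[of 0] by simp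
    then have [measurable]: "\<psi> \<in> borel_measurable borel" by (rule borel_measurable_continuous_onI)
    have w: "borel_weak_gradient T (\<lambda>x. \<psi> x * g l x) (\<lambda>x. \<psi> x *\<^sub>R h l x + g l x *\<^sub>R D x)" for l
      by (rule weak_gradient_mult[OF gh(1) open_T bounded_T \<psi> D])
    have iw: "integrable lborel (\<lambda>x. (\<psi> x *\<^sub>R h l x + g l x *\<^sub>R D x) \<bullet> a l)" for l
      using borel_weak_gradient_integrable(2)[OF w bounded_T] by (rule integrable_inner_left)
    have face: "(LINT x|hyp_measure (affine hull F). indicator F x * btrace (- unit_normal T F) (\<lambda>x. \<psi> x * g l x) x)
       = (LINT x|hyp_measure (affine hull F). indicator F x * (\<psi> x * btrace (- unit_normal T F) (g l) x))" if F: "F \<in> faces_of Fh T" for F l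
    proof (rule integral_cong_AE)
      have [measurable]: "F \<in> sets borel" by (rule face_borel[OF faces_of_subset[OF F]])
      show "(\<lambda>x. indicator F x * btrace (- unit_normal T F) (\<lambda>x. \<psi> x * g l x) x) \<in> borel_measurable (hyp_measure (affine hull F))"
        "(\<lambda>x. indicator F x * (\<psi> x * btrace (- unit_normal T F) (g l) x)) \<in> borel_measurable (hyp_measure (affine hull F))"
        by measurable
      have nm: "norm (- unit_normal T F) = 1" using unit_normal[OF T F] by (simp add: outward_normal_def)
      show "AE x in hyp_measure (affine hull F). indicator F x * btrace (- unit_normal T F) (\<lambda>x. \<psi> x * g l x) x
        = indicator F x * (\<psi> x * btrace (- unit_normal T F) (g l) x)"
        using face_trace_borel(1)[OF gh(1)[of l] F]
      proof eventually_elim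
        case (elim x)
        show ?case
        proof (cases "x \<in> F")
          case True
          have "isCont \<psi> x" using c\<psi> by (simp add: continuous_on_eq_continuous_at)
          from ess_trace_mult[OF elim[rule_format, OF True] this nm]
          have "btrace (- unit_normal T F) (\<lambda>x. \<psi> x * g l x) x = \<psi> x * btrace (- unit_normal T F) (g l) x"
            by (intro btrace_eqI) auto
          then show ?thesis by simp
        qed simp
      qed
    qed
    have i\<psi>: "integrable (hyp_measure (affine hull F)) (\<lambda>x. indicator F x * (\<psi> x * btrace (- unit_normal T F) (g l) x))" if F: "F \<in> faces_of Fh T" for F l
    proof -
      have "integrable (hyp_measure (affine hull F)) (\<lambda>x. (indicator F x * btrace (- unit_normal T F) (g l) x) * \<psi> x)"
        by (rule integrable_mult_bounded[OF face_trace_borel(2)[OF gh(1) F] _ \<psi>(2)]) measurable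
      then show ?thesis by (simp add: mult_ac)
    qed
    have "(\<Sum>F\<in>faces_of Fh T. LINT x|hyp_measure (affine hull F). indicator F x * (\<psi> x * v F x))
      = (\<Sum>F\<in>faces_of Fh T. \<Sum>l\<in>UNIV. (unit_normal T F \<bullet> a l) * (LINT x|hyp_measure (affine hull F). indicator F x * (\<psi> x * btrace (- unit_normal T F) (g l) x)))"
    proof (rule sum.cong[OF refl])
      fix F assume F: "F \<in> faces_of Fh T"
      have "(LINT x|hyp_measure (affine hull F). indicator F x * (\<psi> x * v F x)) =
        (LINT x|hyp_measure (affine hull F). (\<Sum>l\<in>UNIV. (unit_normal T F \<bullet> a l) * (indicator F x * (\<psi> x * btrace (- unit_normal T F) (g l) x))))"
        by (intro Bochner_Integration.integral_cong refl) (simp add: v_def sum_distrib_left inner_commute mult_ac)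
      also have "\<dots> = (\<Sum>l\<in>UNIV. LINT x|hyp_measure (affine hull F). (unit_normal T F \<bullet> a l) * (indicator F x * (\<psi> x * btrace (- unit_normal T F) (g l) x)))"
        by (intro Bochner_Integration.integral_sum integrable_mult_right i\<psi> F)
      finally show "(LINT x|hyp_measure (affine hull F). indicator F x * (\<psi> x * v F x)) =
        (\<Sum>l\<in>UNIV. (unit_normal T F \<bullet> a l) * (LINT x|hyp_measure (affine hull F). indicator F x * (\<psi> x * btrace (- unit_normal T F) (g l) x)))"
        by simp
    qed
    also have "\<dots> = (\<Sum>l\<in>UNIV. \<Sum>F\<in>faces_of Fh T. (unit_normal T F \<bullet> a l) * (LINT x|hyp_measure (affine hull F). indicator F x * btrace (- unit_normal T F) (\<lambda>x. \<psi> x * g l x) x))"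
      by (subst sum.swap) (intro sum.cong refl, simp add: face)
    also have "\<dots> = (\<Sum>l\<in>UNIV. LINT x|lborel. (\<psi> x *\<^sub>R h l x + g l x *\<^sub>R D x) \<bullet> a l)"
      by (intro sum.cong refl divergence_faces[OF w, symmetric])
    also have "\<dots> = (LBINT x. (\<Sum>l\<in>UNIV. (\<psi> x *\<^sub>R h l x + g l x *\<^sub>R D x) \<bullet> a l))"
      by (intro Bochner_Integration.integral_sum[symmetric] iw)
    \<comment> \<open>Here the divergence of A\<nabla>u is replaced by -f, which leaves only
      first-order terms and the source.\<close>
    also have "\<dots> = (LBINT x. (\<Sum>l\<in>UNIV. g l x * (a l \<bullet> D x)) - f' x * \<psi> x)"
    proof (rule integral_cong_AE)
      show "AE x in lborel. (\<Sum>l\<in>UNIV. (\<psi> x *\<^sub>R h l x + g l x *\<^sub>R D x) \<bullet> a l) = (\<Sum>l\<in>UNIV. g l x * (a l \<bullet> D x)) - f' x * \<psi> x"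
        using div
      proof eventually_elim
        case (elim x)
        have "(\<Sum>l\<in>UNIV. h l x \<bullet> a l) = - f' x"
          using elim f0[of x] borel_weak_gradientD(6)[OF gh(1), of x] by (cases "x \<in> T") auto
        moreover have "(\<Sum>l\<in>UNIV. (\<psi> x *\<^sub>R h l x + g l x *\<^sub>R D x) \<bullet> a l) = \<psi> x * (\<Sum>l\<in>UNIV. h l x \<bullet> a l) + (\<Sum>l\<in>UNIV. g l x * (a l \<bullet> D x))"
          unfolding inner_add_left sum.distrib sum_distrib_left inner_scaleR_left inner_commute[of "D x"] by simp
        ultimately show ?case by simp
      qed
    qed measurable
    also have "\<dots> = (LBINT x. (\<Sum>l\<in>UNIV. g l x * (a l \<bullet> D x))) - (LBINT x. f' x * \<psi> x)"
    proof (rule Bochner_Integration.integral_diff)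
      show "integrable lborel (\<lambda>x. \<Sum>l\<in>UNIV. g l x * (a l \<bullet> D x))"
        by (intro Bochner_Integration.integrable_sum igD[OF D(3,2)])
      show "integrable lborel (\<lambda>x. f' x * \<psi> x)" by (rule integrable_mult_bounded[OF if' _ \<psi>(2)]) measurable
    qed
    finally show ?thesis unfolding lhs[OF D(3)] using rhs[of \<psi>] by simp
  qed
  show ?thesis
    unfolding normal_flux_def G_def[symmetric]
  proof (intro exI[of _ v] conjI ballI allI impI)
    fix F assume F: "F \<in> faces_of Fh T"
    show "v F \<in> borel_measurable borel" by (rule vm)
    show "integrable (hyp_measure (affine hull F)) (\<lambda>x. indicator F x * v F x)" by (rule iv[OF F])
    show "AE x in hyp_measure (affine hull F). x \<in> F \<longrightarrow> (A *v face_trace (unit_normal T F) G x) \<bullet> unit_normal T F = v F x"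
      by (rule tr[OF F])
  next
    fix \<psi> :: "real^'n \<Rightarrow> real" and D :: "real^'n \<Rightarrow> real^'n" and B B' :: real
    assume "(\<forall>k. C_k k \<psi>) \<and> (\<forall>x. \<bar>\<psi> x\<bar> \<le> B) \<and> (\<forall>x. GDERIV \<psi> x :> D x) \<and> (\<forall>x. norm (D x) \<le> B') \<and> D \<in> borel_measurable borel"
    then show "(LINT x|lebesgue_on T. (A *v G x) \<bullet> D x) - (LINT x|lebesgue_on T. f x * \<psi> x) =
        (\<Sum>F\<in>faces_of Fh T. LINT x|hyp_measure (affine hull F). indicator F x * (\<psi> x * v F x))"
      using ident[of \<psi> B D B'] unfolding G_def by blast
  qed
qed

end

section \<open>The equation on a cell\<close>

text \<open>The two gradients come from separate choices, but the one on \<Omega> is also a weak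
  gradient on T.\<close>

lemma cell_weak_gradient:
  fixes T \<Omega> :: "(real^'n) set"
  assumes \<Omega>: "open \<Omega>" and T: "open T" "T \<subseteq> \<Omega>" and u: "u \<in> H1 \<Omega>"
  shows "AE x in lborel. x \<in> T \<longrightarrow> weak_grad T u x = weak_grad \<Omega> u x"
proof -
  have w: "has_weak_gradient T u (weak_grad \<Omega> u)"
    by (rule has_weak_gradient_mono[OF T \<Omega> weak_grad[OF u]])
  then have "u \<in> H1 T" by (auto simp: H1_def)
  then show ?thesis by (rule weak_gradient_unique[OF T(1) weak_grad w])
qed

lemma matrix_vector_measurable:
  fixes A :: "real^'n^'n"
  assumes "g \<in> borel_measurable M" shows "(\<lambda>x. A *v g x) \<in> borel_measurable M"
  by (rule borel_measurable_continuous_on[OF _ assms])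
    (rule linear_continuous_on[OF matrix_vector_mul_bounded_linear])

text \<open>The integrand e is a parameter because K carries no measurability hypothesis here; each
  application supplies its own Borel version of the bilinear form, for a single cell or summed over
  the cells.\<close>

lemma weak_equation_borel:
  fixes \<Omega> :: "(real^'n) set" and K :: "real^'n \<Rightarrow> real^'n^'n"
  assumes \<Omega>: "open \<Omega>"
    and h: "AE x in lborel. x \<in> \<Omega> \<longrightarrow> weak_grad \<Omega> u x = h x"
    and f': "f' \<in> borel_measurable borel" "AE x in lborel. x \<in> \<Omega> \<longrightarrow> f x = f' x"
    and sol: "\<forall>v\<in>H10 \<Omega>. (LINT x|lebesgue_on \<Omega>. (K x *v weak_grad \<Omega> u x) \<bullet> weak_grad \<Omega> v x) = (LINT x|lebesgue_on \<Omega>. f x * v x)"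
    and \<phi>: "\<phi> \<in> test_functions \<Omega>" "\<And>x. GDERIV \<phi> x :> D x"
    and e: "e \<in> borel_measurable borel" "AE x in lborel. x \<in> \<Omega> \<longrightarrow> (K x *v h x) \<bullet> D x = e x" "\<And>x. x \<notin> \<Omega> \<Longrightarrow> e x = 0"
  shows "(LBINT x. e x) = (LBINT x. f' x * \<phi> x)"
proof -
  have \<Omega>b: "\<Omega> \<in> sets borel" using \<Omega> by auto
  have [measurable]: "\<phi> \<in> borel_measurable borel"
    using test_function_continuous[OF \<phi>(1)] by (rule borel_measurable_continuous_onI)
  have "(LBINT x. e x) = (LINT x|lebesgue_on \<Omega>. (K x *v weak_grad \<Omega> u x) \<bullet> weak_grad \<Omega> \<phi> x)"
  proof (rule lebesgue_on_AE_eq_borel(2)[OF \<Omega>b e(1) _ e(3), symmetric])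
    show "AE x in lborel. x \<in> \<Omega> \<longrightarrow> (K x *v weak_grad \<Omega> u x) \<bullet> weak_grad \<Omega> \<phi> x = e x"
      using h test_function_H10(2)[OF \<Omega> \<phi>] e(2) by eventually_elim simp
  qed
  also have "\<dots> = (LINT x|lebesgue_on \<Omega>. f x * \<phi> x)"
    by (rule bspec[OF sol test_function_H10(1)[OF \<Omega> \<phi>]])
  also have "\<dots> = (LBINT x. f' x * \<phi> x)"
  proof (rule lebesgue_on_AE_eq_borel(2)[OF \<Omega>b])
    show "(\<lambda>x. f' x * \<phi> x) \<in> borel_measurable borel" using f'(1) by measurable
    show "AE x in lborel. x \<in> \<Omega> \<longrightarrow> f x * \<phi> x = f' x * \<phi> x" using f'(2) by eventually_elim simp
    show "f' x * \<phi> x = 0" if "x \<notin> \<Omega>" for x using test_function_eq_0[OF \<phi>(1) that] by simp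
  qed
  finally show ?thesis .
qed

lemma cell_equation:
  fixes \<Omega> T :: "(real^'n) set" and K :: "real^'n \<Rightarrow> real^'n^'n"
  assumes \<Omega>: "open \<Omega>" and T: "open T" "T \<subseteq> \<Omega>" and u: "u \<in> H1 \<Omega>"
    and f: "f \<in> borel_measurable (lebesgue_on \<Omega>)"
    and K: "\<And>x. x \<in> T \<Longrightarrow> K x = A"
    and sol: "\<forall>v\<in>H10 \<Omega>. (LINT x|lebesgue_on \<Omega>. (K x *v weak_grad \<Omega> u x) \<bullet> weak_grad \<Omega> v x) = (LINT x|lebesgue_on \<Omega>. f x * v x)"
    and \<phi>: "\<phi> \<in> test_functions T" "\<And>x. GDERIV \<phi> x :> D x"
  shows "(LINT x|lebesgue_on T. (A *v weak_grad T u x) \<bullet> D x) = (LINT x|lebesgue_on T. f x * \<phi> x)"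
proof -
  have b: "\<Omega> \<in> sets borel" "T \<in> sets borel" using \<Omega> T by auto
  obtain h where h: "h \<in> borel_measurable borel" "AE x in lborel. x \<in> \<Omega> \<longrightarrow> weak_grad \<Omega> u x = h x"
    using has_weak_gradient_borel[OF \<Omega> weak_grad[OF u]] borel_weak_gradientD(2) by blast
  obtain f' where f': "f' \<in> borel_measurable borel" "AE x in lborel. x \<in> \<Omega> \<longrightarrow> f x = f' x"
    using borel_representative_real[OF b(1) f] by blast
  have \<phi>\<Omega>: "\<phi> \<in> test_functions \<Omega>" using \<phi>(1) test_functions_mono[OF T(2)] by blast
  have D0: "D x = 0" if "x \<notin> T" for x using test_function_gderiv_eq_0[OF \<phi> that] .
  have [measurable]: "D \<in> borel_measurable borel" "\<phi> \<in> borel_measurable borel"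
    using test_function_gderiv_continuous[OF \<phi>] test_function_continuous[OF \<phi>(1)]
    by (auto intro: borel_measurable_continuous_onI)
  note [measurable] = matrix_vector_measurable[OF h(1), of A] f'(1)
  have em: "(\<lambda>x. (A *v h x) \<bullet> D x) \<in> borel_measurable borel" by measurable
  have "(LINT x|lebesgue_on T. (A *v weak_grad T u x) \<bullet> D x) = (LBINT x. (A *v h x) \<bullet> D x)"
  proof (rule lebesgue_on_AE_eq_borel(2)[OF b(2) em])
    show "AE x in lborel. x \<in> T \<longrightarrow> (A *v weak_grad T u x) \<bullet> D x = (A *v h x) \<bullet> D x"
      using h(2) cell_weak_gradient[OF \<Omega> T u] by eventually_elim (use T(2) in auto)
  qed (simp add: D0)
  also have "\<dots> = (LBINT x. f' x * \<phi> x)"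
  proof (rule weak_equation_borel[OF \<Omega> h(2) f' sol \<phi>\<Omega> \<phi>(2) em])
    \<comment> \<open>D vanishes off T, so only the constant value A of K enters, although the
      equation is tested on all of \<Omega>.\<close>
    show "AE x in lborel. x \<in> \<Omega> \<longrightarrow> (K x *v h x) \<bullet> D x = (A *v h x) \<bullet> D x"
    proof (rule AE_I2, rule impI)
      fix x show "(K x *v h x) \<bullet> D x = (A *v h x) \<bullet> D x" using K[of x] D0[of x] by (cases "x \<in> T") auto
    qed
    show "(A *v h x) \<bullet> D x = 0" if "x \<notin> \<Omega>" for x
    proof -
      have "x \<notin> T" using T(2) that by blast
      then show ?thesis by (simp add: D0)
    qed
  qed
  also have "\<dots> = (LINT x|lebesgue_on T. f x * \<phi> x)"
  proof (rule lebesgue_on_AE_eq_borel(2)[OF b(2), symmetric])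
    show "AE x in lborel. x \<in> T \<longrightarrow> f x * \<phi> x = f' x * \<phi> x"
      using f'(2) by eventually_elim (use T(2) in auto)
  qed (use test_function_eq_0[OF \<phi>(1)] in auto)
  finally show ?thesis .
qed

section \<open>Positivity of the coefficients\<close>

lemma symmetric_matrix_inner:
  fixes A :: "real^'n^'n"
  assumes "transpose A = A" shows "(A *v x) \<bullet> y = x \<bullet> (A *v y)"
  using dot_lmul_matrix[of x A y] transpose_matrix_vector[of A x] assms by simp

text \<open>Eigenvectors of distinct eigenvalues are orthogonal and hence independent. Finiteness
  matters because \<open>smallest_eigenvalue\<close> is a \<open>Min\<close>, which is meaningful
  only for finite nonempty sets.\<close>

lemma finite_eigenvalues:
  fixes A :: "real^'n^'n"
  assumes sym: "transpose A = A"
  shows "finite {l. \<exists>v. v \<noteq> 0 \<and> A *v v = l *\<^sub>R v}" (is "finite ?S")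
proof -
  have "\<forall>l\<in>?S. \<exists>v. v \<noteq> 0 \<and> A *v v = l *\<^sub>R v" by blast
  from bchoice[OF this] obtain e where e: "\<And>l. l \<in> ?S \<Longrightarrow> e l \<noteq> 0 \<and> A *v e l = l *\<^sub>R e l" by blast
  have orth: "e l \<bullet> e m = 0" if "l \<in> ?S" "m \<in> ?S" "l \<noteq> m" for l m
  proof -
    have "l * (e l \<bullet> e m) = m * (e l \<bullet> e m)"
      using symmetric_matrix_inner[OF sym, of "e l" "e m"] e[OF that(1)] e[OF that(2)] by simp
    then show ?thesis using that(3) by simp
  qed
  have inj: "inj_on e ?S"
  proof (rule inj_onI, rule ccontr)
    fix l m assume a: "l \<in> ?S" "m \<in> ?S" "e l = e m" "l \<noteq> m"
    then show False using orth[OF a(1,2,4)] e[OF a(2)] by simp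
  qed
  have "pairwise orthogonal (e ` ?S)"
    unfolding pairwise_def orthogonal_def using orth by (metis (no_types, lifting) imageE)
  moreover have "0 \<notin> e ` ?S" using e by (metis (no_types, lifting) imageE)
  ultimately have "independent (e ` ?S)" by (rule pairwise_orthogonal_independent)
  then have "finite (e ` ?S)" by (rule independent_imp_finite)
  then show ?thesis using inj by (rule finite_imageD)
qed

text \<open>The minimum of the Rayleigh quotient is an eigenvalue.\<close>

lemma symmetric_eigenvalue_exists:
  fixes A :: "real^'n^'n"
  assumes sym: "transpose A = A"
  shows "\<exists>l v. v \<noteq> 0 \<and> A *v v = l *\<^sub>R v"
proof -
  define q where "q = (\<lambda>x. (A *v x) \<bullet> x)"
  have "continuous_on (sphere 0 1) q"
    unfolding q_def by (intro continuous_on_inner continuous_on_id linear_continuous_on matrix_vector_mul_bounded_linear)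
  moreover have "sphere (0::real^'n) 1 \<noteq> {}" by (simp add: sphere_eq_empty)
  ultimately obtain x where x: "norm x = 1" "\<And>y. norm y = 1 \<Longrightarrow> q x \<le> q y"
    using continuous_attains_inf[OF compact_sphere, of 0 1 q] by auto
  have low: "q x * (norm y)\<^sup>2 \<le> q y" for y
  proof (cases "y = 0")
    case True then show ?thesis by (simp add: q_def)
  next
    case False
    have "q x \<le> q ((1 / norm y) *\<^sub>R y)" using False by (intro x(2)) simp
    also have "\<dots> = q y / (norm y)\<^sup>2" by (simp add: q_def matrix_vector_mult_scaleR power2_eq_square)
    finally show ?thesis using False by (simp add: field_simps)
  qed
  \<comment> \<open>The residual of x as an eigenvector. Comparing the Rayleigh quotient at x with
    that at x - t r gives an inequality whose linear term in t is 2 t times the squared norm of r,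
    against a quadratic term t^2 c.\<close>
  define r where "r = A *v x - q x *\<^sub>R x"
  define c where "c = q r - q x * (norm r)\<^sup>2"
  have c: "c \<ge> 0" using low[of r] by (simp add: c_def)
  have x1: "x \<bullet> x = 1" using x(1) by (simp add: dot_square_norm)
  have ineq: "2 * t * (norm r)\<^sup>2 \<le> t\<^sup>2 * c" for t :: real
  proof -
    have 1: "q (x - t *\<^sub>R r) = q x - 2 * t * ((A *v x) \<bullet> r) + t\<^sup>2 * q r"
      using symmetric_matrix_inner[OF sym, of r x]
      by (simp add: q_def matrix_vector_mult_diff_distrib matrix_vector_mult_scaleR inner_diff_left inner_diff_right
          inner_commute algebra_simps power2_eq_square)
    have 2: "(norm (x - t *\<^sub>R r))\<^sup>2 = 1 - 2 * t * (x \<bullet> r) + t\<^sup>2 * (norm r)\<^sup>2"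
      unfolding power2_norm_eq_inner by (simp add: x1 inner_diff_left inner_diff_right inner_commute algebra_simps power2_eq_square)
    have "(A *v x) \<bullet> r - q x * (x \<bullet> r) = (norm r)\<^sup>2"
      unfolding power2_norm_eq_inner by (simp add: r_def inner_diff_left)
    then have 3: "(A *v x) \<bullet> r = (norm r)\<^sup>2 + q x * (x \<bullet> r)" by simp
    have "q x * (1 - 2 * t * (x \<bullet> r) + t\<^sup>2 * (norm r)\<^sup>2) \<le> q x - 2 * t * ((norm r)\<^sup>2 + q x * (x \<bullet> r)) + t\<^sup>2 * q r"
      using low[of "x - t *\<^sub>R r"] unfolding 1 2 3 .
    then show ?thesis by (simp add: c_def algebra_simps)
  qed
  have "r = 0"
  proof (rule ccontr)
    \<comment> \<open>The inequality is evaluated at a small positive t proportional to the squared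
      norm of r; the 1 in the denominator c + 1 covers the case c = 0.\<close>
    assume "r \<noteq> 0"
    then have n: "(norm r)\<^sup>2 > 0" by simp
    have "2 * ((norm r)\<^sup>2 / (c + 1)) * (norm r)\<^sup>2 \<le> ((norm r)\<^sup>2 / (c + 1))\<^sup>2 * c" by (rule ineq)
    then have "(norm r)\<^sup>2 / (c + 1) * (norm r)\<^sup>2 * 2 \<le> (norm r)\<^sup>2 / (c + 1) * (norm r)\<^sup>2 * (c / (c + 1))"
      by (simp add: power2_eq_square mult_ac)
    moreover have "(norm r)\<^sup>2 / (c + 1) * (norm r)\<^sup>2 > 0" using n c by simp
    ultimately have "2 \<le> c / (c + 1)" by (simp only: mult_le_cancel_left_pos)
    then show False using c by (simp add: field_simps)
  qed
  then have "A *v x = q x *\<^sub>R x" by (simp add: r_def)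
  moreover have "x \<noteq> 0" using x(1) by auto
  ultimately show ?thesis by blast
qed

lemma smallest_eigenvalue_pos:
  fixes A :: "real^'n^'n"
  assumes sym: "transpose A = A" and "\<alpha> > 0" and ell: "\<And>\<xi>. \<alpha> * (norm \<xi>)\<^sup>2 \<le> (A *v \<xi>) \<bullet> \<xi>"
  shows "smallest_eigenvalue A > 0"
proof -
  have "l > 0" if "v \<noteq> 0" "A *v v = l *\<^sub>R v" for l v
  proof -
    have "0 < \<alpha> * (norm v)\<^sup>2" using that(1) \<open>\<alpha> > 0\<close> by simp
    also have "\<dots> \<le> l * (norm v)\<^sup>2" using ell[of v] that(2) by (simp add: power2_norm_eq_inner)
    finally show ?thesis using that(1) by (simp add: zero_less_mult_iff)
  qed
  moreover have "{l. \<exists>v. v \<noteq> 0 \<and> A *v v = l *\<^sub>R v} \<noteq> {}" using symmetric_eigenvalue_exists[OF sym] by blast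
  ultimately show ?thesis
    unfolding smallest_eigenvalue_def using finite_eigenvalues[OF sym] by (subst Min_gr_iff) auto
qed

context mesh
begin

text \<open>F is relatively open, so the points at height below 1/2 that project into it form a
  nonempty open set of positive volume. Boundedness of F is needed because \<open>measure\<close>
  assigns 0 to sets of infinite measure.\<close>

lemma face_area_pos:
  assumes F: "F \<in> Fh" and b: "bounded F"
  shows "face_area F > 0"
proof -
  let ?n = "hyp_normal (affine hull F)" and ?b = "hyp_offset (affine hull F)"
  note n = face_hyp(1)[OF F]
  obtain U where U: "open U" "F = affine hull F \<inter> U" using face_open[OF F] by (auto simp: openin_open)
  define S where "S = {z. \<bar>?n \<bullet> z - ?b\<bar> < 1/2 \<and> hproj ?n ?b z \<in> U}"
  have "open S"
  proof -
    have "open {z. \<bar>?n \<bullet> z - ?b\<bar> < 1/2}" by (intro open_Collect_less continuous_intros)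
    moreover have "open (hproj ?n ?b -` U)"
      by (rule open_vimage[OF U(1)]) (unfold hproj_def, intro continuous_intros)
    ultimately have "open ({z. \<bar>?n \<bullet> z - ?b\<bar> < 1/2} \<inter> hproj ?n ?b -` U)" by (rule open_Int)
    moreover have "S = {z. \<bar>?n \<bullet> z - ?b\<bar> < 1/2} \<inter> hproj ?n ?b -` U" by (auto simp: S_def)
    ultimately show ?thesis by simp
  qed
  moreover have "S \<noteq> {}"
  proof -
    obtain x where x: "x \<in> F" using face_nonempty[OF F] by blast
    have nx: "?n \<bullet> x = ?b" by (rule face_in_hyperplane[OF F hull_inc[OF x]])
    then have "hproj ?n ?b x = x" using hproj_normal[OF n nx, of 0] by simp
    then have "x \<in> S" using nx x U(2) by (auto simp: S_def)
    then show ?thesis by blast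
  qed
  ultimately have "\<not> negligible S" by (rule open_not_negligible)
  then have S0: "emeasure lborel S \<noteq> 0"
    using \<open>open S\<close> null_sets_completionI[of S lborel] by (auto simp: negligible_iff_null_sets null_sets_def)
  have proj: "hproj ?n ?b z \<in> affine hull F" for z
    by (subst face_hyp(2)[OF F]) (simp add: hyperplane_def hproj_in[OF n])
  have "emeasure lborel S \<le> emeasure (hyp_measure (affine hull F)) F"
    unfolding emeasure_hmeas[OF n face_borel[OF F]]
  proof (rule emeasure_mono)
    show "S \<subseteq> {z. \<bar>?n \<bullet> z - ?b\<bar> \<le> 1/2 \<and> hproj ?n ?b z \<in> F}" using proj by (subst (2) U(2)) (auto simp: S_def)
    note [measurable] = face_borel[OF F]
    show "{z. \<bar>?n \<bullet> z - ?b\<bar> \<le> 1/2 \<and> hproj ?n ?b z \<in> F} \<in> sets lborel" by measurable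
  qed
  moreover have "0 < emeasure lborel S" using S0 by (simp add: zero_less_iff_neq_zero)
  ultimately have "0 < emeasure (hyp_measure (affine hull F)) F" by (rule order_less_le_trans[rotated])
  moreover have "emeasure (hyp_measure (affine hull F)) F < \<infinity>" by (rule emeasure_hmeas_bounded[OF n face_borel[OF F] b])
  ultimately show ?thesis
    unfolding face_measure_eq[OF F] using face_borel[OF F]
    by (simp add: measure_def emeasure_completion main_part_sets enn2real_positive_iff)
qed

end

section \<open>Continuity of the normal flux across internal faces\<close>

text \<open>The lift of w that is constant along normals is integrable on slabs: by Fubini the
  integral of its norm is that of w times the thickness.\<close>

lemma integral_slab:
  fixes w :: "real^'n \<Rightarrow> real"
  assumes n: "norm n = 1" and w: "integrable (hmeas n b) w"
  shows "integrable lborel (\<lambda>z. indicator {z. \<bar>n \<bullet> z - b\<bar> \<le> R} z * w (hproj n b z))"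
proof (rule integrableI_bounded)
  have [measurable]: "w \<in> borel_measurable borel" using borel_measurable_integrable[OF w] by simp
  show "(\<lambda>z. indicator {z. \<bar>n \<bullet> z - b\<bar> \<le> R} z * w (hproj n b z)) \<in> borel_measurable lborel" by measurable
  have "(\<integral>\<^sup>+z. ennreal (norm (indicator {z. \<bar>n \<bullet> z - b\<bar> \<le> R} z * w (hproj n b z))) \<partial>lborel)
    = (\<integral>\<^sup>+x. \<integral>\<^sup>+s. ennreal (norm (indicator {z. \<bar>n \<bullet> z - b\<bar> \<le> R} (x + s *\<^sub>R n) * w (hproj n b (x + s *\<^sub>R n)))) \<partial>lborel \<partial>hmeas n b)"
    by (rule normal_Fubini_nn[OF n, symmetric]) measurable
  also have "\<dots> = (\<integral>\<^sup>+x. ennreal (norm (w x)) * emeasure lborel {-R..R} \<partial>hmeas n b)"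
  proof (rule nn_integral_cong_AE)
    show "AE x in hmeas n b. (\<integral>\<^sup>+s. ennreal (norm (indicator {z. \<bar>n \<bullet> z - b\<bar> \<le> R} (x + s *\<^sub>R n) * w (hproj n b (x + s *\<^sub>R n)))) \<partial>lborel)
      = ennreal (norm (w x)) * emeasure lborel {-R..R}"
      using AE_hmeas_hyperplane[OF n]
    proof eventually_elim
      case (elim x)
      have "n \<bullet> (x + s *\<^sub>R n) = s + b" for s using elim unit_inner[OF n] by (simp add: inner_add_right)
      then have "indicator {z. \<bar>n \<bullet> z - b\<bar> \<le> R} (x + s *\<^sub>R n) = (indicator {-R..R} s :: real)" for s
        by (auto simp: indicator_def abs_le_iff)
      then have "ennreal (norm (indicator {z. \<bar>n \<bullet> z - b\<bar> \<le> R} (x + s *\<^sub>R n) * w (hproj n b (x + s *\<^sub>R n))))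
        = ennreal (norm (w x)) * indicator {-R..R} s" for s
        using hproj_normal[OF n elim, of s] by (simp add: indicator_def)
      then show ?case by (simp add: nn_integral_cmult_indicator)
    qed
  qed
  also have "\<dots> = (\<integral>\<^sup>+x. ennreal (norm (w x)) \<partial>hmeas n b) * emeasure lborel {-R..R}"
    by (rule nn_integral_multc) measurable
  also have "\<dots> < \<infinity>"
    using w emeasure_bounded_finite[of "{-R..R}"]
    by (auto simp: integrable_iff_bounded ennreal_mult_less_top)
  finally show "(\<integral>\<^sup>+z. ennreal (norm (indicator {z. \<bar>n \<bullet> z - b\<bar> \<le> R} z * w (hproj n b z))) \<partial>lborel) < \<infinity>" .
qed

text \<open>Translating along the normal and cutting off away from the hyperplane turns a test function
  of the cylinder into one of \<open>U\<close> with prescribed values on the hyperplane.\<close>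

lemma hyperplane_cutoff:
  fixes U :: "(real^'n) set"
  assumes n: "norm n = 1" and U: "open U" and \<Phi>: "\<Phi> \<in> test_functions {z. hproj n b z \<in> U}"
  shows "\<exists>\<phi>\<in>test_functions U. \<forall>x. n \<bullet> x = b \<longrightarrow> \<phi> x = \<Phi> (x + s *\<^sub>R n)"
proof -
  define C where "C = closure {x. \<Phi> (x + s *\<^sub>R n) \<noteq> 0}"
  have t: "(\<lambda>x. \<Phi> (x + s *\<^sub>R n)) \<in> test_functions {x. hproj n b (x + s *\<^sub>R n) \<in> U}"
    by (rule test_functions_shift[OF \<Phi>]) simp
  have C: "compact C" "C \<subseteq> {x. hproj n b (x + s *\<^sub>R n) \<in> U}"
    using t by (auto simp: C_def test_functions_def)
  \<comment> \<open>Points of C on the hyperplane lie in U, so by compactness the part of C outside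
    U keeps a positive distance from the hyperplane.\<close>
  have "\<exists>\<epsilon>>0. \<forall>x\<in>C - U. \<epsilon> \<le> \<bar>n \<bullet> x - b\<bar>"
  proof (cases "C - U = {}")
    case True then show ?thesis by (intro exI[of _ "1::real"] conjI ballI) auto
  next
    case False
    have "compact (C - U)" using C(1) U by (rule compact_diff)
    moreover have "continuous_on (C - U) (\<lambda>x. \<bar>n \<bullet> x - b\<bar>)" by (intro continuous_intros)
    ultimately obtain y where y: "y \<in> C - U" "\<And>x. x \<in> C - U \<Longrightarrow> \<bar>n \<bullet> y - b\<bar> \<le> \<bar>n \<bullet> x - b\<bar>"
      using continuous_attains_inf[of "C - U" "\<lambda>x. \<bar>n \<bullet> x - b\<bar>"] False by blast
    have "n \<bullet> y \<noteq> b"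
    proof
      assume "n \<bullet> y = b"
      from hproj_normal[OF n this, of s] show False using y(1) C(2) by auto
    qed
    then show ?thesis using y(2) by (intro exI[of _ "\<bar>n \<bullet> y - b\<bar>"]) auto
  qed
  then obtain \<epsilon> where \<epsilon>: "\<epsilon> > 0" "\<And>x. x \<in> C - U \<Longrightarrow> \<epsilon> \<le> \<bar>n \<bullet> x - b\<bar>" by blast
  \<comment> \<open>With this scale the factor \<open>1 - notch\<close> equals 1 on the hyperplane
    and vanishes from distance \<epsilon>/2 on, before C can leave U.\<close>
  define a where "a = 2 / \<epsilon>"
  define \<chi>' where "\<chi>' = (\<lambda>x. 1 + (-1) * notch (((a *\<^sub>R n) \<bullet> x) + (- a * b)))"
  have arg: "((a *\<^sub>R n) \<bullet> x) + (- a * b) = a * (n \<bullet> x - b)" for x by (simp add: algebra_simps)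
  define \<phi> where "\<phi> = (\<lambda>x. \<chi>' x * \<Phi> (x + s *\<^sub>R n))"
  have ck: "C_k k \<chi>'" for k
    unfolding \<chi>'_def by (intro C_k_add C_k_mult C_k_const C_k_ridge C_k_notch)
  have \<phi>t: "\<phi> \<in> test_functions {x. hproj n b (x + s *\<^sub>R n) \<in> U}"
    unfolding \<phi>_def by (rule test_function_mult[OF t ck])
  have "closure {x. \<phi> x \<noteq> 0} \<subseteq> U"
  proof -
    have sub: "{x. \<phi> x \<noteq> 0} \<subseteq> C \<inter> {x. \<bar>n \<bullet> x - b\<bar> \<le> \<epsilon> / 2}"
    proof
      fix x assume x: "x \<in> {x. \<phi> x \<noteq> 0}"
      then have "x \<in> {x. \<Phi> (x + s *\<^sub>R n) \<noteq> 0}" by (simp add: \<phi>_def)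
      then have "x \<in> C" unfolding C_def by (rule rev_subsetD[OF _ closure_subset])
      moreover have "\<bar>n \<bullet> x - b\<bar> \<le> \<epsilon> / 2"
      proof (rule ccontr)
        assume "\<not> \<bar>n \<bullet> x - b\<bar> \<le> \<epsilon> / 2"
        moreover have "\<bar>a * (n \<bullet> x - b)\<bar> = 2 / \<epsilon> * \<bar>n \<bullet> x - b\<bar>"
          unfolding a_def abs_mult using \<epsilon>(1) by simp
        moreover have "2 / \<epsilon> * (\<epsilon> / 2) \<le> 2 / \<epsilon> * \<bar>n \<bullet> x - b\<bar>"
          using \<epsilon>(1) calculation(1) by (intro mult_left_mono) auto
        ultimately have "1 \<le> \<bar>a * (n \<bullet> x - b)\<bar>" using \<epsilon>(1) by simp
        then have "\<chi>' x = 0" unfolding \<chi>'_def arg notch_eq using step_eq_1 by simp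
        then show False using x by (simp add: \<phi>_def)
      qed
      ultimately show "x \<in> C \<inter> {x. \<bar>n \<bullet> x - b\<bar> \<le> \<epsilon> / 2}" by simp
    qed
    have "closed (C \<inter> {x. \<bar>n \<bullet> x - b\<bar> \<le> \<epsilon> / 2})"
      by (intro closed_Int compact_imp_closed C(1) closed_Collect_le continuous_intros)
    then have "closure {x. \<phi> x \<noteq> 0} \<subseteq> C \<inter> {x. \<bar>n \<bullet> x - b\<bar> \<le> \<epsilon> / 2}" using sub by (rule closure_minimal[rotated])
    moreover have "C \<inter> {x. \<bar>n \<bullet> x - b\<bar> \<le> \<epsilon> / 2} \<subseteq> U"
    proof
      fix x assume x: "x \<in> C \<inter> {x. \<bar>n \<bullet> x - b\<bar> \<le> \<epsilon> / 2}"
      show "x \<in> U" using \<epsilon>(2)[of x] \<epsilon>(1) x by (cases "x \<in> U") auto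
    qed
    ultimately show ?thesis by (rule subset_trans)
  qed
  then have "\<phi> \<in> test_functions U" using \<phi>t by (simp add: test_functions_def)
  moreover have "\<phi> x = \<Phi> (x + s *\<^sub>R n)" if "n \<bullet> x = b" for x
    using that step_eq_0[of 0] by (simp add: \<phi>_def \<chi>'_def arg notch_eq)
  ultimately show ?thesis by blast
qed

text \<open>Lift w to the cylinder over U, constant along normals, and apply the fundamental lemma
  of the full space there. Each slice of a test function of the cylinder at fixed height is the
  restriction to the hyperplane of a test function of U, by \<open>hyperplane_cutoff\<close>, so it
  integrates to zero against w.\<close>

lemma fundamental_lemma_hyperplane:
  fixes U :: "(real^'n) set"
  assumes n: "norm n = 1" and U: "open U" and w: "integrable (hmeas n b) w"
    and 0: "\<And>\<phi>. \<phi> \<in> test_functions U \<Longrightarrow> (LINT x|hmeas n b. w x * \<phi> x) = 0"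
  shows "AE x in hmeas n b. x \<in> U \<longrightarrow> w x = 0"
proof -
  define V where "V = {z. hproj n b z \<in> U}"
  define W where "W = (\<lambda>z. w (hproj n b z))"
  have [measurable]: "w \<in> borel_measurable borel" using borel_measurable_integrable[OF w] by simp
  have [measurable]: "W \<in> borel_measurable borel" unfolding W_def by measurable
  have "open (hproj n b -` U)"
    by (rule open_vimage[OF U]) (unfold hproj_def, intro continuous_intros)
  then have oV: "open V" by (simp add: V_def vimage_def)
  have slab: "integrable lborel (\<lambda>z. indicator {z. \<bar>n \<bullet> z - b\<bar> \<le> R} z * W z)" for R
    unfolding W_def by (rule integral_slab[OF n w])
  have WB: "integrable lborel (\<lambda>z. W z * \<Phi> z)"
    if m: "\<Phi> \<in> borel_measurable borel" and B: "\<And>z. \<bar>\<Phi> z\<bar> \<le> B" and S: "bounded {z. \<Phi> z \<noteq> 0}" for \<Phi> B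
  proof -
    obtain r where r: "\<And>z. \<Phi> z \<noteq> 0 \<Longrightarrow> norm z \<le> r" using S by (auto simp: bounded_iff)
    \<comment> \<open>A slab of half-width r + |b| contains the support of \<Phi>, and W is
      integrable on it.\<close>
    have "integrable lborel (\<lambda>z. (indicator {z. \<bar>n \<bullet> z - b\<bar> \<le> r + \<bar>b\<bar>} z * W z) * \<Phi> z)"
      by (rule integrable_mult_bounded[OF slab _ B]) (use m in simp)
    moreover have "(indicator {z. \<bar>n \<bullet> z - b\<bar> \<le> r + \<bar>b\<bar>} z * W z) * \<Phi> z = W z * \<Phi> z" for z
    proof (cases "\<Phi> z = 0")
      case False
      have "\<bar>n \<bullet> z\<bar> \<le> r" using Cauchy_Schwarz_ineq2[of n z] n r[OF False] by simp
      then have "\<bar>n \<bullet> z - b\<bar> \<le> r + \<bar>b\<bar>" by linarith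
      then show ?thesis by (simp add: indicator_def)
    qed simp
    ultimately show ?thesis by (simp only:)
  qed
  have "AE z in lborel. z \<in> V \<longrightarrow> W z = 0"
  proof (rule fundamental_lemma[OF oV])
    fix c d :: "real^'n"
    have "integrable lborel (\<lambda>z. W z * indicator (cbox c d) z)"
    proof (rule WB[where B = 1])
      have "{z. indicator (cbox c d) z \<noteq> (0::real)} = cbox c d" by (auto simp: indicator_def)
      then show "bounded {z. indicator (cbox c d) z \<noteq> (0::real)}" using bounded_cbox by simp
    qed (auto simp: indicator_def)
    then show "integrable lborel (\<lambda>z. indicator (cbox c d) z * W z)" by (simp add: mult.commute)
  next
    fix \<Phi> assume \<Phi>: "\<Phi> \<in> test_functions V"
    have "bounded {z. \<Phi> z \<noteq> 0}" using \<Phi> by (auto simp: test_functions_def compact_closure)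
    moreover have "\<Phi> \<in> borel_measurable borel"
      using test_function_continuous[OF \<Phi>] by (rule borel_measurable_continuous_onI)
    moreover obtain B where "\<And>z. \<bar>\<Phi> z\<bar> \<le> B" using test_function_bounded[OF \<Phi>] by blast
    ultimately have i: "integrable lborel (\<lambda>z. W z * \<Phi> z)" and [measurable]: "\<Phi> \<in> borel_measurable borel" by (auto intro: WB)
    have "(LINT x|hmeas n b. W (x + s *\<^sub>R n) * \<Phi> (x + s *\<^sub>R n)) = 0" for s
    proof -
      obtain \<phi> where \<phi>: "\<phi> \<in> test_functions U" "\<And>x. n \<bullet> x = b \<Longrightarrow> \<phi> x = \<Phi> (x + s *\<^sub>R n)"
        using hyperplane_cutoff[OF n U \<Phi>[unfolded V_def], of s] by blast
      have [measurable]: "\<phi> \<in> borel_measurable borel"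
        using test_function_continuous[OF \<phi>(1)] by (rule borel_measurable_continuous_onI)
      have "(LINT x|hmeas n b. W (x + s *\<^sub>R n) * \<Phi> (x + s *\<^sub>R n)) = (LINT x|hmeas n b. w x * \<phi> x)"
      proof (rule integral_cong_AE)
        show "AE x in hmeas n b. W (x + s *\<^sub>R n) * \<Phi> (x + s *\<^sub>R n) = w x * \<phi> x"
          using AE_hmeas_hyperplane[OF n]
          by eventually_elim (simp add: W_def hproj_normal[OF n] \<phi>(2))
      qed measurable
      then show ?thesis using 0[OF \<phi>(1)] by simp
    qed
    then show "(LBINT z. W z * \<Phi> z) = 0" using normal_Fubini(4)[OF n i, of b] by simp
  qed
  from normal_Fubini_AE[OF n this, of b] AE_hmeas_hyperplane[OF n]
  show ?thesis
  proof eventually_elim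
    case (elim x)
    show ?case
    proof
      assume "x \<in> U"
      then have "AE s::real in lborel. w x = 0"
        using elim by (simp add: V_def W_def hproj_normal[OF n])
      moreover have "ae_filter (lborel :: real measure) \<noteq> bot" by (simp add: ae_filter_eq_bot_iff)
      ultimately show "w x = 0" using eventually_happens' by blast
    qed
  qed
qed

context mesh
begin

text \<open>If G lies in the same hyperplane, F is relatively open and disjoint from G, so it misses
  the closure of G. Otherwise the two hyperplanes differ and meet in a null set.\<close>

lemma AE_face_off_other_closures:
  assumes F: "F \<in> Fh"
  shows "AE x in hyp_measure (affine hull F). x \<in> F \<longrightarrow> x \<notin> (\<Union>G\<in>Fh - {F}. closure G)"
proof -
  have "AE x in hyp_measure (affine hull F). \<forall>G\<in>Fh - {F}. x \<in> F \<longrightarrow> x \<notin> closure G"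
  proof (rule AE_finite_allI)
    show "finite (Fh - {F})" using finite_Fh by simp
    fix G assume G: "G \<in> Fh - {F}"
    show "AE x in hyp_measure (affine hull F). x \<in> F \<longrightarrow> x \<notin> closure G"
    proof (cases "affine hull G = affine hull F")
      case True
      obtain U where U: "open U" "F = affine hull F \<inter> U" using face_open[OF F] by (auto simp: openin_open)
      have "disjnt F G" using disjoint_Fh F G by (auto simp: pairwise_def)
      moreover have "G \<subseteq> affine hull F" using True hull_subset[of G affine] by simp
      ultimately have "U \<inter> G = {}" using U(2) by (auto simp: disjnt_def)
      then have "U \<inter> closure G = {}" using open_Int_closure_eq_empty[OF U(1)] by simp
      then have "x \<notin> closure G" if "x \<in> F" for x using that U(2) by blast
      then show ?thesis by simp
    next
      case False
      have "AE x in hyp_measure (affine hull F). x \<notin> affine hull G"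
        by (rule AE_off_other_hyperplanes[OF F _ False]) (use G in simp)
      then show ?thesis by eventually_elim (use closure_face_subset in auto)
    qed
  qed
  then show ?thesis by eventually_elim blast
qed

lemma flux_continuity:
  assumes \<Omega>: "open \<Omega>" and F: "F \<in> Fh" "F \<subseteq> \<Omega>" and c: "cells_of Th F = {S, S'}" "S \<noteq> S'"
    and v: "\<And>T G. T \<in> Th \<Longrightarrow> G \<in> faces_of Fh T \<Longrightarrow> v T G \<in> borel_measurable borel"
      "\<And>T G. T \<in> Th \<Longrightarrow> G \<in> faces_of Fh T \<Longrightarrow> integrable (hyp_measure (affine hull G)) (\<lambda>x. indicator G x * v T G x)"
    and 0: "\<And>\<phi>. \<phi> \<in> test_functions \<Omega> \<Longrightarrow>
      (\<Sum>T\<in>Th. \<Sum>G\<in>faces_of Fh T. LINT x|hyp_measure (affine hull G). indicator G x * (\<phi> x * v T G x)) = 0"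
  shows "(LINT x|hyp_measure (affine hull F). indicator F x * v S F x) + (LINT x|hyp_measure (affine hull F). indicator F x * v S' F x) = 0"
proof -
  let ?M = "hyp_measure (affine hull F)"
  have "S \<in> cells_of Th F" "S' \<in> cells_of Th F" using c(1) by auto
  then have S: "S \<in> Th" "S' \<in> Th" "F \<in> faces_of Fh S" "F \<in> faces_of Fh S'"
    using F(1) by (auto simp: cells_of_def faces_of_def)
  define w where "w = (\<lambda>x. indicator F x * v S F x + indicator F x * v S' F x)"
  \<comment> \<open>Removing the closures of the other faces leaves an open set whose test functions
    see no face but F; what F itself loses is a null set.\<close>
  define U where "U = \<Omega> - (\<Union>G\<in>Fh - {F}. closure G)"
  have U: "open U" unfolding U_def using finite_Fh by (intro open_Diff \<Omega> closed_UN) auto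
  note iS = v(2)[OF S(1,3)] and iS' = v(2)[OF S(2,4)]
  have iw: "integrable ?M w" unfolding w_def by (rule Bochner_Integration.integrable_add[OF iS iS'])
  have "(LINT x|?M. w x * \<phi> x) = 0" if \<phi>: "\<phi> \<in> test_functions U" for \<phi>
  proof -
    have \<phi>\<Omega>: "\<phi> \<in> test_functions \<Omega>" using \<phi> test_functions_mono[of U \<Omega>] by (auto simp: U_def)
    obtain B where B: "\<And>x. \<bar>\<phi> x\<bar> \<le> B" using test_function_bounded[OF \<phi>] by blast
    have [measurable]: "\<phi> \<in> borel_measurable borel"
      using test_function_continuous[OF \<phi>] by (rule borel_measurable_continuous_onI)
    have m: "\<phi> \<in> borel_measurable ?M" by measurable
    define t where "t = (\<lambda>T G. LINT x|hyp_measure (affine hull G). indicator G x * (\<phi> x * v T G x))"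
    have t0: "t T G = 0" if G: "G \<in> Fh" "G \<noteq> F" for T G
    proof -
      have "\<phi> x = 0" if "x \<in> G" for x
        using closure_subset[of G] that G by (intro test_function_eq_0[OF \<phi>]) (auto simp: U_def)
      then have "indicator G x * (\<phi> x * v T G x) = 0" for x by (cases "x \<in> G") auto
      then show ?thesis unfolding t_def by (simp only: Bochner_Integration.integral_zero)
    qed
    have "(\<Sum>G\<in>faces_of Fh T. t T G) = (if T \<in> cells_of Th F then t T F else 0)" if "T \<in> Th" for T
    proof -
      have "(\<Sum>G\<in>faces_of Fh T. t T G) = (\<Sum>G\<in>faces_of Fh T. if G = F then t T F else 0)"
        by (intro sum.cong refl) (use t0 faces_of_subset in auto)
      also have "\<dots> = (if F \<in> faces_of Fh T then t T F else 0)" by (rule sum.delta[OF finite_faces_of, THEN trans]) simp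
      also have "F \<in> faces_of Fh T \<longleftrightarrow> T \<in> cells_of Th F" using that F(1) by (simp add: faces_of_def cells_of_def)
      finally show ?thesis .
    qed
    then have "0 = (\<Sum>T\<in>Th. if T \<in> cells_of Th F then t T F else 0)" using 0[OF \<phi>\<Omega>] by (simp add: t_def)
    also have "\<dots> = (\<Sum>T\<in>Th \<inter> cells_of Th F. t T F)" by (rule sum.inter_restrict[OF finite_Th, symmetric])
    also have "Th \<inter> cells_of Th F = {S, S'}" using c(1) by (auto simp: cells_of_def)
    also have "(\<Sum>T\<in>{S, S'}. t T F) = t S F + t S' F" using c(2) by simp
    also have "\<dots> = (LINT x|?M. (indicator F x * v S F x) * \<phi> x) + (LINT x|?M. (indicator F x * v S' F x) * \<phi> x)"
      unfolding t_def by (intro arg_cong2[of _ _ _ _ "(+)"] Bochner_Integration.integral_cong refl) (simp_all add: mult_ac)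
    also have "\<dots> = (LINT x|?M. w x * \<phi> x)"
      unfolding w_def distrib_right
      by (rule Bochner_Integration.integral_add[symmetric]) (intro integrable_mult_bounded[OF _ m B] iS iS')+
    finally show ?thesis by simp
  qed
  from fundamental_lemma_hyperplane[OF face_hyp(1)[OF F(1)] U iw this]
  have "AE x in ?M. x \<in> U \<longrightarrow> w x = 0" .
  then have "AE x in ?M. w x = 0"
    using AE_face_off_other_closures[OF F(1)]
  proof eventually_elim
    case (elim x)
    show ?case
    proof (cases "x \<in> F")
      case True
      then have "x \<in> U" using elim(2) F(2) by (auto simp: U_def)
      then show ?thesis using elim(1) by simp
    qed (simp add: w_def)
  qed
  then have "(LINT x|?M. w x) = 0" by (rule integral_eq_zero_AE)
  then show ?thesis unfolding w_def using Bochner_Integration.integral_add[OF iS iS'] by simp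
qed

text \<open>A point of \<Omega> lies in the closure of some cell. If it is off the finitely many
  hyperplanes of the faces, it is not in the frontier of that cell, hence in the cell.\<close>

lemma AE_in_some_cell: "AE x in lborel. x \<in> \<Omega> \<longrightarrow> (\<exists>T\<in>Th. x \<in> T)"
proof -
  have "AE x in lborel. \<forall>F\<in>Fh. x \<notin> affine hull F"
  proof (rule AE_finite_allI[OF finite_Fh])
    fix F assume F: "F \<in> Fh"
    show "AE x in lborel. x \<notin> affine hull F"
    proof -
      have "hyp_normal (affine hull F) \<noteq> 0" using face_hyp(1)[OF F] by auto
      from AE_not_hyperplane[OF this, of "hyp_offset (affine hull F)"] show ?thesis
        by eventually_elim (use face_in_hyperplane[OF F] in blast)
    qed
  qed
  then show ?thesis
  proof eventually_elim
    case (elim x)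
    show ?case
    proof
      assume "x \<in> \<Omega>"
      then have "x \<in> closure \<Omega>" using closure_subset by blast
      then obtain T where T: "T \<in> Th" "x \<in> closure T" using closure_cells by blast
      have "x \<notin> frontier T"
      proof
        assume "x \<in> frontier T"
        then obtain F where "F \<in> faces_of Fh T" "x \<in> closure F" using cell_frontier[OF T(1)] by blast
        then show False using elim faces_of_subset closure_face_subset by blast
      qed
      then have "x \<in> interior T" using T(2) by (simp add: frontier_def)
      then show "\<exists>T\<in>Th. x \<in> T" using T(1) interior_subset by blast
    qed
  qed
qed

end

section \<open>The error estimate\<close>

lemma L2_subset_integrable:
  fixes \<Omega> T :: "(real^'n) set" and f :: "real^'n \<Rightarrow> real"
  assumes f: "f \<in> L2 \<Omega>" and b: "\<Omega> \<in> sets borel" "bounded \<Omega>" "T \<in> sets borel" "T \<subseteq> \<Omega>"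
  shows "f \<in> borel_measurable (lebesgue_on T)" "integrable (lebesgue_on T) f"
proof -
  obtain f' where f' [measurable]: "f' \<in> borel_measurable borel" and e: "AE x in lborel. x \<in> \<Omega> \<longrightarrow> f x = f' x" and 0: "\<And>x. x \<notin> \<Omega> \<Longrightarrow> f' x = 0"
    using borel_representative_real[OF b(1), of f] f by (auto simp: L2_def)
  have sq: "integrable lborel (\<lambda>x. (f' x)\<^sup>2)"
  proof -
    have "AE x in lborel. x \<in> \<Omega> \<longrightarrow> (norm (f x))\<^sup>2 = (f' x)\<^sup>2" using e by eventually_elim auto
    from lebesgue_on_AE_eq_borel(3)[OF b(1) _ this] 0 f show ?thesis by (simp add: L2_def)
  qed
  have i: "integrable lborel f'"
    by (rule integrable_of_square_bounded_support[OF f' _ b(2) 0]) (use sq in simp_all)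
  note [measurable] = b(3)
  have m: "(\<lambda>x. indicator T x * f' x) \<in> borel_measurable borel" by measurable
  have e': "AE x in lborel. x \<in> T \<longrightarrow> f x = indicator T x * f' x"
    using e by eventually_elim (use b(4) in auto)
  have z: "\<And>x. x \<notin> T \<Longrightarrow> indicator T x * f' x = 0" by simp
  show "f \<in> borel_measurable (lebesgue_on T)" by (rule lebesgue_on_AE_eq_borel(1)[OF b(3) m e' z])
  have "integrable lborel (\<lambda>x. indicator T x * f' x)" using integrable_mult_indicator[of T lborel f'] i by simp
  then show "integrable (lebesgue_on T) f" using lebesgue_on_AE_eq_borel(3)[OF b(3) m e' z] by simp
qed

text \<open>The two weights multiply to (d i)^2, so the product of their square roots cancels the
  division by d i in the jump quotient. They are the weights of the error bound and of the discrete
  norm.\<close>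

lemma weighted_Cauchy_Schwarz:
  fixes l a d X j :: "'a \<Rightarrow> real"
  assumes pos: "\<And>i. i \<in> I \<Longrightarrow> l i > 0 \<and> a i > 0 \<and> d i > 0"
  shows "\<bar>\<Sum>i\<in>I. X i * j i\<bar> \<le> sqrt (\<Sum>i\<in>I. inverse (l i) * (d i / a i) * (X i)\<^sup>2) * sqrt (\<Sum>i\<in>I. l i * a i * d i * (j i / d i)\<^sup>2)"
proof -
  define p where "p = (\<lambda>i. sqrt (inverse (l i) * (d i / a i)) * X i)"
  define r where "r = (\<lambda>i. sqrt (l i * a i * d i) * (j i / d i))"
  have pr: "p i * r i = X i * j i" if "i \<in> I" for i
  proof -
    note P = pos[OF that]
    have "sqrt (inverse (l i) * (d i / a i)) * sqrt (l i * a i * d i) = sqrt ((d i)\<^sup>2)"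
      unfolding real_sqrt_mult[symmetric] using P by (intro arg_cong[of _ _ sqrt]) (simp add: field_simps power2_eq_square)
    then have s: "sqrt (inverse (l i) * (d i / a i)) * sqrt (l i * a i * d i) = d i" using P by simp
    have "p i * r i = (sqrt (inverse (l i) * (d i / a i)) * sqrt (l i * a i * d i)) * (X i * (j i / d i))"
      unfolding p_def r_def by (simp only: mult_ac)
    also have "\<dots> = X i * j i" unfolding s using P by simp
    finally show ?thesis .
  qed
  have "\<bar>\<Sum>i\<in>I. X i * j i\<bar> \<le> (\<Sum>i\<in>I. \<bar>X i * j i\<bar>)" by (rule sum_abs)
  also have "\<dots> = (\<Sum>i\<in>I. \<bar>p i\<bar> * \<bar>r i\<bar>)" by (intro sum.cong refl) (simp add: pr abs_mult[symmetric])
  also have "\<dots> \<le> L2_set p I * L2_set r I" by (rule L2_set_mult_ineq)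
  also have "L2_set p I = sqrt (\<Sum>i\<in>I. inverse (l i) * (d i / a i) * (X i)\<^sup>2)"
    unfolding L2_set_def
    by (intro arg_cong[of _ _ sqrt] sum.cong refl) (use pos in \<open>fastforce simp: p_def power_mult_distrib intro: less_imp_le\<close>)
  also have "L2_set r I = sqrt (\<Sum>i\<in>I. l i * a i * d i * (j i / d i)\<^sup>2)"
    unfolding L2_set_def
  proof (intro arg_cong[of _ _ sqrt] sum.cong refl)
    fix i assume "i \<in> I"
    then have "0 \<le> l i * a i * d i" using pos[of i] by (simp add: less_imp_le)
    then show "(r i)\<^sup>2 = l i * a i * d i * (j i / d i)\<^sup>2" unfolding r_def power_mult_distrib by simp
  qed
  finally show ?thesis .
qed

context mesh
begin

lemma sum_over_cells:
  fixes c :: "(real^'n) set \<Rightarrow> real"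
  assumes T: "T \<in> Th" "x \<in> T"
  shows "(\<Sum>S\<in>Th. indicator S x * c S) = c T"
proof -
  have "(\<Sum>S\<in>Th. indicator S x * c S) = (\<Sum>S\<in>Th. if S = T then c T else 0)"
  proof (intro sum.cong refl)
    fix S assume S: "S \<in> Th"
    have "x \<notin> S" if "S \<noteq> T" using disjoint_Th S T that by (auto simp: pairwise_def disjnt_def)
    then show "indicator S x * c S = (if S = T then c T else 0)" using T(2) by auto
  qed
  also have "\<dots> = c T" using T(1) finite_Th by simp
  finally show ?thesis .
qed

text \<open>The disjoint cells exhaust \<Omega> up to a null set, so the sum is the variational
  equation tested with \<phi>. Since \<phi> may be nonzero on internal faces, this carries
  information across them that the equations inside the cells do not.\<close>

lemma sum_cell_equations:
  fixes K :: "real^'n \<Rightarrow> real^'n^'n"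
  assumes \<Omega>: "open \<Omega>" "bounded \<Omega>" and u: "u \<in> H1 \<Omega>" and f: "f \<in> L2 \<Omega>"
    and K: "\<And>T x. T \<in> Th \<Longrightarrow> x \<in> T \<Longrightarrow> K x = A T"
    and sol: "\<forall>v\<in>H10 \<Omega>. (LINT x|lebesgue_on \<Omega>. (K x *v weak_grad \<Omega> u x) \<bullet> weak_grad \<Omega> v x) = (LINT x|lebesgue_on \<Omega>. f x * v x)"
    and \<phi>: "\<phi> \<in> test_functions \<Omega>" "\<And>x. GDERIV \<phi> x :> D x"
  shows "(\<Sum>T\<in>Th. (LINT x|lebesgue_on T. (A T *v weak_grad T u x) \<bullet> D x) - (LINT x|lebesgue_on T. f x * \<phi> x)) = 0"
proof -
  have \<Omega>b: "\<Omega> \<in> sets borel" using \<Omega> by auto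
  obtain g h where gh: "borel_weak_gradient \<Omega> g h" "AE x in lborel. x \<in> \<Omega> \<longrightarrow> weak_grad \<Omega> u x = h x"
    using has_weak_gradient_borel[OF \<Omega>(1) weak_grad[OF u]] by blast
  have h0: "\<And>x. x \<notin> \<Omega> \<Longrightarrow> h x = 0" by (rule borel_weak_gradientD(6)[OF gh(1)])
  have ih: "integrable lborel h" by (rule borel_weak_gradient_integrable(2)[OF gh(1) \<Omega>(2)])
  note fi = L2_subset_integrable[OF f \<Omega>b \<Omega>(2) \<Omega>b subset_refl]
  obtain f' where f' [measurable]: "f' \<in> borel_measurable borel" and fe: "AE x in lborel. x \<in> \<Omega> \<longrightarrow> f x = f' x" and f0: "\<And>x. x \<notin> \<Omega> \<Longrightarrow> f' x = 0"
    using borel_representative_real[OF \<Omega>b fi(1)] by blast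
  have if': "integrable lborel f'" using lebesgue_on_AE_eq_borel(3)[OF \<Omega>b f' fe f0] fi(2) by simp
  have [measurable]: "D \<in> borel_measurable borel" "\<phi> \<in> borel_measurable borel"
    using test_function_gderiv_continuous[OF \<phi>] test_function_continuous[OF \<phi>(1)]
    by (auto intro: borel_measurable_continuous_onI)
  obtain B where B: "\<And>x. \<bar>\<phi> x\<bar> \<le> B" using test_function_bounded[OF \<phi>(1)] by blast
  obtain B' where B': "\<And>x. norm (D x) \<le> B'" using test_function_gderiv_bounded[OF \<phi>] by blast
  note cb [measurable] = borel_open[OF cell_open]
  define a where "a = (\<lambda>T x. (A T *v h x) \<bullet> D x)"
  have iAh: "integrable lborel (\<lambda>x. A T *v h x)" for T
    by (rule integrable_bounded_linear[OF matrix_vector_mul_bounded_linear ih])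
  then have [measurable]: "(\<lambda>x. A T *v h x) \<in> borel_measurable borel" for T
    using borel_measurable_integrable[of lborel] by simp
  have am [measurable]: "a T \<in> borel_measurable borel" for T unfolding a_def by measurable
  have ia: "integrable lborel (a T)" for T
  proof (rule Bochner_Integration.integrable_bound[of _ "\<lambda>x. B' *\<^sub>R (A T *v h x)"])
    show "AE x in lborel. norm (a T x) \<le> norm (B' *\<^sub>R (A T *v h x))"
    proof (rule AE_I2)
      fix x
      have "norm (a T x) \<le> norm (A T *v h x) * norm (D x)" unfolding a_def using Cauchy_Schwarz_ineq2 by simp
      also have "\<dots> \<le> norm (A T *v h x) * B'" by (intro mult_left_mono B') simp
      also have "\<dots> \<le> norm (B' *\<^sub>R (A T *v h x))" by (simp add: mult.commute mult_right_mono)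
      finally show "norm (a T x) \<le> norm (B' *\<^sub>R (A T *v h x))" .
    qed
  qed (use iAh in auto)
  have ifp: "integrable lborel (\<lambda>x. f' x * \<phi> x)" by (rule integrable_mult_bounded[OF if' _ B]) measurable
  have ind: "integrable lborel (\<lambda>x. indicator T x * p x)" if "T \<in> Th" "integrable lborel p" for T and p :: "real^'n \<Rightarrow> real"
    using integrable_mult_indicator[of T lborel p] cb[OF that(1)] that(2) by simp
  have cell: "(LINT x|lebesgue_on T. (A T *v weak_grad T u x) \<bullet> D x) = (LBINT x. indicator T x * a T x)"
    "(LINT x|lebesgue_on T. f x * \<phi> x) = (LBINT x. indicator T x * (f' x * \<phi> x))" if T: "T \<in> Th" for T
  proof -
    note [measurable] = cb[OF T]
    show "(LINT x|lebesgue_on T. (A T *v weak_grad T u x) \<bullet> D x) = (LBINT x. indicator T x * a T x)"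
    proof (rule lebesgue_on_AE_eq_borel(2)[OF cb[OF T]])
      show "AE x in lborel. x \<in> T \<longrightarrow> (A T *v weak_grad T u x) \<bullet> D x = indicator T x * a T x"
        using gh(2) cell_weak_gradient[OF \<Omega>(1) cell_open[OF T] cell_subset[OF T] u]
        by eventually_elim (use cell_subset[OF T] in \<open>auto simp: a_def\<close>)
    qed auto
    show "(LINT x|lebesgue_on T. f x * \<phi> x) = (LBINT x. indicator T x * (f' x * \<phi> x))"
    proof (rule lebesgue_on_AE_eq_borel(2)[OF cb[OF T]])
      show "AE x in lborel. x \<in> T \<longrightarrow> f x * \<phi> x = indicator T x * (f' x * \<phi> x)"
        using fe by eventually_elim (use cell_subset[OF T] in auto)
    qed auto
  qed
  define e where "e = (\<lambda>x. \<Sum>T\<in>Th. indicator T x * a T x)"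
  have em: "e \<in> borel_measurable borel"
    unfolding e_def by (intro borel_measurable_sum borel_measurable_times am borel_measurable_indicator cb)
  have "(\<Sum>T\<in>Th. LINT x|lebesgue_on T. (A T *v weak_grad T u x) \<bullet> D x) = (\<Sum>T\<in>Th. LINT x|lborel. indicator T x * a T x)"
    by (intro sum.cong refl cell(1))
  also have "\<dots> = (LBINT x. e x)"
    unfolding e_def by (rule Bochner_Integration.integral_sum[symmetric]) (rule ind[OF _ ia])
  also have "\<dots> = (LBINT x. f' x * \<phi> x)"
  proof (rule weak_equation_borel[OF \<Omega>(1) gh(2) f' fe sol \<phi> em])
    show "AE x in lborel. x \<in> \<Omega> \<longrightarrow> (K x *v h x) \<bullet> D x = e x"
      using AE_in_some_cell
    proof eventually_elim
      case (elim x)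
      show ?case
      proof
        assume "x \<in> \<Omega>"
        then obtain T where T: "T \<in> Th" "x \<in> T" using elim by blast
        show "(K x *v h x) \<bullet> D x = e x"
          unfolding e_def sum_over_cells[OF T, of "\<lambda>T. a T x"] by (simp add: a_def K[OF T])
      qed
    qed
    show "e x = 0" if "x \<notin> \<Omega>" for x
      unfolding e_def by (rule sum.neutral) (use cell_subset that in \<open>auto simp: indicator_def\<close>)
  qed
  also have "\<dots> = (LBINT x. (\<Sum>T\<in>Th. indicator T x * (f' x * \<phi> x)))"
  proof (rule integral_cong_AE)
    show "AE x in lborel. f' x * \<phi> x = (\<Sum>T\<in>Th. indicator T x * (f' x * \<phi> x))"
      using AE_in_some_cell
    proof eventually_elim
      case (elim x)
      show ?case
      proof (cases "x \<in> \<Omega>")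
        case True
        then obtain T where T: "T \<in> Th" "x \<in> T" using elim by blast
        show ?thesis unfolding sum_over_cells[OF T, of "\<lambda>T. f' x * \<phi> x"] ..
      next
        case False
        then show ?thesis using f0 by simp
      qed
    qed
    show "(\<lambda>x. \<Sum>T\<in>Th. indicator T x * (f' x * \<phi> x)) \<in> borel_measurable lborel"
      by (intro borel_measurable_integrable Bochner_Integration.integrable_sum ind ifp)
  qed measurable
  also have "\<dots> = (\<Sum>T\<in>Th. LINT x|lborel. indicator T x * (f' x * \<phi> x))"
    by (rule Bochner_Integration.integral_sum) (rule ind[OF _ ifp])
  also have "\<dots> = (\<Sum>T\<in>Th. LINT x|lebesgue_on T. f x * \<phi> x)"
    by (intro sum.cong refl cell(2)[symmetric])
  finally show ?thesis by (simp add: sum_subtractf)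
qed

section \<open>Summation by faces\<close>

lemma jump_boundary:
  assumes "F \<in> boundary_faces Th Fh" "T \<in> cells_of Th F"
  shows "cells_of Th F = {T}" "jump Th w T F = w T"
proof -
  obtain S where "cells_of Th F = {S}" using assms(1) by (auto simp: boundary_faces_def card_1_singleton_iff)
  then show *: "cells_of Th F = {T}" using assms(2) by simp
  show "jump Th w T F = w T" unfolding jump_def * by simp
qed

lemma internal_cells:
  assumes "F \<in> internal_faces Th Fh" "T \<in> cells_of Th F"
  obtains T' where "cells_of Th F = {T, T'}" "T \<noteq> T'"
proof -
  obtain S S' where "cells_of Th F = {S, S'}" "S \<noteq> S'"
    using assms(1) by (auto simp: internal_faces_def card_2_iff)
  then show thesis using assms(2) that[of S] that[of S'] by (auto simp: insert_commute)
qed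

text \<open>Discrete integration by parts: an internal face is met from its two cells with opposite
  values of y, which produces the jump of w. Exchanging the two cells changes the sign of both y and
  the jump, so any choice of \<tau> F gives the same product.\<close>

lemma sum_by_faces:
  fixes y :: "(real^'n) set \<Rightarrow> (real^'n) set \<Rightarrow> real"
  assumes anti: "\<And>F T T'. F \<in> internal_faces Th Fh \<Longrightarrow> cells_of Th F = {T, T'} \<Longrightarrow> T \<noteq> T' \<Longrightarrow> y T F + y T' F = 0"
    and \<tau>: "\<forall>F\<in>Fh. \<tau> F \<in> cells_of Th F"
  shows "(\<Sum>T\<in>Th. w T * (\<Sum>F\<in>faces_of Fh T. y T F)) = (\<Sum>F\<in>Fh. y (\<tau> F) F * jump Th w (\<tau> F) F)"
proof -
  have "(\<Sum>T\<in>Th. w T * (\<Sum>F\<in>faces_of Fh T. y T F)) = (\<Sum>T\<in>Th. \<Sum>F\<in>{F. F \<in> Fh \<and> F \<subseteq> frontier T}. w T * y T F)"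
    by (simp add: sum_distrib_left faces_of_def)
  also have "\<dots> = (\<Sum>F\<in>Fh. \<Sum>T\<in>{T. T \<in> Th \<and> F \<subseteq> frontier T}. w T * y T F)"
    by (rule sum.swap_restrict[OF finite_Th finite_Fh])
  also have "\<dots> = (\<Sum>F\<in>Fh. y (\<tau> F) F * jump Th w (\<tau> F) F)"
  proof (rule sum.cong[OF refl])
    fix F assume F: "F \<in> Fh"
    have \<tau>F: "\<tau> F \<in> cells_of Th F" using \<tau> F by blast
    have "(\<Sum>T\<in>cells_of Th F. w T * y T F) = y (\<tau> F) F * jump Th w (\<tau> F) F"
    proof (cases "F \<in> internal_faces Th Fh")
      case True
      obtain T' where T': "cells_of Th F = {\<tau> F, T'}" "\<tau> F \<noteq> T'" by (rule internal_cells[OF True \<tau>F])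
      have "cells_of Th F - {\<tau> F} = {T'}" using T' by auto
      then have j: "jump Th w (\<tau> F) F = w (\<tau> F) - w T'" by (simp add: jump_def)
      have "y T' F = - y (\<tau> F) F" using anti[OF True T'] by simp
      then show ?thesis using T'(2) unfolding T'(1) j by (simp add: algebra_simps)
    next
      case False
      then have b: "F \<in> boundary_faces Th Fh" using face_position[OF F] by blast
      show ?thesis unfolding jump_boundary(2)[OF b \<tau>F] jump_boundary(1)[OF b \<tau>F] by simp
    qed
    then show "(\<Sum>T\<in>{T. T \<in> Th \<and> F \<subseteq> frontier T}. w T * y T F) = y (\<tau> F) F * jump Th w (\<tau> F) F"
      by (simp add: cells_of_def)
  qed
  finally show ?thesis .
qed

lemma sum_internal_boundary:
  assumes "\<forall>F\<in>Fh. \<tau> F \<in> cells_of Th F"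
  shows "(\<Sum>F\<in>internal_faces Th Fh. y F * jump Th w (\<tau> F) F) + (\<Sum>F\<in>boundary_faces Th Fh. y F * w (\<tau> F))
    = (\<Sum>F\<in>Fh. y F * jump Th w (\<tau> F) F)"
proof -
  have Fh: "Fh = internal_faces Th Fh \<union> boundary_faces Th Fh"
    using face_position by (auto simp: internal_faces_def boundary_faces_def)
  have "(\<Sum>F\<in>boundary_faces Th Fh. y F * w (\<tau> F)) = (\<Sum>F\<in>boundary_faces Th Fh. y F * jump Th w (\<tau> F) F)"
    using assms by (intro sum.cong refl) (simp add: jump_boundary(2) boundary_faces_def[of Th Fh])
  moreover have "(\<Sum>F\<in>Fh. y F * jump Th w (\<tau> F) F) = (\<Sum>F\<in>internal_faces Th Fh. y F * jump Th w (\<tau> F) F) + (\<Sum>F\<in>boundary_faces Th Fh. y F * jump Th w (\<tau> F) F)"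
    by (subst Fh, rule sum.union_disjoint) (use finite_Fh in \<open>auto simp: internal_faces_def boundary_faces_def\<close>)
  ultimately show ?thesis by simp
qed

end

context mesh_cell
begin

text \<open>Identifies the face integral of the error bound, taken with the completed measure and
  the actual trace, with its Borel version.\<close>

lemma face_functional_eq:
  assumes v: "normal_flux A u f T v" and F: "F \<in> faces_of Fh T"
  shows "(LINT x:F|face_measure F. (A *v face_trace (unit_normal T F) (weak_grad T u) x) \<bullet> unit_normal T F)
    = (LINT x|hyp_measure (affine hull F). indicator F x * v F x)"
proof -
  note n = bspec[OF conjunct1[OF v[unfolded normal_flux_def]] F]
  note [measurable] = face_borel[OF faces_of_subset[OF F]] conjunct1[OF n]
  show ?thesis
    unfolding set_lebesgue_integral_def face_measure_eq[OF faces_of_subset[OF F]]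
  proof (rule integral_completion_AE)
    show "(\<lambda>x. indicator F x * v F x) \<in> borel_measurable (hyp_measure (affine hull F))" by measurable
    show "AE x in hyp_measure (affine hull F). indicator F x *\<^sub>R ((A *v face_trace (unit_normal T F) (weak_grad T u) x) \<bullet> unit_normal T F) = indicator F x * v F x"
      using conjunct2[OF conjunct2[OF n]] by eventually_elim (auto simp: indicator_def)
  qed
qed

lemma normal_flux_test:
  fixes \<psi> :: "real^'n \<Rightarrow> real"
  assumes v: "normal_flux A u f T v" and "\<And>k. C_k k \<psi>" "\<And>x. \<bar>\<psi> x\<bar> \<le> B" "\<And>x. GDERIV \<psi> x :> D x" "\<And>x. norm (D x) \<le> B'" "D \<in> borel_measurable borel"
  shows "(LINT x|lebesgue_on T. (A *v weak_grad T u x) \<bullet> D x) - (LINT x|lebesgue_on T. f x * \<psi> x) =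
    (\<Sum>F\<in>faces_of Fh T. LINT x|hyp_measure (affine hull F). indicator F x * (\<psi> x * v F x))"
  by (rule conjunct2[OF v[unfolded normal_flux_def], rule_format]) (use assms(2-) in auto)

text \<open>The identity defining the normal flux, tested with \<open>\<psi> = 1\<close>.\<close>

lemma flux_balance:
  assumes v: "normal_flux A u f T v"
  shows "(\<Sum>F\<in>faces_of Fh T. LINT x|hyp_measure (affine hull F). indicator F x * v F x) = - (LINT x|lebesgue_on T. f x)"
  using normal_flux_test[OF v, of "\<lambda>x. 1" 1 "\<lambda>x. 0" 0] by (simp add: C_k_const GDERIV_const)

end

theorem theorem34:
  fixes \<Omega> :: "(real^'n) set"
    and f u :: "real^'n \<Rightarrow> real"
    and K :: "real^'n \<Rightarrow> real^'n^'n"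
    and P Th Fh :: "(real^'n) set set"
    and xc :: "(real^'n) set \<Rightarrow> real^'n"
    and flux :: "(real^'n) set \<Rightarrow> (real^'n) set \<Rightarrow> ((real^'n) set \<Rightarrow> real) \<Rightarrow> real"
    and \<gamma> :: real
    and uh :: "(real^'n) set \<Rightarrow> real"
    and \<tau> :: "(real^'n) set \<Rightarrow> (real^'n) set"
  assumes domain: "polytopal_domain \<Omega>"
    and source: "f \<in> L2 \<Omega>"
    and tensor: "diffusion_tensor \<Omega> P K"
    and mesh: "polytopal_mesh \<Omega> Th Fh"
    and mesh_compatible: "\<forall>T\<in>Th. \<exists>Q\<in>P. T \<subseteq> Q"
    and points: "\<forall>T\<in>Th. xc T \<in> T"
    and distances: "\<forall>T\<in>Th. \<forall>F\<in>faces_of Fh T. cell_face_dist xc T F > 0"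
    and choice: "\<forall>F\<in>Fh. \<tau> F \<in> cells_of Th F"
    and flux_linear: "\<forall>T\<in>Th. \<forall>F\<in>faces_of Fh T. linear_on_X_c Th (flux T F)"
    and flux_conservative:
      "\<forall>F\<in>internal_faces Th Fh. \<forall>T T'. cells_of Th F = {T, T'} \<longrightarrow>
         (\<forall>v\<in>X_c Th. flux T F v + flux T' F v = 0)"
    and gamma_pos: "\<gamma> > 0"
    and flux_coercive:
      "\<forall>v\<in>X_c Th.
         (\<Sum>F\<in>internal_faces Th Fh. flux (\<tau> F) F v * jump Th v (\<tau> F) F) +
         (\<Sum>F\<in>boundary_faces Th Fh. flux (\<tau> F) F v * v (\<tau> F))
         \<ge> \<gamma> * (norm_1_c K xc Th Fh \<tau> v)\<^sup>2"
    and solution: "u \<in> H10 \<Omega>"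
      "\<forall>v\<in>H10 \<Omega>. (LINT x|lebesgue_on \<Omega>. (K x *v weak_grad \<Omega> u x) \<bullet> weak_grad \<Omega> v x) =
                 (LINT x|lebesgue_on \<Omega>. f x * v x)"
    and regularity: "continuous_on (closure \<Omega>) u" "u \<in> broken_H2 \<Omega> Th"
    and scheme: "uh \<in> X_c Th"
      "\<forall>T\<in>Th. (\<Sum>F\<in>faces_of Fh T. flux T F uh) = (LINT x|lebesgue_on T. f x)"
  shows "norm_1_c K xc Th Fh \<tau> (\<lambda>T. uh T - interpolant xc Th u T) \<le>
    (1 / \<gamma>) * sqrt (\<Sum>F\<in>Fh. inverse (face_lambda K Th F) * (face_dist xc Th F / face_area F) *
      ((LINT x:F|face_measure F.
          (cell_tensor K (\<tau> F) *v face_trace (unit_normal (\<tau> F) F) (weak_grad (\<tau> F) u) x)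
            \<bullet> unit_normal (\<tau> F) F)
       + flux (\<tau> F) F (interpolant xc Th u))\<^sup>2)"
proof -
  interpret mesh \<Omega> Th Fh by unfold_locales (rule mesh)
  have \<Omega>: "open \<Omega>" "bounded \<Omega>" using polytopal_domain_open_bounded[OF domain] by auto
  have \<Omega>b: "\<Omega> \<in> sets borel" using \<Omega>(1) by auto
  have uH: "u \<in> H1 \<Omega>" using solution(1) by (simp add: H10_def)
  have K: "K x = cell_tensor K T" if T: "T \<in> Th" "x \<in> T" for T x
  proof -
    obtain Q where Q: "Q \<in> P" "T \<subseteq> Q" using bspec[OF mesh_compatible T(1)] by (elim bexE)
    have "K constant_on Q" using tensor Q(1) by (simp add: diffusion_tensor_def)
    then obtain A where A: "\<And>y. y \<in> T \<Longrightarrow> K y = A" using Q(2) unfolding constant_on_def by blast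
    have "cell_tensor K T = A" unfolding cell_tensor_def by (rule the_equality) (use A T(2) in auto)
    then show ?thesis using A T(2) by simp
  qed
  obtain \<alpha> where \<alpha>: "\<alpha> > 0" "\<And>x \<xi>. x \<in> \<Omega> \<Longrightarrow> \<alpha> * (norm \<xi>)\<^sup>2 \<le> (K x *v \<xi>) \<bullet> \<xi>"
    and sym: "\<And>x. x \<in> \<Omega> \<Longrightarrow> transpose (K x) = K x"
    using tensor unfolding diffusion_tensor_def by blast
  \<comment> \<open>The point \<open>xc T\<close> lies in T, so the cell tensor is a value of K, and
    symmetry and ellipticity at that point apply to it.\<close>
  have eig: "smallest_eigenvalue (cell_tensor K T) > 0" if T: "T \<in> Th" for T
  proof -
    have x: "xc T \<in> T" "xc T \<in> \<Omega>" using points T cell_subset[OF T] by auto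
    show ?thesis unfolding K[OF T x(1), symmetric] using sym[OF x(2)] \<alpha>(1) \<alpha>(2)[OF x(2)] by (rule smallest_eigenvalue_pos)
  qed
  have cells: "finite (cells_of Th F)" "\<And>T. T \<in> cells_of Th F \<Longrightarrow> T \<in> Th" for F
    using finite_Th by (auto simp: cells_of_def)
  have \<tau>: "\<tau> F \<in> cells_of Th F" "\<tau> F \<in> Th" "F \<in> faces_of Fh (\<tau> F)" if "F \<in> Fh" for F
    using choice that by (auto simp: cells_of_def faces_of_def)
  \<comment> \<open>Strict positivity keeps the quotients of the norm and of the bound genuine; a
    zero denominator would silently give 0 and break the Cauchy-Schwarz step.\<close>
  have pos: "face_lambda K Th F > 0 \<and> face_area F > 0 \<and> face_dist xc Th F > 0" if F: "F \<in> Fh" for F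
  proof (intro conjI)
    show "face_lambda K Th F > 0"
      unfolding face_lambda_def using cells eig \<tau>(1)[OF F] by (subst Min_gr_iff) auto
    have "F \<subseteq> closure (\<tau> F)" using \<tau>(3)[OF F] by (auto simp: faces_of_def frontier_def)
    then have "bounded F" by (rule bounded_subset[OF bounded_closure[OF cell_bounded[OF \<tau>(2)[OF F]]]])
    then show "face_area F > 0" by (rule face_area_pos[OF F])
    show "face_dist xc Th F > 0"
      unfolding face_dist_def
    proof (rule sum_pos[OF cells(1)])
      show "cells_of Th F \<noteq> {}" using \<tau>(1)[OF F] by blast
      show "0 < cell_face_dist xc T F" if "T \<in> cells_of Th F" for T
        using distances that F by (auto simp: cells_of_def faces_of_def)
    qed
  qed
  have "\<forall>T\<in>Th. \<exists>v. normal_flux (cell_tensor K T) u f T v"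
  proof
    fix T assume T: "T \<in> Th"
    then interpret mesh_cell \<Omega> Th Fh T by unfold_locales
    note fT = L2_subset_integrable[OF source \<Omega>b \<Omega>(2) borel_open[OF cell_open[OF T]] cell_subset[OF T]]
    note f\<Omega> = L2_subset_integrable(1)[OF source \<Omega>b \<Omega>(2) \<Omega>b subset_refl]
    have "u \<in> H2 T" using regularity(2) T by (simp add: broken_H2_def)
    then show "\<exists>v. normal_flux (cell_tensor K T) u f T v"
      by (rule cell_flux[OF _ fT])
        (rule cell_equation[OF \<Omega>(1) cell_open[OF T] cell_subset[OF T] uH f\<Omega> K[OF T] solution(2)])
  qed
  from bchoice[OF this] obtain v where v: "\<And>T. T \<in> Th \<Longrightarrow> normal_flux (cell_tensor K T) u f T (v T)" by blast
  have cell: "mesh_cell \<Omega> Th Fh T" if "T \<in> Th" for T using that by unfold_locales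
  define J where "J = (\<lambda>T F. LINT x|hyp_measure (affine hull F). indicator F x * v T F x)"
  have J: "(LINT x:F|face_measure F. (cell_tensor K T *v face_trace (unit_normal T F) (weak_grad T u) x) \<bullet> unit_normal T F) = J T F"
    if "T \<in> Th" "F \<in> faces_of Fh T" for T F
    unfolding J_def by (rule mesh_cell.face_functional_eq[OF cell[OF that(1)] v[OF that(1)] that(2)])
  have balance: "(\<Sum>F\<in>faces_of Fh T. J T F) = - (LINT x|lebesgue_on T. f x)" if "T \<in> Th" for T
    unfolding J_def by (rule mesh_cell.flux_balance[OF cell[OF that] v[OF that]])
  have J_anti: "J S F + J S' F = 0" if F: "F \<in> internal_faces Th Fh" and c: "cells_of Th F = {S, S'}" "S \<noteq> S'" for F S S'
  proof -
    have "F \<in> Fh" using F by (simp add: internal_faces_def)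
    moreover have "F \<notin> boundary_faces Th Fh" using F by (simp add: internal_faces_def boundary_faces_def)
    ultimately have F': "F \<in> Fh" "F \<subseteq> \<Omega>" using face_position by blast+
    show ?thesis
      unfolding J_def
    proof (rule flux_continuity[OF \<Omega>(1) F' c])
      fix T G assume TG: "T \<in> Th" "G \<in> faces_of Fh T"
      note n = bspec[OF conjunct1[OF v[OF TG(1), unfolded normal_flux_def]] TG(2)]
      show "v T G \<in> borel_measurable borel" by (rule conjunct1[OF n])
      show "integrable (hyp_measure (affine hull G)) (\<lambda>x. indicator G x * v T G x)" by (rule conjunct1[OF conjunct2[OF n]])
    next
      fix \<phi> assume \<phi>: "\<phi> \<in> test_functions \<Omega>"
      obtain D where D: "\<And>x. GDERIV \<phi> x :> D x" using test_function_gderiv[OF \<phi>] by metis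
      have Dm: "D \<in> borel_measurable borel"
        using test_function_gderiv_continuous[OF \<phi> D] by (rule borel_measurable_continuous_onI)
      obtain B where B: "\<And>x. \<bar>\<phi> x\<bar> \<le> B" using test_function_bounded[OF \<phi>] by blast
      obtain B' where B': "\<And>x. norm (D x) \<le> B'" using test_function_gderiv_bounded[OF \<phi> D] by blast
      have ck: "\<And>k. C_k k \<phi>" using \<phi> by (simp add: test_functions_def)
      have "(\<Sum>T\<in>Th. \<Sum>G\<in>faces_of Fh T. LINT x|hyp_measure (affine hull G). indicator G x * (\<phi> x * v T G x))
        = (\<Sum>T\<in>Th. (LINT x|lebesgue_on T. (cell_tensor K T *v weak_grad T u x) \<bullet> D x) - (LINT x|lebesgue_on T. f x * \<phi> x))"
        by (intro sum.cong refl mesh_cell.normal_flux_test[OF cell v ck B D B' Dm, symmetric])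
      also have "\<dots> = 0" by (rule sum_cell_equations[OF \<Omega> uH source K solution(2) \<phi> D])
      finally show "(\<Sum>T\<in>Th. \<Sum>G\<in>faces_of Fh T. LINT x|hyp_measure (affine hull G). indicator G x * (\<phi> x * v T G x)) = 0" .
    qed
  qed
  define Iu where "Iu = interpolant xc Th u"
  define e where "e = (\<lambda>T. uh T - Iu T)"
  have Xc: "Iu \<in> X_c Th" "e \<in> X_c Th"
    using scheme(1) by (auto simp: X_c_def Iu_def e_def interpolant_def)
  define X where "X = (\<lambda>T F. J T F + flux T F Iu)"
  have cons: "flux S F w + flux S' F w = 0" if "F \<in> internal_faces Th Fh" "cells_of Th F = {S, S'}" "w \<in> X_c Th" for S S' F w
    using flux_conservative that by blast
  have split: "flux T F uh = flux T F e + flux T F Iu" if "T \<in> Th" "F \<in> faces_of Fh T" for T F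
  proof -
    have "linear_on_X_c Th (flux T F)" using flux_linear that by blast
    then have "flux T F (\<lambda>T. e T + Iu T) = flux T F e + flux T F Iu"
      using Xc unfolding linear_on_X_c_def by blast
    then show ?thesis by (simp add: e_def)
  qed
  \<comment> \<open>The exact fluxes sum to minus the cell integral of f and the numerical ones to
    plus it; this explains the sign in front of X and the plus sign inside X.\<close>
  have defect: "(\<Sum>F\<in>faces_of Fh T. flux T F e) = (\<Sum>F\<in>faces_of Fh T. - X T F)" if T: "T \<in> Th" for T
  proof -
    have "(\<Sum>F\<in>faces_of Fh T. flux T F e) + (\<Sum>F\<in>faces_of Fh T. flux T F Iu) = (\<Sum>F\<in>faces_of Fh T. flux T F uh)"
      unfolding sum.distrib[symmetric] by (intro sum.cong refl split[OF T, symmetric])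
    also have "\<dots> = (LINT x|lebesgue_on T. f x)" using scheme(2) T by blast
    finally show ?thesis using balance[OF T] by (simp add: X_def sum.distrib sum_negf sum_subtractf)
  qed
  define N where "N = norm_1_c K xc Th Fh \<tau> e"
  define R where "R = sqrt (\<Sum>F\<in>Fh. inverse (face_lambda K Th F) * (face_dist xc Th F / face_area F) * (X (\<tau> F) F)\<^sup>2)"
  have "\<gamma> * N\<^sup>2 \<le> (\<Sum>F\<in>internal_faces Th Fh. flux (\<tau> F) F e * jump Th e (\<tau> F) F) + (\<Sum>F\<in>boundary_faces Th Fh. flux (\<tau> F) F e * e (\<tau> F))"
    unfolding N_def using flux_coercive Xc(2) by blast
  also have "\<dots> = (\<Sum>F\<in>Fh. flux (\<tau> F) F e * jump Th e (\<tau> F) F)" by (rule sum_internal_boundary[OF choice])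
  also have "\<dots> = (\<Sum>T\<in>Th. e T * (\<Sum>F\<in>faces_of Fh T. flux T F e))"
    by (rule sum_by_faces[OF _ choice, symmetric]) (rule cons[OF _ _ Xc(2)])
  also have "\<dots> = (\<Sum>T\<in>Th. e T * (\<Sum>F\<in>faces_of Fh T. - X T F))" by (intro sum.cong refl) (simp only: defect)
  \<comment> \<open>The summation is undone with the defects in place of the fluxes of e; they are
    antisymmetric because both the exact fluxes and the numerical ones are conservative.\<close>
  also have "\<dots> = (\<Sum>F\<in>Fh. - X (\<tau> F) F * jump Th e (\<tau> F) F)"
  proof (rule sum_by_faces[OF _ choice])
    fix F S S' assume "F \<in> internal_faces Th Fh" "cells_of Th F = {S, S'}" "S \<noteq> S'"
    then show "- X S F + - X S' F = 0" using J_anti[of F S S'] cons[of F S S' Iu] Xc(1) by (simp add: X_def)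
  qed
  also have "\<dots> \<le> \<bar>\<Sum>F\<in>Fh. X (\<tau> F) F * jump Th e (\<tau> F) F\<bar>" by (simp add: sum_negf)
  also have "\<dots> \<le> R * N"
    unfolding R_def N_def norm_1_c_def by (rule weighted_Cauchy_Schwarz) (rule pos)
  finally have main: "\<gamma> * N\<^sup>2 \<le> R * N" .
  have "N \<ge> 0" "R \<ge> 0"
    unfolding N_def norm_1_c_def R_def using pos
    by (auto intro!: real_sqrt_ge_zero sum_nonneg mult_nonneg_nonneg divide_nonneg_nonneg simp: less_imp_le)
  have "\<gamma> * N \<le> R"
  proof (cases "N = 0")
    case True then show ?thesis using \<open>R \<ge> 0\<close> by simp
  next
    case False
    then have "N > 0" using \<open>N \<ge> 0\<close> by simp
    moreover have "(\<gamma> * N) * N \<le> R * N" using main by (simp add: power2_eq_square mult_ac)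
    ultimately show ?thesis by (simp only: mult_le_cancel_right_pos)
  qed
  then have "N \<le> (1 / \<gamma>) * R" using gamma_pos by (simp add: field_simps)
  moreover have "R = sqrt (\<Sum>F\<in>Fh. inverse (face_lambda K Th F) * (face_dist xc Th F / face_area F) *
      ((LINT x:F|face_measure F.
          (cell_tensor K (\<tau> F) *v face_trace (unit_normal (\<tau> F) F) (weak_grad (\<tau> F) u) x)
            \<bullet> unit_normal (\<tau> F) F)
       + flux (\<tau> F) F (interpolant xc Th u))\<^sup>2)"
    unfolding R_def X_def Iu_def by (intro arg_cong[of _ _ sqrt] sum.cong refl) (simp only: J[OF \<tau>(2,3)])
  ultimately show ?thesis unfolding N_def e_def Iu_def by simp
qed

end
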